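(* Let $N=3$ and let $R$ be the Nichols algebra of type $A_2$ with parameters $\bar q, q_{12}, q_{21}$ (so $\bar q$ is a primitive root of unity of order $3$). Then $\operatorname{Ext}_R^*(k,k)$ is generated by elements $\mathfrak a_1,\mathfrak a_2,\mathfrak b_1,\mathfrak b_2,\mathfrak b_y,\mathfrak c_1,\mathfrak c_2$ with $\deg\mathfrak a_i=1$ and $\deg \mathfrak b_i=\deg\mathfrak b_y=\deg\mathfrak c_i=2$ ($i=1,2$), subject to the relations (i.e. it is the algebra presented by these generators and relations) $$\mathfrak a_1^2=\mathfrak a_2^2=0,\quad \mathfrak a_1\mathfrak a_2=\mathfrak a_2\mathfrak a_1=0,$$ $$\mathfrak a_1\mathfrak b_1=\mathfrak b_1\mathfrak a_1,\quad \mathfrak a_1\mathfrak b_y=q_{12}^{3}\mathfrak b_y\mathfrak a_1,\quad \mathfrak a_1\mathfrak b_2=q_{12}^3\mathfrak b_2\mathfrak a_1,$$ $$\mathfrak a_1\mathfrak c_1=\bar q^2q_{12}\mathfrak c_1\mathfrak a_1,\quad \mathfrak a_1\mathfrak c_2=\bar q q_{12}^2\mathfrak c_2\mathfrak a_1,$$ $$q_{12}^3\mathfrak a_2\mathfrak b_1=\mathfrak b_1\mathfrak a_2,\quad q_{12}^3\mathfrak a_2\mathfrak b_y=\mathfrak b_y\mathfrak a_2,\quad \mathfrak a_2\mathfrak b_2=\mathfrak b_2\mathfrak a_2,$$ $$\mathfrak a_2\mathfrak c_1=\bar q q_{21}^2\mathfrak c_1\mathfrak a_2,\quad \bar q^2q_{12}\mathfrak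 a_2\mathfrak c_2=\mathfrak c_2\mathfrak a_2,$$ $$\bar q^2q_{12}\mathfrak a_2\mathfrak b_1=\mathfrak a_1\mathfrak c_1,\quad \mathfrak a_1\mathfrak b_2=\bar q^2q_{12}\mathfrak a_2\mathfrak c_2,\quad \mathfrak c_1\mathfrak a_2=\mathfrak c_2\mathfrak a_1,$$ $$\mathfrak b_1\mathfrak c_2=q_{12}^6\mathfrak c_1^2,\quad q_{12}^6\mathfrak b_2\mathfrak c_1=\mathfrak c_2^2,\quad \mathfrak b_1\mathfrak b_2=q_{12}^3\mathfrak c_1\mathfrak c_2,\quad \mathfrak c_1\mathfrak c_2=q_{12}^3\mathfrak c_2\mathfrak c_1,$$ $$\mathfrak b_1\mathfrak b_y=q_{12}^9\mathfrak b_y\mathfrak b_1,\quad \mathfrak b_1\mathfrak b_2=q_{12}^9\mathfrak b_2\mathfrak b_1,\quad \mathfrak b_y\mathfrak b_2=q_{12}^9\mathfrak b_2\mathfrak b_y,$$ $$q_{12}^3\mathfrak c_1\mathfrak b_1=\mathfrak b_1\mathfrak c_1,\quad \mathfrak c_1\mathfrak b_y=q_{12}^3\mathfrak b_y\mathfrak c_1,\quad \mathfrak c_1\mathfrak b_2=q_{12}^6\mathfrak b_2\mathfrak c_1,$$ $$q_{12}^6\mathfrak c_2\mathfrak b_1=\mathfrak b_1\mathfrak c_2,\quad q_{12}^3\mathfrak c_2\mathfrak b_y=\mathfrak b_y\mathfrak c_2,\quad \mathfrak c_2\mathfrak b_2=q_{12}^3\mathfrak b_2\mathfrak c_2.$$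
   Context: $k$ is an algebraically closed field with $\operatorname{char}k\neq 2$. For an integer $N\geq 3$, let $\bar q\in k$ be a primitive root of $1$ of order $N$ and let $q_{ij}\in k$ ($1\le i,j\le 2$) be roots of $1$ with $q_{11}=q_{22}=\bar q$ and $q_{12}q_{21}=\bar q^{-1}$. The Nichols algebra $R$ of type $A_2$ with these parameters (the Nichols algebra of the braided vector space $V$ with basis $x_1,x_2$ and braiding $c(x_i\otimes x_j)=q_{ij}x_j\otimes x_i$) is the $k$-algebra generated by $x_1,x_2$ subject to the relations $$x_1^2x_2-(q_{12}+q_{12}q_{11})x_1x_2x_1+q_{12}^2q_{22}x_2x_1^2=0,$$ $$x_2^2x_1-(q_{21}+q_{21}q_{22})x_2x_1x_2+q_{21}^2q_{22}x_1x_2^2=0,$$ $$x_1^N=x_2^N=(x_1x_2-q_{12}x_2x_1)^N=0;$$ it has dimension $N^3$. $k$ is the trivial left $R$-module ($x_1,x_2$ act by $0$). $\operatorname{Ext}_R^*(k,k)$ is a graded algebra under the Yoneda product. *)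

theory Defs
  imports
    "HOL-Library.Poly_Mapping"
    "HOL-Computational_Algebra.Computational_Algebra"
    "HOL-Algebra.QuotRing"
    "HOL-Algebra.Module"
begin

section \<open>Algebras presented by generators and relations\<close>

text \<open>Words in the letters \<open>'g\<close>, a monoid under concatenation (written additively so that
  the convolution product of \<^theory>\<open>HOL-Library.Poly_Mapping\<close> applies). The free associative algebra
  \<open>k\<langle>'g\<rangle>\<close> is the monoid algebra \<open>'g word \<Rightarrow>\<^sub>0 'k\<close>.\<close>

datatype 'g word = Word "'g list"

instantiation word :: (type) monoid_add
begin

definition zero_word :: "'a word" where "0 = Word []"

definition plus_word :: "'a word \<Rightarrow> 'a word \<Rightarrow> 'a word" where
  "u + v = (case (u, v) of (Word a, Word b) \<Rightarrow> Word (a @ b))"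

instance
proof
  fix u v w :: "'a word"
  show "(u + v) + w = u + (v + w)" by (cases u; cases v; cases w) (simp add: plus_word_def)
  show "0 + u = u" by (cases u) (simp add: zero_word_def plus_word_def)
  show "u + 0 = u" by (cases u) (simp add: zero_word_def plus_word_def)
qed

end

definition gen :: "'g \<Rightarrow> ('g word \<Rightarrow>\<^sub>0 'k::comm_ring_1)" where
  "gen g = Poly_Mapping.single (Word [g]) 1"

definition scal :: "'k::comm_ring_1 \<Rightarrow> ('g word \<Rightarrow>\<^sub>0 'k)" where
  "scal c = Poly_Mapping.single 0 c"

definition free_algebra :: "('g word \<Rightarrow>\<^sub>0 'k::comm_ring_1) ring" where
  "free_algebra = \<lparr>carrier = UNIV, monoid.mult = (*), one = 1, zero = 0, add = (+)\<rparr>"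

text \<open>A \<open>k\<close>-algebra is represented by the record type \<^typ>\<open>('k, 'a) module\<close>, which has both a
  ring multiplication and a scalar multiplication; the scalars are the whole type \<open>'k\<close>.\<close>

definition presented_algebra ::
    "('g word \<Rightarrow>\<^sub>0 'k::comm_ring_1) set \<Rightarrow> ('k, ('g word \<Rightarrow>\<^sub>0 'k) set) module" where
  "presented_algebra rels =
    (let I = genideal free_algebra rels; Q = free_algebra Quot I in
     \<lparr>carrier = carrier Q, monoid.mult = monoid.mult Q, one = one Q, zero = zero Q, add = add Q,
      smult = (\<lambda>c X. (I +>\<^bsub>free_algebra\<^esub> scal c) \<otimes>\<^bsub>Q\<^esub> X)\<rparr>)"

text \<open>The class of a generator in the presented algebra.\<close>

definition pgen :: "('g word \<Rightarrow>\<^sub>0 'k::comm_ring_1) set \<Rightarrow> 'g \<Rightarrow> ('g word \<Rightarrow>\<^sub>0 'k) set" where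
  "pgen rels g = genideal free_algebra rels +>\<^bsub>free_algebra\<^esub> gen g"

definition algebra_iso ::
    "('k, 'a, 'x) module_scheme \<Rightarrow> ('k, 'b, 'y) module_scheme \<Rightarrow> ('a \<Rightarrow> 'b) set" where
  "algebra_iso A B =
    {h \<in> ring_iso A B. \<forall>c. \<forall>x\<in>carrier A. h (c \<odot>\<^bsub>A\<^esub> x) = c \<odot>\<^bsub>B\<^esub> h x}"


section \<open>Left modules and free resolutions\<close>

text \<open>The locale \<^locale>\<open>module\<close> of the library requires a commutative base ring.  As there, the
  ring multiplication of the record \<open>M\<close> is not used.\<close>

locale left_module = R?: ring R + M?: abelian_group M for R (structure) and M (structure) +
  assumes smult_closed [simp, intro]:
      "\<lbrakk>a \<in> carrier R; x \<in> carrier M\<rbrakk> \<Longrightarrow> a \<odot>\<^bsub>M\<^esub> x \<in> carrier M"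
    and smult_l_distr:
      "\<lbrakk>a \<in> carrier R; b \<in> carrier R; x \<in> carrier M\<rbrakk> \<Longrightarrow>
        (a \<oplus> b) \<odot>\<^bsub>M\<^esub> x = a \<odot>\<^bsub>M\<^esub> x \<oplus>\<^bsub>M\<^esub> b \<odot>\<^bsub>M\<^esub> x"
    and smult_r_distr:
      "\<lbrakk>a \<in> carrier R; x \<in> carrier M; y \<in> carrier M\<rbrakk> \<Longrightarrow>
        a \<odot>\<^bsub>M\<^esub> (x \<oplus>\<^bsub>M\<^esub> y) = a \<odot>\<^bsub>M\<^esub> x \<oplus>\<^bsub>M\<^esub> a \<odot>\<^bsub>M\<^esub> y"
    and smult_assoc:
      "\<lbrakk>a \<in> carrier R; b \<in> carrier R; x \<in> carrier M\<rbrakk> \<Longrightarrow>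
        (a \<otimes> b) \<odot>\<^bsub>M\<^esub> x = a \<odot>\<^bsub>M\<^esub> (b \<odot>\<^bsub>M\<^esub> x)"
    and smult_one [simp]: "x \<in> carrier M \<Longrightarrow> \<one> \<odot>\<^bsub>M\<^esub> x = x"

definition left_hom ::
    "('r, 'x) ring_scheme \<Rightarrow> ('r, 'm, 'y) module_scheme \<Rightarrow> ('r, 'n, 'z) module_scheme
      \<Rightarrow> ('m \<Rightarrow> 'n) set" where
  "left_hom R M N = {f \<in> carrier M \<rightarrow>\<^sub>E carrier N.
     (\<forall>x\<in>carrier M. \<forall>y\<in>carrier M. f (x \<oplus>\<^bsub>M\<^esub> y) = f x \<oplus>\<^bsub>N\<^esub> f y) \<and>
     (\<forall>r\<in>carrier R. \<forall>x\<in>carrier M. f (r \<odot>\<^bsub>M\<^esub> x) = r \<odot>\<^bsub>N\<^esub> f x)}"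

definition is_basis ::
    "('r, 'x) ring_scheme \<Rightarrow> ('r, 'm, 'y) module_scheme \<Rightarrow> 'm set \<Rightarrow> bool" where
  "is_basis R M B \<longleftrightarrow> B \<subseteq> carrier M \<and>
     (\<forall>x\<in>carrier M. \<exists>!c. c \<in> B \<rightarrow>\<^sub>E carrier R \<and> finite {b\<in>B. c b \<noteq> \<zero>\<^bsub>R\<^esub>} \<and>
        x = (\<Oplus>\<^bsub>M\<^esub>b\<in>{b\<in>B. c b \<noteq> \<zero>\<^bsub>R\<^esub>}. c b \<odot>\<^bsub>M\<^esub> b))"

definition free_left_module ::
    "('r, 'x) ring_scheme \<Rightarrow> ('r, 'm, 'y) module_scheme \<Rightarrow> bool" where
  "free_left_module R M \<longleftrightarrow> left_module R M \<and> (\<exists>B. is_basis R M B)"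

text \<open>\<open>\<cdots> \<rightarrow> P\<^sub>2 \<rightarrow> P\<^sub>1 \<rightarrow> P\<^sub>0 \<rightarrow> M \<rightarrow> 0\<close> is exact, with differentials \<open>d n : P (n + 1) \<rightarrow> P n\<close> and
  augmentation \<open>e : P 0 \<rightarrow> M\<close>.\<close>

definition free_resolution ::
    "('r, 'x) ring_scheme \<Rightarrow> ('r, 'n) module \<Rightarrow>
     (nat \<Rightarrow> ('r, 'm) module) \<Rightarrow> (nat \<Rightarrow> 'm \<Rightarrow> 'm) \<Rightarrow> ('m \<Rightarrow> 'n) \<Rightarrow> bool" where
  "free_resolution R M P d e \<longleftrightarrow>
     (\<forall>n. free_left_module R (P n)) \<and>
     (\<forall>n. d n \<in> left_hom R (P (Suc n)) (P n)) \<and>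
     e \<in> left_hom R (P 0) M \<and>
     e ` carrier (P 0) = carrier M \<and>
     {x\<in>carrier (P 0). e x = \<zero>\<^bsub>M\<^esub>} = d 0 ` carrier (P 1) \<and>
     (\<forall>n. {x\<in>carrier (P (Suc n)). d n x = \<zero>\<^bsub>P n\<^esub>} = d (Suc n) ` carrier (P (Suc (Suc n))))"


section \<open>The Ext algebra with the Yoneda product\<close>

text \<open>\<open>Ext\<^sup>n\<^sub>R(M, M)\<close> is the \<open>n\<close>-th cohomology of \<open>Hom\<^sub>R(P, M)\<close> for a resolution \<open>(P, d, e)\<close> of \<open>M\<close>;
  a class is a coset of the group of coboundaries.\<close>

definition cocycles ::
    "('r, 'x) ring_scheme \<Rightarrow> ('r, 'n) module \<Rightarrow> (nat \<Rightarrow> ('r, 'm) module) \<Rightarrow>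
     (nat \<Rightarrow> 'm \<Rightarrow> 'm) \<Rightarrow> nat \<Rightarrow> ('m \<Rightarrow> 'n) set" where
  "cocycles R M P d n =
     {f \<in> left_hom R (P n) M. \<forall>x\<in>carrier (P (Suc n)). f (d n x) = \<zero>\<^bsub>M\<^esub>}"

fun coboundaries ::
    "('r, 'x) ring_scheme \<Rightarrow> ('r, 'n) module \<Rightarrow> (nat \<Rightarrow> ('r, 'm) module) \<Rightarrow>
     (nat \<Rightarrow> 'm \<Rightarrow> 'm) \<Rightarrow> nat \<Rightarrow> ('m \<Rightarrow> 'n) set" where
  "coboundaries R M P d 0 = {\<lambda>x\<in>carrier (P 0). \<zero>\<^bsub>M\<^esub>}"
| "coboundaries R M P d (Suc n) =
     (\<lambda>f. compose (carrier (P (Suc n))) f (d n)) ` left_hom R (P n) M"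

definition ext_class ::
    "('r, 'x) ring_scheme \<Rightarrow> ('r, 'n) module \<Rightarrow> (nat \<Rightarrow> ('r, 'm) module) \<Rightarrow>
     (nat \<Rightarrow> 'm \<Rightarrow> 'm) \<Rightarrow> nat \<Rightarrow> ('m \<Rightarrow> 'n) \<Rightarrow> ('m \<Rightarrow> 'n) set" where
  "ext_class R M P d n f =
     (\<lambda>b. \<lambda>x\<in>carrier (P n). f x \<oplus>\<^bsub>M\<^esub> b x) ` coboundaries R M P d n"

text \<open>The \<open>k\<close>-vector space \<open>Ext\<^sup>n\<^sub>R(M, M)\<close> for a \<open>k\<close>-algebra \<open>R\<close>; a scalar \<open>c\<close> acts as the central
  element \<open>c 1\<close> of \<open>R\<close>.  The operations on classes are given by the union of the classes
  obtained from all representatives, all of which coincide.  The fields \<open>mult\<close> and \<open>one\<close> of the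
  record are not used.\<close>

definition ext_component ::
    "('k, 'r, 'x) module_scheme \<Rightarrow> ('r, 'n) module \<Rightarrow> (nat \<Rightarrow> ('r, 'm) module) \<Rightarrow>
     (nat \<Rightarrow> 'm \<Rightarrow> 'm) \<Rightarrow> nat \<Rightarrow> ('k, ('m \<Rightarrow> 'n) set) module" where
  "ext_component R M P d n =
    \<lparr>carrier = ext_class R M P d n ` cocycles R M P d n,
     monoid.mult = undefined, one = undefined,
     zero = ext_class R M P d n (\<lambda>x\<in>carrier (P n). \<zero>\<^bsub>M\<^esub>),
     add = (\<lambda>X Y. \<Union>f\<in>X. \<Union>g\<in>Y. ext_class R M P d n (\<lambda>x\<in>carrier (P n). f x \<oplus>\<^bsub>M\<^esub> g x)),
     smult = (\<lambda>c X. \<Union>f\<in>X.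
       ext_class R M P d n (\<lambda>x\<in>carrier (P n). (c \<odot>\<^bsub>R\<^esub> \<one>\<^bsub>R\<^esub>) \<odot>\<^bsub>M\<^esub> f x))\<rparr>"

text \<open>Chain maps \<open>F i : P (n + i) \<rightarrow> P i\<close> lifting a cocycle \<open>g : P n \<rightarrow> M\<close>.\<close>

definition chain_lifts ::
    "('r, 'x) ring_scheme \<Rightarrow> (nat \<Rightarrow> ('r, 'm) module) \<Rightarrow> (nat \<Rightarrow> 'm \<Rightarrow> 'm) \<Rightarrow> ('m \<Rightarrow> 'n) \<Rightarrow>
     nat \<Rightarrow> ('m \<Rightarrow> 'n) \<Rightarrow> (nat \<Rightarrow> 'm \<Rightarrow> 'm) set" where
  "chain_lifts R P d e n g =
    {F. (\<forall>i. F i \<in> left_hom R (P (n + i)) (P i)) \<and>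
        (\<forall>x\<in>carrier (P n). e (F 0 x) = g x) \<and>
        (\<forall>i. \<forall>x\<in>carrier (P (n + Suc i)). d i (F (Suc i) x) = F i (d (n + i) x))}"

text \<open>The Yoneda product \<open>Ext\<^sup>m \<times> Ext\<^sup>n \<rightarrow> Ext\<^sup>n\<^sup>+\<^sup>m\<close>, \<open>[f] [g] = [f \<circ> F m]\<close> for a lift \<open>F\<close> of \<open>g\<close>, i.e.
  composition of morphisms in the derived category.\<close>

definition yoneda ::
    "('r, 'x) ring_scheme \<Rightarrow> ('r, 'n) module \<Rightarrow> (nat \<Rightarrow> ('r, 'm) module) \<Rightarrow>
     (nat \<Rightarrow> 'm \<Rightarrow> 'm) \<Rightarrow> ('m \<Rightarrow> 'n) \<Rightarrow> nat \<Rightarrow> nat \<Rightarrow>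
     ('m \<Rightarrow> 'n) set \<Rightarrow> ('m \<Rightarrow> 'n) set \<Rightarrow> ('m \<Rightarrow> 'n) set" where
  "yoneda R M P d e m n X Y =
    (\<Union>f\<in>X. \<Union>g\<in>Y. \<Union>F\<in>chain_lifts R P d e n g.
       ext_class R M P d (n + m) (compose (carrier (P (n + m))) f (F m)))"

text \<open>\<open>Ext\<^sup>*\<^sub>R(M, M)\<close>, the direct sum of the \<open>Ext\<^sup>n\<^sub>R(M, M)\<close>: finitely supported sequences of classes.
  The unit is the class of the augmentation.\<close>

definition ext_algebra ::
    "('k, 'r, 'x) module_scheme \<Rightarrow> ('r, 'n) module \<Rightarrow> (nat \<Rightarrow> ('r, 'm) module) \<Rightarrow>
     (nat \<Rightarrow> 'm \<Rightarrow> 'm) \<Rightarrow> ('m \<Rightarrow> 'n) \<Rightarrow> ('k, nat \<Rightarrow> ('m \<Rightarrow> 'n) set) module" where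
  "ext_algebra R M P d e =
    (let E = ext_component R M P d in
     \<lparr>carrier = {X. (\<forall>n. X n \<in> carrier (E n)) \<and> finite {n. X n \<noteq> \<zero>\<^bsub>E n\<^esub>}},
      monoid.mult = (\<lambda>X Y n. \<Oplus>\<^bsub>E n\<^esub>i\<in>{..n}. yoneda R M P d e i (n - i) (X i) (Y (n - i))),
      one = (\<lambda>n. if n = 0 then ext_class R M P d 0 e else \<zero>\<^bsub>E n\<^esub>),
      zero = (\<lambda>n. \<zero>\<^bsub>E n\<^esub>),
      add = (\<lambda>X Y n. X n \<oplus>\<^bsub>E n\<^esub> Y n),
      smult = (\<lambda>c X n. c \<odot>\<^bsub>E n\<^esub> X n)\<rparr>)"

definition ext_degree ::
    "('k, 'r, 'x) module_scheme \<Rightarrow> ('r, 'n) module \<Rightarrow> (nat \<Rightarrow> ('r, 'm) module) \<Rightarrow>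
     (nat \<Rightarrow> 'm \<Rightarrow> 'm) \<Rightarrow> ('m \<Rightarrow> 'n) \<Rightarrow> nat \<Rightarrow> (nat \<Rightarrow> ('m \<Rightarrow> 'n) set) set" where
  "ext_degree R M P d e n =
    {X \<in> carrier (ext_algebra R M P d e). \<forall>m. m \<noteq> n \<longrightarrow> X m = \<zero>\<^bsub>ext_component R M P d m\<^esub>}"


section \<open>The Nichols algebra of type \<open>A\<^sub>2\<close>\<close>

definition root_of_one :: "'k::field \<Rightarrow> bool" where
  "root_of_one q \<longleftrightarrow> (\<exists>n>0. q ^ n = 1)"

definition primitive_root_of_one :: "nat \<Rightarrow> 'k::field \<Rightarrow> bool" where
  "primitive_root_of_one N q \<longleftrightarrow> N > 0 \<and> q ^ N = 1 \<and> (\<forall>m. 0 < m \<and> m < N \<longrightarrow> q ^ m \<noteq> 1)"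

definition A2_parameters :: "nat \<Rightarrow> 'k::field \<Rightarrow> (nat \<Rightarrow> nat \<Rightarrow> 'k) \<Rightarrow> bool" where
  "A2_parameters N qbar q \<longleftrightarrow>
     N \<ge> 3 \<and> primitive_root_of_one N qbar \<and>
     (\<forall>i\<in>{1, 2}. \<forall>j\<in>{1, 2}. root_of_one (q i j)) \<and>
     q 1 1 = qbar \<and> q 2 2 = qbar \<and> q 1 2 * q 2 1 = inverse qbar"

datatype nichols_gen = X1 | X2

definition nichols_relations ::
    "nat \<Rightarrow> (nat \<Rightarrow> nat \<Rightarrow> 'k::field) \<Rightarrow> (nichols_gen word \<Rightarrow>\<^sub>0 'k) set" where
  "nichols_relations N q =
    (let x1 = gen X1; x2 = gen X2 in
     {x1^2 * x2 - scal (q 1 2 + q 1 2 * q 1 1) * x1 * x2 * x1 + scal ((q 1 2)^2 * q 2 2) * x2 * x1^2,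
      x2^2 * x1 - scal (q 2 1 + q 2 1 * q 2 2) * x2 * x1 * x2 + scal ((q 2 1)^2 * q 2 2) * x1 * x2^2,
      x1^N, x2^N, (x1 * x2 - scal (q 1 2) * x2 * x1)^N})"

definition nichols_algebra ::
    "nat \<Rightarrow> (nat \<Rightarrow> nat \<Rightarrow> 'k::field) \<Rightarrow> ('k, (nichols_gen word \<Rightarrow>\<^sub>0 'k) set) module" where
  "nichols_algebra N q = presented_algebra (nichols_relations N q)"

text \<open>The trivial module \<open>k\<close> of an algebra presented by relations without constant term: a class
  acts by the common constant term of its representatives, so that all generators act by \<open>0\<close>.\<close>

definition trivial_module :: "(('g word \<Rightarrow>\<^sub>0 'k::field) set, 'k) module" where
  "trivial_module =
    \<lparr>carrier = UNIV, monoid.mult = (*), one = 1, zero = 0, add = (+),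
     smult = (\<lambda>X c. the_elem ((\<lambda>p. Poly_Mapping.lookup p 0) ` X) * c)\<rparr>"


section \<open>The presentation of the Ext algebra\<close>

datatype ext_gen = Ga1 | Ga2 | Gb1 | Gb2 | Gby | Gc1 | Gc2

fun ext_gen_degree :: "ext_gen \<Rightarrow> nat" where
  "ext_gen_degree Ga1 = 1"
| "ext_gen_degree Ga2 = 1"
| "ext_gen_degree Gb1 = 2"
| "ext_gen_degree Gb2 = 2"
| "ext_gen_degree Gby = 2"
| "ext_gen_degree Gc1 = 2"
| "ext_gen_degree Gc2 = 2"

definition ext_relations ::
    "'k::field \<Rightarrow> 'k \<Rightarrow> 'k \<Rightarrow> (ext_gen word \<Rightarrow>\<^sub>0 'k) set" where
  "ext_relations qbar q12 q21 =
    (let a1 = gen Ga1; a2 = gen Ga2; b1 = gen Gb1; b2 = gen Gb2; bY = gen Gby;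
         c1 = gen Gc1; c2 = gen Gc2 in
     {a1^2, a2^2, a1 * a2, a2 * a1,

      a1 * b1 - b1 * a1,
      a1 * bY - scal (q12^3) * bY * a1,
      a1 * b2 - scal (q12^3) * b2 * a1,

      a1 * c1 - scal (qbar^2 * q12) * c1 * a1,
      a1 * c2 - scal (qbar * q12^2) * c2 * a1,

      scal (q12^3) * a2 * b1 - b1 * a2,
      scal (q12^3) * a2 * bY - bY * a2,
      a2 * b2 - b2 * a2,

      a2 * c1 - scal (qbar * q21^2) * c1 * a2,
      scal (qbar^2 * q12) * a2 * c2 - c2 * a2,

      scal (qbar^2 * q12) * a2 * b1 - a1 * c1,
      a1 * b2 - scal (qbar^2 * q12) * a2 * c2,
      c1 * a2 - c2 * a1,

      b1 * c2 - scal (q12^6) * c1^2,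
      scal (q12^6) * b2 * c1 - c2^2,
      b1 * b2 - scal (q12^3) * c1 * c2,
      c1 * c2 - scal (q12^3) * c2 * c1,

      b1 * bY - scal (q12^9) * bY * b1,
      b1 * b2 - scal (q12^9) * b2 * b1,
      bY * b2 - scal (q12^9) * b2 * bY,

      scal (q12^3) * c1 * b1 - b1 * c1,
      c1 * bY - scal (q12^3) * bY * c1,
      c1 * b2 - scal (q12^6) * b2 * c1,

      scal (q12^6) * c2 * b1 - b1 * c2,
      scal (q12^3) * c2 * bY - bY * c2,
      c2 * b2 - scal (q12^3) * b2 * c2})"


section \<open>Existence of free resolutions\<close>

text \<open>Ext is independent of the resolution, and statements about it quantify over all resolutions
  whose terms have elements in a given type.  The facts below show that for a suitable type of
  elements there always is one.\<close>

text \<open>An index type whose free module \<open>F\<close> maps onto \<open>M\<close> (constructor \<open>Base\<close>) and also onto each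
  submodule of itself, because \<open>Comb\<close> enumerates all elements of \<open>F\<close>; hence \<open>F\<close> can serve as
  every term of a resolution.\<close>

datatype ('r, 'n) cover_index = Base 'n | Comb "(('r, 'n) cover_index \<times> 'r) list"

text \<open>The free left module on the type \<open>'i\<close>.\<close>

definition fun_module :: "('r, 'x) ring_scheme \<Rightarrow> ('r, 'i \<Rightarrow> 'r) module" where
  "fun_module R =
    \<lparr>carrier = {f. (\<forall>i. f i \<in> carrier R) \<and> finite {i. f i \<noteq> \<zero>\<^bsub>R\<^esub>}},
     monoid.mult = undefined, one = undefined, zero = (\<lambda>i. \<zero>\<^bsub>R\<^esub>),
     add = (\<lambda>f g i. f i \<oplus>\<^bsub>R\<^esub> g i), smult = (\<lambda>r f i. r \<otimes>\<^bsub>R\<^esub> f i)\<rparr>"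

lemma fun_module_simps:
  "f \<in> carrier (fun_module R) \<longleftrightarrow> (\<forall>i. f i \<in> carrier R) \<and> finite {i. f i \<noteq> \<zero>\<^bsub>R\<^esub>}"
  "\<zero>\<^bsub>fun_module R\<^esub> = (\<lambda>i. \<zero>\<^bsub>R\<^esub>)"
  "f \<oplus>\<^bsub>fun_module R\<^esub> g = (\<lambda>i. f i \<oplus>\<^bsub>R\<^esub> g i)"
  "r \<odot>\<^bsub>fun_module R\<^esub> f = (\<lambda>i. r \<otimes>\<^bsub>R\<^esub> f i)"
  by (simp_all add: fun_module_def)

lemma left_module_fun_module:
  assumes "ring R" shows "left_module R (fun_module R :: ('r, 'i \<Rightarrow> 'r) module)"
proof -
  interpret R: ring R by fact
  let ?F = "fun_module R :: ('r, 'i \<Rightarrow> 'r) module"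
  have add: "f \<oplus>\<^bsub>?F\<^esub> g \<in> carrier ?F" if "f \<in> carrier ?F" "g \<in> carrier ?F" for f g
  proof -
    have "{i. f i \<oplus>\<^bsub>R\<^esub> g i \<noteq> \<zero>\<^bsub>R\<^esub>} \<subseteq> {i. f i \<noteq> \<zero>\<^bsub>R\<^esub>} \<union> {i. g i \<noteq> \<zero>\<^bsub>R\<^esub>}"
      by auto
    then have "finite {i. f i \<oplus>\<^bsub>R\<^esub> g i \<noteq> \<zero>\<^bsub>R\<^esub>}"
      by (rule finite_subset) (use that in \<open>simp add: fun_module_simps\<close>)
    then show ?thesis using that by (simp add: fun_module_simps)
  qed
  have smult: "r \<odot>\<^bsub>?F\<^esub> f \<in> carrier ?F" if "r \<in> carrier R" "f \<in> carrier ?F" for f r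
  proof -
    have "{i. r \<otimes>\<^bsub>R\<^esub> f i \<noteq> \<zero>\<^bsub>R\<^esub>} \<subseteq> {i. f i \<noteq> \<zero>\<^bsub>R\<^esub>}"
      using that by auto
    then have "finite {i. r \<otimes>\<^bsub>R\<^esub> f i \<noteq> \<zero>\<^bsub>R\<^esub>}"
      by (rule finite_subset) (use that in \<open>simp add: fun_module_simps\<close>)
    then show ?thesis using that by (simp add: fun_module_simps)
  qed
  have "abelian_group ?F"
  proof (rule abelian_groupI)
    fix f assume f: "f \<in> carrier ?F"
    then have f': "f i \<in> carrier R" for i by (simp add: fun_module_simps)
    have "(\<ominus>\<^bsub>R\<^esub> \<one>\<^bsub>R\<^esub>) \<odot>\<^bsub>?F\<^esub> f \<oplus>\<^bsub>?F\<^esub> f = \<zero>\<^bsub>?F\<^esub>"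
      using f' by (simp add: fun_module_simps R.l_minus R.l_neg)
    then show "\<exists>g\<in>carrier ?F. g \<oplus>\<^bsub>?F\<^esub> f = \<zero>\<^bsub>?F\<^esub>"
      using smult[OF _ f, of "\<ominus>\<^bsub>R\<^esub> \<one>\<^bsub>R\<^esub>"] by blast
  next
    fix f g assume "f \<in> carrier ?F" "g \<in> carrier ?F"
    then show "f \<oplus>\<^bsub>?F\<^esub> g \<in> carrier ?F" by (rule add)
  next
    show "\<zero>\<^bsub>?F\<^esub> \<in> carrier ?F" by (simp add: fun_module_simps)
  next
    fix f g h assume "f \<in> carrier ?F" "g \<in> carrier ?F" "h \<in> carrier ?F"
    then show "f \<oplus>\<^bsub>?F\<^esub> g \<oplus>\<^bsub>?F\<^esub> h = f \<oplus>\<^bsub>?F\<^esub> (g \<oplus>\<^bsub>?F\<^esub> h)"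
      by (simp add: fun_module_simps R.a_assoc)
  next
    fix f g assume "f \<in> carrier ?F" "g \<in> carrier ?F"
    then show "f \<oplus>\<^bsub>?F\<^esub> g = g \<oplus>\<^bsub>?F\<^esub> f"
      by (simp add: fun_module_simps R.a_comm)
  next
    fix f assume "f \<in> carrier ?F"
    then show "\<zero>\<^bsub>?F\<^esub> \<oplus>\<^bsub>?F\<^esub> f = f" by (simp add: fun_module_simps)
  qed
  then show ?thesis
  proof (intro left_module.intro left_module_axioms.intro \<open>ring R\<close>)
    fix a f assume "a \<in> carrier R" "f \<in> carrier ?F"
    then show "a \<odot>\<^bsub>?F\<^esub> f \<in> carrier ?F" by (rule smult)
  qed (simp_all add: fun_module_simps R.l_distr R.r_distr R.m_assoc)
qed

definition lin_ext ::
    "('r, 'x) ring_scheme \<Rightarrow> ('r, 'n, 'y) module_scheme \<Rightarrow> ('i \<Rightarrow> 'n) \<Rightarrow> ('i \<Rightarrow> 'r) \<Rightarrow> 'n" where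
  "lin_ext R N v = (\<lambda>f\<in>carrier (fun_module R). \<Oplus>\<^bsub>N\<^esub>i\<in>{i. f i \<noteq> \<zero>\<^bsub>R\<^esub>}. f i \<odot>\<^bsub>N\<^esub> v i)"

context left_module begin

lemma smult_zero_left [simp]: "x \<in> carrier M \<Longrightarrow> \<zero> \<odot>\<^bsub>M\<^esub> x = \<zero>\<^bsub>M\<^esub>"
proof -
  assume x: "x \<in> carrier M"
  have "\<zero> \<odot>\<^bsub>M\<^esub> x \<oplus>\<^bsub>M\<^esub> \<zero> \<odot>\<^bsub>M\<^esub> x = \<zero> \<odot>\<^bsub>M\<^esub> x \<oplus>\<^bsub>M\<^esub> \<zero>\<^bsub>M\<^esub>"
    using smult_l_distr[of \<zero> \<zero> x] x by simp
  then show ?thesis using x by (simp add: M.add.l_cancel_one)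
qed

lemma smult_zero_right [simp]: "r \<in> carrier R \<Longrightarrow> r \<odot>\<^bsub>M\<^esub> \<zero>\<^bsub>M\<^esub> = \<zero>\<^bsub>M\<^esub>"
proof -
  assume r: "r \<in> carrier R"
  have "r \<odot>\<^bsub>M\<^esub> \<zero>\<^bsub>M\<^esub> \<oplus>\<^bsub>M\<^esub> r \<odot>\<^bsub>M\<^esub> \<zero>\<^bsub>M\<^esub> = r \<odot>\<^bsub>M\<^esub> \<zero>\<^bsub>M\<^esub> \<oplus>\<^bsub>M\<^esub> \<zero>\<^bsub>M\<^esub>"
    using smult_r_distr[of r "\<zero>\<^bsub>M\<^esub>" "\<zero>\<^bsub>M\<^esub>"] r by simp
  then show ?thesis using r by (simp add: M.add.l_cancel_one)
qed

lemma lin_ext_superset: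
  assumes "finite S" "\<And>i. v i \<in> carrier M" "f \<in> carrier (fun_module R)" "{i. f i \<noteq> \<zero>} \<subseteq> S"
  shows "lin_ext R M v f = (\<Oplus>\<^bsub>M\<^esub>i\<in>S. f i \<odot>\<^bsub>M\<^esub> v i)"
  unfolding lin_ext_def using assms
  by (simp, intro M.add.finprod_mono_neutral_cong_left) (auto simp: fun_module_simps)

lemma finsum_smult:
  "\<lbrakk>finite S; r \<in> carrier R; \<And>i. i \<in> S \<Longrightarrow> g i \<in> carrier M\<rbrakk> \<Longrightarrow>
    r \<odot>\<^bsub>M\<^esub> (\<Oplus>\<^bsub>M\<^esub>i\<in>S. g i) = (\<Oplus>\<^bsub>M\<^esub>i\<in>S. r \<odot>\<^bsub>M\<^esub> g i)"
proof (induction S rule: finite_induct)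
  case (insert a S)
  then show ?case
    by (subst (1 2) M.finsum_insert) (auto simp: smult_r_distr Pi_def)
qed simp

lemma lin_ext_hom:
  assumes v: "\<And>i. v i \<in> carrier M"
  shows "lin_ext R M v \<in> left_hom R (fun_module R) M"
proof -
  interpret F: left_module R "fun_module R"
    by (rule left_module_fun_module) (rule R.ring_axioms)
  have closed: "lin_ext R M v f \<in> carrier M" if "f \<in> carrier (fun_module R)" for f
    using that v by (auto simp: lin_ext_def fun_module_simps intro!: M.finsum_closed)
  have "lin_ext R M v (f \<oplus>\<^bsub>fun_module R\<^esub> g) = lin_ext R M v f \<oplus>\<^bsub>M\<^esub> lin_ext R M v g"
    if fg: "f \<in> carrier (fun_module R)" "g \<in> carrier (fun_module R)" for f g
  proof -
    let ?S = "{i. f i \<noteq> \<zero>} \<union> {i. g i \<noteq> \<zero>}"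
    have S: "finite ?S" using fg by (auto simp: fun_module_simps)
    have sum: "f \<oplus>\<^bsub>fun_module R\<^esub> g \<in> carrier (fun_module R)" using fg by simp
    have "lin_ext R M v (f \<oplus>\<^bsub>fun_module R\<^esub> g) = (\<Oplus>\<^bsub>M\<^esub>i\<in>?S. (f \<oplus>\<^bsub>fun_module R\<^esub> g) i \<odot>\<^bsub>M\<^esub> v i)"
      by (rule lin_ext_superset[OF S v sum]) (use fg in \<open>auto simp: fun_module_simps\<close>)
    also have "\<dots> = (\<Oplus>\<^bsub>M\<^esub>i\<in>?S. f i \<odot>\<^bsub>M\<^esub> v i \<oplus>\<^bsub>M\<^esub> g i \<odot>\<^bsub>M\<^esub> v i)"
      by (rule M.finsum_cong') (use fg v in \<open>auto simp: fun_module_simps smult_l_distr\<close>)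
    also have "\<dots> = (\<Oplus>\<^bsub>M\<^esub>i\<in>?S. f i \<odot>\<^bsub>M\<^esub> v i) \<oplus>\<^bsub>M\<^esub> (\<Oplus>\<^bsub>M\<^esub>i\<in>?S. g i \<odot>\<^bsub>M\<^esub> v i)"
      by (rule M.finsum_addf) (use fg v in \<open>auto simp: fun_module_simps\<close>)
    also have "\<dots> = lin_ext R M v f \<oplus>\<^bsub>M\<^esub> lin_ext R M v g"
      using fg by (simp add: lin_ext_superset[OF S v])
    finally show ?thesis .
  qed
  moreover have "lin_ext R M v (r \<odot>\<^bsub>fun_module R\<^esub> f) = r \<odot>\<^bsub>M\<^esub> lin_ext R M v f"
    if rf: "r \<in> carrier R" "f \<in> carrier (fun_module R)" for r f
  proof -
    let ?S = "{i. f i \<noteq> \<zero>}"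
    have S: "finite ?S" using rf by (auto simp: fun_module_simps)
    have rf': "r \<odot>\<^bsub>fun_module R\<^esub> f \<in> carrier (fun_module R)" using rf by simp
    have "lin_ext R M v (r \<odot>\<^bsub>fun_module R\<^esub> f) = (\<Oplus>\<^bsub>M\<^esub>i\<in>?S. (r \<odot>\<^bsub>fun_module R\<^esub> f) i \<odot>\<^bsub>M\<^esub> v i)"
      by (rule lin_ext_superset[OF S v rf']) (use rf in \<open>auto simp: fun_module_simps\<close>)
    also have "\<dots> = (\<Oplus>\<^bsub>M\<^esub>i\<in>?S. r \<odot>\<^bsub>M\<^esub> (f i \<odot>\<^bsub>M\<^esub> v i))"
      by (rule M.finsum_cong') (use rf v in \<open>auto simp: fun_module_simps smult_assoc\<close>)
    also have "\<dots> = r \<odot>\<^bsub>M\<^esub> (\<Oplus>\<^bsub>M\<^esub>i\<in>?S. f i \<odot>\<^bsub>M\<^esub> v i)"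
      by (rule finsum_smult[symmetric]) (use S rf v in \<open>auto simp: fun_module_simps\<close>)
    also have "\<dots> = r \<odot>\<^bsub>M\<^esub> lin_ext R M v f"
      using rf by (simp add: lin_ext_superset[OF S v])
    finally show ?thesis .
  qed
  ultimately show ?thesis
    using closed by (auto simp: left_hom_def lin_ext_def)
qed

lemma lin_ext_delta:
  assumes v: "\<And>i. v i \<in> carrier M"
  shows "(\<lambda>j. if j = i then \<one> else \<zero>) \<in> carrier (fun_module R)"
    "lin_ext R M v (\<lambda>j. if j = i then \<one> else \<zero>) = v i"
proof -
  let ?d = "\<lambda>j. if j = i then \<one> else \<zero>"
  show d: "?d \<in> carrier (fun_module R)"
    by (auto simp: fun_module_simps)
  have "lin_ext R M v ?d = (\<Oplus>\<^bsub>M\<^esub>j\<in>{i}. ?d j \<odot>\<^bsub>M\<^esub> v j)"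
    by (rule lin_ext_superset[OF _ v d]) auto
  then show "lin_ext R M v ?d = v i" using v[of i] by simp
qed

lemma lin_ext_image:
  assumes K: "K \<subseteq> carrier M" "\<zero>\<^bsub>M\<^esub> \<in> K" "\<And>x y. \<lbrakk>x \<in> K; y \<in> K\<rbrakk> \<Longrightarrow> x \<oplus>\<^bsub>M\<^esub> y \<in> K"
    "\<And>r x. \<lbrakk>r \<in> carrier R; x \<in> K\<rbrakk> \<Longrightarrow> r \<odot>\<^bsub>M\<^esub> x \<in> K"
    and v: "range v = K"
  shows "lin_ext R M v ` carrier (fun_module R) = K"
proof (intro equalityI subsetI)
  have v': "\<And>i. v i \<in> carrier M" "\<And>i. v i \<in> K" using v K by auto
  have sum: "(\<Oplus>\<^bsub>M\<^esub>i\<in>S. g i) \<in> K" if "finite S" "\<And>i. i \<in> S \<Longrightarrow> g i \<in> K" for S and g :: "'z \<Rightarrow> 'c"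
    using that
  proof (induction S rule: finite_induct)
    case (insert a S)
    then show ?case using K(1,3) by (subst M.finsum_insert) auto
  qed (use K in auto)
  fix x assume "x \<in> lin_ext R M v ` carrier (fun_module R)"
  then show "x \<in> K"
    using v' K by (auto simp: lin_ext_def fun_module_simps intro!: sum)
next
  have v': "\<And>i. v i \<in> carrier M" using v K by auto
  fix x assume "x \<in> K"
  then obtain i where "x = v i" using v by auto
  then show "x \<in> lin_ext R M v ` carrier (fun_module R)"
    using lin_ext_delta[of v i, OF v'] by (metis image_eqI)
qed

end

lemma free_fun_module:
  assumes "ring R" shows "free_left_module R (fun_module R :: ('r, 'i \<Rightarrow> 'r) module)"
proof -
  interpret R: ring R by fact
  interpret F: left_module R "fun_module R :: ('r, 'i \<Rightarrow> 'r) module"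
    using assms by (rule left_module_fun_module)
  let ?F = "fun_module R :: ('r, 'i \<Rightarrow> 'r) module"
  have "\<exists>B. is_basis R ?F B"
  proof (cases "\<one>\<^bsub>R\<^esub> = \<zero>\<^bsub>R\<^esub>")
    case True
    then have R0: "carrier R = {\<zero>\<^bsub>R\<^esub>}" using R.carrier_one_zero by blast
    have "f = \<zero>\<^bsub>?F\<^esub>" if "f \<in> carrier ?F" for f
    proof
      fix i
      have "f i \<in> carrier R" using that by (simp add: fun_module_simps)
      then show "f i = \<zero>\<^bsub>?F\<^esub> i" unfolding R0 by (simp add: fun_module_simps)
    qed
    then have "is_basis R ?F {}" by (simp add: is_basis_def)
    then show ?thesis by (rule exI)
  next
    case False
    define \<delta> :: "'i \<Rightarrow> 'i \<Rightarrow> 'r" where "\<delta> i = (\<lambda>j. if j = i then \<one>\<^bsub>R\<^esub> else \<zero>\<^bsub>R\<^esub>)" for i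
    have inj: "inj \<delta>"
    proof (rule injI)
      fix i j assume "\<delta> i = \<delta> j"
      then have "\<delta> i i = \<delta> j i" by simp
      then show "i = j" using False by (simp add: \<delta>_def split: if_splits)
    qed
    have \<delta>F: "\<delta> i \<in> carrier ?F" for i by (simp add: \<delta>_def fun_module_simps)
    have sum_eval: "(\<Oplus>\<^bsub>?F\<^esub>i\<in>S. c i \<odot>\<^bsub>?F\<^esub> \<delta> i) = (\<lambda>j. if j \<in> S then c j else \<zero>\<^bsub>R\<^esub>)"
      if "finite S" "\<And>i. c i \<in> carrier R" for S and c :: "'i \<Rightarrow> 'r"
      using that(1)
    proof (induction S rule: finite_induct)
      case (insert a S)
      have "(\<Oplus>\<^bsub>?F\<^esub>i\<in>insert a S. c i \<odot>\<^bsub>?F\<^esub> \<delta> i) =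
        c a \<odot>\<^bsub>?F\<^esub> \<delta> a \<oplus>\<^bsub>?F\<^esub> (\<Oplus>\<^bsub>?F\<^esub>i\<in>S. c i \<odot>\<^bsub>?F\<^esub> \<delta> i)"
        by (rule F.M.finsum_insert) (use insert.hyps \<delta>F that(2) in \<open>simp_all add: Pi_def\<close>)
      also have "\<dots> = (\<lambda>j. if j \<in> insert a S then c j else \<zero>\<^bsub>R\<^esub>)"
        unfolding insert.IH
        by (rule ext) (use insert.hyps that(2) in \<open>simp add: fun_module_simps \<delta>_def\<close>)
      finally show ?case .
    qed (simp add: fun_module_simps)
    have sum_B: "(\<Oplus>\<^bsub>?F\<^esub>b\<in>{b\<in>range \<delta>. c b \<noteq> \<zero>\<^bsub>R\<^esub>}. c b \<odot>\<^bsub>?F\<^esub> b) = (\<lambda>j. c (\<delta> j))"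
      if c: "c \<in> range \<delta> \<rightarrow>\<^sub>E carrier R" "finite {b\<in>range \<delta>. c b \<noteq> \<zero>\<^bsub>R\<^esub>}" for c
    proof -
      let ?S = "{i. c (\<delta> i) \<noteq> \<zero>\<^bsub>R\<^esub>}"
      have eq: "{b\<in>range \<delta>. c b \<noteq> \<zero>\<^bsub>R\<^esub>} = \<delta> ` ?S" by blast
      have injS: "inj_on \<delta> ?S" using inj by (rule inj_on_subset) simp
      have fin: "finite ?S"
        using c(2) unfolding eq by (rule finite_imageD) (rule injS)
      have c': "c (\<delta> i) \<in> carrier R" for i using c(1) by blast
      have "(\<Oplus>\<^bsub>?F\<^esub>b\<in>\<delta> ` ?S. c b \<odot>\<^bsub>?F\<^esub> b) = (\<Oplus>\<^bsub>?F\<^esub>i\<in>?S. c (\<delta> i) \<odot>\<^bsub>?F\<^esub> \<delta> i)"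
      proof (rule F.M.finsum_reindex[OF _ injS])
        show "(\<lambda>b. c b \<odot>\<^bsub>?F\<^esub> b) \<in> \<delta> ` ?S \<rightarrow> carrier ?F"
          using c' \<delta>F F.smult_closed by blast
      qed
      also have "\<dots> = (\<lambda>j. c (\<delta> j))"
        unfolding sum_eval[OF fin c'] by (rule ext) simp
      finally show ?thesis unfolding eq .
    qed
    have "is_basis R ?F (range \<delta>)"
      unfolding is_basis_def
    proof (intro conjI ballI)
      show "range \<delta> \<subseteq> carrier ?F" using \<delta>F by blast
      fix f assume f: "f \<in> carrier ?F"
      let ?c = "\<lambda>b\<in>range \<delta>. f (inv_into UNIV \<delta> b)"
      have c\<delta>: "?c (\<delta> i) = f i" for i using inj by simp
      show "\<exists>!c. c \<in> range \<delta> \<rightarrow>\<^sub>E carrier R \<and> finite {b\<in>range \<delta>. c b \<noteq> \<zero>\<^bsub>R\<^esub>} \<and>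
        f = (\<Oplus>\<^bsub>?F\<^esub>b\<in>{b\<in>range \<delta>. c b \<noteq> \<zero>\<^bsub>R\<^esub>}. c b \<odot>\<^bsub>?F\<^esub> b)"
      proof (rule ex1I[of _ ?c])
        have f': "f i \<in> carrier R" for i using f by (simp add: fun_module_simps)
        have c1: "?c \<in> range \<delta> \<rightarrow>\<^sub>E carrier R" using f' by (simp add: PiE_iff)
        have "{b\<in>range \<delta>. ?c b \<noteq> \<zero>\<^bsub>R\<^esub>} \<subseteq> \<delta> ` {i. f i \<noteq> \<zero>\<^bsub>R\<^esub>}"
        proof
          fix b assume b: "b \<in> {b\<in>range \<delta>. ?c b \<noteq> \<zero>\<^bsub>R\<^esub>}"
          then obtain i where i: "b = \<delta> i" by blast
          have "?c (\<delta> i) \<noteq> \<zero>\<^bsub>R\<^esub>" using b unfolding i mem_Collect_eq by (rule conjunct2)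
          then show "b \<in> \<delta> ` {i. f i \<noteq> \<zero>\<^bsub>R\<^esub>}" unfolding i c\<delta> by blast
        qed
        then have c2: "finite {b\<in>range \<delta>. ?c b \<noteq> \<zero>\<^bsub>R\<^esub>}"
          by (rule finite_subset) (use f in \<open>simp add: fun_module_simps\<close>)
        have "f = (\<Oplus>\<^bsub>?F\<^esub>b\<in>{b\<in>range \<delta>. ?c b \<noteq> \<zero>\<^bsub>R\<^esub>}. ?c b \<odot>\<^bsub>?F\<^esub> b)"
          unfolding sum_B[OF c1 c2] c\<delta> ..
        with c1 c2 show "?c \<in> range \<delta> \<rightarrow>\<^sub>E carrier R \<and> finite {b\<in>range \<delta>. ?c b \<noteq> \<zero>\<^bsub>R\<^esub>} \<and>
          f = (\<Oplus>\<^bsub>?F\<^esub>b\<in>{b\<in>range \<delta>. ?c b \<noteq> \<zero>\<^bsub>R\<^esub>}. ?c b \<odot>\<^bsub>?F\<^esub> b)"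
          by blast
      next
        fix c
        assume c: "c \<in> range \<delta> \<rightarrow>\<^sub>E carrier R \<and> finite {b\<in>range \<delta>. c b \<noteq> \<zero>\<^bsub>R\<^esub>} \<and>
          f = (\<Oplus>\<^bsub>?F\<^esub>b\<in>{b\<in>range \<delta>. c b \<noteq> \<zero>\<^bsub>R\<^esub>}. c b \<odot>\<^bsub>?F\<^esub> b)"
        then have f_eq: "f = (\<lambda>j. c (\<delta> j))"
          using sum_B[of c] by (elim conjE) (rule trans)
        show "c = ?c"
        proof (rule extensionalityI[of _ "range \<delta>"])
          show "c \<in> extensional (range \<delta>)" using c unfolding PiE_def by blast
          show "?c \<in> extensional (range \<delta>)" by (rule restrict_extensional)
          fix b assume "b \<in> range \<delta>"
          then obtain i where "b = \<delta> i" by blast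
          then show "c b = ?c b" using c\<delta>[of i] f_eq by metis
        qed
      qed
    qed
    then show ?thesis by (rule exI)
  qed
  then show ?thesis using F.left_module_axioms unfolding free_left_module_def by blast
qed

definition decode :: "('r, 'x) ring_scheme \<Rightarrow> ('i \<times> 'r) list \<Rightarrow> 'i \<Rightarrow> 'r" where
  "decode R l i = (case map_of l i of None \<Rightarrow> \<zero>\<^bsub>R\<^esub> | Some r \<Rightarrow> r)"

lemma decode_surj:
  assumes "finite {i. f i \<noteq> \<zero>\<^bsub>R\<^esub>}" shows "\<exists>l. f = decode R l"
proof -
  obtain xs where xs: "set xs = {i. f i \<noteq> \<zero>\<^bsub>R\<^esub>}" using finite_list[OF assms] by auto
  have "f i = decode R (map (\<lambda>i. (i, f i)) xs) i" for i
    unfolding decode_def map_of_map_restrict using xs by (auto simp: restrict_map_def)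
  then show ?thesis by blast
qed

definition cover :: "('r, 'x) ring_scheme \<Rightarrow> (('r, 'n) cover_index \<Rightarrow> 'r) set \<Rightarrow>
    (('r, 'n) cover_index \<Rightarrow> 'r) \<Rightarrow> (('r, 'n) cover_index \<Rightarrow> 'r)" where
  "cover R K = lin_ext R (fun_module R)
     (\<lambda>i. case i of Comb l \<Rightarrow> if decode R l \<in> K then decode R l else (\<lambda>_. \<zero>\<^bsub>R\<^esub>) | Base _ \<Rightarrow> (\<lambda>_. \<zero>\<^bsub>R\<^esub>))"

lemma free_resolution_exists:
  fixes R :: "('r, 'x) ring_scheme" and M :: "('r, 'n) module"
  assumes "left_module R M"
  shows "\<exists>P d (e :: (('r, 'n) cover_index \<Rightarrow> 'r) \<Rightarrow> 'n). free_resolution R M P d e"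
proof -
  interpret left_module R M by fact
  let ?F = "fun_module R :: ('r, ('r, 'n) cover_index \<Rightarrow> 'r) module"
  have ring: "ring R" by (rule R.ring_axioms)
  interpret F: left_module R ?F using ring by (rule left_module_fun_module)
  have cover: "cover R K \<in> left_hom R ?F ?F \<and> cover R K ` carrier ?F = K"
    if N: "left_module R N" and h: "h \<in> left_hom R ?F N"
      and K: "K = {x\<in>carrier ?F. h x = \<zero>\<^bsub>N\<^esub>}" for K and N :: "('r, 'p) module" and h
  proof -
    interpret N: left_module R N by fact
    have h_add: "h (x \<oplus>\<^bsub>?F\<^esub> y) = h x \<oplus>\<^bsub>N\<^esub> h y" if "x \<in> carrier ?F" "y \<in> carrier ?F" for x y
      using h that by (auto simp: left_hom_def)
    have h_smult: "h (r \<odot>\<^bsub>?F\<^esub> x) = r \<odot>\<^bsub>N\<^esub> h x" if "r \<in> carrier R" "x \<in> carrier ?F" for r x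
      using h that by (auto simp: left_hom_def)
    have h_closed: "h x \<in> carrier N" if "x \<in> carrier ?F" for x
      using h that by (auto simp: left_hom_def)
    have h0: "h \<zero>\<^bsub>?F\<^esub> = \<zero>\<^bsub>N\<^esub>"
      using h_smult[of "\<zero>\<^bsub>R\<^esub>" "\<zero>\<^bsub>?F\<^esub>"] h_closed by simp
    let ?v = "\<lambda>i. case i of Comb l \<Rightarrow> if decode R l \<in> K then decode R l else (\<lambda>_. \<zero>\<^bsub>R\<^esub>)
      | Base _ \<Rightarrow> (\<lambda>_. \<zero>\<^bsub>R\<^esub>)"
    have K0: "(\<lambda>_. \<zero>\<^bsub>R\<^esub>) \<in> K" using h0 F.M.zero_closed K by (auto simp: fun_module_simps)
    have range: "range ?v = K"
    proof (intro equalityI subsetI)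
      fix x assume x: "x \<in> K"
      then have "finite {i. x i \<noteq> \<zero>\<^bsub>R\<^esub>}" using K by (auto simp: fun_module_simps)
      then obtain l where "x = decode R l" using decode_surj by blast
      then have "x = ?v (Comb l)" using x by simp
      then show "x \<in> range ?v" by blast
    qed (use K0 in \<open>auto split: cover_index.splits if_splits\<close>)
    have "?v i \<in> carrier ?F" for i using range K by blast
    then have "cover R K \<in> left_hom R ?F ?F" unfolding cover_def by (rule F.lin_ext_hom)
    moreover have "cover R K ` carrier ?F = K"
      unfolding cover_def
      by (rule F.lin_ext_image[OF _ _ _ _ range])
         (auto simp: K h0 h_add h_smult)
    ultimately show ?thesis by blast
  qed
  define v where "v i = (case i of Base m \<Rightarrow> if m \<in> carrier M then m else \<zero>\<^bsub>M\<^esub> | Comb _ \<Rightarrow> \<zero>\<^bsub>M\<^esub>)"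
    for i :: "('r, 'n) cover_index"
  have v: "range v = carrier M"
    by (auto simp: v_def split: cover_index.splits intro: image_eqI[of _ _ "Base _"])
  have v': "v i \<in> carrier M" for i using v by blast
  define e where "e = lin_ext R M v"
  have e: "e \<in> left_hom R ?F M" unfolding e_def by (rule lin_ext_hom) (rule v')
  have e_surj: "e ` carrier ?F = carrier M"
    unfolding e_def by (rule lin_ext_image[OF _ _ _ _ v]) auto
  define d where "d = rec_nat (cover R {x\<in>carrier ?F. e x = \<zero>\<^bsub>M\<^esub>})
    (\<lambda>_ h. cover R {x\<in>carrier ?F. h x = \<zero>\<^bsub>?F\<^esub>})"
  have d_simps: "d 0 = cover R {x\<in>carrier ?F. e x = \<zero>\<^bsub>M\<^esub>}"
    "d (Suc n) = cover R {x\<in>carrier ?F. d n x = \<zero>\<^bsub>?F\<^esub>}" for n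
    by (simp_all add: d_def)
  have d: "d n \<in> left_hom R ?F ?F" for n
  proof (induction n)
    case 0
    then show ?case
      using cover[OF left_module_axioms e refl] by (simp add: d_simps)
  next
    case (Suc n)
    then show ?case
      using cover[OF F.left_module_axioms Suc refl] by (simp add: d_simps)
  qed
  have "free_resolution R M (\<lambda>_. ?F) d e"
    unfolding free_resolution_def
    using free_fun_module[OF ring] d e e_surj cover[OF left_module_axioms e refl]
      cover[OF F.left_module_axioms d refl]
    by (auto simp: d_simps)
  then show ?thesis by blast
qed

lemma ring_free_algebra: "ring (free_algebra :: ('g word \<Rightarrow>\<^sub>0 'k::comm_ring_1) ring)"
proof (rule ringI)
  show "abelian_group (free_algebra :: ('g word \<Rightarrow>\<^sub>0 'k) ring)"
  proof (rule abelian_groupI)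
    fix x :: "'g word \<Rightarrow>\<^sub>0 'k"
    show "\<exists>y\<in>carrier free_algebra. y \<oplus>\<^bsub>free_algebra\<^esub> x = \<zero>\<^bsub>free_algebra\<^esub>"
      by (rule bexI[of _ "- x"]) (simp_all add: free_algebra_def)
  qed (simp_all add: free_algebra_def add.assoc add.commute)
  show "Group.monoid (free_algebra :: ('g word \<Rightarrow>\<^sub>0 'k) ring)"
    by (rule monoidI) (simp_all add: free_algebra_def mult.assoc)
qed (simp_all add: free_algebra_def distrib_left distrib_right)

lemma ideal_relations: "ideal (genideal free_algebra rels) free_algebra"
  by (rule ring.genideal_ideal[OF ring_free_algebra]) (simp add: free_algebra_def)

lemma presented_algebra_simps:
  "carrier (presented_algebra rels) = carrier (free_algebra Quot genideal free_algebra rels)"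
  "monoid.mult (presented_algebra rels) = monoid.mult (free_algebra Quot genideal free_algebra rels)"
  "one (presented_algebra rels) = one (free_algebra Quot genideal free_algebra rels)"
  "zero (presented_algebra rels) = zero (free_algebra Quot genideal free_algebra rels)"
  "add (presented_algebra rels) = add (free_algebra Quot genideal free_algebra rels)"
  by (simp_all add: presented_algebra_def Let_def)

lemma ring_presented_algebra: "ring (presented_algebra rels)"
proof -
  interpret Q: ring "free_algebra Quot genideal free_algebra rels"
    by (rule ideal.quotient_is_ring[OF ideal_relations])
  show ?thesis
  proof (rule ringI)
    show "abelian_group (presented_algebra rels)"
    proof (rule abelian_groupI, unfold presented_algebra_simps)
      fix x assume x: "x \<in> carrier (free_algebra Quot genideal free_algebra rels)"
      show "\<exists>y\<in>carrier (free_algebra Quot genideal free_algebra rels).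
          y \<oplus>\<^bsub>free_algebra Quot genideal free_algebra rels\<^esub> x =
          \<zero>\<^bsub>free_algebra Quot genideal free_algebra rels\<^esub>"
        using Q.l_neg[OF x] Q.a_inv_closed[OF x] by blast
    qed (erule (2) Q.a_assoc Q.a_closed Q.zero_closed | erule (1) Q.a_comm Q.a_closed | erule Q.l_zero | rule Q.zero_closed)+
    show "Group.monoid (presented_algebra rels)"
      by (rule monoidI, unfold presented_algebra_simps) (simp_all add: Q.m_assoc)
  qed (unfold presented_algebra_simps, (erule (2) Q.l_distr Q.r_distr)+)
qed

lemma lookup_mult_0:
  fixes p r :: "'g word \<Rightarrow>\<^sub>0 'k::comm_ring_1"
  shows "Poly_Mapping.lookup (p * r) 0 = Poly_Mapping.lookup p 0 * Poly_Mapping.lookup r 0"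
proof -
  have eq: "0 = l + m \<longleftrightarrow> l = 0 \<and> m = 0" for l m :: "'g word"
    by (cases l; cases m) (auto simp: zero_word_def plus_word_def)
  have "(\<Sum>m. Poly_Mapping.lookup r m when 0 = l + m) = (Poly_Mapping.lookup r 0 when l = 0)" for l
    by (cases "l = 0") (simp_all add: eq)
  then show ?thesis by (simp add: lookup_mult mult_when)
qed

lemma lookup_power_0:
  fixes p :: "'g word \<Rightarrow>\<^sub>0 'k::comm_ring_1"
  shows "Poly_Mapping.lookup (p ^ n) 0 = Poly_Mapping.lookup p 0 ^ n"
  by (induction n) (simp_all add: lookup_mult_0)

lemma lookup_gen_0: "Poly_Mapping.lookup (gen g) 0 = 0"
  by (simp add: gen_def lookup_single zero_word_def)

lemma left_module_trivial:
  fixes q :: "nat \<Rightarrow> nat \<Rightarrow> 'k::field"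
  assumes "N > 0"
  shows "left_module (nichols_algebra N q) trivial_module"
proof -
  let ?F = "free_algebra :: (nichols_gen word \<Rightarrow>\<^sub>0 'k) ring"
  let ?I = "genideal ?F (nichols_relations N q)"
  let ?c = "\<lambda>p :: nichols_gen word \<Rightarrow>\<^sub>0 'k. Poly_Mapping.lookup p 0"
  interpret F: ring ?F by (rule ring_free_algebra)
  interpret I: ideal ?I ?F by (rule ideal_relations)
  have "ideal {p. ?c p = 0} ?F"
  proof (rule idealI[OF ring_free_algebra])
    show "subgroup {p. ?c p = 0} (add_monoid ?F)"
    proof (rule group.subgroupI[OF F.add.is_group])
      show "inv\<^bsub>add_monoid ?F\<^esub> p \<in> {p. ?c p = 0}" if "p \<in> {p. ?c p = 0}" for p
      proof -
        have "inv\<^bsub>add_monoid ?F\<^esub> p = - p"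
          by (rule group.inv_equality[OF F.add.is_group]) (simp_all add: free_algebra_def)
        then show ?thesis using that by simp
      qed
    qed (auto simp: free_algebra_def lookup_add intro: exI[of _ 0])
  qed (simp_all add: free_algebra_def lookup_mult_0)
  moreover have "nichols_relations N q \<subseteq> {p. ?c p = 0}"
    using assms by (simp add: nichols_relations_def Let_def lookup_add lookup_minus lookup_mult_0
        lookup_power_0 lookup_gen_0 zero_power)
  ultimately have I0: "?I \<subseteq> {p. ?c p = 0}" by (rule F.genideal_minimal)
  have act: "(?I +>\<^bsub>?F\<^esub> p) \<odot>\<^bsub>trivial_module\<^esub> x = ?c p * x" for p x
  proof -
    have "?c ` (?I +>\<^bsub>?F\<^esub> p) = {?c p}"
    proof (intro equalityI subsetI)
      fix y assume "y \<in> ?c ` (?I +>\<^bsub>?F\<^esub> p)"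
      then obtain i where "i \<in> ?I" "y = ?c (i + p)"
        by (auto simp: a_r_coset_def' free_algebra_def)
      then show "y \<in> {?c p}" using I0 by (auto simp: lookup_add)
    next
      fix y assume "y \<in> {?c p}"
      moreover have "p \<in> ?I +>\<^bsub>?F\<^esub> p"
        by (rule I.a_rcos_self) (simp add: free_algebra_def)
      ultimately show "y \<in> ?c ` (?I +>\<^bsub>?F\<^esub> p)" by blast
    qed
    then show ?thesis by (simp add: trivial_module_def)
  qed
  let ?Q = "?F Quot ?I"
  have rep: "\<exists>p. X = ?I +>\<^bsub>?F\<^esub> p" if "X \<in> carrier ?Q" for X
    using that by (auto simp: FactRing_def A_RCOSETS_def')
  have Q: "monoid.mult ?Q (?I +>\<^bsub>?F\<^esub> p) (?I +>\<^bsub>?F\<^esub> r) = ?I +>\<^bsub>?F\<^esub> (p * r)"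
      "add ?Q (?I +>\<^bsub>?F\<^esub> p) (?I +>\<^bsub>?F\<^esub> r) = ?I +>\<^bsub>?F\<^esub> (p + r)"
      "one ?Q = ?I +>\<^bsub>?F\<^esub> 1" for p r
    using I.rcoset_mult_add[of p r] I.a_rcos_sum[of p r]
    by (simp_all add: FactRing_def free_algebra_def)
  have triv: "abelian_group (trivial_module :: ((nichols_gen word \<Rightarrow>\<^sub>0 'k) set, 'k) module)"
  proof (rule abelian_groupI)
    fix x :: 'k
    show "\<exists>y\<in>carrier trivial_module. y \<oplus>\<^bsub>trivial_module\<^esub> x = \<zero>\<^bsub>trivial_module\<^esub>"
      by (rule bexI[of _ "- x"]) (simp_all add: trivial_module_def)
  qed (simp_all add: trivial_module_def ac_simps)
  have tadd: "add trivial_module = ((+) :: 'k \<Rightarrow> _)" by (simp add: trivial_module_def)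
  show ?thesis
    unfolding nichols_algebra_def
  proof (intro left_module.intro left_module_axioms.intro ring_presented_algebra triv)
    fix a b x
    assume "a \<in> carrier (presented_algebra (nichols_relations N q))"
      "b \<in> carrier (presented_algebra (nichols_relations N q))"
    then obtain p r where ab: "a = ?I +>\<^bsub>?F\<^esub> p" "b = ?I +>\<^bsub>?F\<^esub> r"
      using rep unfolding presented_algebra_simps by blast
    show "(a \<oplus>\<^bsub>presented_algebra (nichols_relations N q)\<^esub> b) \<odot>\<^bsub>trivial_module\<^esub> x =
      a \<odot>\<^bsub>trivial_module\<^esub> x \<oplus>\<^bsub>trivial_module\<^esub> b \<odot>\<^bsub>trivial_module\<^esub> x"
      unfolding presented_algebra_simps ab Q act tadd by (simp add: lookup_add algebra_simps)
    show "(a \<otimes>\<^bsub>presented_algebra (nichols_relations N q)\<^esub> b) \<odot>\<^bsub>trivial_module\<^esub> x =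
      a \<odot>\<^bsub>trivial_module\<^esub> (b \<odot>\<^bsub>trivial_module\<^esub> x)"
      unfolding presented_algebra_simps ab Q act by (simp add: lookup_mult_0)
  next
    fix a x y
    assume "a \<in> carrier (presented_algebra (nichols_relations N q))"
    then obtain p where a: "a = ?I +>\<^bsub>?F\<^esub> p"
      using rep unfolding presented_algebra_simps by blast
    show "a \<odot>\<^bsub>trivial_module\<^esub> (x \<oplus>\<^bsub>trivial_module\<^esub> y) =
      a \<odot>\<^bsub>trivial_module\<^esub> x \<oplus>\<^bsub>trivial_module\<^esub> a \<odot>\<^bsub>trivial_module\<^esub> y"
      unfolding a act tadd by (simp add: algebra_simps)
  next
    fix x
    show "\<one>\<^bsub>presented_algebra (nichols_relations N q)\<^esub> \<odot>\<^bsub>trivial_module\<^esub> x = x"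
      unfolding presented_algebra_simps Q act by simp
  qed (simp add: trivial_module_def)
qed

corollary resolution_of_trivial_module_exists:
  fixes q :: "nat \<Rightarrow> nat \<Rightarrow> 'k::field"
  assumes "N > 0"
  shows "\<exists>P d (e :: (((nichols_gen word \<Rightarrow>\<^sub>0 'k) set, 'k) cover_index
                       \<Rightarrow> (nichols_gen word \<Rightarrow>\<^sub>0 'k) set) \<Rightarrow> 'k).
           free_resolution (nichols_algebra N q) trivial_module P d e"
  by (rule free_resolution_exists[OF left_module_trivial[OF assms]])

end

theory Submission
  imports Defs "HOL-Library.Function_Algebras"
begin

text \<open>
  Put \<open>y = x\<^sub>1 x\<^sub>2 - q\<^sub>1\<^sub>2 x\<^sub>2 x\<^sub>1\<close>.  The trivial module has an explicit free resolution \<open>Q\<close> in which \<open>Q\<^sub>n\<close> is free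
  on symbols \<open>w(i, l) g^j\<close> with \<open>i + l + 3 j = 3 (n div 2) + n mod 2\<close>, and whose differentials have
  coefficients in the augmentation ideal; so \<open>Ext\<^sup>n\<close> has the dual basis of these symbols.  Each of the seven
  generators lifts to a chain map of \<open>Q\<close> that lowers \<open>(i, l, j)\<close> by a fixed vector and commutes with the
  differentials on the nose.  Hence the free algebra on the generators acts on \<open>Q\<close>, and composing the
  action with the augmentation is a multiplicative map to Ext, under which a word becomes a multiple of a
  single dual basis vector; this gives the relations.  Conversely the relations reduce every word to a multiple
  of \<open>\<beta> b\<^sub>1^x b\<^sub>2^y b\<^sub>y^z\<close> with \<open>\<beta> \<in> {1, a\<^sub>1, a\<^sub>2, c\<^sub>1, c\<^sub>2, a\<^sub>1 c\<^sub>2}\<close>, and these words meet every dual basis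
  vector exactly once.  Comparison maps transport the result from \<open>Q\<close> to an arbitrary free resolution.
\<close>

section \<open>The resolution and its periodicity maps\<close>

text \<open>At q12 = om the relations x1^3, x2^3 and the two Serre relations are the sums of all
  words with i letters x1 and l letters x2, i + l = 3. Such an algebra carries a complex of 3-Koszul
  shape: one symbol w(i, l) for each symmetrised word, only the degrees with i + l = 0 or 1 mod 3,
  and differentials that split off alternately one letter and two. The last relation y^3 = 0 is
  adjoined as for a hypersurface, by a variable g of homological degree 2 whose bidegree is that of
  y^3; the terms in y^2 of the differentials carry the homotopy for y^3. Hence the weight 3 (n div
  2) + n mod 2. A general q12 would put powers of the parameter into every formula. The twist leaves
  the right multiplications alone, so the differentials, their exactness and the untwisted
  periodicity maps are computed once, at q12 = om. The Yoneda product composes maps, and this fixes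
  the naming: \<open>Ga1\<close> and \<open>Gb1\<close> are dual to x2 and its cube,
  \<open>Ga2\<close> and \<open>Gb2\<close> to x1 and its cube. The opposite choice would turn the
  p^3 in the commutation of \<open>Ga2\<close> and \<open>Gb1\<close> into p^(-3).\<close>

datatype tri = T0 | T1 | T2

text \<open>The entry \<open>v a c b\<close> is the coefficient of \<open>x\<^sub>2^a y^c x\<^sub>1^b\<close>, and the entry \<open>f i l j\<close> of a chain is the
  coefficient of the symbol \<open>w(i, l) g^j\<close>.\<close>

type_synonym 'k vec = "tri \<Rightarrow> tri \<Rightarrow> tri \<Rightarrow> 'k"
type_synonym 'k chn = "nat \<Rightarrow> nat \<Rightarrow> nat \<Rightarrow> 'k vec"

text \<open>Coefficients after multiplication by a letter of cube zero: exponents go up by one and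
  the top coefficient is lost.\<close>

definition dn :: "(tri \<Rightarrow> 'k::zero) \<Rightarrow> tri \<Rightarrow> 'k" where
  "dn g t = (case t of T0 \<Rightarrow> 0 | T1 \<Rightarrow> g T0 | T2 \<Rightarrow> g T1)"

definition pw :: "'k::comm_ring_1 \<Rightarrow> tri \<Rightarrow> 'k" where
  "pw x t = (case t of T0 \<Rightarrow> 1 | T1 \<Rightarrow> x | T2 \<Rightarrow> x * x)"

definition sv :: "'k::comm_ring_1 \<Rightarrow> 'k vec \<Rightarrow> 'k vec" where
  "sv x v = (\<lambda>a c b. x * v a c b)"

text \<open>\<open>tw1\<close> weighs x2^a y^c x1^b by its degree b + c in x1, and
  \<open>tw2\<close> by its degree a + c in x2.\<close>

definition tw1 :: "'k::comm_ring_1 \<Rightarrow> 'k vec \<Rightarrow> 'k vec" where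
  "tw1 x v = (\<lambda>a c b. pw x c * pw x b * v a c b)"

definition tw2 :: "'k::comm_ring_1 \<Rightarrow> 'k vec \<Rightarrow> 'k vec" where
  "tw2 x v = (\<lambda>a c b. pw x a * pw x c * v a c b)"

locale cube_root =
  fixes om :: "'k::field"
  assumes om2: "om * om = - 1 - om"
begin

text \<open>The right and left multiplications by \<open>x\<^sub>1, y, x\<^sub>2\<close> are those for \<open>q\<^sub>1\<^sub>2 = om\<close>.  The case
  \<open>q\<^sub>1\<^sub>2 = om p\<close> is a cocycle twist of it: with suitably rescaled bases only the left action of \<open>x\<^sub>1\<close>
  changes, by a power of \<open>p\<close> that depends on the degree.\<close>

definition rx1 :: "'k vec \<Rightarrow> 'k vec" where
  "rx1 v = (\<lambda>a c b. dn (v a c) b)"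

definition ry :: "'k vec \<Rightarrow> 'k vec" where
  "ry v = (\<lambda>a c b. pw (om * om) b * dn (\<lambda>c. v a c b) c)"

text \<open>Straightening rules: x1 x2 = y + om x2 x1 and y x2 = om^2 x2 y, hence x1^2 x2 = - y x1 +
  om^2 x2 x1^2 with - 1 = om^2 + om.\<close>

definition rx2 :: "'k vec \<Rightarrow> 'k vec" where
  "rx2 v = (\<lambda>a c b. pw om b * pw (om * om) c * dn (\<lambda>a. v a c b) a +
     (case b of T0 \<Rightarrow> dn (\<lambda>c. v a c T1) c | T1 \<Rightarrow> - dn (\<lambda>c. v a c T2) c | T2 \<Rightarrow> 0))"

definition lx1 :: "'k vec \<Rightarrow> 'k vec" where
  "lx1 v = (\<lambda>a c b. pw om a * pw (om * om) c * dn (v a c) b +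
     (case a of T0 \<Rightarrow> dn (\<lambda>c. v T1 c b) c | T1 \<Rightarrow> - dn (\<lambda>c. v T2 c b) c | T2 \<Rightarrow> 0))"

definition lx2 :: "'k vec \<Rightarrow> 'k vec" where
  "lx2 v = (\<lambda>a c b. dn (\<lambda>a. v a c b) a)"

lemma om3: "om * (om * x) = - x - om * x"
  by (simp add: om2 mult.assoc[symmetric] algebra_simps)

lemmas vec_defs = rx1_def ry_def rx2_def lx1_def lx2_def sv_def tw1_def tw2_def

lemma vec_eqI: "(\<And>a c b. v a c b = w a c b) \<Longrightarrow> v = (w :: 'k vec)"
  by (intro ext) simp

text \<open>As rewrite rules they bring every product of right multiplications into the order v x2^a
  y^c x1^b. Identities between chain maps then become identities between coefficients.\<close>

lemma right_mult_rules:
  "rx2 (rx1 v) = ry v + sv om (rx1 (rx2 v))"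
  "ry (rx1 v) = sv (om * om) (rx1 (ry v))"
  "rx2 (ry v) = sv (om * om) (ry (rx2 v))"
  "rx1 (rx1 (rx1 v)) = 0" "ry (ry (ry v)) = 0" "rx2 (rx2 (rx2 v)) = 0"
  by (rule vec_eqI; simp add: vec_defs dn_def pw_def om2 om3 algebra_simps split: tri.splits)+

lemma right_mult_linear:
  "rx1 (v + w) = rx1 v + rx1 w" "ry (v + w) = ry v + ry w" "rx2 (v + w) = rx2 v + rx2 w"
  "rx1 (sv x v) = sv x (rx1 v)" "ry (sv x v) = sv x (ry v)" "rx2 (sv x v) = sv x (rx2 v)"
  "rx1 0 = 0" "ry 0 = 0" "rx2 0 = 0"
  by (rule vec_eqI; simp add: vec_defs dn_def pw_def om2 om3 algebra_simps split: tri.splits)+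

lemma left_mult_linear:
  "lx1 (v + w) = lx1 v + lx1 w" "lx2 (v + w) = lx2 v + lx2 w"
  "lx1 (sv x v) = sv x (lx1 v)" "lx2 (sv x v) = sv x (lx2 v)"
  "lx1 0 = 0" "lx2 0 = 0"
  by (rule vec_eqI; simp add: vec_defs dn_def pw_def om2 om3 algebra_simps split: tri.splits)+

text \<open>Associativity of the algebra. It turns every formula built from right multiplications
  into a map of left modules.\<close>

lemma left_right_commute:
  "lx1 (rx1 v) = rx1 (lx1 v)" "lx1 (ry v) = ry (lx1 v)" "lx1 (rx2 v) = rx2 (lx1 v)"
  "lx2 (rx1 v) = rx1 (lx2 v)" "lx2 (ry v) = ry (lx2 v)" "lx2 (rx2 v) = rx2 (lx2 v)"
  by (rule vec_eqI; simp add: vec_defs dn_def pw_def om2 om3 algebra_simps split: tri.splits)+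

lemma sv_simps [simp]: "sv x (v + w) = sv x v + sv x w" "sv x (sv y v) = sv (x * y) v"
  "sv x 0 = 0" "sv 1 v = (v :: 'k vec)" "sv 0 v = 0"
  by (rule vec_eqI; simp add: sv_def algebra_simps)+

lemma twist_linear:
  "tw1 x (v + w) = tw1 x v + tw1 x w" "tw1 x (sv y v) = sv y (tw1 x v)" "tw1 x (0::'k vec) = 0"
  "tw2 x (v + w) = tw2 x v + tw2 x w" "tw2 x (sv y v) = sv y (tw2 x v)" "tw2 x (0::'k vec) = 0"
  by (rule vec_eqI; simp add: vec_defs algebra_simps)+

lemma twist_mult:
  "tw1 x (rx1 v) = sv x (rx1 (tw1 x v))" "tw1 x (ry v) = sv x (ry (tw1 x v))" "tw1 x (rx2 v) = rx2 (tw1 x v)"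
  "tw2 x (rx1 v) = rx1 (tw2 x v)" "tw2 x (ry v) = sv x (ry (tw2 x v))" "tw2 x (rx2 v) = sv x (rx2 (tw2 x v))"
  "tw1 x (lx1 v) = sv x (lx1 (tw1 x v))" "tw1 x (lx2 v) = lx2 (tw1 x v)"
  "tw2 x (lx1 v) = lx1 (tw2 x v)" "tw2 x (lx2 v) = sv x (lx2 (tw2 x v))"
  "tw1 x (tw2 y v) = tw2 y (tw1 x v)"
  by (rule vec_eqI; simp add: vec_defs dn_def pw_def algebra_simps split: tri.splits)+

text \<open>The q-integer 1 + q + ... + q^i at q = om^2, which has period 3 in i.\<close>

definition dc :: "nat \<Rightarrow> 'k" where
  "dc i = (if i mod 3 = 0 then 1 else if i mod 3 = 1 then - om else 0)"

text \<open>The coefficient for which \<open>D1 f i l j\<close> equals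
  \<open>D0 (D0 f) i l j\<close> whenever l > 0: moving y^2 past x1 costs om^4 = om, which gives
  \<open>om * dc i + dc (Suc i)\<close>.\<close>

definition ec :: "nat \<Rightarrow> 'k" where
  "ec i = (if i mod 3 = 0 then 1 else if i mod 3 = 1 then 0 else - om * om)"

definition kc :: "nat \<Rightarrow> 'k" where
  "kc i = (if i mod 3 = 0 then - om * om else if i mod 3 = 1 then 0 else om)"

text \<open>\<open>D0\<close> and \<open>D1\<close> are the differentials into even and odd degrees, where \<open>(i + l) mod 3\<close> is \<open>0\<close> and \<open>1\<close>.\<close>

definition D0 :: "'k chn \<Rightarrow> 'k chn" where
  "D0 f = (\<lambda>i l j. rx1 (f (Suc i) l j) + rx2 (f i (Suc l) j) +
     (case i of 0 \<Rightarrow> 0 | Suc i' \<Rightarrow> (case l of 0 \<Rightarrow> 0 | Suc l' \<Rightarrow>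
        sv (dc i') (ry (ry (f i' l' (Suc j)))))))"

definition D1 :: "'k chn \<Rightarrow> 'k chn" where
  "D1 f = (\<lambda>i l j. rx1 (rx1 (f (Suc (Suc i)) l j)) +
     (rx1 (rx2 (f (Suc i) (Suc l) j)) + rx2 (rx1 (f (Suc i) (Suc l) j))) +
     rx2 (rx2 (f i (Suc (Suc l)) j)) +
     (case l of 0 \<Rightarrow> 0 | Suc l' \<Rightarrow> sv (ec i) (rx1 (ry (ry (f i l' (Suc j)))))) +
     (case i of 0 \<Rightarrow> 0 | Suc i' \<Rightarrow> sv (- om * om * dc i') (ry (ry (rx2 (f i' l (Suc j)))))))"

lemmas op_rules = right_mult_rules right_mult_linear

lemma sv_apply [simp]: "sv x v a c b = x * v a c b"
  by (simp add: sv_def)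

lemmas coef_defs = dc_def ec_def kc_def mod_Suc

lemma mod3_cases:
  fixes i :: nat
  obtains "i mod 3 = 0" | "i mod 3 = Suc 0" | "i mod 3 = Suc (Suc 0)"
proof -
  have "i mod 3 = 0 \<or> i mod 3 = Suc 0 \<or> i mod 3 = Suc (Suc 0)" by presburger
  then show ?thesis by (elim disjE) (fact that)+
qed

end

section \<open>Periodicity maps and their compatibility with the differentials\<close>

context cube_root begin

lemma dc_rec: "dc (Suc i) = 1 + om * om * dc i"
  by (cases i rule: mod3_cases; simp add: coef_defs om2 om3 algebra_simps)

lemma ec_rec: "ec (Suc i) = om * dc i + dc (Suc i)" "ec 0 = 1" "dc 0 = 1" "dc (Suc 0) = -om"
  by (cases i rule: mod3_cases; simp add: coef_defs om2 om3)+

lemma dc_at: "k mod 3 = 0 \<Longrightarrow> dc k = 1" "k mod 3 = 0 \<Longrightarrow> dc (Suc k) = - om"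
  "k mod 3 = 1 \<Longrightarrow> dc k = - om" "k mod 3 = 1 \<Longrightarrow> dc (Suc k) = 0"
  "k mod 3 = 2 \<Longrightarrow> dc k = 0" "k mod 3 = 2 \<Longrightarrow> dc (Suc k) = 1"
  by (simp_all add: coef_defs)

lemma nat2_cases: obtains "i = (0::nat)" | "i = Suc 0" | k where "i = Suc (Suc k)"
  by (metis not0_implies_Suc)

text \<open>Equal to om^(2 i). It is expressed by \<open>dc\<close> so that the identities below
  close under the recursion of \<open>dc\<close>.\<close>

definition wc :: "nat \<Rightarrow> 'k" where
  "wc i = om - (om - 1) * dc i"

text \<open>A shift of i that is not a multiple of 3 changes the coefficients \<open>dc\<close> and
  \<open>ec\<close> of the differentials. The extra term, fed by the neighbour with one more g,
  repairs this. \<open>Fc12\<close>, \<open>Fa10e\<close> and \<open>Fa10o\<close> are corrected in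
  the same way, whereas \<open>Fa01e\<close> leaves i alone and is a bare shift.\<close>

definition Fc21e :: "'k chn \<Rightarrow> 'k chn" where
  "Fc21e f = (\<lambda>i l j. f (Suc (Suc i)) (Suc l) j + sv (om * wc i) (ry (rx2 (f i l (Suc j)))))"

definition Fc21o :: "'k chn \<Rightarrow> 'k chn" where
  "Fc21o f = (\<lambda>i l j. f (Suc (Suc i)) (Suc l) j + sv (om * om * wc i) (ry (rx2 (f i l (Suc j)))))"

definition Fc12 :: "'k chn \<Rightarrow> 'k chn" where
  "Fc12 f = (\<lambda>i l j. f (Suc i) (Suc (Suc l)) j + sv (wc i) (rx1 (ry (f i l (Suc j)))))"

definition Fa01e :: "'k chn \<Rightarrow> 'k chn" where
  "Fa01e f = (\<lambda>i l j. f i (Suc l) j)"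

text \<open>This is \<open>D0 f i (Suc l) j\<close>. In odd degrees a class of degree 1 lowers the
  weight by two; since \<open>D1\<close> is \<open>D0\<close> applied twice for l > 0, one step of
  \<open>D0\<close> beside the shift of l supplies the missing letter.\<close>

definition Fa01o :: "'k chn \<Rightarrow> 'k chn" where
  "Fa01o f = (\<lambda>i l j. rx1 (f (Suc i) (Suc l) j) + rx2 (f i (Suc (Suc l)) j) +
     (case i of 0 \<Rightarrow> 0 | Suc i' \<Rightarrow> sv (dc i') (ry (ry (f i' l (Suc j))))))"

definition Fa10e :: "'k chn \<Rightarrow> 'k chn" where
  "Fa10e f = (\<lambda>i l j. f (Suc i) l j +
     (case i of 0 \<Rightarrow> 0 | Suc i' \<Rightarrow> (case l of 0 \<Rightarrow> 0 | Suc l' \<Rightarrow>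
        sv (om * dc i') (ry (rx2 (f i' l' (Suc j)))))))"

definition Fa10o :: "'k chn \<Rightarrow> 'k chn" where
  "Fa10o f = (\<lambda>i l j. rx1 (f (Suc (Suc i)) l j) + rx2 (f (Suc i) (Suc l) j) +
     (case l of 0 \<Rightarrow> 0 | Suc l' \<Rightarrow> sv (- om * om * ec i) (rx1 (ry (rx2 (f i l' (Suc j)))))) +
     (case i of 0 \<Rightarrow> 0 | Suc i' \<Rightarrow> sv (om * om * dc i') (ry (rx2 (rx2 (f i' l (Suc j)))))))"

text \<open>On the edges l = 0 and l = 1 some terms of the differentials are absent. The residue of
  i + l then fixes the residue of i, and with it the values of \<open>dc\<close>.\<close>

lemma mod3_facts:
  fixes i l :: nat
  assumes "(i + l) mod 3 = r"
  shows "r = 0 \<Longrightarrow> l = 0 \<Longrightarrow> i = Suc (Suc k) \<Longrightarrow> k mod 3 = 1"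
    "r = 0 \<Longrightarrow> l = Suc 0 \<Longrightarrow> i = Suc (Suc k) \<Longrightarrow> k mod 3 = 0"
    "r = 1 \<Longrightarrow> l = 0 \<Longrightarrow> i = Suc (Suc k) \<Longrightarrow> k mod 3 = 2"
    "r = 1 \<Longrightarrow> l = Suc 0 \<Longrightarrow> i = Suc (Suc k) \<Longrightarrow> k mod 3 = 1"
  using assms by presburger+

lemmas lift_defs = Fc21e_def Fc21o_def wc_def Fc12_def Fa01e_def Fa01o_def Fa10e_def Fa10o_def

text \<open>Comparison of normal forms, position by position. Two steps are split off from i and
  from l because the composite reaches back at most two places; the recursion of \<open>dc\<close>
  settles the generic position. The lemmas up to \<open>D1_Fa10\<close> follow the same
  scheme.\<close>

lemma D0_D1: assumes "(i + l) mod 3 = 0" shows "D0 (D1 f) i l j = 0"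
  using assms mod3_facts[OF assms]
  by (cases i rule: nat2_cases; cases l rule: nat2_cases; 
      (simp add: D0_def D1_def lift_defs op_rules ec_rec dc_at)?)
    (rule vec_eqI, simp (no_asm_simp) add: dc_rec dc_at om2 om3 algebra_simps)+

lemma D1_D0: assumes "(i + l) mod 3 = 1" shows "D1 (D0 f) i l j = 0"
  using assms mod3_facts[OF assms]
  by (cases i rule: nat2_cases; cases l rule: nat2_cases; 
      (simp add: D0_def D1_def lift_defs op_rules ec_rec dc_at)?)
    (rule vec_eqI, simp (no_asm_simp) add: dc_rec dc_at om2 om3 algebra_simps)+

lemma D0_Fc21: assumes "(i + l) mod 3 = 0" shows "D0 (Fc21o f) i l j = Fc21e (D0 f) i l j"
  using assms mod3_facts[OF assms]
  by (cases i rule: nat2_cases; cases l rule: nat2_cases; 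
      (simp add: D0_def D1_def lift_defs op_rules ec_rec dc_at)?)
    (rule vec_eqI, simp (no_asm_simp) add: dc_rec dc_at om2 om3 algebra_simps)+

lemma D1_Fc21: assumes "(i + l) mod 3 = 1" shows "D1 (Fc21e f) i l j = Fc21o (D1 f) i l j"
  using assms mod3_facts[OF assms]
  by (cases i rule: nat2_cases; cases l rule: nat2_cases; 
      (simp add: D0_def D1_def lift_defs op_rules ec_rec dc_at)?)
    (rule vec_eqI, simp (no_asm_simp) add: dc_rec dc_at om2 om3 algebra_simps)+

lemma D0_Fc12: assumes "(i + l) mod 3 = 0" shows "D0 (Fc12 f) i l j = Fc12 (D0 f) i l j"
  using assms mod3_facts[OF assms]
  by (cases i rule: nat2_cases; cases l rule: nat2_cases; 
      (simp add: D0_def D1_def lift_defs op_rules ec_rec dc_at)?)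
    (rule vec_eqI, simp (no_asm_simp) add: dc_rec dc_at om2 om3 algebra_simps)+

lemma D1_Fc12: assumes "(i + l) mod 3 = 1" shows "D1 (Fc12 f) i l j = Fc12 (D1 f) i l j"
  using assms mod3_facts[OF assms]
  by (cases i rule: nat2_cases; cases l rule: nat2_cases; 
      (simp add: D0_def D1_def lift_defs op_rules ec_rec dc_at)?)
    (rule vec_eqI, simp (no_asm_simp) add: dc_rec dc_at om2 om3 algebra_simps)+

lemma D0_Fa01: assumes "(i + l) mod 3 = 0" shows "D0 (Fa01o f) i l j = Fa01e (D1 f) i l j"
  using assms mod3_facts[OF assms]
  by (cases i rule: nat2_cases; cases l rule: nat2_cases; 
      (simp add: D0_def D1_def lift_defs op_rules ec_rec dc_at)?)
    (rule vec_eqI, simp (no_asm_simp) add: dc_rec dc_at om2 om3 algebra_simps)+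

lemma D1_Fa01: assumes "(i + l) mod 3 = 1" shows "D1 (Fa01e f) i l j = Fa01o (D0 f) i l j"
  using assms mod3_facts[OF assms]
  by (cases i rule: nat2_cases; cases l rule: nat2_cases; 
      (simp add: D0_def D1_def lift_defs op_rules ec_rec dc_at)?)
    (rule vec_eqI, simp (no_asm_simp) add: dc_rec dc_at om2 om3 algebra_simps)+

lemma D0_Fa10: assumes "(i + l) mod 3 = 0" shows "D0 (Fa10o f) i l j = Fa10e (D1 f) i l j"
  using assms mod3_facts[OF assms]
  by (cases i rule: nat2_cases; cases l rule: nat2_cases; 
      (simp add: D0_def D1_def lift_defs op_rules ec_rec dc_at)?)
    (rule vec_eqI, simp (no_asm_simp) add: dc_rec dc_at om2 om3 algebra_simps)+

lemma D1_Fa10: assumes "(i + l) mod 3 = 1" shows "D1 (Fa10e f) i l j = Fa10o (D0 f) i l j"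
  using assms mod3_facts[OF assms]
  by (cases i rule: nat2_cases; cases l rule: nat2_cases; 
      (simp add: D0_def D1_def lift_defs op_rules ec_rec dc_at)?)
    (rule vec_eqI, simp (no_asm_simp) add: dc_rec dc_at om2 om3 algebra_simps)+
end

section \<open>Exactness\<close>

context cube_root begin

definition Fb30 :: "'k chn \<Rightarrow> 'k chn" where "Fb30 f = (\<lambda>i l j. f (Suc (Suc (Suc i))) l j)"
definition Fb03 :: "'k chn \<Rightarrow> 'k chn" where "Fb03 f = (\<lambda>i l j. f i (Suc (Suc (Suc l))) j)"
definition Fb001 :: "'k chn \<Rightarrow> 'k chn" where "Fb001 f = (\<lambda>i l j. f i l (Suc j))"

lemma dc_per: "dc (Suc (Suc (Suc i))) = dc i" "ec (Suc (Suc (Suc i))) = ec i"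
proof -
  have "Suc (Suc (Suc i)) mod 3 = i mod 3" by presburger
  then show "dc (Suc (Suc (Suc i))) = dc i" "ec (Suc (Suc (Suc i))) = ec i"
    unfolding dc_def ec_def by simp_all
qed

lemma dc_zero: "k mod 3 = 2 \<Longrightarrow> dc k = 0" "k mod 3 = 1 \<Longrightarrow> ec k = 0" "dc (Suc (Suc 0)) = 0" "ec 0 = 1"
  by (simp_all add: dc_def ec_def)

text \<open>The terms that lower l are cut off at l = 0, whereas after a shift of l by 3 they would
  be present. These residues of i make their coefficients vanish, so that the shift commutes with
  the differentials.\<close>

lemma boundary_coef:
  "(i + l) mod 3 = 0 \<Longrightarrow> l = 0 \<Longrightarrow> i = Suc k \<Longrightarrow> dc k = 0"
  "(i + l) mod 3 = 1 \<Longrightarrow> l = 0 \<Longrightarrow> ec i = 0"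
proof -
  show "dc k = 0" if "(i + l) mod 3 = 0" "l = 0" "i = Suc k"
    by (rule dc_zero) (use that in presburger)
  show "ec i = 0" if "(i + l) mod 3 = 1" "l = 0"
    by (rule dc_zero) (use that in presburger)
qed

lemma D0_simps:
  "D0 f 0 l j = rx1 (f (Suc 0) l j) + rx2 (f 0 (Suc l) j)"
  "D0 f (Suc i) 0 j = rx1 (f (Suc (Suc i)) 0 j) + rx2 (f (Suc i) (Suc 0) j)"
  "D0 f (Suc i) (Suc l) j = rx1 (f (Suc (Suc i)) (Suc l) j) + rx2 (f (Suc i) (Suc (Suc l)) j) +
     sv (dc i) (ry (ry (f i l (Suc j))))"
  by (simp_all add: D0_def)

lemma D1_simps:
  "D1 f 0 0 j = rx1 (rx1 (f (Suc (Suc 0)) 0 j)) +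
     (rx1 (rx2 (f (Suc 0) (Suc 0) j)) + rx2 (rx1 (f (Suc 0) (Suc 0) j))) + rx2 (rx2 (f 0 (Suc (Suc 0)) j))"
  "D1 f 0 (Suc l) j = rx1 (rx1 (f (Suc (Suc 0)) (Suc l) j)) +
     (rx1 (rx2 (f (Suc 0) (Suc (Suc l)) j)) + rx2 (rx1 (f (Suc 0) (Suc (Suc l)) j))) +
     rx2 (rx2 (f 0 (Suc (Suc (Suc l))) j)) + rx1 (ry (ry (f 0 l (Suc j))))"
  "D1 f (Suc i) 0 j = rx1 (rx1 (f (Suc (Suc (Suc i))) 0 j)) +
     (rx1 (rx2 (f (Suc (Suc i)) (Suc 0) j)) + rx2 (rx1 (f (Suc (Suc i)) (Suc 0) j))) +
     rx2 (rx2 (f (Suc i) (Suc (Suc 0)) j)) + sv (- om * om * dc i) (ry (ry (rx2 (f i 0 (Suc j)))))"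
  "D1 f (Suc i) (Suc l) j = rx1 (rx1 (f (Suc (Suc (Suc i))) (Suc l) j)) +
     (rx1 (rx2 (f (Suc (Suc i)) (Suc (Suc l)) j)) + rx2 (rx1 (f (Suc (Suc i)) (Suc (Suc l)) j))) +
     rx2 (rx2 (f (Suc i) (Suc (Suc (Suc l))) j)) + sv (ec (Suc i)) (rx1 (ry (ry (f (Suc i) l (Suc j))))) +
     sv (- om * om * dc i) (ry (ry (rx2 (f i (Suc l) (Suc j)))))"
  by (simp_all add: D1_def ec_def)

lemmas Fb_defs = Fb30_def Fb03_def Fb001_def

lemma D0_Fb: assumes "(i + l) mod 3 = 0"
  shows "D0 (Fb30 f) i l j = Fb30 (D0 f) i l j" "D0 (Fb03 f) i l j = Fb03 (D0 f) i l j"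
    "D0 (Fb001 f) i l j = Fb001 (D0 f) i l j"
proof -
  have "dc k = 0" if "l = 0" "i = Suc k" for k using boundary_coef(1)[OF assms that] .
  then show "D0 (Fb30 f) i l j = Fb30 (D0 f) i l j" "D0 (Fb03 f) i l j = Fb03 (D0 f) i l j"
    "D0 (Fb001 f) i l j = Fb001 (D0 f) i l j"
    by (cases i; cases l; simp add: D0_simps Fb_defs dc_per dc_zero(3))+
qed

lemma D1_Fb: assumes "(i + l) mod 3 = 1"
  shows "D1 (Fb30 f) i l j = Fb30 (D1 f) i l j" "D1 (Fb03 f) i l j = Fb03 (D1 f) i l j"
    "D1 (Fb001 f) i l j = Fb001 (D1 f) i l j"
proof -
  have "ec i = 0" if "l = 0" using boundary_coef(2)[OF assms that] .
  then show "D1 (Fb30 f) i l j = Fb30 (D1 f) i l j" "D1 (Fb03 f) i l j = Fb03 (D1 f) i l j"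
    "D1 (Fb001 f) i l j = Fb001 (D1 f) i l j"
    by (cases i; cases l; simp add: D1_simps Fb_defs dc_per dc_zero(3,4))+
qed

section \<open>Reduction modulo boundaries and uniqueness of reduced cycles\<close>

definition res :: "nat \<Rightarrow> 'k chn \<Rightarrow> 'k chn" where
  "res M f = (\<lambda>i l j. if i + l + 3 * j = M then f i l j else 0)"

lemma res_D0: "D0 (res (Suc M) f) = res M (D0 f)"
  by (intro ext) (auto simp: D0_def res_def op_rules split: nat.splits)

lemma res_D1: "D1 (res (Suc (Suc M)) f) = res M (D1 f)"
  by (intro ext) (auto simp: D1_def res_def op_rules split: nat.splits)

text \<open>The conditions \<open>Uev\<close> and \<open>Uod\<close> below cut out complements of the images of the differentials: each chain
  differs from a chain satisfying them by the differential of an explicit chain (\<open>osol\<close>, \<open>esol\<close>), and a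
  cycle satisfying them vanishes.\<close>

definition st :: "'k vec \<Rightarrow> 'k vec" where
  "st v = (\<lambda>a c b. case b of T0 \<Rightarrow> v a c T1 | T1 \<Rightarrow> v a c T2 | T2 \<Rightarrow> 0)"

text \<open>Solves \<open>rx2 v = t\<close> on the coefficients without x1: x2^a y^c with a > 0
  comes from x2^(a-1) y^c, where om^c undoes the factor om^(2c), and y^c with c > 0 comes from
  y^(c-1) x1.\<close>

definition od0 :: "'k chn \<Rightarrow> nat \<Rightarrow> nat \<Rightarrow> 'k vec" where
  "od0 t l j = (case l of 0 \<Rightarrow> 0 | Suc l' \<Rightarrow> (\<lambda>a c b. case b of
      T0 \<Rightarrow> (case a of T0 \<Rightarrow> pw om c * t 0 l' j T1 c T0 | T1 \<Rightarrow> pw om c * t 0 l' j T2 c T0 | T2 \<Rightarrow> 0)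
    | T1 \<Rightarrow> (case a of T0 \<Rightarrow> (case c of T0 \<Rightarrow> t 0 l' j T0 T1 T0 | T1 \<Rightarrow> t 0 l' j T0 T2 T0 | T2 \<Rightarrow> 0) | _ \<Rightarrow> 0)
    | T2 \<Rightarrow> 0))"

definition od1 :: "'k chn \<Rightarrow> nat \<Rightarrow> nat \<Rightarrow> 'k vec" where
  "od1 t l j = st (t 0 l j - rx2 (od0 t (Suc l) j))"

text \<open>A multiple of x2^2. Right multiplication by x2 kills it, so it can be added at i = 0
  without disturbing the equation there; in the equations at i = 1 it appears as x2^2 y^2.\<close>

definition e200 :: "'k \<Rightarrow> 'k vec" where
  "e200 x = (\<lambda>a c b. if a = T2 \<and> c = T0 \<and> b = T0 then x else 0)"

text \<open>The equation at position i + 1 gives the entry at i + 2 by division by x1; only its part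
  free of x1 remains unsolved.\<close>

fun osol :: "'k chn \<Rightarrow> nat \<Rightarrow> nat \<Rightarrow> nat \<Rightarrow> 'k vec" where
  "osol t 0 l j = od0 t l j + (case j of 0 \<Rightarrow> 0 | Suc j' \<Rightarrow>
     e200 (t (Suc 0) (Suc l) j' T2 T2 T0 - rx2 (od1 t (Suc (Suc l)) j') T2 T2 T0))"
| "osol t (Suc 0) l j = od1 t l j"
| "osol t (Suc (Suc i)) l j = st (t (Suc i) l j - rx2 (osol t (Suc i) (Suc l) j) -
     (case l of 0 \<Rightarrow> 0 | Suc l' \<Rightarrow> sv (dc i) (ry (ry (osol t i l' (Suc j))))))"

declare osol.simps(1) [simp del]

definition Uev :: "'k chn \<Rightarrow> bool" where
  "Uev z \<longleftrightarrow> (\<forall>i l j a c b. (b \<noteq> T0 \<longrightarrow> z i l j a c b = 0) \<and>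
     ((a, c) \<noteq> (T0, T0) \<longrightarrow> z 0 l j a c b = 0) \<and> (l \<noteq> 0 \<longrightarrow> z (Suc 0) l j T2 T2 T0 = 0))"

definition Uod :: "'k chn \<Rightarrow> bool" where
  "Uod z \<longleftrightarrow> (\<forall>i l j a c. z i l j a c T2 = 0 \<and> (a \<noteq> T0 \<or> c = T2 \<longrightarrow> z 0 (Suc l) j a c T1 = 0) \<and>
     (c \<noteq> T0 \<or> j = 0 \<longrightarrow> z 0 (Suc l) j T2 c T0 = 0))"

lemma om_nz: "om \<noteq> 0" using om2 by auto

lemma om1_nz: "1 + om \<noteq> 0"
  using om2 om_nz by (metis add.commute add_eq_0_iff diff_add_cancel mult_eq_0_iff minus_add_distrib uminus_add_conv_diff)

lemma e200_simps: "rx2 (e200 x) = 0" "ry (ry (e200 x)) T2 T2 T0 = x" "rx2 (v + e200 x) = rx2 v"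
proof -
  show 1: "rx2 (e200 x) = 0" for x
    by (rule vec_eqI) (simp add: rx2_def e200_def dn_def split: tri.splits)
  show "ry (ry (e200 x)) T2 T2 T0 = x" by (simp add: ry_def e200_def dn_def pw_def)
  show "rx2 (v + e200 x) = rx2 v" by (simp add: right_mult_linear 1)
qed

lemma rx1_st: "b \<noteq> T0 \<Longrightarrow> rx1 (st v) a c b = v a c b"
  by (cases b) (simp_all add: rx1_def st_def dn_def)

lemma rx1_0: "rx1 v a c T0 = 0"
  by (simp add: rx1_def dn_def)

lemma rx2_osol0: "rx2 (osol t 0 l j) = rx2 (od0 t l j)"
  by (cases j) (simp_all add: osol.simps(1) e200_simps right_mult_linear)

lemma rx2_od0: "(a, c) \<noteq> (T0, T0) \<Longrightarrow> rx2 (od0 t (Suc l) j) a c T0 = t 0 l j a c T0"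
  by (cases a; cases c) (simp_all add: rx2_def od0_def dn_def pw_def om2 om3 algebra_simps)

lemma odd_solution: "Uev (\<lambda>i l j. t i l j - D0 (osol t) i l j)"
proof -
  have 1: "D0 (osol t) i l j a c b = t i l j a c b" if "b \<noteq> T0" for i l j a c b
  proof (cases i)
    case 0
    then show ?thesis using that by (simp add: D0_simps od1_def rx1_st rx2_osol0)
  next
    case (Suc i')
    then show ?thesis using that by (cases l) (simp_all add: D0_simps rx1_st)
  qed
  have 2: "D0 (osol t) 0 l j a c T0 = t 0 l j a c T0" if "(a, c) \<noteq> (T0, T0)" for l j a c
    using that by (simp add: D0_simps rx1_0 rx2_osol0 rx2_od0)
  have 4: "ry (ry (od0 t l j)) T2 T2 T0 = 0" for l j
    by (cases l) (simp_all add: ry_def od0_def dn_def)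
  have 3: "D0 (osol t) (Suc 0) (Suc l) j T2 T2 T0 = t (Suc 0) (Suc l) j T2 T2 T0" for l j
    by (simp add: D0_simps rx1_0 osol.simps(1) right_mult_linear e200_simps 4 dc_def)
  have 5: "D0 (osol t) (Suc 0) l j T2 T2 T0 = t (Suc 0) l j T2 T2 T0" if "l \<noteq> 0" for l j
    using 3 that by (cases l) simp_all
  have "D0 (osol t) 0 l j a c b = t 0 l j a c b" if "(a, c) \<noteq> (T0, T0)" for l j a c b
    using 1[of b 0 l j a c] 2[OF that] by (cases "b = T0") simp_all
  then show ?thesis unfolding Uev_def using 1 5 by simp
qed

lemma zero_vecI: "(\<And>a c b. v a c b = 0) \<Longrightarrow> v = (0 :: 'k vec)"
  by (rule vec_eqI) simp

lemma lam0: "(\<lambda>a c b. 0) = (0 :: 'k vec)"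
  by (simp add: fun_eq_iff)

text \<open>The equations at i = 0 leave of \<open>g 0 l j\<close> only a multiple of x2^2, which x2
  annihilates. Then \<open>g (Suc 0)\<close> vanishes, and the y^2 term at i = 1 detects the
  remaining coefficient. For larger i, right multiplication by x1 is injective on vectors without
  x1^2.\<close>

lemma odd_unique:
  assumes U: "Uod g" and D: "\<And>i l j. (i + l) mod 3 = 0 \<Longrightarrow> D0 g i l j = 0"
    and supp: "\<And>i l j. (i + l) mod 3 \<noteq> 1 \<Longrightarrow> g i l j = 0"
  shows "g i l j = 0"
proof -
  have b2: "g i l j a c T2 = 0" for i l j a c using U by (simp add: Uod_def)
  have D': "D0 g i l j = 0" for i l j
  proof (cases "(i + l) mod 3 = 0")
    case False
    have "(Suc i + l) mod 3 \<noteq> 1" "(i + Suc l) mod 3 \<noteq> 1" using False by presburger+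
    moreover have "(i' + l') mod 3 \<noteq> 1" if "i = Suc i'" "l = Suc l'" for i' l'
      using False that by presburger
    ultimately show ?thesis
      by (cases i; cases l) (simp_all add: D0_simps supp right_mult_linear del: add_Suc add_Suc_right)
  qed (rule D)
  have rx1_inj: "v = 0" if "\<And>a c b. b \<noteq> T0 \<Longrightarrow> rx1 v a c b = 0" "\<And>a c. v a c T2 = 0" for v :: "'k vec"
  proof (rule zero_vecI)
    fix a c b
    show "v a c b = 0"
      using that(1)[of T1 a c] that(1)[of T2 a c] that(2)[of a c] by (cases b) (simp_all add: rx1_def dn_def)
  qed
  have r0: "rx2 (g 0 (Suc l) j) a c T0 = 0" for l j a c
    using fun_cong[OF fun_cong[OF fun_cong[OF D'[of 0 l j]]], of a c T0] by (simp add: D0_simps rx1_0)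
  have u1: "g 0 (Suc l) j a c T1 = 0" if "a \<noteq> T0 \<or> c = T2" for l j a c
    using U that by (simp add: Uod_def)
  have u0: "g 0 (Suc l) j T2 c T0 = 0" if "c \<noteq> T0 \<or> j = 0" for l j c
    using U that by (simp add: Uod_def)
  have g01: "g 0 (Suc l) j a c T1 = 0" for l j a c
    using r0[of l j T0 T1] r0[of l j T0 T2] u1[of a c]
    by (cases a; cases c) (simp_all add: rx2_def dn_def)
  have g00: "g 0 (Suc l) j T0 c T0 = 0" "g 0 (Suc l) j T1 c T0 = 0" for l j c
    using r0[of l j T1 c] r0[of l j T2 c] om_nz
    by (cases c; simp add: rx2_def dn_def pw_def g01)+
  have g0: "g 0 l j = e200 (g 0 l j T2 T0 T0)" for l j
  proof (cases l)
    case 0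
    then show ?thesis using supp[of 0 0 j] by (simp add: e200_def fun_eq_iff)
  next
    case (Suc l')
    show ?thesis
    proof (rule vec_eqI)
      fix a c b show "g 0 l j a c b = e200 (g 0 l j T2 T0 T0) a c b"
        by (cases a; cases b) (simp_all add: Suc e200_def g01 g00 b2 u0)
    qed
  qed
  have g1: "g (Suc 0) l j = 0" for l j
  proof (rule rx1_inj)
    have "rx2 (g 0 (Suc l) j) = 0" by (subst g0) (rule e200_simps)
    then show "rx1 (g (Suc 0) l j) a c b = 0" for a c b
      using fun_cong[OF fun_cong[OF fun_cong[OF D'[of 0 l j]]], of a c b] by (simp add: D0_simps)
  qed (rule b2)
  have x: "g 0 l (Suc j) T2 T0 T0 = 0" for l j
  proof -
    have "ry (ry (g 0 l (Suc j))) T2 T2 T0 = g 0 l (Suc j) T2 T0 T0"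
      by (subst g0) (rule e200_simps)
    then show ?thesis
      using fun_cong[OF fun_cong[OF fun_cong[OF D'[of "Suc 0" "Suc l" j]]], of T2 T2 T0]
      by (simp add: D0_simps rx1_0 g1 right_mult_linear dc_def)
  qed
  have g0': "g 0 l j = 0" for l j
  proof -
    have "g 0 l j T2 T0 T0 = 0"
      by (cases j; cases l) (use x u0 supp[of 0 0 0] in simp_all)
    then show ?thesis by (subst g0) (auto simp: e200_def fun_eq_iff)
  qed
  have "g i l j = 0 \<and> g (Suc i) l j = 0" for l j
  proof (induction i arbitrary: l j)
    case (Suc i)
    have "g (Suc (Suc i)) l j = 0"
    proof (rule rx1_inj)
      show "rx1 (g (Suc (Suc i)) l j) a c b = 0" for a c b
        using fun_cong[OF fun_cong[OF fun_cong[OF D'[of "Suc i" l j]]], of a c b]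
        by (cases l) (simp_all add: D0_simps Suc right_mult_linear lam0)
    qed (rule b2)
    then show ?case using Suc by simp
  qed (simp add: g0' g1)
  then show ?thesis by simp
qed

text \<open>All entries are free of x1. The coefficient of x1^2 in \<open>D1\<close> then sees only
  the entry at i + 2; the entries at 0 and 1 are chosen for the equations at i = 0. The factor
  \<open>- om\<close> inverts 1 + om = - om^2, which arises from x1 x2 + x2 x1.\<close>

definition esol :: "'k chn \<Rightarrow> 'k chn" where
  "esol t = (\<lambda>i l j a c b. if b \<noteq> T0 then 0 else case i of
      0 \<Rightarrow> if a = T0 \<and> c = T0 then
          (case j of 0 \<Rightarrow> (case l of Suc (Suc l') \<Rightarrow> t 0 l' 0 T2 T0 T0 | _ \<Rightarrow> 0)
           | Suc j' \<Rightarrow> t 0 (Suc l) j' T0 T2 T1)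
        else 0
    | Suc 0 \<Rightarrow> (case l of 0 \<Rightarrow> 0 | Suc l' \<Rightarrow> (case a of
          T0 \<Rightarrow> - om * pw om c * t 0 l' j T1 c T1
        | T1 \<Rightarrow> - om * pw om c * t 0 l' j T2 c T1
        | T2 \<Rightarrow> (case c of T0 \<Rightarrow> t 0 l' j T2 T1 T0 | T1 \<Rightarrow> t 0 l' j T2 T2 T0 | T2 \<Rightarrow> 0)))
    | Suc (Suc i') \<Rightarrow> t i' l j a c T2)"

definition pure0 :: "'k vec \<Rightarrow> bool" where
  "pure0 w \<longleftrightarrow> (\<forall>a c b. b \<noteq> T0 \<longrightarrow> w a c b = 0)"

lemma pure0_rules:
  assumes "pure0 w"
  shows "rx1 (rx1 w) a c T2 = w a c T0" "rx1 (rx1 w) a c T1 = 0" "rx1 (rx1 w) a c T0 = 0"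
    "rx1 (rx2 w) a c T2 = 0" "rx1 (rx2 w) a c T1 = pw (om * om) c * dn (\<lambda>a. w a c T0) a" "rx1 (rx2 w) a c T0 = 0"
    "rx2 (rx1 w) a c T2 = 0" "rx2 (rx1 w) a c T1 = om * pw (om * om) c * dn (\<lambda>a. w a c T0) a"
    "rx2 (rx1 w) a c T0 = dn (\<lambda>c. w a c T0) c"
    "rx2 (rx2 w) a c T2 = 0" "rx2 (rx2 w) a c T1 = 0"
    "rx2 (rx2 w) a c T0 = pw om c * dn (dn (\<lambda>a. w a c T0)) a"
    "rx1 (ry (ry w)) a c T2 = 0" "rx1 (ry (ry w)) a c T1 = dn (dn (\<lambda>c. w a c T0)) c" "rx1 (ry (ry w)) a c T0 = 0"
    "ry (ry (rx2 w)) a c T2 = 0" "ry (ry (rx2 w)) a c T1 = 0"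
  using assms
  by (simp_all add: pure0_def rx1_def rx2_def ry_def dn_def pw_def om2 om3 algebra_simps split: tri.splits)

lemma pure0_esol: "pure0 (esol t i l j)"
  by (simp add: pure0_def esol_def)

lemma even_solution: "Uod (\<lambda>i l j. t i l j - D1 (esol t) i l j)"
proof -
  note rules = pure0_rules[OF pure0_esol]
  have 1: "D1 (esol t) i l j a c T2 = t i l j a c T2" for i l j a c
    by (cases i; cases l) (simp_all add: D1_simps rules, simp_all add: esol_def)
  have 2: "D1 (esol t) 0 (Suc l) j a c T1 = t 0 (Suc l) j a c T1" if "a \<noteq> T0 \<or> c = T2" for l j a c
    using that
    by (cases a; cases c) (simp_all add: D1_simps rules, simp_all add: esol_def dn_def pw_def om2 om3 algebra_simps)
  have 3: "D1 (esol t) 0 (Suc l) j T2 c T0 = t 0 (Suc l) j T2 c T0" if "c \<noteq> T0 \<or> j = 0" for l j c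
    using that
    by (cases c; cases j) (simp_all add: D1_simps rules, simp_all add: esol_def dn_def pw_def om2 om3 algebra_simps)
  show ?thesis unfolding Uod_def using 1 2 3 by simp
qed

text \<open>The coefficients of x1^2 in D1 g = 0 kill all entries with i >= 2. What is left at i =
  1, and after that at i = 0, is isolated by single coefficients of the equations at i = 0. The
  position (0, 0, 0) carries the augmentation and survives.\<close>

lemma even_unique:
  assumes U: "Uev g" and D: "\<And>i l j. (i + l) mod 3 = 1 \<Longrightarrow> D1 g i l j = 0"
    and supp: "\<And>i l j. (i + l) mod 3 \<noteq> 0 \<Longrightarrow> g i l j = 0"
    and ijl: "(i, l, j) \<noteq> (0, 0, 0)"
  shows "g i l j = 0"
proof -
  have pure: "pure0 (g i l j)" for i l j using U by (simp add: Uev_def pure0_def)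
  note rules = pure0_rules[OF pure]
  have D': "D1 g i l j a c b = 0" if "(i + l) mod 3 = 1" for i l j a c b using D[OF that] by simp
  have pI: "v = 0" if "pure0 v" "\<And>a c. v a c T0 = 0" for v :: "'k vec"
    by (rule zero_vecI) (use that in \<open>metis pure0_def\<close>)
  have 2: "g (Suc (Suc i)) l j = 0" for i l j
  proof (cases "(Suc (Suc i) + l) mod 3 = 0")
    case True
    then have m: "(i + l) mod 3 = 1" by presburger
    show ?thesis
      by (rule pI[OF pure]) (use D'[OF m, of j _ _ T2] in \<open>cases i; cases l; simp add: D1_simps rules\<close>)
  qed (rule supp)
  have z: "g 0 l j a c T0 = 0" if "(a, c) \<noteq> (T0, T0)" for l j a c
    using U that by (simp add: Uev_def)
  have 1: "g (Suc 0) l j = 0" for l j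
  proof (cases "(Suc 0 + l) mod 3 = 0")
    case True
    then have "l \<noteq> 0" by presburger
    then obtain l' where l1: "l = Suc l'" by (cases l) simp_all
    moreover have "(0 + l') mod 3 = 1" "l' \<noteq> 0" using True unfolding l1 by presburger+
    ultimately have l': "l = Suc l'" "(0 + l') mod 3 = 1" "l' \<noteq> 0" by auto
    have u: "g (Suc 0) l j T2 T2 T0 = 0" using U l' by (simp add: Uev_def)
    show ?thesis
    proof (rule pI[OF pure])
      fix a c
      obtain l'' where l'': "l' = Suc l''" using l'(3) by (cases l') auto
      have e: "y * x + om * y * x = (1 + om) * (y * x)" "x + om * x = (1 + om) * x" for x y :: 'k
        by (simp_all add: algebra_simps)
      \<comment> \<open>The coefficient of x2^a y^c is visible one place higher in the equation: at
        x2^(a+1) y^c x1 if a < 2, and otherwise at x2^2 y^(c+1).\<close>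
      show "g (Suc 0) l j a c T0 = 0"
        using D'[OF l'(2), of j "case a of T0 \<Rightarrow> T1 | _ \<Rightarrow> T2" "case a of T2 \<Rightarrow> (case c of T0 \<Rightarrow> T1 | _ \<Rightarrow> T2) | _ \<Rightarrow> c" "case a of T2 \<Rightarrow> T0 | _ \<Rightarrow> T1"]
          u om_nz om1_nz
        by (cases a; cases c) (simp_all add: l'(1) l'' D1_simps rules dn_def pw_def z 2 e right_mult_linear)
    qed
  qed (rule supp)
  have zz: "g 0 l j T0 T0 T0 = 0" if "(l, j) \<noteq> (0, 0)" for l j
  proof (cases "l mod 3 = 0")
    case True
    show ?thesis
    proof (cases j)
      case 0
      with that have "l \<noteq> 0" by simp
      with True have "l \<ge> 3" by presburger
      then obtain l' where l1: "l = Suc (Suc (Suc l'))"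
        by (metis le_Suc_ex add_Suc numeral_3_eq_3 add_0)
      moreover have "(0 + Suc l') mod 3 = 1" using True unfolding l1 by presburger
      ultimately have l': "l = Suc (Suc (Suc l'))" "(0 + Suc l') mod 3 = 1" by auto
      show ?thesis using D'[OF l'(2), of 0 T2 T0 T0]
        by (simp add: l'(1) 0 D1_simps rules dn_def pw_def 1 2 right_mult_linear)
    next
      case (Suc j')
      have m: "(0 + Suc l) mod 3 = 1" using True by presburger
      show ?thesis using D'[OF m, of j' T0 T2 T1]
        by (simp add: Suc D1_simps rules dn_def pw_def 1 2 right_mult_linear)
    qed
  next
    case False then show ?thesis using supp[of 0 l j] by simp
  qed
  have 0: "g 0 l j = 0" if "(l, j) \<noteq> (0, 0)" for l j
  proof (rule pI[OF pure])
    show "g 0 l j a c T0 = 0" for a c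
      using zz[OF that] z[of a c l j] by (cases "(a, c) = (T0, T0)") auto
  qed
  show ?thesis using 0 1 2 ijl by (cases i rule: nat2_cases) auto
qed

end

section \<open>The twisted left action\<close>

definition sc :: "'k::comm_ring_1 \<Rightarrow> 'k chn \<Rightarrow> 'k chn" where
  "sc x f = (\<lambda>i l j. sv x (f i l j))"

locale a2_twist = cube_root om for om :: "'k::field" +
  fixes p :: 'k
  assumes p_nz: "p \<noteq> 0"
begin

text \<open>The twisted product with x1 is p^m times the untwisted one, where m is the x2-degree of
  the right factor: a + c in the coefficient, l from w(i, l), and 3 for each g, which has the
  bidegree of y^3.\<close>

definition A1 :: "'k chn \<Rightarrow> 'k chn" where
  "A1 f = (\<lambda>i l j. sv (p ^ (l + 3 * j)) (tw2 p (lx1 (f i l j))))"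

definition A2 :: "'k chn \<Rightarrow> 'k chn" where
  "A2 f = (\<lambda>i l j. lx2 (f i l j))"

text \<open>Weighs a chain by its total degree in x1. The differentials preserve this degree and
  \<open>A1\<close> raises it by one, so \<open>Pm\<close> commutes with the former and rescales the
  latter.\<close>

definition Pm :: "'k \<Rightarrow> 'k chn \<Rightarrow> 'k chn" where
  "Pm x f = (\<lambda>i l j. sv (x ^ (i + 3 * j)) (tw1 x (f i l j)))"

definition ip :: 'k where "ip = inverse p"

fun lfe :: "ext_gen \<Rightarrow> 'k chn \<Rightarrow> 'k chn" where
  "lfe Ga1 = Fa01e" | "lfe Ga2 = Fa10e" | "lfe Gb1 = Fb03" | "lfe Gb2 = Fb30" | "lfe Gby = Fb001"
| "lfe Gc1 = Fc12" | "lfe Gc2 = Fc21e"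

fun lfo :: "ext_gen \<Rightarrow> 'k chn \<Rightarrow> 'k chn" where
  "lfo Ga1 = Fa01o" | "lfo Ga2 = Fa10o" | "lfo Gb1 = Fb03" | "lfo Gb2 = Fb30" | "lfo Gby = Fb001"
| "lfo Gc1 = Fc12" | "lfo Gc2 = Fc21o"

fun ghi :: "ext_gen \<Rightarrow> nat \<times> nat \<times> nat" where
  "ghi Ga1 = (0, 1, 0)" | "ghi Ga2 = (1, 0, 0)" | "ghi Gb1 = (0, 3, 0)" | "ghi Gb2 = (3, 0, 0)"
| "ghi Gby = (0, 0, 1)" | "ghi Gc1 = (1, 2, 0)" | "ghi Gc2 = (2, 1, 0)"

text \<open>The degree in x2 of the basis symbol to which the generator is dual.\<close>

fun ht :: "ext_gen \<Rightarrow> nat" where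
  "ht Ga1 = 1" | "ht Ga2 = 0" | "ht Gb1 = 3" | "ht Gb2 = 0" | "ht Gby = 3" | "ht Gc1 = 2" | "ht Gc2 = 1"

text \<open>Chosen so that c1 a2 = c2 a1 holds: without it c2 a1 has the factor p^(-2) and c1 a2 the
  factor 1.\<close>

fun norm_coeff :: "ext_gen \<Rightarrow> 'k" where
  "norm_coeff Gc1 = ip\<^sup>2" | "norm_coeff _ = 1"

text \<open>The chain map of a generator: even and odd parts are separated by \<open>(i + l) mod 3\<close>, and \<open>Pm\<close> compensates the
  twist of the left action.\<close>

definition lop :: "ext_gen \<Rightarrow> 'k chn \<Rightarrow> 'k chn" where
  "lop g f = sc (norm_coeff g) (Pm (ip ^ ht g) (\<lambda>i l j.
     if (i + l) mod 3 = 0 then lfe g f i l j else if (i + l) mod 3 = 1 then lfo g f i l j else 0))"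

lemmas all_lift_defs = lift_defs Fb_defs

lemma chn_eqI: "(\<And>i l j. f i l j = g i l j) \<Longrightarrow> f = (g :: 'k chn)"
  by (intro ext) simp

lemmas push_rules = right_mult_linear left_mult_linear twist_linear twist_mult left_right_commute

lemma Pm_D: "D0 (Pm x f) = Pm x (D0 f)" "D1 (Pm x f) = Pm x (D1 f)"
proof -
  show "D0 (Pm x f) = Pm x (D0 f)"
  proof (rule chn_eqI)
    fix i l j show "D0 (Pm x f) i l j = Pm x (D0 f) i l j"
      by (cases i; cases l) (simp_all add: D0_simps Pm_def push_rules mult_ac power_add power2_eq_square power3_eq_cube)
  qed
  show "D1 (Pm x f) = Pm x (D1 f)"
  proof (rule chn_eqI)
    fix i l j show "D1 (Pm x f) i l j = Pm x (D1 f) i l j"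
      by (cases i; cases l) (simp_all add: D1_simps Pm_def push_rules mult_ac power_add power2_eq_square power3_eq_cube)
  qed
qed

lemma A_D: "D0 (A1 f) = A1 (D0 f)" "D1 (A1 f) = A1 (D1 f)" "D0 (A2 f) = A2 (D0 f)" "D1 (A2 f) = A2 (D1 f)"
proof -
  show "D0 (A1 f) = A1 (D0 f)"
  proof (rule chn_eqI)
    fix i l j show "D0 (A1 f) i l j = A1 (D0 f) i l j"
      by (cases i; cases l) (simp_all add: D0_simps A1_def push_rules mult_ac power_add power2_eq_square power3_eq_cube)
  qed
  show "D1 (A1 f) = A1 (D1 f)"
  proof (rule chn_eqI)
    fix i l j show "D1 (A1 f) i l j = A1 (D1 f) i l j"
      by (cases i; cases l) (simp_all add: D1_simps A1_def push_rules mult_ac power_add power2_eq_square power3_eq_cube)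
  qed
  show "D0 (A2 f) = A2 (D0 f)"
  proof (rule chn_eqI)
    fix i l j show "D0 (A2 f) i l j = A2 (D0 f) i l j"
      by (cases i; cases l) (simp_all add: D0_simps A2_def push_rules mult_ac power_add power2_eq_square power3_eq_cube)
  qed
  show "D1 (A2 f) = A2 (D1 f)"
  proof (rule chn_eqI)
    fix i l j show "D1 (A2 f) i l j = A2 (D1 f) i l j"
      by (cases i; cases l) (simp_all add: D1_simps A2_def push_rules mult_ac power_add power2_eq_square power3_eq_cube)
  qed
qed

lemma Pm_A: "Pm x (A1 f) = sc x (A1 (Pm x f))" "Pm x (A2 f) = A2 (Pm x f)"
  by (rule chn_eqI; simp add: Pm_def A1_def A2_def sc_def push_rules mult_ac power_add power2_eq_square power3_eq_cube)+

text \<open>\<open>A1\<close> weighs by the degree in x2, which the map of g lowers by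
  \<open>ht g\<close>. The resulting factor is what \<open>Pm\<close> absorbs in
  \<open>lop\<close>.\<close>

lemma lfe_A1: "lfe g (A1 f) = sc (p ^ ht g) (A1 (lfe g f))"
proof (rule chn_eqI)
  fix i l j show "lfe g (A1 f) i l j = sc (p ^ ht g) (A1 (lfe g f)) i l j"
    by (rule vec_eqI; cases g; cases i; cases l; simp add: all_lift_defs A1_def sc_def push_rules algebra_simps power_add power2_eq_square power3_eq_cube)
qed

lemma lfo_A1: "lfo g (A1 f) = sc (p ^ ht g) (A1 (lfo g f))"
proof (rule chn_eqI)
  fix i l j show "lfo g (A1 f) i l j = sc (p ^ ht g) (A1 (lfo g f)) i l j"
    by (rule vec_eqI; cases g; cases i; cases l; simp add: all_lift_defs A1_def sc_def push_rules algebra_simps power_add power2_eq_square power3_eq_cube)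
qed

lemma lfe_A2: "lfe g (A2 f) = A2 (lfe g f)"
proof (rule chn_eqI)
  fix i l j show "lfe g (A2 f) i l j = A2 (lfe g f) i l j"
    by (rule vec_eqI; cases g; cases i; cases l; simp add: all_lift_defs A2_def sc_def push_rules algebra_simps power_add power2_eq_square power3_eq_cube)
qed

lemma lfo_A2: "lfo g (A2 f) = A2 (lfo g f)"
proof (rule chn_eqI)
  fix i l j show "lfo g (A2 f) i l j = A2 (lfo g f) i l j"
    by (rule vec_eqI; cases g; cases i; cases l; simp add: all_lift_defs A2_def sc_def push_rules algebra_simps power_add power2_eq_square power3_eq_cube)
qed

lemma lfe_linear: "lfe g (f + h) = lfe g f + lfe g h" "lfe g (sc x f) = sc x (lfe g f)"
  by (rule chn_eqI, rule vec_eqI, cases g; simp add: all_lift_defs sc_def push_rules algebra_simps split: nat.splits)+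

lemma lfo_linear: "lfo g (f + h) = lfo g f + lfo g h" "lfo g (sc x f) = sc x (lfo g f)"
  by (rule chn_eqI, rule vec_eqI, cases g; simp add: all_lift_defs sc_def push_rules algebra_simps split: nat.splits)+

end

section \<open>The terms of the resolution and exactness in each degree\<close>

context a2_twist begin

definition wt :: "nat \<Rightarrow> nat" where "wt n = 3 * (n div 2) + n mod 2"

definition Qc :: "nat \<Rightarrow> 'k chn set" where
  "Qc n = {f. \<forall>i l j. i + l + 3 * j \<noteq> wt n \<longrightarrow> f i l j = 0}"

definition dQ :: "nat \<Rightarrow> 'k chn \<Rightarrow> 'k chn" where
  "dQ n = (if even n then D0 else D1)"

lemma QcD: "f \<in> Qc n \<Longrightarrow> i + l + 3 * j \<noteq> wt n \<Longrightarrow> f i l j = 0"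
  by (simp add: Qc_def)

lemma wt_Suc: "even n \<Longrightarrow> wt (Suc n) = Suc (wt n)" "odd n \<Longrightarrow> wt (Suc n) = Suc (Suc (wt n))"
  by (auto elim!: evenE oddE simp: wt_def)

lemma wt_mod: "even n \<Longrightarrow> wt n mod 3 = 0" "odd n \<Longrightarrow> wt n mod 3 = 1"
  by (simp_all add: wt_def odd_iff_mod_2_eq_one mod_Suc)

lemma wt_pos_mod: assumes "i + l + 3 * j = wt n"
  shows "even n \<Longrightarrow> (i + l) mod 3 = 0" "odd n \<Longrightarrow> (i + l) mod 3 = 1"
proof -
  have e: "(i + l) mod 3 = wt n mod 3" using assms by presburger
  show "even n \<Longrightarrow> (i + l) mod 3 = 0" "odd n \<Longrightarrow> (i + l) mod 3 = 1"
    using wt_mod[of n] by (simp_all add: e)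
qed

lemma Qc_mod: assumes "f \<in> Qc n" shows "even n \<Longrightarrow> (i + l) mod 3 \<noteq> 0 \<Longrightarrow> f i l j = 0"
  "odd n \<Longrightarrow> (i + l) mod 3 \<noteq> 1 \<Longrightarrow> f i l j = 0"
  using wt_pos_mod[of i l j n] QcD[OF assms, of i l j] by auto

lemma sc_simps [simp]: "sc x (0 :: 'k chn) = 0" "sc 1 f = (f :: 'k chn)" "sc 0 f = (0 :: 'k chn)"
  "sc x (f + g) = sc x f + sc x (g :: 'k chn)" "sc x (sc y f) = sc (x * y) (f :: 'k chn)"
  by (rule chn_eqI; simp add: sc_def)+

lemma op_zero: "D0 0 = 0" "D1 0 = 0" "A1 0 = 0" "A2 0 = 0" "Pm x 0 = 0" "lfe g 0 = 0" "lfo g 0 = 0"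
proof -
  show "D0 0 = 0" "D1 0 = 0" "A1 0 = 0" "A2 0 = 0" "Pm x 0 = 0"
    by (rule chn_eqI; simp add: D0_def D1_def A1_def A2_def Pm_def push_rules split: nat.splits)+
  show "lfe g 0 = 0" "lfo g 0 = 0"
    using lfe_linear(2)[of g 0 0] lfo_linear(2)[of g 0 0] by simp_all
qed

lemma op_linear:
  "D0 (f + g) = D0 f + D0 g" "D1 (f + g) = D1 f + D1 g" "A1 (f + g) = A1 f + A1 g" "A2 (f + g) = A2 f + A2 g"
  "Pm x (f + g) = Pm x f + Pm x g" "D0 (sc y f) = sc y (D0 f)" "D1 (sc y f) = sc y (D1 f)"
  "A1 (sc y f) = sc y (A1 f)" "A2 (sc y f) = sc y (A2 f)" "Pm x (sc y f) = sc y (Pm x f)"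
  by (rule chn_eqI, rule vec_eqI; simp add: D0_def D1_def A1_def A2_def Pm_def sc_def push_rules algebra_simps split: nat.splits)+

lemma Qc_closed:
  "0 \<in> Qc n" "f \<in> Qc n \<Longrightarrow> g \<in> Qc n \<Longrightarrow> f + g \<in> Qc n" "f \<in> Qc n \<Longrightarrow> sc x f \<in> Qc n"
  "f \<in> Qc n \<Longrightarrow> A1 f \<in> Qc n" "f \<in> Qc n \<Longrightarrow> A2 f \<in> Qc n" "f \<in> Qc n \<Longrightarrow> Pm x f \<in> Qc n"
  "f \<in> Qc n \<Longrightarrow> - f \<in> Qc n"
  by (simp_all add: Qc_def sc_def A1_def A2_def Pm_def push_rules)

lemma supp_D:
  assumes "\<And>i l j. i + l + 3 * j \<noteq> N \<Longrightarrow> f i l j = 0"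
  shows "Suc (i + l + 3 * j) \<noteq> N \<Longrightarrow> D0 f i l j = 0" "Suc (Suc (i + l + 3 * j)) \<noteq> N \<Longrightarrow> D1 f i l j = 0"
  by (cases i; cases l; simp add: D0_simps D1_simps assms push_rules)+

text \<open>Weight lost in passing from degree n + deg g to degree n: \<open>wl\<close> for even n
  and \<open>wlo\<close> for odd n. For generators of degree 1 the two differ, because the weights
  grow alternately by 1 and by 2.\<close>

fun wl :: "ext_gen \<Rightarrow> nat" where "wl g = (if g = Ga1 \<or> g = Ga2 then 1 else 3)"
fun wlo :: "ext_gen \<Rightarrow> nat" where "wlo g = (if g = Ga1 \<or> g = Ga2 then 2 else 3)"

lemma supp_lf:
  assumes "\<And>i l j. i + l + 3 * j \<noteq> N \<Longrightarrow> f i l j = 0"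
  shows "i + l + 3 * j + wl g \<noteq> N \<Longrightarrow> lfe g f i l j = 0" "i + l + 3 * j + wlo g \<noteq> N \<Longrightarrow> lfo g f i l j = 0"
  by (cases g; cases i; cases l; simp add: all_lift_defs assms push_rules)+

lemma dQ_closed: assumes "f \<in> Qc (Suc n)" shows "dQ n f \<in> Qc n"
proof (cases "even n")
  case True
  show ?thesis using supp_D(1)[OF QcD[OF assms]] True by (simp add: Qc_def dQ_def wt_Suc)
next
  case False
  show ?thesis using supp_D(2)[OF QcD[OF assms]] False by (simp add: Qc_def dQ_def wt_Suc)
qed

lemma dQ_dQ: assumes "f \<in> Qc (Suc (Suc n))" shows "dQ n (dQ (Suc n) f) = 0"
proof (rule chn_eqI)
  fix i l j
  have Q: "dQ n (dQ (Suc n) f) \<in> Qc n" by (intro dQ_closed assms)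
  show "dQ n (dQ (Suc n) f) i l j = 0 i l j"
  proof (cases "i + l + 3 * j = wt n")
    case True
    then show ?thesis using wt_pos_mod[OF True] D0_D1[of i l f j] D1_D0[of i l f j]
      by (cases "even n") (simp_all add: dQ_def)
  next
    case False
    then show ?thesis using QcD[OF Q] by simp
  qed
qed

definition resw :: "nat \<Rightarrow> 'k chn \<Rightarrow> 'k chn" where "resw n f = res (wt n) f"

lemma resw: "resw n f \<in> Qc n" "f \<in> Qc n \<Longrightarrow> resw n f = f"
  by (auto simp: resw_def res_def Qc_def intro!: chn_eqI)

lemma dQ_resw: "dQ n (resw (Suc n) f) = resw n (dQ n f)"
  by (cases "even n") (simp_all add: dQ_def resw_def wt_Suc res_D0 res_D1)

lemma exact_aux:
  assumes f: "f \<in> Qc n"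
  shows "\<exists>g \<in> Qc (Suc n). (even n \<longrightarrow> Uev (f - dQ n g)) \<and> (odd n \<longrightarrow> Uod (f - dQ n g))"
proof (cases "even n")
  case True
  have "Uev (resw n (\<lambda>i l j. f i l j - D0 (osol f) i l j))"
    using odd_solution[of f] unfolding Uev_def resw_def res_def by simp
  moreover have "resw n (\<lambda>i l j. f i l j - D0 (osol f) i l j) = f - dQ n (resw (Suc n) (osol f))"
    unfolding dQ_resw using QcD[OF f] True by (auto simp: resw_def res_def dQ_def intro!: chn_eqI)
  ultimately show ?thesis using True resw(1) by (intro bexI[of _ "resw (Suc n) (osol f)"]) simp_all
next
  case False
  have "Uod (resw n (\<lambda>i l j. f i l j - D1 (esol f) i l j))"
    using even_solution[of f] unfolding Uod_def resw_def res_def by simp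
  moreover have "resw n (\<lambda>i l j. f i l j - D1 (esol f) i l j) = f - dQ n (resw (Suc n) (esol f))"
    unfolding dQ_resw using QcD[OF f] False by (auto simp: resw_def res_def dQ_def intro!: chn_eqI)
  ultimately show ?thesis using False resw(1) by (intro bexI[of _ "resw (Suc n) (esol f)"]) simp_all
qed

lemma dQ_diff: "dQ n (f - g) = dQ n f - dQ n g"
proof -
  have "dQ n (f - g) + dQ n g = dQ n f"
    using op_linear(1,2)[of "f - g" g] by (simp add: dQ_def)
  then show ?thesis by (simp add: algebra_simps)
qed

lemma dQ_exact:
  assumes f: "f \<in> Qc (Suc n)" and df: "dQ n f = 0"
  shows "\<exists>g \<in> Qc (Suc (Suc n)). dQ (Suc n) g = f"
proof -
  obtain g where g: "g \<in> Qc (Suc (Suc n))"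
    and U: "odd n \<Longrightarrow> Uev (f - dQ (Suc n) g)" "even n \<Longrightarrow> Uod (f - dQ (Suc n) g)"
    using exact_aux[OF f] by auto
  define h where "h = f - dQ (Suc n) g"
  have hQ: "h \<in> Qc (Suc n)"
    using Qc_closed(2)[OF f Qc_closed(7)[OF dQ_closed[OF g]]] by (simp add: h_def)
  have dh: "dQ n h = 0" using df dQ_dQ[OF g] by (simp add: h_def dQ_diff)
  have U': "odd n \<Longrightarrow> Uev h" "even n \<Longrightarrow> Uod h" unfolding h_def by (fact U)+
  have "h i l j = 0" for i l j
  proof (cases "even n")
    case True
    show ?thesis
    proof (rule odd_unique[OF U'(2)[OF True]])
      show "D0 h i l j = 0" for i l j using dh True by (simp add: dQ_def)
      show "h i l j = 0" if "(i + l) mod 3 \<noteq> 1" for i l j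
        by (rule Qc_mod(2)[OF hQ _ that]) (use True in simp)
    qed
  next
    case False
    show ?thesis
    proof (cases "(i, l, j) = (0, 0, 0)")
      case True
      then show ?thesis using QcD[OF hQ, of 0 0 0] False by (simp add: wt_def)
    next
      case ne: False
      show ?thesis
      proof (rule even_unique[OF U'(1)[OF False] _ _ ne])
        show "D1 h i l j = 0" for i l j using dh False by (simp add: dQ_def)
        show "h i l j = 0" if "(i + l) mod 3 \<noteq> 0" for i l j
          by (rule Qc_mod(1)[OF hQ _ that]) (use False in simp)
      qed
    qed
  qed
  then have "h = 0" by (intro chn_eqI) simp
  then show ?thesis using g by (intro bexI[of _ g]) (simp_all add: h_def)
qed

lemma corner_zero: "D0 f i l j T0 T0 T0 = 0" "D1 f i l j T0 T0 T0 = 0" "A1 f i l j T0 T0 T0 = 0" "A2 f i l j T0 T0 T0 = 0"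
  by (simp_all add: D0_def D1_def A1_def A2_def rx1_def rx2_def ry_def lx1_def lx2_def dn_def tw2_def split: nat.splits)

text \<open>Minimality of the resolution: it makes all differentials on Hom into the trivial module
  vanish.\<close>

lemma dQ_corner: "dQ n f i l j T0 T0 T0 = 0"
  by (simp add: dQ_def corner_zero)

text \<open>In degree 0 the reduction leaves a single coefficient, the augmentation.\<close>

lemma dQ_exact0:
  assumes f: "f \<in> Qc 0" and e: "f 0 0 0 T0 T0 T0 = 0"
  shows "\<exists>g \<in> Qc (Suc 0). dQ 0 g = f"
proof -
  obtain g where g: "g \<in> Qc (Suc 0)" and U: "Uev (f - dQ 0 g)" using exact_aux[OF f] by auto
  define h where "h = f - dQ 0 g"
  have hQ: "h \<in> Qc 0"
    using Qc_closed(2)[OF f Qc_closed(7)[OF dQ_closed[OF g]]] by (simp add: h_def)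
  have h0: "h 0 0 0 T0 T0 T0 = 0" using e by (simp add: h_def dQ_corner)
  have "h i l j a c b = 0" for i l j a c b
  proof (cases "(i, l, j) = (0, 0, 0)")
    case True
    then show ?thesis using U h0 unfolding h_def[symmetric] Uev_def by (cases "b = T0"; cases "(a, c) = (T0, T0)") auto
  next
    case False
    then show ?thesis using QcD[OF hQ, of i l j] by (auto simp: wt_def)
  qed
  then have "h = 0" by (intro chn_eqI vec_eqI) simp
  then show ?thesis using g by (intro bexI[of _ g]) (simp_all add: h_def)
qed

end

section \<open>The chain maps of the generators on the twisted complex\<close>

context a2_twist begin

definition pr :: "'k chn \<Rightarrow> 'k chn \<Rightarrow> 'k chn" where
  "pr f h = (\<lambda>i l j. if (i + l) mod 3 = 0 then f i l j else if (i + l) mod 3 = 1 then h i l j else 0)"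

lemma lop_pr: "lop g f = sc (norm_coeff g) (Pm (ip ^ ht g) (pr (lfe g f) (lfo g f)))"
  by (simp add: lop_def pr_def)

lemma pr_A: "pr (A1 f) (A1 h) = A1 (pr f h)" "pr (A2 f) (A2 h) = A2 (pr f h)"
  "pr (sc x f) (sc x h) = sc x (pr f h)" "pr (f + f') (h + h') = pr f h + pr f' h'"
  by (rule chn_eqI; simp add: pr_def A1_def A2_def sc_def push_rules)+

lemma ip_p: "p ^ n * ip ^ n = 1"
  using p_nz by (simp add: ip_def power_inverse)

lemma lop_A: "lop g (A1 f) = A1 (lop g f)" "lop g (A2 f) = A2 (lop g f)"
  by (simp_all add: lop_pr lfe_A1 lfo_A1 lfe_A2 lfo_A2 pr_A op_linear Pm_A mult.assoc ip_p)

lemma lop_linear: "lop g (f + h) = lop g f + lop g h" "lop g (sc x f) = sc x (lop g f)"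
  by (simp_all add: lop_pr lfe_linear lfo_linear pr_A op_linear mult.commute)

lemma wt_deg: "even n \<Longrightarrow> wt (n + ext_gen_degree g) = wt n + wl g"
  "odd n \<Longrightarrow> wt (n + ext_gen_degree g) = wt n + wlo g"
  by (cases g; simp add: wt_Suc)+

lemma mod3_aux:
  fixes x j w d :: nat
  shows "x + 3 * j + d = w \<Longrightarrow> d \<le> 1 \<Longrightarrow> w mod 3 = 0 \<Longrightarrow> x mod 3 \<noteq> 1"
    "x + 3 * j = w + d \<Longrightarrow> d \<le> 1 \<Longrightarrow> w mod 3 = 1 \<Longrightarrow> x mod 3 \<noteq> 0"
  by (cases "d = 0"; presburger)+

text \<open>\<open>lop\<close> chooses its branch by (i + l) mod 3 and does not know n. On a
  homogeneous chain the branch of the wrong parity contributes nothing, since its weight would have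
  the wrong residue.\<close>

lemma lop_eq:
  assumes f: "f \<in> Qc (n + ext_gen_degree g)"
  shows "pr (lfe g f) (lfo g f) = (if even n then lfe g f else lfo g f)"
    "(if even n then lfe g f else lfo g f) \<in> Qc n"
proof -
  have e: "lfe g f i l j = 0" if "i + l + 3 * j + wl g \<noteq> wt (n + ext_gen_degree g)" for i l j
    by (rule supp_lf(1)[OF _ that]) (rule QcD[OF f])
  have o: "lfo g f i l j = 0" if "i + l + 3 * j + wlo g \<noteq> wt (n + ext_gen_degree g)" for i l j
    by (rule supp_lf(2)[OF _ that]) (rule QcD[OF f])
  show Q: "(if even n then lfe g f else lfo g f) \<in> Qc n"
    using e o by (simp add: Qc_def wt_deg)
  show "pr (lfe g f) (lfo g f) = (if even n then lfe g f else lfo g f)"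
  proof (rule chn_eqI)
    fix i l j
    show "pr (lfe g f) (lfo g f) i l j = (if even n then lfe g f else lfo g f) i l j"
    proof (cases "even n")
      case True
      have "lfo g f i l j = 0" if m: "(i + l) mod 3 = 1"
      proof (rule o)
        show "i + l + 3 * j + wlo g \<noteq> wt (n + ext_gen_degree g)"
        proof
          assume "i + l + 3 * j + wlo g = wt (n + ext_gen_degree g)"
          then have "i + l + 3 * j + (wlo g - wl g) = wt n" "wlo g - wl g \<le> 1"
            using True by (simp_all add: wt_deg split: if_splits)
          then show False using m mod3_aux(1)[of "i + l" j "wlo g - wl g" "wt n"] wt_mod(1)[OF True] by (simp del: wl.simps wlo.simps)
        qed
      qed
      moreover have "(i + l) mod 3 \<noteq> 0 \<Longrightarrow> lfe g f i l j = 0"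
        using Qc_mod(1)[OF Q True, of i l j] True by simp
      ultimately show ?thesis using True by (auto simp: pr_def)
    next
      case False
      have "lfe g f i l j = 0" if m: "(i + l) mod 3 = 0"
      proof (rule e)
        show "i + l + 3 * j + wl g \<noteq> wt (n + ext_gen_degree g)"
        proof
          assume "i + l + 3 * j + wl g = wt (n + ext_gen_degree g)"
          then have "i + l + 3 * j = wt n + (wlo g - wl g)" "wlo g - wl g \<le> 1"
            using False by (simp_all add: wt_deg split: if_splits)
          then show False using m mod3_aux(2)[of "i + l" j "wt n" "wlo g - wl g"] wt_mod(2)[OF False] by (simp del: wl.simps wlo.simps)
        qed
      qed
      moreover have "(i + l) mod 3 \<noteq> 1 \<Longrightarrow> lfo g f i l j = 0"
        using Qc_mod(2)[OF Q False, of i l j] False by simp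
      ultimately show ?thesis using False by (auto simp: pr_def)
    qed
  qed
qed

lemma lop_Qc: "f \<in> Qc (n + ext_gen_degree g) \<Longrightarrow> lop g f \<in> Qc n"
  using lop_eq[of f n g] by (simp add: lop_pr Qc_closed)

lemma lop_below: assumes f: "f \<in> Qc n" and n: "n < ext_gen_degree g" shows "lop g f = 0"
proof -
  have w: "wt n < wl g" "wt n < wlo g" using n by (cases g; auto simp: wt_def less_Suc_eq numeral_2_eq_2)+
  have "lfe g f i l j = 0" for i l j
    by (rule supp_lf(1)[of "wt n"]) (use w in \<open>simp_all add: QcD[OF f] del: wl.simps\<close>)
  moreover have "lfo g f i l j = 0" for i l j
    by (rule supp_lf(2)[of "wt n"]) (use w in \<open>simp_all add: QcD[OF f] del: wlo.simps\<close>)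
  ultimately have "lfe g f = 0" "lfo g f = 0" by (intro chn_eqI; simp)+
  moreover have "pr 0 0 = 0" by (rule chn_eqI) (simp add: pr_def)
  ultimately show ?thesis by (simp add: lop_pr op_zero)
qed

lemma dQ_lf:
  assumes f: "f \<in> Qc (Suc n + ext_gen_degree g)"
  shows "dQ n (if even n then lfo g f else lfe g f) =
    (if even n then lfe g (dQ (n + ext_gen_degree g) f) else lfo g (dQ (n + ext_gen_degree g) f))" (is "?L = ?R")
proof (rule chn_eqI)
  fix i l j
  have L: "?L \<in> Qc n" using dQ_closed[OF lop_eq(2)[OF f]] by (cases "even n") simp_all
  have df: "dQ (n + ext_gen_degree g) f \<in> Qc (n + ext_gen_degree g)" using dQ_closed[of f "n + ext_gen_degree g"] f by simp
  have R: "?R \<in> Qc n" by (rule lop_eq(2)[OF df])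
  show "?L i l j = ?R i l j"
  proof (cases "i + l + 3 * j = wt n")
    case True
    note m = wt_pos_mod[OF True]
    show ?thesis
      by (cases "even n"; cases g)
        (use m in \<open>simp_all add: dQ_def D0_Fa01 D1_Fa01 D0_Fa10 D1_Fa10 D0_Fb D1_Fb D0_Fc12 D1_Fc12 D0_Fc21 D1_Fc21\<close>)
  qed (simp add: QcD[OF L] QcD[OF R])
qed

lemma dQ_lop:
  assumes f: "f \<in> Qc (Suc n + ext_gen_degree g)"
  shows "dQ n (lop g f) = lop g (dQ (n + ext_gen_degree g) f)"
proof -
  have df: "dQ (n + ext_gen_degree g) f \<in> Qc (n + ext_gen_degree g)" using dQ_closed[of f "n + ext_gen_degree g"] f by simp
  have l: "dQ n (sc y (Pm x h)) = sc y (Pm x (dQ n h))" for x y h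
    by (simp add: dQ_def op_linear Pm_D)
  show ?thesis unfolding lop_pr lop_eq(1)[OF f] lop_eq(1)[OF df] l
    using dQ_lf[OF f] by (cases "even n") simp_all
qed

lemma vec_corner: "rx1 v T0 T0 T0 = 0" "rx2 v T0 T0 T0 = 0" "ry v T0 T0 T0 = 0"
  by (simp_all add: rx1_def rx2_def ry_def dn_def)

text \<open>Correction terms end in a right multiplication and do not reach the constant
  coefficient. There only the bare shift is seen, and the odd parts of \<open>Ga1\<close> and
  \<open>Ga2\<close> disappear altogether.\<close>

lemma lf_corner:
  "lfe g f i l j T0 T0 T0 = f (i + fst (ghi g)) (l + fst (snd (ghi g))) (j + snd (snd (ghi g))) T0 T0 T0"
  "lfo g f i l j T0 T0 T0 = (if ext_gen_degree g = 2
     then f (i + fst (ghi g)) (l + fst (snd (ghi g))) (j + snd (snd (ghi g))) T0 T0 T0 else 0)"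
  by (cases g; simp add: all_lift_defs vec_corner eval_nat_numeral split: nat.splits)+

lemma lop_corner:
  "lop g f i l j T0 T0 T0 = (if (i + l) mod 3 = 0 \<or> (i + l) mod 3 = 1 \<and> ext_gen_degree g = 2 then
     norm_coeff g * ip ^ (ht g * (i + 3 * j)) *
       f (i + fst (ghi g)) (l + fst (snd (ghi g))) (j + snd (snd (ghi g))) T0 T0 T0 else 0)"
  by (simp add: lop_def sc_def Pm_def tw1_def pw_def lf_corner power_mult del: ext_gen_degree.simps ghi.simps)

end

section \<open>Comparison of free resolutions\<close>

lemma left_homI:
  assumes "\<And>x. x \<in> carrier M \<Longrightarrow> f x \<in> carrier N" "f \<in> extensional (carrier M)"
    "\<And>x y. x \<in> carrier M \<Longrightarrow> y \<in> carrier M \<Longrightarrow> f (x \<oplus>\<^bsub>M\<^esub> y) = f x \<oplus>\<^bsub>N\<^esub> f y"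
    "\<And>r x. r \<in> carrier R \<Longrightarrow> x \<in> carrier M \<Longrightarrow> f (r \<odot>\<^bsub>M\<^esub> x) = r \<odot>\<^bsub>N\<^esub> f x"
  shows "f \<in> left_hom R M N"
  using assms by (simp add: left_hom_def PiE_iff)

lemma left_homD:
  assumes "f \<in> left_hom R M N"
  shows "x \<in> carrier M \<Longrightarrow> f x \<in> carrier N" "f \<in> extensional (carrier M)"
    "x \<in> carrier M \<Longrightarrow> y \<in> carrier M \<Longrightarrow> f (x \<oplus>\<^bsub>M\<^esub> y) = f x \<oplus>\<^bsub>N\<^esub> f y"
    "r \<in> carrier R \<Longrightarrow> x \<in> carrier M \<Longrightarrow> f (r \<odot>\<^bsub>M\<^esub> x) = r \<odot>\<^bsub>N\<^esub> f x"
  using assms by (auto simp: left_hom_def PiE_iff)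

lemma left_hom_zero:
  assumes "left_module R M" "left_module R N" "f \<in> left_hom R M N"
  shows "f \<zero>\<^bsub>M\<^esub> = \<zero>\<^bsub>N\<^esub>"
proof -
  interpret M: left_module R M by fact
  interpret N: left_module R N by fact
  have "f (\<zero>\<^bsub>R\<^esub> \<odot>\<^bsub>M\<^esub> \<zero>\<^bsub>M\<^esub>) = \<zero>\<^bsub>R\<^esub> \<odot>\<^bsub>N\<^esub> f \<zero>\<^bsub>M\<^esub>"
    by (rule left_homD(4)[OF assms(3)]) simp_all
  then show ?thesis using left_homD(1)[OF assms(3), of "\<zero>\<^bsub>M\<^esub>"] by simp
qed

lemma left_hom_compose:
  assumes "left_module R A" "f \<in> left_hom R A B" "g \<in> left_hom R B C"
  shows "compose (carrier A) g f \<in> left_hom R A C"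
proof -
  interpret A: left_module R A by fact
  show ?thesis
    using left_homD[OF assms(2)] left_homD[OF assms(3)]
    by (intro left_homI) (simp_all add: compose_def)
qed

lemma (in left_module) smult_minus: "r \<in> carrier R \<Longrightarrow> x \<in> carrier M \<Longrightarrow> r \<odot>\<^bsub>M\<^esub> (\<ominus>\<^bsub>M\<^esub> x) = \<ominus>\<^bsub>M\<^esub> (r \<odot>\<^bsub>M\<^esub> x)"
proof -
  assume a: "r \<in> carrier R" "x \<in> carrier M"
  have "r \<odot>\<^bsub>M\<^esub> (\<ominus>\<^bsub>M\<^esub> x) \<oplus>\<^bsub>M\<^esub> r \<odot>\<^bsub>M\<^esub> x = \<zero>\<^bsub>M\<^esub>"
    using a by (simp add: smult_r_distr[symmetric] M.l_neg)
  then show ?thesis using a by (simp add: M.minus_equality)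
qed

lemma left_hom_minus:
  assumes "left_module R A" "left_module R B" "f \<in> left_hom R A B" "g \<in> left_hom R A B"
  shows "(\<lambda>x\<in>carrier A. f x \<ominus>\<^bsub>B\<^esub> g x) \<in> left_hom R A B"
proof -
  interpret A: left_module R A by fact
  interpret B: left_module R B by fact
  note f = left_homD[OF assms(3)]
  note g = left_homD[OF assms(4)]
  show ?thesis
  proof (rule left_homI)
    fix x y assume xy: "x \<in> carrier A" "y \<in> carrier A"
    have "f x \<oplus>\<^bsub>B\<^esub> f y \<oplus>\<^bsub>B\<^esub> \<ominus>\<^bsub>B\<^esub> (g x \<oplus>\<^bsub>B\<^esub> g y) = (f x \<oplus>\<^bsub>B\<^esub> \<ominus>\<^bsub>B\<^esub> g x) \<oplus>\<^bsub>B\<^esub> (f y \<oplus>\<^bsub>B\<^esub> \<ominus>\<^bsub>B\<^esub> g y)"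
      using xy f(1) g(1) by (simp add: B.M.minus_add B.M.a_ac)
    then show "(\<lambda>x\<in>carrier A. f x \<ominus>\<^bsub>B\<^esub> g x) (x \<oplus>\<^bsub>A\<^esub> y) = (\<lambda>x\<in>carrier A. f x \<ominus>\<^bsub>B\<^esub> g x) x \<oplus>\<^bsub>B\<^esub> (\<lambda>x\<in>carrier A. f x \<ominus>\<^bsub>B\<^esub> g x) y"
      using xy f g by (simp add: a_minus_def)
  qed (use f g in \<open>simp_all add: a_minus_def B.smult_r_distr B.smult_minus\<close>)
qed

lemma left_hom_diff:
  assumes "left_module R A" "left_module R B" "f \<in> left_hom R A B" "x \<in> carrier A" "y \<in> carrier A"
  shows "f (x \<ominus>\<^bsub>A\<^esub> y) = f x \<ominus>\<^bsub>B\<^esub> f y"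
proof -
  interpret A: left_module R A by fact
  interpret B: left_module R B by fact
  have "f (x \<ominus>\<^bsub>A\<^esub> y) \<oplus>\<^bsub>B\<^esub> f y = f x"
    using left_homD(3)[OF assms(3), of "x \<ominus>\<^bsub>A\<^esub> y" y] assms(4,5) by (simp add: a_minus_def A.M.a_assoc A.M.l_neg)
  then have "f x \<ominus>\<^bsub>B\<^esub> f y = f (x \<ominus>\<^bsub>A\<^esub> y) \<oplus>\<^bsub>B\<^esub> f y \<ominus>\<^bsub>B\<^esub> f y" by simp
  also have "\<dots> = f (x \<ominus>\<^bsub>A\<^esub> y)"
    using left_homD(1)[OF assms(3)] assms(4,5) by (simp add: a_minus_def B.M.a_assoc B.M.r_neg)
  finally show ?thesis by simp
qed

section \<open>Free modules: coefficients, extension and lifting\<close>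

lemma is_basis_unique_sum:
  assumes "is_basis R A B" "x \<in> carrier A"
  shows "\<exists>!c. c \<in> B \<rightarrow>\<^sub>E carrier R \<and> finite {b\<in>B. c b \<noteq> \<zero>\<^bsub>R\<^esub>} \<and>
    x = (\<Oplus>\<^bsub>A\<^esub>b\<in>{b\<in>B. c b \<noteq> \<zero>\<^bsub>R\<^esub>}. c b \<odot>\<^bsub>A\<^esub> b)"
  by (rule bspec[OF conjunct2[OF assms(1)[unfolded is_basis_def]] assms(2)])

text \<open>Coefficients become functions on the whole type that vanish outside B, instead of
  extensional functions on B. In this form they are elements of \<open>fun_module\<close>, and
  \<open>lin_ext\<close> applies to them.\<close>

lemma basis_coefficients:
  fixes A :: "('r, 'm, 'y) module_scheme"
  assumes "left_module R A" "is_basis R A B"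
  defines "v \<equiv> \<lambda>b. if b \<in> B then b else \<zero>\<^bsub>A\<^esub>"
  shows "x \<in> carrier A \<Longrightarrow> \<exists>g\<in>carrier (fun_module R). {b. g b \<noteq> \<zero>\<^bsub>R\<^esub>} \<subseteq> B \<and> lin_ext R A v g = x"
    and "\<lbrakk>g \<in> carrier (fun_module R); {b. g b \<noteq> \<zero>\<^bsub>R\<^esub>} \<subseteq> B; h \<in> carrier (fun_module R); {b. h b \<noteq> \<zero>\<^bsub>R\<^esub>} \<subseteq> B;
      lin_ext R A v g = lin_ext R A v h\<rbrakk> \<Longrightarrow> g = h"
proof -
  interpret A: left_module R A by fact
  have B: "B \<subseteq> carrier A" using assms(2) by (simp add: is_basis_def)
  have v: "v b \<in> carrier A" for b using B by (auto simp: v_def)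
  let ?sum = "\<lambda>c. (\<Oplus>\<^bsub>A\<^esub>b\<in>{b\<in>B. c b \<noteq> \<zero>\<^bsub>R\<^esub>}. c b \<odot>\<^bsub>A\<^esub> b)"
  have sum: "lin_ext R A v g = ?sum (restrict g B)"
    if g: "g \<in> carrier (fun_module R)" "{b. g b \<noteq> \<zero>\<^bsub>R\<^esub>} \<subseteq> B" for g
  proof -
    have eq: "{b\<in>B. restrict g B b \<noteq> \<zero>\<^bsub>R\<^esub>} = {b. g b \<noteq> \<zero>\<^bsub>R\<^esub>}" using g(2) by auto
    have gB: "b \<in> B" if "g b \<noteq> \<zero>\<^bsub>R\<^esub>" for b using g(2) that by auto
    have gR: "g b \<in> carrier R" for b using g(1) by (simp add: fun_module_simps)
    have gA: "g b \<odot>\<^bsub>A\<^esub> b \<in> carrier A" if "g b \<noteq> \<zero>\<^bsub>R\<^esub>" for b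
      using gB[OF that] gR B by (intro A.smult_closed) auto
    have "lin_ext R A v g = (\<Oplus>\<^bsub>A\<^esub>b\<in>{b. g b \<noteq> \<zero>\<^bsub>R\<^esub>}. g b \<odot>\<^bsub>A\<^esub> v b)" using g(1) by (simp add: lin_ext_def)
    also have "\<dots> = (\<Oplus>\<^bsub>A\<^esub>b\<in>{b. g b \<noteq> \<zero>\<^bsub>R\<^esub>}. restrict g B b \<odot>\<^bsub>A\<^esub> b)"
      by (rule A.M.finsum_cong') (use gB gA in \<open>auto simp: v_def\<close>)
    finally show ?thesis unfolding eq .
  qed
  show "\<exists>g\<in>carrier (fun_module R). {b. g b \<noteq> \<zero>\<^bsub>R\<^esub>} \<subseteq> B \<and> lin_ext R A v g = x" if "x \<in> carrier A"
  proof -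
    obtain c where c: "c \<in> B \<rightarrow>\<^sub>E carrier R" "finite {b\<in>B. c b \<noteq> \<zero>\<^bsub>R\<^esub>}" "x = ?sum c"
      by (rule ex1E[OF is_basis_unique_sum[OF assms(2) \<open>x \<in> carrier A\<close>]], elim conjE)
    define g where "g b = (if b \<in> B then c b else \<zero>\<^bsub>R\<^esub>)" for b
    have "{b. g b \<noteq> \<zero>\<^bsub>R\<^esub>} = {b\<in>B. c b \<noteq> \<zero>\<^bsub>R\<^esub>}" by (auto simp: g_def)
    then have g: "g \<in> carrier (fun_module R)" "{b. g b \<noteq> \<zero>\<^bsub>R\<^esub>} \<subseteq> B"
      using c by (auto simp: fun_module_simps g_def)
    moreover have "restrict g B = c" using c(1) by (auto simp: g_def PiE_iff extensional_def)
    ultimately show ?thesis using sum[OF g] c(3) by auto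
  qed
  show "g = h" if gh: "g \<in> carrier (fun_module R)" "{b. g b \<noteq> \<zero>\<^bsub>R\<^esub>} \<subseteq> B"
    "h \<in> carrier (fun_module R)" "{b. h b \<noteq> \<zero>\<^bsub>R\<^esub>} \<subseteq> B" "lin_ext R A v g = lin_ext R A v h"
  proof -
    let ?Q = "\<lambda>c. c \<in> B \<rightarrow>\<^sub>E carrier R \<and> finite {b\<in>B. c b \<noteq> \<zero>\<^bsub>R\<^esub>} \<and> lin_ext R A v g = ?sum c"
    have Q: "?Q (restrict f B)" if "f \<in> carrier (fun_module R)" "{b. f b \<noteq> \<zero>\<^bsub>R\<^esub>} \<subseteq> B" "lin_ext R A v f = lin_ext R A v g" for f
    proof -
      have "{b\<in>B. restrict f B b \<noteq> \<zero>\<^bsub>R\<^esub>} \<subseteq> {b. f b \<noteq> \<zero>\<^bsub>R\<^esub>}" by auto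
      then have "finite {b\<in>B. restrict f B b \<noteq> \<zero>\<^bsub>R\<^esub>}" using that(1) by (auto simp: fun_module_simps intro: finite_subset)
      then show ?thesis using that sum[OF that(1,2)] by (auto simp: fun_module_simps)
    qed
    have "lin_ext R A v g \<in> carrier A" using left_homD(1)[OF A.lin_ext_hom[OF v] gh(1)] .
    then have "\<exists>!c. ?Q c" by (rule is_basis_unique_sum[OF assms(2)])
    then have eq: "restrict g B = restrict h B" using Q[OF gh(1,2) refl] Q[OF gh(3,4) gh(5)[symmetric]] by blast
    show ?thesis
    proof
      fix b
      have "b \<notin> B \<Longrightarrow> g b = \<zero>\<^bsub>R\<^esub> \<and> h b = \<zero>\<^bsub>R\<^esub>" using gh(2,4) by blast
      then show "g b = h b" using fun_cong[OF eq, of b] by (cases "b \<in> B") auto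
    qed
  qed
qed

text \<open>By uniqueness the coefficient function of x is linear in x, so the extension is
  \<open>lin_ext\<close> of the prescribed values applied to it.\<close>

lemma free_extend:
  fixes A :: "('r, 'm, 'y) module_scheme" and N :: "('r, 'n, 'z) module_scheme"
  assumes A: "left_module R A" "is_basis R A B" and N: "left_module R N"
    and v: "\<And>b. b \<in> B \<Longrightarrow> v b \<in> carrier N"
  shows "\<exists>f\<in>left_hom R A N. \<forall>b\<in>B. f b = v b"
proof -
  interpret A: left_module R A by fact
  interpret N: left_module R N by fact
  interpret F: left_module R "fun_module R" by (rule left_module_fun_module) (rule A.R.ring_axioms)
  let ?F = "fun_module R :: ('r, 'm \<Rightarrow> 'r) module"
  let ?u = "\<lambda>b. if b \<in> B then b else \<zero>\<^bsub>A\<^esub>"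
  let ?v = "\<lambda>b. if b \<in> B then v b else \<zero>\<^bsub>N\<^esub>"
  have B: "B \<subseteq> carrier A" using A(2) by (simp add: is_basis_def)
  have u': "?u b \<in> carrier A" for b using B by auto
  have v': "?v b \<in> carrier N" for b using v by auto
  note hu = left_homD[OF A.lin_ext_hom[of ?u, OF u']]
  note hv = left_homD[OF N.lin_ext_hom[of ?v, OF v']]
  let ?ok = "\<lambda>x g. g \<in> carrier ?F \<and> {b. g b \<noteq> \<zero>\<^bsub>R\<^esub>} \<subseteq> B \<and> lin_ext R A ?u g = x"
  have "\<forall>x\<in>carrier A. \<exists>g. ?ok x g" using basis_coefficients(1)[OF A] by blast
  then obtain \<kappa> where "\<forall>x\<in>carrier A. ?ok x (\<kappa> x)" by (rule bchoice[THEN exE])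
  then have \<kappa>: "?ok x (\<kappa> x)" if "x \<in> carrier A" for x using that by (rule bspec)
  have uniq: "\<kappa> x = g" if "?ok x g" for x g
  proof -
    have "x \<in> carrier A" using that hu(1) by blast
    then show ?thesis using basis_coefficients(2)[OF A, of "\<kappa> x" g] \<kappa> that by auto
  qed
  have add: "\<kappa> (x \<oplus>\<^bsub>A\<^esub> y) = \<kappa> x \<oplus>\<^bsub>?F\<^esub> \<kappa> y" if "x \<in> carrier A" "y \<in> carrier A" for x y
  proof (rule uniq, intro conjI)
    have "{b. (\<kappa> x \<oplus>\<^bsub>?F\<^esub> \<kappa> y) b \<noteq> \<zero>\<^bsub>R\<^esub>} \<subseteq> {b. \<kappa> x b \<noteq> \<zero>\<^bsub>R\<^esub>} \<union> {b. \<kappa> y b \<noteq> \<zero>\<^bsub>R\<^esub>}"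
      by (auto simp: fun_module_simps)
    then show "{b. (\<kappa> x \<oplus>\<^bsub>?F\<^esub> \<kappa> y) b \<noteq> \<zero>\<^bsub>R\<^esub>} \<subseteq> B" using \<kappa>[OF that(1)] \<kappa>[OF that(2)] by blast
  qed (use \<kappa>[OF that(1)] \<kappa>[OF that(2)] hu(3) in auto)
  have smult: "\<kappa> (r \<odot>\<^bsub>A\<^esub> x) = r \<odot>\<^bsub>?F\<^esub> \<kappa> x" if "r \<in> carrier R" "x \<in> carrier A" for r x
  proof (rule uniq, intro conjI)
    have "{b. (r \<odot>\<^bsub>?F\<^esub> \<kappa> x) b \<noteq> \<zero>\<^bsub>R\<^esub>} \<subseteq> {b. \<kappa> x b \<noteq> \<zero>\<^bsub>R\<^esub>}"
      using that by (auto simp: fun_module_simps)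
    then show "{b. (r \<odot>\<^bsub>?F\<^esub> \<kappa> x) b \<noteq> \<zero>\<^bsub>R\<^esub>} \<subseteq> B" using \<kappa>[OF that(2)] by blast
  qed (use \<kappa>[OF that(2)] that hu(4) in auto)
  have "(\<lambda>x\<in>carrier A. lin_ext R N ?v (\<kappa> x)) \<in> left_hom R A N"
    by (rule left_homI) (use \<kappa> hv add smult in auto)
  moreover have "lin_ext R N ?v (\<kappa> b) = v b" if "b \<in> B" for b
  proof -
    let ?\<delta> = "\<lambda>j. if j = b then \<one>\<^bsub>R\<^esub> else \<zero>\<^bsub>R\<^esub>"
    have "\<kappa> b = ?\<delta>"
      by (rule uniq) (use A.lin_ext_delta[of ?u b, OF u'] that in auto)
    then show ?thesis using N.lin_ext_delta(2)[of ?v b, OF v'] that by simp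
  qed
  ultimately show ?thesis using B by (intro bexI[of _ "\<lambda>x\<in>carrier A. lin_ext R N ?v (\<kappa> x)"]) auto
qed

lemma free_eqI:
  assumes A: "left_module R A" "is_basis R A B" and N: "left_module R N"
    and f: "f \<in> left_hom R A N" and g: "g \<in> left_hom R A N" and eq: "\<And>b. b \<in> B \<Longrightarrow> f b = g b"
    and x: "x \<in> carrier A"
  shows "f x = g x"
proof -
  interpret A: left_module R A by fact
  interpret N: left_module R N by fact
  have B: "B \<subseteq> carrier A" using A(2) by (simp add: is_basis_def)
  obtain c where c: "c \<in> B \<rightarrow>\<^sub>E carrier R" "finite {b\<in>B. c b \<noteq> \<zero>\<^bsub>R\<^esub>}"
    "x = (\<Oplus>\<^bsub>A\<^esub>b\<in>{b\<in>B. c b \<noteq> \<zero>\<^bsub>R\<^esub>}. c b \<odot>\<^bsub>A\<^esub> b)"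
    by (rule ex1E[OF is_basis_unique_sum[OF A(2) x]], elim conjE)
  have "f (\<Oplus>\<^bsub>A\<^esub>b\<in>S. c b \<odot>\<^bsub>A\<^esub> b) = g (\<Oplus>\<^bsub>A\<^esub>b\<in>S. c b \<odot>\<^bsub>A\<^esub> b)" if "finite S" "S \<subseteq> B" for S
    using that
  proof (induction S rule: finite_induct)
    case empty
    then show ?case using left_hom_zero[OF A(1) N f] left_hom_zero[OF A(1) N g] by simp
  next
    case (insert b S)
    have b: "c b \<in> carrier R" "b \<in> carrier A" using insert B c(1) by auto
    have S: "(\<lambda>b. c b \<odot>\<^bsub>A\<^esub> b) \<in> S \<rightarrow> carrier A" using insert B c(1) by auto
    then have "(\<Oplus>\<^bsub>A\<^esub>b\<in>S. c b \<odot>\<^bsub>A\<^esub> b) \<in> carrier A" by (rule A.M.finsum_closed)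
    then show ?case using insert b S eq[of b]
      by (simp add: left_homD(3,4)[OF f] left_homD(3,4)[OF g])
  qed
  then show ?thesis using c(2) unfolding c(3) by blast
qed

lemma free_lift:
  assumes A: "free_left_module R A" and B: "left_module R B" and N: "left_module R N"
    and g: "g \<in> left_hom R B N" and f: "f \<in> left_hom R A N"
    and im: "\<And>x. x \<in> carrier A \<Longrightarrow> f x \<in> g ` carrier B"
  shows "\<exists>h\<in>left_hom R A B. \<forall>x\<in>carrier A. g (h x) = f x"
proof -
  obtain S where A': "left_module R A" and S: "is_basis R A S" using A unfolding free_left_module_def by blast
  interpret A: left_module R A by fact
  have SA: "S \<subseteq> carrier A" using S by (simp add: is_basis_def)
  have "\<forall>b\<in>S. \<exists>y\<in>carrier B. g y = f b" using im SA by (metis imageE subsetD)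
  then obtain v where v: "\<And>b. b \<in> S \<Longrightarrow> v b \<in> carrier B" "\<And>b. b \<in> S \<Longrightarrow> g (v b) = f b" by metis
  obtain h where h: "h \<in> left_hom R A B" "\<forall>b\<in>S. h b = v b" by (rule bexE[OF free_extend[where v=v, OF A' S B v(1)]])
  have "compose (carrier A) g h x = f x" if "x \<in> carrier A" for x
    by (rule free_eqI[OF A' S N left_hom_compose[OF A' h(1) g] f _ that])
      (use h v SA in \<open>auto simp: compose_def\<close>)
  then show ?thesis using h(1) by (intro bexI[of _ h]) (auto simp: compose_def)
qed

section \<open>Comparison maps and homotopies\<close>

lemma free_resolutionD:
  assumes "free_resolution R M P d e"
  shows "free_left_module R (P n)" "left_module R (P n)" "d n \<in> left_hom R (P (Suc n)) (P n)" "e \<in> left_hom R (P 0) M"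
    "e ` carrier (P 0) = carrier M"
    "\<lbrakk>x \<in> carrier (P 0); e x = \<zero>\<^bsub>M\<^esub>\<rbrakk> \<Longrightarrow> x \<in> d 0 ` carrier (P (Suc 0))"
    "\<lbrakk>x \<in> carrier (P (Suc n)); d n x = \<zero>\<^bsub>P n\<^esub>\<rbrakk> \<Longrightarrow> x \<in> d (Suc n) ` carrier (P (Suc (Suc n)))"
    "x \<in> carrier (P (Suc 0)) \<Longrightarrow> e (d 0 x) = \<zero>\<^bsub>M\<^esub>"
    "x \<in> carrier (P (Suc (Suc n))) \<Longrightarrow> d n (d (Suc n) x) = \<zero>\<^bsub>P n\<^esub>"
proof -
  note r = assms[unfolded free_resolution_def]
  have k0: "{x\<in>carrier (P 0). e x = \<zero>\<^bsub>M\<^esub>} = d 0 ` carrier (P (Suc 0))" using r by simp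
  have k: "{x\<in>carrier (P (Suc n)). d n x = \<zero>\<^bsub>P n\<^esub>} = d (Suc n) ` carrier (P (Suc (Suc n)))" for n using r by blast
  show "free_left_module R (P n)" "left_module R (P n)" "d n \<in> left_hom R (P (Suc n)) (P n)" "e \<in> left_hom R (P 0) M"
    "e ` carrier (P 0) = carrier M" using r by (auto simp: free_left_module_def)
  show "\<lbrakk>x \<in> carrier (P 0); e x = \<zero>\<^bsub>M\<^esub>\<rbrakk> \<Longrightarrow> x \<in> d 0 ` carrier (P (Suc 0))" using k0 by blast
  show "\<lbrakk>x \<in> carrier (P (Suc n)); d n x = \<zero>\<^bsub>P n\<^esub>\<rbrakk> \<Longrightarrow> x \<in> d (Suc n) ` carrier (P (Suc (Suc n)))" using k[of n] by blast
  show "x \<in> carrier (P (Suc 0)) \<Longrightarrow> e (d 0 x) = \<zero>\<^bsub>M\<^esub>" using k0 by blast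
  show "x \<in> carrier (P (Suc (Suc n))) \<Longrightarrow> d n (d (Suc n) x) = \<zero>\<^bsub>P n\<^esub>" using k[of n] by blast
qed

lemma chain_lift_exists:
  assumes free: "\<And>i. free_left_module R (A i)" and a: "\<And>i. a i \<in> left_hom R (A (Suc i)) (A i)"
    and aa: "\<And>i x. x \<in> carrier (A (Suc (Suc i))) \<Longrightarrow> a i (a (Suc i) x) = \<zero>\<^bsub>A i\<^esub>"
    and M: "left_module R M" and B: "free_resolution R M B b e"
    and g: "g \<in> left_hom R (A 0) M" "\<And>x. x \<in> carrier (A (Suc 0)) \<Longrightarrow> g (a 0 x) = \<zero>\<^bsub>M\<^esub>"
  shows "\<exists>F. (\<forall>i. F i \<in> left_hom R (A i) (B i)) \<and> (\<forall>x\<in>carrier (A 0). e (F 0 x) = g x) \<and>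
    (\<forall>i. \<forall>x\<in>carrier (A (Suc i)). b i (F (Suc i) x) = F i (a i x))"
proof -
  note rB = free_resolutionD[OF B]
  have A: "left_module R (A i)" for i using free by (auto simp: free_left_module_def)
  \<comment> \<open>The last clause puts the values \<open>h (a n x)\<close> into the kernel of the
    preceding differential, so that exactness provides the next map.\<close>
  let ?P = "\<lambda>n h. h \<in> left_hom R (A n) (B n) \<and> (n = 0 \<longrightarrow> (\<forall>x\<in>carrier (A 0). e (h x) = g x)) \<and>
    (\<forall>k. n = Suc k \<longrightarrow> (\<forall>x\<in>carrier (A (Suc n)). b k (h (a n x)) = \<zero>\<^bsub>B k\<^esub>))"
  let ?Q = "\<lambda>n h h'. \<forall>x\<in>carrier (A (Suc n)). b n (h' x) = h (a n x)"
  have "\<exists>F. \<forall>n. ?P n (F n) \<and> ?Q n (F n) (F (Suc n))"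
  proof (rule dependent_nat_choice)
    have "\<exists>h\<in>left_hom R (A 0) (B 0). \<forall>x\<in>carrier (A 0). e (h x) = g x"
      by (rule free_lift[OF free rB(2) M rB(4) g(1)]) (use rB(5) left_homD(1)[OF g(1)] in auto)
    then show "\<exists>h. ?P 0 h" by auto
  next
    fix h n assume h: "?P n h"
    then have hh: "h \<in> left_hom R (A n) (B n)" by blast
    have c: "compose (carrier (A (Suc n))) h (a n) \<in> left_hom R (A (Suc n)) (B n)"
      by (rule left_hom_compose[OF A a hh])
    have "h (a n x) \<in> b n ` carrier (B (Suc n))" if x: "x \<in> carrier (A (Suc n))" for x
    proof -
      have y: "h (a n x) \<in> carrier (B n)" using left_homD(1)[OF hh] left_homD(1)[OF a] x by blast
      show ?thesis
      proof (cases n)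
        case 0
        then have "e (h (a n x)) = \<zero>\<^bsub>M\<^esub>" using h g(2) x left_homD(1)[OF a, of x 0] by simp
        then show ?thesis using rB(6) y 0 by simp
      next
        case (Suc k)
        then have "b k (h (a n x)) = \<zero>\<^bsub>B k\<^esub>" using h x by blast
        then show ?thesis using rB(7) y Suc by simp
      qed
    qed
    then have "\<exists>h'\<in>left_hom R (A (Suc n)) (B (Suc n)). \<forall>x\<in>carrier (A (Suc n)). b n (h' x) = compose (carrier (A (Suc n))) h (a n) x"
      by (intro free_lift[OF free rB(2) rB(2) rB(3) c]) (simp add: compose_def)
    then obtain h' where h': "h' \<in> left_hom R (A (Suc n)) (B (Suc n))" "?Q n h h'" by (auto simp: compose_def)
    have "b n (h' (a (Suc n) x)) = \<zero>\<^bsub>B n\<^esub>" if "x \<in> carrier (A (Suc (Suc n)))" for x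
      using h'(2) left_homD(1)[OF a that] aa[OF that] left_hom_zero[OF A rB(2) hh] by simp
    then show "\<exists>h'. ?P (Suc n) h' \<and> ?Q n h h'" using h' by auto
  qed
  then obtain F where F: "\<forall>n. ?P n (F n) \<and> ?Q n (F n) (F (Suc n))" by (rule exE)
  have "e (F 0 x) = g x" if "x \<in> carrier (A 0)" for x using F that by blast
  then show ?thesis using F by (intro exI[of _ F]) blast
qed

lemma null_homotopy_exists:
  assumes free: "\<And>i. free_left_module R (A i)" and a: "\<And>i. a i \<in> left_hom R (A (Suc i)) (A i)"
    and aa: "\<And>i x. x \<in> carrier (A (Suc (Suc i))) \<Longrightarrow> a i (a (Suc i) x) = \<zero>\<^bsub>A i\<^esub>"
    and M: "left_module R M" and B: "free_resolution R M B b e"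
    and F: "\<And>i. F i \<in> left_hom R (A i) (B i)" "\<And>x. x \<in> carrier (A 0) \<Longrightarrow> e (F 0 x) = \<zero>\<^bsub>M\<^esub>"
      "\<And>i x. x \<in> carrier (A (Suc i)) \<Longrightarrow> b i (F (Suc i) x) = F i (a i x)"
  shows "\<exists>H. (\<forall>i. H i \<in> left_hom R (A i) (B (Suc i))) \<and> (\<forall>x\<in>carrier (A 0). F 0 x = b 0 (H 0 x)) \<and>
    (\<forall>i. \<forall>x\<in>carrier (A (Suc i)). F (Suc i) x = b (Suc i) (H (Suc i) x) \<oplus>\<^bsub>B (Suc i)\<^esub> H i (a i x))"
proof -
  note rB = free_resolutionD[OF B]
  have A: "left_module R (A i)" for i using free by (auto simp: free_left_module_def)
  \<comment> \<open>By the last clause, \<open>F (Suc n)\<close> minus \<open>h\<close> after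
    \<open>a n\<close> takes values in the cycles; exactness then yields the next homotopy.\<close>
  let ?P = "\<lambda>n h. h \<in> left_hom R (A n) (B (Suc n)) \<and> (n = 0 \<longrightarrow> (\<forall>x\<in>carrier (A 0). F 0 x = b 0 (h x))) \<and>
    (\<forall>x\<in>carrier (A (Suc n)). b n (h (a n x)) = F n (a n x))"
  let ?Q = "\<lambda>n h h'. \<forall>x\<in>carrier (A (Suc n)). F (Suc n) x = b (Suc n) (h' x) \<oplus>\<^bsub>B (Suc n)\<^esub> h (a n x)"
  have "\<exists>H. \<forall>n. ?P n (H n) \<and> ?Q n (H n) (H (Suc n))"
  proof (rule dependent_nat_choice)
    have "\<exists>h\<in>left_hom R (A 0) (B (Suc 0)). \<forall>x\<in>carrier (A 0). b 0 (h x) = F 0 x"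
      by (rule free_lift[OF free rB(2) rB(2) rB(3) F(1)]) (use rB(6) F(2) left_homD(1)[OF F(1)] in auto)
    then obtain h where "h \<in> left_hom R (A 0) (B (Suc 0))" "\<forall>x\<in>carrier (A 0). b 0 (h x) = F 0 x" by blast
    then show "\<exists>h. ?P 0 h" using left_homD(1)[OF a[of 0]] by (intro exI[of _ h]) auto
  next
    fix h n assume h: "?P n h"
    then have hh: "h \<in> left_hom R (A n) (B (Suc n))" by blast
    interpret B1: left_module R "B (Suc n)" by (rule rB(2))
    interpret B0: left_module R "B n" by (rule rB(2))
    have c: "compose (carrier (A (Suc n))) h (a n) \<in> left_hom R (A (Suc n)) (B (Suc n))"
      by (rule left_hom_compose[OF A a hh])
    let ?f = "\<lambda>x\<in>carrier (A (Suc n)). F (Suc n) x \<ominus>\<^bsub>B (Suc n)\<^esub> compose (carrier (A (Suc n))) h (a n) x"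
    have f: "?f \<in> left_hom R (A (Suc n)) (B (Suc n))" by (rule left_hom_minus[OF A rB(2) F(1) c])
    have "?f x \<in> b (Suc n) ` carrier (B (Suc (Suc n)))" if x: "x \<in> carrier (A (Suc n))" for x
    proof (rule rB(7))
      show "?f x \<in> carrier (B (Suc n))" using left_homD(1)[OF f x] .
      have ax: "a n x \<in> carrier (A n)" using left_homD(1)[OF a x] .
      have "b n (F (Suc n) x \<ominus>\<^bsub>B (Suc n)\<^esub> h (a n x)) = b n (F (Suc n) x) \<ominus>\<^bsub>B n\<^esub> b n (h (a n x))"
        by (rule left_hom_diff[OF rB(2) rB(2) rB(3)]) (use left_homD(1)[OF F(1) x] left_homD(1)[OF hh ax] in auto)
      also have "\<dots> = \<zero>\<^bsub>B n\<^esub>"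
        using F(3)[OF x] h x left_homD(1)[OF F(1) ax] by (simp add: a_minus_def B0.M.r_neg)
      finally show "b n (?f x) = \<zero>\<^bsub>B n\<^esub>" using x by (simp add: compose_def)
    qed
    then obtain h' where h': "h' \<in> left_hom R (A (Suc n)) (B (Suc (Suc n)))" "\<forall>x\<in>carrier (A (Suc n)). b (Suc n) (h' x) = ?f x"
      using free_lift[OF free rB(2) rB(2) rB(3) f] by blast
    have Q: "?Q n h h'"
    proof
      fix x assume x: "x \<in> carrier (A (Suc n))"
      have "F (Suc n) x \<in> carrier (B (Suc n))" "h (a n x) \<in> carrier (B (Suc n))"
        using left_homD(1)[OF F(1) x] left_homD(1)[OF hh left_homD(1)[OF a x]] .
      then show "F (Suc n) x = b (Suc n) (h' x) \<oplus>\<^bsub>B (Suc n)\<^esub> h (a n x)"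
        using h'(2) x by (simp add: compose_def a_minus_def B1.M.a_assoc B1.M.l_neg)
    qed
    have "b (Suc n) (h' (a (Suc n) x)) = F (Suc n) (a (Suc n) x)" if x: "x \<in> carrier (A (Suc (Suc n)))" for x
    proof -
      have ax: "a (Suc n) x \<in> carrier (A (Suc n))" using left_homD(1)[OF a x] .
      have "b (Suc n) (h' (a (Suc n) x)) \<in> carrier (B (Suc n))"
        using left_homD(1)[OF rB(3)] left_homD(1)[OF h'(1) ax] by blast
      then show ?thesis using Q ax aa[OF x] left_hom_zero[OF A rB(2) hh] by simp
    qed
    then show "\<exists>h'. ?P (Suc n) h' \<and> ?Q n h h'" using h'(1) Q by (intro exI[of _ h']) simp
  qed
  then obtain H where H: "\<forall>n. ?P n (H n) \<and> ?Q n (H n) (H (Suc n))" by (rule exE)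
  then show ?thesis by (intro exI[of _ H]) blast
qed

text \<open>If e after \<open>F 0\<close> equals c after d, lift c to a map C into
  \<open>P 0\<close> and subtract C after d from \<open>F 0\<close>: the result is null-homotopic.
  As f kills boundaries, only f after H after d survives, which is a coboundary. This serves twice:
  for the independence of Yoneda products from all choices, and with n = 0 for comparing a round
  trip of comparison maps with the identity.\<close>

lemma lift_of_coboundary:
  assumes M: "left_module R M" and P: "free_resolution R M P d e"
    and F: "\<And>i. F i \<in> left_hom R (P (n + i)) (P i)"
      "\<And>i x. x \<in> carrier (P (n + Suc i)) \<Longrightarrow> d i (F (Suc i) x) = F i (d (n + i) x)"
    and cob: "(\<lambda>x\<in>carrier (P n). e (F 0 x)) \<in> coboundaries R M P d n"
    and f: "f \<in> cocycles R M P d m"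
  shows "compose (carrier (P (n + m))) f (F m) \<in> coboundaries R M P d (n + m)"
proof -
  note rP = free_resolutionD[OF P]
  interpret M: left_module R M by fact
  have fh: "f \<in> left_hom R (P m) M" and fd: "\<And>x. x \<in> carrier (P (Suc m)) \<Longrightarrow> f (d m x) = \<zero>\<^bsub>M\<^esub>"
    using f by (auto simp: cocycles_def)
  have hd: "d (n + i) \<in> left_hom R (P (n + Suc i)) (P (n + i))" for i using rP(3)[of "n + i"] by simp
  have dd: "d (n + i) (d (n + Suc i) x) = \<zero>\<^bsub>P (n + i)\<^esub>" if "x \<in> carrier (P (n + Suc (Suc i)))" for i x
    using rP(9)[of x "n + i"] that by simp
  \<comment> \<open>\<open>F'\<close> will differ from \<open>F\<close> at index 0 only, so for m >
    0 both have the same composite with f.\<close>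
  have step: "compose (carrier (P (n + Suc m'))) f (F' (Suc m')) \<in> coboundaries R M P d (n + Suc m')"
    if m: "m = Suc m'" and F'0: "F' (Suc m') = F (Suc m')"
      and H: "\<forall>i. H i \<in> left_hom R (P (n + i)) (P (Suc i))"
        "\<forall>i. \<forall>x\<in>carrier (P (n + Suc i)). F' (Suc i) x = d (Suc i) (H (Suc i) x) \<oplus>\<^bsub>P (Suc i)\<^esub> H i (d (n + i) x)" for F' H m'
  proof -
    have c: "compose (carrier (P (n + m'))) f (H m') \<in> left_hom R (P (n + m')) M"
      by (rule left_hom_compose[OF rP(2)]) (use H(1) fh m in auto)
    have "f (F' (Suc m') x) = f (H m' (d (n + m') x))" if x: "x \<in> carrier (P (n + Suc m'))" for x
    proof -
      have y: "H (Suc m') x \<in> carrier (P (Suc (Suc m')))" "H m' (d (n + m') x) \<in> carrier (P (Suc m'))"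
        using left_homD(1)[of "H (Suc m')"] left_homD(1)[of "H m'"] H(1) x left_homD(1)[OF hd x] by blast+
      have "f (F' (Suc m') x) = f (d (Suc m') (H (Suc m') x)) \<oplus>\<^bsub>M\<^esub> f (H m' (d (n + m') x))"
        using left_homD(3)[OF fh, of "d (Suc m') (H (Suc m') x)"] left_homD(1)[OF rP(3) y(1)] y(2) H(2) x m by simp
      then show ?thesis using fd y left_homD(1)[OF fh] m by simp
    qed
    then have "compose (carrier (P (n + Suc m'))) f (F' (Suc m')) =
        compose (carrier (P (Suc (n + m')))) (compose (carrier (P (n + m'))) f (H m')) (d (n + m'))"
      using left_homD(1)[OF hd] by (auto simp: compose_def)
    then show ?thesis using c by auto
  qed
  show ?thesis
  proof (cases n)
    case 0
    have eq: "(\<lambda>x\<in>carrier (P 0). e (F 0 x)) = (\<lambda>x\<in>carrier (P 0). \<zero>\<^bsub>M\<^esub>)"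
      using cob by (simp add: 0)
    have e0: "e (F 0 x) = \<zero>\<^bsub>M\<^esub>" if x: "x \<in> carrier (P (n + 0))" for x
    proof -
      have "x \<in> carrier (P 0)" using x 0 by simp
      then show ?thesis using fun_cong[OF eq, of x] by (simp only: restrict_apply if_True)
    qed
    obtain H where H: "\<forall>i. H i \<in> left_hom R (P (n + i)) (P (Suc i))" "\<forall>x\<in>carrier (P (n + 0)). F 0 x = d 0 (H 0 x)"
        "\<forall>i. \<forall>x\<in>carrier (P (n + Suc i)). F (Suc i) x = d (Suc i) (H (Suc i) x) \<oplus>\<^bsub>P (Suc i)\<^esub> H i (d (n + i) x)"
      using null_homotopy_exists[of R "\<lambda>i. P (n + i)" "\<lambda>i. d (n + i)", OF rP(1) hd dd M P F(1) e0 F(2)] by blast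
    show ?thesis
    proof (cases m)
      case (Suc m')
      then show ?thesis using step[OF Suc refl H(1,3)] by simp
    next
      case m0: 0
      have "f (F 0 x) = \<zero>\<^bsub>M\<^esub>" if "x \<in> carrier (P n)" for x
        using H(2) that fd left_homD(1)[of "H 0"] H(1) m0 by (metis add.right_neutral)
      then show ?thesis using m0 0 by (auto simp: compose_def)
    qed
  next
    case (Suc n')
    obtain c where c: "c \<in> left_hom R (P n') M" "(\<lambda>x\<in>carrier (P n). e (F 0 x)) = compose (carrier (P n)) c (d n')"
      using cob Suc by auto
    have ec: "e (F 0 x) = c (d n' x)" if "x \<in> carrier (P n)" for x
      using fun_cong[OF c(2), of x] that by (simp add: compose_def)
    obtain C where C: "C \<in> left_hom R (P n') (P 0)" "\<forall>x\<in>carrier (P n'). e (C x) = c x"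
      using free_lift[OF rP(1) rP(2) M rP(4) c(1)] rP(5) left_homD(1)[OF c(1)] by blast
    have dn: "d n' \<in> left_hom R (P n) (P n')" using rP(3)[of n'] Suc by simp
    have Cd: "compose (carrier (P n)) C (d n') \<in> left_hom R (P n) (P 0)" by (rule left_hom_compose[OF rP(2) dn C(1)])
    define F' where "F' i = (if i = 0 then (\<lambda>x\<in>carrier (P n). F 0 x \<ominus>\<^bsub>P 0\<^esub> compose (carrier (P n)) C (d n') x) else F i)" for i
    interpret P0: left_module R "P 0" by (rule rP(2))
    have F0: "F 0 \<in> left_hom R (P n) (P 0)" using F(1)[of 0] by simp
    have F'1: "F' i \<in> left_hom R (P (n + i)) (P i)" for i
      using left_hom_minus[OF rP(2) rP(2) F0 Cd] F(1)[of i] by (simp add: F'_def)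
    have e0: "e (F' 0 x) = \<zero>\<^bsub>M\<^esub>" if x: "x \<in> carrier (P (n + 0))" for x
    proof -
      have x': "x \<in> carrier (P n)" using x by simp
      have y: "C (d n' x) \<in> carrier (P 0)" "F 0 x \<in> carrier (P 0)" "d n' x \<in> carrier (P n')"
        using left_homD(1)[OF C(1)] left_homD(1)[OF dn x'] left_homD(1)[OF F0 x'] by auto
      have "e (F' 0 x) = e (F 0 x) \<ominus>\<^bsub>M\<^esub> e (C (d n' x))"
        using left_hom_diff[OF rP(2) M rP(4) y(2,1)] x' by (simp add: F'_def compose_def)
      then show ?thesis using ec[OF x'] C(2) y left_homD(1)[OF c(1)] by (simp add: a_minus_def M.M.r_neg)
    qed
    have ch: "d i (F' (Suc i) x) = F' i (d (n + i) x)" if x: "x \<in> carrier (P (n + Suc i))" for i x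
    proof (cases i)
      case 0
      then have x': "x \<in> carrier (P (Suc n))" using x by simp
      have y: "d n x \<in> carrier (P n)" using left_homD(1)[OF rP(3) x'] .
      have "d n' (d n x) = \<zero>\<^bsub>P n'\<^esub>" using rP(9)[of x n'] x' Suc by simp
      then have "C (d n' (d n x)) = \<zero>\<^bsub>P 0\<^esub>" using left_hom_zero[OF rP(2) rP(2) C(1)] by simp
      then show ?thesis using F(2)[OF x] 0 y left_homD(1)[OF F0 y] by (simp add: F'_def compose_def a_minus_def)
    qed (use F(2)[OF x] in \<open>simp add: F'_def\<close>)
    obtain H where H: "\<forall>i. H i \<in> left_hom R (P (n + i)) (P (Suc i))" "\<forall>x\<in>carrier (P (n + 0)). F' 0 x = d 0 (H 0 x)"
        "\<forall>i. \<forall>x\<in>carrier (P (n + Suc i)). F' (Suc i) x = d (Suc i) (H (Suc i) x) \<oplus>\<^bsub>P (Suc i)\<^esub> H i (d (n + i) x)"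
      using null_homotopy_exists[of R "\<lambda>i. P (n + i)" "\<lambda>i. d (n + i)", OF rP(1) hd dd M P F'1 e0 ch] by blast
    show ?thesis
    proof (cases m)
      case m: (Suc m')
      show ?thesis using step[OF m _ H(1,3)] m by (simp add: F'_def)
    next
      case m0: 0
      have fh0: "f \<in> left_hom R (P 0) M" using fh m0 by simp
      have "f (F 0 x) = f (C (d n' x))" if x: "x \<in> carrier (P n)" for x
      proof -
        have y: "C (d n' x) \<in> carrier (P 0)" "F 0 x \<in> carrier (P 0)"
          using left_homD(1)[OF C(1)] left_homD(1)[OF dn x] left_homD(1)[OF F0 x] by auto
        have "f (F' 0 x) = \<zero>\<^bsub>M\<^esub>" using H(2) x fd left_homD(1)[of "H 0"] H(1) m0 by (metis add.right_neutral)
        then have "f (F 0 x) \<ominus>\<^bsub>M\<^esub> f (C (d n' x)) = \<zero>\<^bsub>M\<^esub>"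
          using left_hom_diff[OF rP(2) M fh0 y(2,1)] x by (simp add: F'_def compose_def)
        moreover have "f (F 0 x) = (f (F 0 x) \<ominus>\<^bsub>M\<^esub> f (C (d n' x))) \<oplus>\<^bsub>M\<^esub> f (C (d n' x))"
          using left_homD(1)[OF fh0 y(1)] left_homD(1)[OF fh0 y(2)] by (simp add: a_minus_def M.M.a_assoc M.M.l_neg)
        ultimately show ?thesis using left_homD(1)[OF fh0 y(1)] by simp
      qed
      moreover have "compose (carrier (P n')) f C \<in> left_hom R (P n') M"
        by (rule left_hom_compose[OF rP(2) C(1) fh0])
      moreover have "compose (carrier (P n)) f (F 0) = compose (carrier (P (Suc n'))) (compose (carrier (P n')) f C) (d n')"
        using calculation(1) left_homD(1)[OF dn] Suc by (auto simp: compose_def)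
      ultimately show ?thesis using m0 Suc by auto
    qed
  qed
qed

section \<open>Ext over an augmented algebra\<close>

lemma trivial_simps: "carrier (trivial_module :: (('g word \<Rightarrow>\<^sub>0 'k::field) set, 'k) module) = UNIV"
  "add (trivial_module :: (('g word \<Rightarrow>\<^sub>0 'k::field) set, 'k) module) = (+)"
  "zero (trivial_module :: (('g word \<Rightarrow>\<^sub>0 'k::field) set, 'k) module) = 0"
  "smult (trivial_module :: (('g word \<Rightarrow>\<^sub>0 'k::field) set, 'k) module) X (c * y) =
    c * smult (trivial_module :: (('g word \<Rightarrow>\<^sub>0 'k::field) set, 'k) module) X y"
  "smult (trivial_module :: (('g word \<Rightarrow>\<^sub>0 'k::field) set, 'k) module) X (a + b) =
    smult trivial_module X a + smult trivial_module X b"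
  by (simp_all add: trivial_module_def algebra_simps)

text \<open>The k-action on Ext passes through the elements c 1 of R; \<open>scalar\<close> reduces
  it to multiplication of values.\<close>

locale trivial_resolution =
  fixes R :: "('k::field, ('g word \<Rightarrow>\<^sub>0 'k) set, 'x) module_scheme"
    and P :: "nat \<Rightarrow> (('g word \<Rightarrow>\<^sub>0 'k) set, 'm) module" and d :: "nat \<Rightarrow> 'm \<Rightarrow> 'm" and e :: "'m \<Rightarrow> 'k"
  assumes trivial: "left_module R trivial_module"
    and resolution: "free_resolution R trivial_module P d e"
    and scalar: "(c \<odot>\<^bsub>R\<^esub> \<one>\<^bsub>R\<^esub>) \<odot>\<^bsub>trivial_module\<^esub> y = c * y"
begin

abbreviation T :: "(('g word \<Rightarrow>\<^sub>0 'k) set, 'k) module" where "T \<equiv> trivial_module"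
abbreviation E where "E n \<equiv> ext_component R T P d n"
abbreviation Z where "Z n \<equiv> cocycles R T P d n"
abbreviation B where "B n \<equiv> coboundaries R T P d n"
abbreviation cl where "cl n f \<equiv> ext_class R T P d n f"
abbreviation fadd where "fadd n f g \<equiv> (\<lambda>x\<in>carrier (P n). f x + g x)"
abbreviation fscale where "fscale n c f \<equiv> (\<lambda>x\<in>carrier (P n). c * f x)"

lemmas res = free_resolutionD[OF resolution]

lemma hom_add:
  assumes "left_module R A" "f \<in> left_hom R A T" "g \<in> left_hom R A T"
  shows "(\<lambda>x\<in>carrier A. f x + g x) \<in> left_hom R A T"
proof -
  interpret A: left_module R A by fact
  show ?thesis
    by (rule left_homI) (use left_homD(3,4)[OF assms(2)] left_homD(3,4)[OF assms(3)] in \<open>simp_all add: trivial_simps\<close>)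
qed

lemma hom_scale:
  assumes "left_module R A" "f \<in> left_hom R A T"
  shows "(\<lambda>x\<in>carrier A. c * f x) \<in> left_hom R A T"
proof -
  interpret A: left_module R A by fact
  show ?thesis
    by (rule left_homI) (use left_homD(3,4)[OF assms(2)] in \<open>simp_all add: trivial_simps algebra_simps\<close>)
qed

lemma hom_0: assumes "left_module R A" shows "(\<lambda>x\<in>carrier A. 0) \<in> left_hom R A T"
proof -
  interpret A: left_module R A by fact
  show ?thesis by (rule left_homI) (simp_all add: trivial_simps, simp add: trivial_module_def)
qed

section \<open>Cocycles, coboundaries and operations on classes\<close>

lemma d_closed: "x \<in> carrier (P (Suc n)) \<Longrightarrow> d n x \<in> carrier (P n)"
  by (rule left_homD(1)[OF res(3)])

lemma B_Z: "b \<in> B n \<Longrightarrow> b \<in> Z n"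
proof (cases n)
  case 0
  assume "b \<in> B n"
  then show ?thesis using hom_0[OF res(2)] d_closed 0 by (auto simp: cocycles_def trivial_simps)
next
  case (Suc m)
  assume "b \<in> B n"
  then obtain f where f: "f \<in> left_hom R (P m) T" "b = compose (carrier (P (Suc m))) f (d m)" using Suc by auto
  have "f \<zero>\<^bsub>P m\<^esub> = 0" using left_hom_zero[OF res(2) trivial f(1)] by (simp add: trivial_simps)
  then show ?thesis using left_hom_compose[OF res(2) res(3) f(1)] f(2) Suc res(9) d_closed
    by (auto simp: cocycles_def trivial_simps compose_def)
qed

lemma Z_hom: "f \<in> Z n \<Longrightarrow> f \<in> left_hom R (P n) T" by (simp add: cocycles_def)
lemma Z_ext: "f \<in> Z n \<Longrightarrow> f \<in> extensional (carrier (P n))" using Z_hom left_homD(2) by blast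

lemma Z_closed:
  "f \<in> Z n \<Longrightarrow> g \<in> Z n \<Longrightarrow> fadd n f g \<in> Z n" "f \<in> Z n \<Longrightarrow> fscale n c f \<in> Z n" "(\<lambda>x\<in>carrier (P n). 0) \<in> Z n"
  using hom_add[OF res(2)] hom_scale[OF res(2)] hom_0[OF res(2)] d_closed
  by (auto simp: cocycles_def trivial_simps)

lemma B_0: "(\<lambda>x\<in>carrier (P n). 0) \<in> B n"
proof (cases n)
  case (Suc m)
  have "(\<lambda>x\<in>carrier (P n). 0) = compose (carrier (P (Suc m))) (\<lambda>x\<in>carrier (P m). 0) (d m)"
    using d_closed Suc by (auto simp: compose_def)
  then show ?thesis using hom_0[OF res(2)] Suc by auto
qed (simp add: trivial_simps)

lemma B_closed:
  assumes b: "b \<in> B n"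
  shows "b' \<in> B n \<Longrightarrow> fadd n b b' \<in> B n" "fscale n c b \<in> B n"
proof -
  show "fadd n b b' \<in> B n" if b': "b' \<in> B n"
  proof (cases n)
    case 0 then show ?thesis using b b' by (auto simp: trivial_simps restrict_def)
  next
    case (Suc m)
    obtain f f' where f: "f \<in> left_hom R (P m) T" "b = compose (carrier (P (Suc m))) f (d m)"
      and f': "f' \<in> left_hom R (P m) T" "b' = compose (carrier (P (Suc m))) f' (d m)" using b b' Suc by auto
    have "fadd n b b' = compose (carrier (P (Suc m))) (\<lambda>x\<in>carrier (P m). f x + f' x) (d m)"
      using d_closed Suc f(2) f'(2) by (auto simp: compose_def)
    then show ?thesis using hom_add[OF res(2) f(1) f'(1)] Suc by auto
  qed
  show "fscale n c b \<in> B n"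
  proof (cases n)
    case 0 then show ?thesis using b by (auto simp: trivial_simps restrict_def)
  next
    case (Suc m)
    obtain f where f: "f \<in> left_hom R (P m) T" "b = compose (carrier (P (Suc m))) f (d m)" using b Suc by auto
    have "fscale n c b = compose (carrier (P (Suc m))) (\<lambda>x\<in>carrier (P m). c * f x) (d m)"
      using d_closed Suc f(2) by (auto simp: compose_def)
    then show ?thesis using hom_scale[OF res(2) f(1)] Suc by auto
  qed
qed

lemma cl_eqI:
  assumes f: "f \<in> Z n" and g: "g \<in> Z n" and b: "b \<in> B n" "\<And>x. x \<in> carrier (P n) \<Longrightarrow> f x = g x + b x"
  shows "cl n f = cl n g"
proof -
  have sub: "cl n f \<subseteq> cl n g" if b: "b \<in> B n" and eq: "\<And>x. x \<in> carrier (P n) \<Longrightarrow> f x = g x + b x" for f g b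
  proof
    fix h assume "h \<in> cl n f"
    then obtain c where c: "c \<in> B n" "h = (\<lambda>x\<in>carrier (P n). f x + c x)" by (auto simp: ext_class_def trivial_simps)
    have "h = (\<lambda>x\<in>carrier (P n). g x + fadd n b c x)" using c eq by (auto simp: add.assoc)
    then show "h \<in> cl n g" unfolding ext_class_def trivial_simps
      by (rule image_eqI[where x = "fadd n b c"]) (rule B_closed(1)[OF b c(1)])
  qed
  show ?thesis
    using sub[OF b] sub[OF B_closed(2)[OF b(1), of "-1"], of g f] b(2) by auto
qed

lemma cl_eqD:
  assumes f: "f \<in> Z n" and eq: "cl n f = cl n g"
  obtains b where "b \<in> B n" "\<And>x. x \<in> carrier (P n) \<Longrightarrow> f x = g x + b x"
proof -
  have "(\<lambda>x\<in>carrier (P n). f x + (\<lambda>x\<in>carrier (P n). 0) x) \<in> cl n f" unfolding ext_class_def trivial_simps using B_0 by blast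
  moreover have "(\<lambda>x\<in>carrier (P n). f x + (\<lambda>x\<in>carrier (P n). 0) x) = f"
    using Z_ext[OF f] by (auto simp: extensional_def fun_eq_iff)
  ultimately have "f \<in> cl n g" using eq by simp
  then obtain b where "b \<in> B n" "f = (\<lambda>x\<in>carrier (P n). g x + b x)" by (auto simp: ext_class_def trivial_simps)
  then show ?thesis using that[of b] by auto
qed

lemma cl_self: "f \<in> Z n \<Longrightarrow> f \<in> cl n f"
proof -
  assume f: "f \<in> Z n"
  have "f = (\<lambda>x\<in>carrier (P n). f x + (\<lambda>x\<in>carrier (P n). 0) x)"
    using Z_ext[OF f] by (auto simp: extensional_def fun_eq_iff)
  then show ?thesis unfolding ext_class_def trivial_simps using B_0 by blast
qed

lemma cl_mem:
  assumes f: "f \<in> Z n" and f': "f' \<in> cl n f"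
  obtains b where "b \<in> B n" "f' \<in> Z n" "\<And>x. x \<in> carrier (P n) \<Longrightarrow> f' x = f x + b x"
proof -
  obtain b where b: "b \<in> B n" "f' = (\<lambda>x\<in>carrier (P n). f x + b x)" using f' by (auto simp: ext_class_def trivial_simps)
  show ?thesis by (rule that[OF b(1)]) (use b Z_closed(1)[OF f B_Z[OF b(1)]] in auto)
qed

text \<open>Operations on classes are unions over all representatives. All members of such a union
  coincide, and this extracts the common value.\<close>

lemma UN_constant: "(\<And>x. x \<in> A \<Longrightarrow> C x = D) \<Longrightarrow> A \<noteq> {} \<Longrightarrow> (\<Union>x\<in>A. C x) = D"
  by auto

lemma E_simps:
  "carrier (E n) = cl n ` Z n" "zero (E n) = cl n (\<lambda>x\<in>carrier (P n). 0)"
  by (simp_all add: ext_component_def trivial_simps)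

lemma E_add: assumes f: "f \<in> Z n" and g: "g \<in> Z n" shows "cl n f \<oplus>\<^bsub>E n\<^esub> cl n g = cl n (fadd n f g)"
proof -
  have "cl n f \<oplus>\<^bsub>E n\<^esub> cl n g = (\<Union>f'\<in>cl n f. \<Union>g'\<in>cl n g. cl n (fadd n f' g'))"
    by (simp add: ext_component_def trivial_simps)
  also have "\<dots> = cl n (fadd n f g)"
  proof (intro UN_constant)
    fix f' g' assume f': "f' \<in> cl n f" and g': "g' \<in> cl n g"
    obtain b c where b: "b \<in> B n" "f' \<in> Z n" "\<And>x. x \<in> carrier (P n) \<Longrightarrow> f' x = f x + b x"
      and c: "c \<in> B n" "g' \<in> Z n" "\<And>x. x \<in> carrier (P n) \<Longrightarrow> g' x = g x + c x"
      using cl_mem[OF f f'] cl_mem[OF g g'] by metis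
    show "cl n (fadd n f' g') = cl n (fadd n f g)"
      by (rule cl_eqI[OF Z_closed(1)[OF b(2) c(2)] Z_closed(1)[OF f g] B_closed(1)[OF b(1) c(1)]])
        (simp add: b(3) c(3))
  qed (use cl_self[OF f] cl_self[OF g] in auto)
  finally show ?thesis .
qed

lemma E_smult: assumes f: "f \<in> Z n" shows "c \<odot>\<^bsub>E n\<^esub> cl n f = cl n (fscale n c f)"
proof -
  have "c \<odot>\<^bsub>E n\<^esub> cl n f = (\<Union>f'\<in>cl n f. cl n (fscale n c f'))"
    by (simp add: ext_component_def trivial_simps scalar)
  also have "\<dots> = cl n (fscale n c f)"
  proof (intro UN_constant)
    fix f' assume f': "f' \<in> cl n f"
    obtain b where b: "b \<in> B n" "f' \<in> Z n" "\<And>x. x \<in> carrier (P n) \<Longrightarrow> f' x = f x + b x"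
      using cl_mem[OF f f'] by metis
    show "cl n (fscale n c f') = cl n (fscale n c f)"
      by (rule cl_eqI[OF Z_closed(2)[OF b(2)] Z_closed(2)[OF f] B_closed(2)[OF b(1), of c]])
        (simp add: b(3) algebra_simps)
  qed (use cl_self[OF f] in auto)
  finally show ?thesis .
qed

lemma E_abelian_monoid: "abelian_monoid (E n)"
proof (rule abelian_monoidI)
  show "\<zero>\<^bsub>E n\<^esub> \<in> carrier (E n)" using Z_closed(3) by (auto simp: E_simps)
  fix X Y W assume "X \<in> carrier (E n)" "Y \<in> carrier (E n)" "W \<in> carrier (E n)"
  then obtain f g h where f: "f \<in> Z n" "X = cl n f" and g: "g \<in> Z n" "Y = cl n g" and h: "h \<in> Z n" "W = cl n h"
    by (auto simp: E_simps)
  show "X \<oplus>\<^bsub>E n\<^esub> Y \<in> carrier (E n)" unfolding f g E_add[OF f(1) g(1)] using Z_closed(1)[OF f(1) g(1)] by (auto simp: E_simps)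
  have "fadd n (fadd n f g) h = fadd n f (fadd n g h)" by (auto simp: add.assoc)
  then show "X \<oplus>\<^bsub>E n\<^esub> Y \<oplus>\<^bsub>E n\<^esub> W = X \<oplus>\<^bsub>E n\<^esub> (Y \<oplus>\<^bsub>E n\<^esub> W)"
    unfolding f g h by (simp only: E_add f(1) g(1) h(1) Z_closed)
  have "fadd n f g = fadd n g f" by (auto simp: add.commute)
  then show "X \<oplus>\<^bsub>E n\<^esub> Y = Y \<oplus>\<^bsub>E n\<^esub> X" unfolding f g by (simp only: E_add f(1) g(1) Z_closed)
next
  fix X assume "X \<in> carrier (E n)"
  then obtain f where f: "f \<in> Z n" "X = cl n f" by (auto simp: E_simps)
  have "fadd n (\<lambda>x\<in>carrier (P n). 0) f = f" using Z_ext[OF f(1)] by (auto simp: extensional_def fun_eq_iff)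
  then show "\<zero>\<^bsub>E n\<^esub> \<oplus>\<^bsub>E n\<^esub> X = X" unfolding f E_simps by (simp only: E_add f(1) Z_closed)
qed

text \<open>Each component of a product in the Ext algebra is a \<open>finsum\<close> of classes;
  this supplies a representative for it.\<close>

lemma E_finsum:
  assumes "finite A" "\<And>i. i \<in> A \<Longrightarrow> f i \<in> Z n"
  shows "(\<lambda>x\<in>carrier (P n). \<Sum>i\<in>A. f i x) \<in> Z n \<and>
    (\<Oplus>\<^bsub>E n\<^esub>i\<in>A. cl n (f i)) = cl n (\<lambda>x\<in>carrier (P n). \<Sum>i\<in>A. f i x)"
  using assms
proof (induction A rule: finite_induct)
  case empty
  interpret abelian_monoid "E n" by (rule E_abelian_monoid)
  show ?case using Z_closed(3)[of n] by (simp only: sum.empty finsum_empty E_simps simp_thms)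
next
  case (insert a A)
  interpret abelian_monoid "E n" by (rule E_abelian_monoid)
  have fa: "f a \<in> Z n" and fA: "\<And>i. i \<in> A \<Longrightarrow> f i \<in> Z n" using insert.prems by blast+
  have IH0: "(\<lambda>x\<in>carrier (P n). \<Sum>i\<in>A. f i x) \<in> Z n \<and>
      (\<Oplus>\<^bsub>E n\<^esub>i\<in>A. cl n (f i)) = cl n (\<lambda>x\<in>carrier (P n). \<Sum>i\<in>A. f i x)"
    by (rule insert.IH) (rule fA)
  note IH = conjunct1[OF IH0] conjunct2[OF IH0]
  have eq: "(\<lambda>x\<in>carrier (P n). \<Sum>i\<in>insert a A. f i x) = fadd n (f a) (\<lambda>x\<in>carrier (P n). \<Sum>i\<in>A. f i x)"
    using insert.hyps by auto
  have fs: "(\<Oplus>\<^bsub>E n\<^esub>i\<in>insert a A. cl n (f i)) = cl n (f a) \<oplus>\<^bsub>E n\<^esub> (\<Oplus>\<^bsub>E n\<^esub>i\<in>A. cl n (f i))"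
    by (rule finsum_insert) (use insert.hyps fA fa in \<open>auto simp: E_simps\<close>)
  have s1: "cl n (f a) \<oplus>\<^bsub>E n\<^esub> (\<Oplus>\<^bsub>E n\<^esub>i\<in>A. cl n (f i)) = cl n (fadd n (f a) (\<lambda>x\<in>carrier (P n). \<Sum>i\<in>A. f i x))"
    by (subst IH(2)) (rule E_add[OF fa IH(1)])
  show ?case unfolding eq
  proof (rule conjI)
    show "fadd n (f a) (\<lambda>x\<in>carrier (P n). \<Sum>i\<in>A. f i x) \<in> Z n" by (rule Z_closed(1)[OF fa IH(1)])
  qed (rule trans[OF fs s1])
qed

lemma cocycle_compose:
  assumes f: "f \<in> Z m" and F: "F \<in> chain_lifts R P d e n g"
  shows "compose (carrier (P (n + m))) f (F m) \<in> Z (n + m)"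
proof -
  have Fh: "F i \<in> left_hom R (P (n + i)) (P i)" and Fc: "\<And>x. x \<in> carrier (P (n + Suc i)) \<Longrightarrow> d i (F (Suc i) x) = F i (d (n + i) x)" for i
    using F by (auto simp: chain_lifts_def)
  have "f (F m (d (n + m) x)) = 0" if x: "x \<in> carrier (P (Suc (n + m)))" for x
  proof -
    have "F (Suc m) x \<in> carrier (P (Suc m))" using left_homD(1)[OF Fh, of x "Suc m"] x by simp
    then have "f (d m (F (Suc m) x)) = 0" using f by (simp add: cocycles_def trivial_simps)
    then show ?thesis using Fc[of x m] x by simp
  qed
  then show ?thesis using left_hom_compose[OF res(2) Fh Z_hom[OF f]] d_closed
    by (auto simp: cocycles_def trivial_simps compose_def)
qed

text \<open>Lifts of two cohomologous cocycles differ by a lift of a coboundary, which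
  \<open>lift_of_coboundary\<close> disposes of, and a change of f by a coboundary composes to a
  coboundary. So a single lift computes the product.\<close>

lemma yoneda_cl:
  assumes f: "f \<in> Z m" and g: "g \<in> Z n" and F: "F \<in> chain_lifts R P d e n g"
  shows "yoneda R T P d e m n (cl m f) (cl n g) = cl (n + m) (compose (carrier (P (n + m))) f (F m))"
proof -
  have hom: "F i \<in> left_hom R (P (n + i)) (P i)" and ch: "\<And>x. x \<in> carrier (P (n + Suc i)) \<Longrightarrow> d i (F (Suc i) x) = F i (d (n + i) x)"
    and e0: "\<And>x. x \<in> carrier (P n) \<Longrightarrow> e (F 0 x) = g x" if "F \<in> chain_lifts R P d e n g" for F i g
    using that by (auto simp: chain_lifts_def)
  have key: "cl (n + m) (compose (carrier (P (n + m))) f' (F' m)) = cl (n + m) (compose (carrier (P (n + m))) f (F m))"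
    if f': "f' \<in> cl m f" and g': "g' \<in> cl n g" and F': "F' \<in> chain_lifts R P d e n g'" for f' g' F'
  proof -
    obtain b where b: "b \<in> B m" "f' \<in> Z m" "\<And>x. x \<in> carrier (P m) \<Longrightarrow> f' x = f x + b x"
      using cl_mem[OF f f'] by metis
    obtain c where c: "c \<in> B n" "g' \<in> Z n" "\<And>x. x \<in> carrier (P n) \<Longrightarrow> g' x = g x + c x"
      using cl_mem[OF g g'] by metis
    note h = hom[OF F] and h' = hom[OF F']
    have 1: "compose (carrier (P (n + m))) b (F' m) \<in> B (n + m)"
    proof (cases m)
      case 0
      have "compose (carrier (P (n + m))) b (F' m) = (\<lambda>x\<in>carrier (P (n + m)). 0)"
        using b(1) 0 left_homD(1)[OF h', of _ 0] by (auto simp: compose_def trivial_simps)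
      then show ?thesis using B_0 by simp
    next
      case (Suc m')
      obtain a where a: "a \<in> left_hom R (P m') T" "b = compose (carrier (P (Suc m'))) a (d m')" using b(1) Suc by auto
      have dc: "d (n + m') x \<in> carrier (P (n + m'))" if "x \<in> carrier (P (n + Suc m'))" for x
        using d_closed that by simp
      have "compose (carrier (P (n + m))) b (F' m) = compose (carrier (P (Suc (n + m')))) (compose (carrier (P (n + m'))) a (F' m')) (d (n + m'))"
        using left_homD(1)[OF h', of _ m] Suc ch[OF F', of _ m'] dc unfolding a(2) by (auto simp: compose_def)
      then show ?thesis using left_hom_compose[OF res(2) h' a(1)] Suc by auto
    qed
    define G where "G i = (\<lambda>x\<in>carrier (P (n + i)). F' i x \<ominus>\<^bsub>P i\<^esub> F i x)" for i
    have Gh: "G i \<in> left_hom R (P (n + i)) (P i)" for i unfolding G_def by (rule left_hom_minus[OF res(2) res(2) h' h])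
    have Gc: "d i (G (Suc i) x) = G i (d (n + i) x)" if x: "x \<in> carrier (P (n + Suc i))" for i x
      using left_hom_diff[OF res(2) res(2) res(3)[of i] left_homD(1)[OF h' x] left_homD(1)[OF h x]]
        ch[OF F' x] ch[OF F x] x d_closed[of x "n + i"] by (simp add: G_def)
    have "(\<lambda>x\<in>carrier (P n). e (G 0 x)) = c"
    proof
      fix x show "(\<lambda>x\<in>carrier (P n). e (G 0 x)) x = c x"
      proof (cases "x \<in> carrier (P n)")
        case True
        then have x: "x \<in> carrier (P (n + 0))" by simp
        interpret T: left_module R T by (rule trivial)
        have "e (F' 0 x \<ominus>\<^bsub>P 0\<^esub> F 0 x) = e (F' 0 x) \<ominus>\<^bsub>T\<^esub> e (F 0 x)"
          by (rule left_hom_diff[OF res(2) trivial res(4) left_homD(1)[OF h' x] left_homD(1)[OF h x]])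
        also have "\<dots> = c x"
        proof -
          have "(e (F' 0 x) \<ominus>\<^bsub>T\<^esub> e (F 0 x)) \<oplus>\<^bsub>T\<^esub> e (F 0 x) = e (F' 0 x)"
            by (simp add: a_minus_def T.M.a_assoc T.M.l_neg trivial_simps(1))
          then have "(e (F' 0 x) \<ominus>\<^bsub>T\<^esub> e (F 0 x)) + g x = g' x" using e0[OF F' True] e0[OF F True] by (simp add: trivial_simps)
          then show ?thesis using c(3)[OF True] by (metis add.commute add_left_cancel)
        qed
        finally show ?thesis using True by (simp add: G_def)
      next
        case False
        then show ?thesis using Z_ext[OF B_Z[OF c(1)]] by (simp add: extensional_def)
      qed
    qed
    then have 2: "compose (carrier (P (n + m))) f (G m) \<in> B (n + m)"
      using lift_of_coboundary[OF trivial resolution Gh Gc _ f] c(1) by simp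
    show ?thesis
    proof (rule cl_eqI[OF cocycle_compose[OF b(2) F'] cocycle_compose[OF f F] B_closed(1)[OF 1 2]])
      fix x assume x: "x \<in> carrier (P (n + m))"
      interpret Pm: left_module R "P m" by (rule res(2))
      have y: "F' m x \<in> carrier (P m)" "F m x \<in> carrier (P m)" "G m x \<in> carrier (P m)"
        using left_homD(1)[OF h' x] left_homD(1)[OF h x] left_homD(1)[OF Gh x] by auto
      have "F' m x = G m x \<oplus>\<^bsub>P m\<^esub> F m x"
        using x y by (simp add: G_def a_minus_def Pm.M.a_assoc Pm.M.l_neg)
      then have "f (F' m x) = f (G m x) + f (F m x)"
        using left_homD(3)[OF Z_hom[OF f] y(3,2)] by (simp add: trivial_simps)
      then show "compose (carrier (P (n + m))) f' (F' m) x = compose (carrier (P (n + m))) f (F m) x +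
          fadd (n + m) (compose (carrier (P (n + m))) b (F' m)) (compose (carrier (P (n + m))) f (G m)) x"
        using x b(3)[OF y(1)] by (simp add: compose_def)
    qed
  qed
  show ?thesis unfolding yoneda_def
  proof (intro equalityI subsetI)
    fix u assume "u \<in> (\<Union>f\<in>cl m f. \<Union>g\<in>cl n g. \<Union>F\<in>chain_lifts R P d e n g. cl (n + m) (compose (carrier (P (n + m))) f (F m)))"
    then show "u \<in> cl (n + m) (compose (carrier (P (n + m))) f (F m))" using key by blast
  next
    fix u assume "u \<in> cl (n + m) (compose (carrier (P (n + m))) f (F m))"
    then show "u \<in> (\<Union>f\<in>cl m f. \<Union>g\<in>cl n g. \<Union>F\<in>chain_lifts R P d e n g. cl (n + m) (compose (carrier (P (n + m))) f (F m)))"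
      using cl_self[OF f] cl_self[OF g] F by blast
  qed
qed

end

section \<open>Free algebras acting on vector spaces\<close>

fun letters :: "'g word \<Rightarrow> 'g list" where "letters (Word l) = l"

lemma letters_add: "letters (u + v) = letters u @ letters v" "letters 0 = []"
  by (cases u; cases v; simp add: plus_word_def zero_word_def)+

lemma free_algebra_induct [case_names zero add single]:
  assumes "P 0" "\<And>p q. P p \<Longrightarrow> P q \<Longrightarrow> P (p + q)" "\<And>w c. P (Poly_Mapping.single w c)"
  shows "P (p :: 'a \<Rightarrow>\<^sub>0 'b::comm_monoid_add)"
proof -
  have "p = (\<Sum>w\<in>Poly_Mapping.keys p. Poly_Mapping.single w (Poly_Mapping.lookup p w))"
    by (rule poly_mapping_eqI) (simp add: lookup_sum lookup_single when_def in_keys_iff)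
  moreover have "P (\<Sum>w\<in>S. Poly_Mapping.single w (Poly_Mapping.lookup p w))" if "finite S" for S
    using that by (induction S) (use assms in auto)
  ultimately show ?thesis by (metis finite_keys)
qed

lemma single_Word: "Poly_Mapping.single (Word (g # l)) c = gen g * Poly_Mapping.single (Word l) (c :: 'k::comm_ring_1)"
  "Poly_Mapping.single (Word []) c = scal c"
  by (simp_all add: gen_def scal_def mult_single plus_word_def zero_word_def)

lemma free_algebra_left_induct [case_names scal add gen]:
  assumes "\<And>c. P (scal c)" "\<And>p q. P p \<Longrightarrow> P q \<Longrightarrow> P (p + q)" "\<And>g p. P p \<Longrightarrow> P (gen g * p)"
  shows "P (p :: 'g word \<Rightarrow>\<^sub>0 'k::comm_ring_1)"
proof (induction p rule: free_algebra_induct)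
  case zero
  show ?case using assms(1)[of 0] by (simp add: scal_def)
next
  case (single w c)
  obtain l where w: "w = Word l" by (cases w)
  show ?case unfolding w by (induction l) (use assms in \<open>simp_all add: single_Word\<close>)
qed (rule assms(2))

lemma scal_simps: "scal (a + b) = scal a + scal b" "scal (a * b) = scal a * scal b" "scal 1 = 1" "scal 0 = 0"
  "scal (- a) = - scal a"
  by (simp_all add: scal_def single_add mult_single single_uminus)

lemma scal_central: "scal c * (p :: 'g word \<Rightarrow>\<^sub>0 'k::comm_ring_1) = p * scal c"
  by (induction p rule: free_algebra_induct)
    (simp_all add: scal_def mult_single distrib_left distrib_right mult.commute)

locale word_action = Modules.module scale for scale :: "'k::comm_ring_1 \<Rightarrow> 'v::ab_group_add \<Rightarrow> 'v" +
  fixes opr :: "'g \<Rightarrow> 'v \<Rightarrow> 'v"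
  assumes opr_add: "opr g (u + v) = opr g u + opr g v" and opr_scale: "opr g (scale c v) = scale c (opr g v)"
begin

text \<open>\<open>foldr\<close> lets the last letter act first, so that words act from the left.
  This is also the order of composition in the Yoneda product.\<close>

definition act :: "('g word \<Rightarrow>\<^sub>0 'k) \<Rightarrow> 'v \<Rightarrow> 'v" where
  "act p v = (\<Sum>w\<in>Poly_Mapping.keys p. scale (Poly_Mapping.lookup p w) (foldr opr (letters w) v))"

lemma act_superset:
  assumes "finite S" "Poly_Mapping.keys p \<subseteq> S"
  shows "act p v = (\<Sum>w\<in>S. scale (Poly_Mapping.lookup p w) (foldr opr (letters w) v))"
  unfolding act_def by (rule sum.mono_neutral_left) (use assms in \<open>auto simp: in_keys_iff\<close>)

lemma act_add: "act (p + q) v = act p v + act q v"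
proof -
  let ?S = "Poly_Mapping.keys p \<union> Poly_Mapping.keys q"
  have "Poly_Mapping.keys (p + q) \<subseteq> ?S" by (rule keys_add)
  then show ?thesis
    using act_superset[of ?S p v] act_superset[of ?S q v] act_superset[of ?S "p + q" v]
    by (simp add: lookup_add scale_left_distrib sum.distrib)
qed

lemma act_single: "act (Poly_Mapping.single w c) v = scale c (foldr opr (letters w) v)"
  by (cases "c = 0") (simp_all add: act_def)

lemma foldr_linear: "foldr opr l (u + v) = foldr opr l u + foldr opr l v" "foldr opr l (scale c v) = scale c (foldr opr l v)"
  by (induction l) (simp_all add: opr_add opr_scale)

lemma act_linear: "act p (u + v) = act p u + act p v" "act p (scale c v) = scale c (act p v)"
  by (simp_all add: act_def foldr_linear scale_right_distrib sum.distrib scale_sum_right mult.commute)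

lemma act_zero [simp]: "act 0 v = 0" "act p 0 = 0"
  using act_linear(2)[of p 0 0] by (simp_all add: act_def)

lemma act_mult: "act (p * q) v = act p (act q v)"
proof (induction p rule: free_algebra_induct)
  case (single w c)
  show ?case
  proof (induction q rule: free_algebra_induct)
    case (single u b)
    then show ?case by (simp add: mult_single act_single letters_add foldr_linear)
  qed (simp_all add: distrib_left act_add act_linear)
qed (simp_all add: distrib_right act_add)

lemma act_gen [simp]: "act (gen g) v = opr g v" and act_scal [simp]: "act (scal c) v = scale c v" and act_one [simp]: "act 1 v = v"
  using act_single[of 0 1 v] by (simp_all add: gen_def scal_def act_single letters_add)

lemma act_minus: "act (- p) v = - act p v"
proof -
  have "act (- p) v + act p v = 0" by (simp add: act_add[symmetric])
  then show ?thesis by (rule eq_neg_iff_add_eq_0[THEN iffD2])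
qed

lemma act_diff: "act (p - q) v = act p v - act q v"
  using act_add[of p "- q" v] by (simp add: act_minus)

lemma act_invariant:
  assumes "v \<in> S" "0 \<in> S" "\<And>u w. u \<in> S \<Longrightarrow> w \<in> S \<Longrightarrow> u + w \<in> S" "\<And>c u. u \<in> S \<Longrightarrow> scale c u \<in> S" "\<And>g u. u \<in> S \<Longrightarrow> opr g u \<in> S"
  shows "act p v \<in> S"
  using assms(1)
proof (induction p rule: free_algebra_left_induct)
  case (gen g p) then show ?case using assms by (simp add: act_mult)
qed (use assms in \<open>simp_all add: act_add\<close>)

end

section \<open>Cosets of the ideal of relations\<close>

abbreviation relation_ideal :: "('g word \<Rightarrow>\<^sub>0 'k::comm_ring_1) set \<Rightarrow> ('g word \<Rightarrow>\<^sub>0 'k) set" where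
  "relation_ideal rels \<equiv> genideal free_algebra rels"

definition pclass :: "('g word \<Rightarrow>\<^sub>0 'k::comm_ring_1) set \<Rightarrow> ('g word \<Rightarrow>\<^sub>0 'k) \<Rightarrow> ('g word \<Rightarrow>\<^sub>0 'k) set" where
  "pclass rels p = relation_ideal rels +>\<^bsub>free_algebra\<^esub> p"

lemma free_algebra_simps [simp]: "carrier free_algebra = UNIV" "x \<otimes>\<^bsub>free_algebra\<^esub> y = x * y" "\<one>\<^bsub>free_algebra\<^esub> = 1"
  "\<zero>\<^bsub>free_algebra\<^esub> = 0" "x \<oplus>\<^bsub>free_algebra\<^esub> y = x + y"
  by (simp_all add: free_algebra_def)

lemma free_algebra_a_inv: "\<ominus>\<^bsub>free_algebra\<^esub> p = - (p :: 'g word \<Rightarrow>\<^sub>0 'k::comm_ring_1)"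
proof -
  interpret F: ring "free_algebra :: ('g word \<Rightarrow>\<^sub>0 'k) ring" by (rule ring_free_algebra)
  show ?thesis by (rule F.minus_equality) simp_all
qed

lemma relation_ideal_closed:
  fixes rels :: "('g word \<Rightarrow>\<^sub>0 'k::comm_ring_1) set"
  shows "0 \<in> relation_ideal rels" "p \<in> relation_ideal rels \<Longrightarrow> r \<in> relation_ideal rels \<Longrightarrow> p + r \<in> relation_ideal rels"
    "p \<in> relation_ideal rels \<Longrightarrow> - p \<in> relation_ideal rels"
    "p \<in> relation_ideal rels \<Longrightarrow> f * p \<in> relation_ideal rels" "p \<in> relation_ideal rels \<Longrightarrow> p * f \<in> relation_ideal rels"
    "p \<in> rels \<Longrightarrow> p \<in> relation_ideal rels"
proof -
  interpret F: ring "free_algebra :: ('g word \<Rightarrow>\<^sub>0 'k) ring" by (rule ring_free_algebra)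
  interpret I: ideal "relation_ideal rels" free_algebra by (rule ideal_relations)
  show "0 \<in> relation_ideal rels" using I.zero_closed by simp
  show "p + r \<in> relation_ideal rels" if "p \<in> relation_ideal rels" "r \<in> relation_ideal rels"
    using I.a_closed[OF that] by simp
  show "- p \<in> relation_ideal rels" if "p \<in> relation_ideal rels" using I.a_inv_closed[OF that] by (simp add: free_algebra_a_inv)
  show "f * p \<in> relation_ideal rels" if "p \<in> relation_ideal rels" using I.I_l_closed[OF that, of f] by simp
  show "p * f \<in> relation_ideal rels" if "p \<in> relation_ideal rels" using I.I_r_closed[OF that, of f] by simp
  show "p \<in> relation_ideal rels" if "p \<in> rels" using F.genideal_self[of rels] that by auto
qed

lemma relation_ideal_minimal:
  fixes J :: "('g word \<Rightarrow>\<^sub>0 'k::comm_ring_1) set"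
  assumes "rels \<subseteq> J" "0 \<in> J" "\<And>p r. p \<in> J \<Longrightarrow> r \<in> J \<Longrightarrow> p + r \<in> J" "\<And>p. p \<in> J \<Longrightarrow> - p \<in> J"
    "\<And>f p. p \<in> J \<Longrightarrow> f * p \<in> J" "\<And>f p. p \<in> J \<Longrightarrow> p * f \<in> J"
  shows "relation_ideal rels \<subseteq> J"
proof -
  interpret F: ring "free_algebra :: ('g word \<Rightarrow>\<^sub>0 'k) ring" by (rule ring_free_algebra)
  have "ideal J free_algebra"
  proof (rule idealI[OF ring_free_algebra])
    show "subgroup J (add_monoid free_algebra)"
    proof (rule group.subgroupI[OF F.add.is_group])
      show "inv\<^bsub>add_monoid free_algebra\<^esub> p \<in> J" if "p \<in> J" for p
        using assms(4)[OF that] free_algebra_a_inv[of p] unfolding a_inv_def by simp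
    qed (use assms in auto)
  qed (use assms in auto)
  then show ?thesis by (rule F.genideal_minimal) (rule assms(1))
qed

lemma mem_pclass: "x \<in> pclass rels p \<longleftrightarrow> x - p \<in> relation_ideal rels"
proof -
  have "x \<in> pclass rels p \<longleftrightarrow> (\<exists>i\<in>relation_ideal rels. x = i + p)"
    by (auto simp: pclass_def a_r_coset_def')
  also have "\<dots> \<longleftrightarrow> x - p \<in> relation_ideal rels" by (metis add_diff_cancel_right' diff_add_cancel)
  finally show ?thesis .
qed

lemma pclass_eq_iff: "pclass rels p = pclass rels r \<longleftrightarrow> p - r \<in> relation_ideal rels"
proof
  assume "pclass rels p = pclass rels r"
  then have "p \<in> pclass rels r" using mem_pclass[of p rels p] relation_ideal_closed(1)[of rels] by simp
  then show "p - r \<in> relation_ideal rels" by (simp add: mem_pclass)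
next
  assume a: "p - r \<in> relation_ideal rels"
  have "x - p \<in> relation_ideal rels \<longleftrightarrow> x - r \<in> relation_ideal rels" for x
    using relation_ideal_closed(2)[OF _ a, of "x - p"] relation_ideal_closed(2)[OF _ relation_ideal_closed(3)[OF a], of "x - r"] by auto
  then show "pclass rels p = pclass rels r" by (auto simp: mem_pclass)
qed

lemma presented_algebra_pclass:
  fixes rels :: "('g word \<Rightarrow>\<^sub>0 'k::comm_ring_1) set"
  shows "carrier (presented_algebra rels) = range (pclass rels)"
    "pclass rels p \<otimes>\<^bsub>presented_algebra rels\<^esub> pclass rels r = pclass rels (p * r)"
    "pclass rels p \<oplus>\<^bsub>presented_algebra rels\<^esub> pclass rels r = pclass rels (p + r)"
    "\<one>\<^bsub>presented_algebra rels\<^esub> = pclass rels 1" "\<zero>\<^bsub>presented_algebra rels\<^esub> = pclass rels 0"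
    "c \<odot>\<^bsub>presented_algebra rels\<^esub> pclass rels p = pclass rels (scal c * p)" "pgen rels g = pclass rels (gen g)"
proof -
  interpret F: ring "free_algebra :: ('g word \<Rightarrow>\<^sub>0 'k) ring" by (rule ring_free_algebra)
  interpret I: ideal "relation_ideal rels" free_algebra by (rule ideal_relations)
  show "carrier (presented_algebra rels) = range (pclass rels)"
    by (auto simp: presented_algebra_simps FactRing_def A_RCOSETS_def' pclass_def)
  show "pclass rels p \<otimes>\<^bsub>presented_algebra rels\<^esub> pclass rels r = pclass rels (p * r)"
    using I.rcoset_mult_add[of p r] by (simp add: presented_algebra_simps FactRing_def pclass_def)
  show "pclass rels p \<oplus>\<^bsub>presented_algebra rels\<^esub> pclass rels r = pclass rels (p + r)"
    using I.a_rcos_sum[of p r] by (simp add: presented_algebra_simps FactRing_def pclass_def)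
  show "\<one>\<^bsub>presented_algebra rels\<^esub> = pclass rels 1" by (simp add: presented_algebra_simps FactRing_def pclass_def)
  show "\<zero>\<^bsub>presented_algebra rels\<^esub> = pclass rels 0"
    by (auto simp: presented_algebra_simps FactRing_def mem_pclass)
  show "c \<odot>\<^bsub>presented_algebra rels\<^esub> pclass rels p = pclass rels (scal c * p)"
    using I.rcoset_mult_add[of "scal c" p] by (simp add: presented_algebra_def Let_def FactRing_def pclass_def)
  show "pgen rels g = pclass rels (gen g)" by (simp add: pgen_def pclass_def)
qed

section \<open>The PBW basis of the Nichols algebra\<close>

fun tn :: "tri \<Rightarrow> nat" where "tn T0 = 0" | "tn T1 = 1" | "tn T2 = 2"

text \<open>The exponents are natural numbers, and the vector is zero as soon as one of them is at
  least 3; thus the rules that raise exponents need no bounds on the results.\<close>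

definition dl :: "nat \<Rightarrow> nat \<Rightarrow> nat \<Rightarrow> 'k::comm_ring_1 vec" where
  "dl a c b = (\<lambda>a' c' b'. if tn a' = a \<and> tn c' = c \<and> tn b' = b then 1 else 0)"

definition tris :: "tri set" where "tris = {T0, T1, T2}"

lemma vec_expand: "v = (\<Sum>a\<in>tris. \<Sum>c\<in>tris. \<Sum>b\<in>tris. sv (v a c b) (dl (tn a) (tn c) (tn b)))"
proof (intro ext)
  fix a c b
  show "v a c b = (\<Sum>a\<in>tris. \<Sum>c\<in>tris. \<Sum>b\<in>tris. sv (v a c b) (dl (tn a) (tn c) (tn b))) a c b"
    by (cases a; cases c; cases b) (simp_all add: tris_def sv_def dl_def)
qed

context a2_twist begin

lemma sc_module: "Modules.module (sc :: 'k \<Rightarrow> 'k chn \<Rightarrow> 'k chn)"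
  by standard (rule chn_eqI, rule vec_eqI, simp add: sc_def algebra_simps)+

primrec nop :: "nichols_gen \<Rightarrow> 'k chn \<Rightarrow> 'k chn" where "nop X1 = A1" | "nop X2 = A2"

text \<open>Two actions on the same chains: \<open>N\<close> gives the module structure over the
  Nichols algebra, \<open>L\<close> the chain maps of the Ext generators. They commute.\<close>

sublocale N: word_action "sc :: 'k \<Rightarrow> 'k chn \<Rightarrow> 'k chn" nop
proof (intro word_action.intro sc_module word_action_axioms.intro)
  fix g and u v :: "'k chn" and c
  show "nop g (u + v) = nop g u + nop g v" "nop g (sc c v) = sc c (nop g v)"
    by (cases g; simp add: op_linear)+
qed

sublocale L: word_action "sc :: 'k \<Rightarrow> 'k chn \<Rightarrow> 'k chn" lop
  by (intro word_action.intro sc_module word_action_axioms.intro lop_linear)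

definition qq :: "nat \<Rightarrow> nat \<Rightarrow> 'k" where
  "qq i j = (if i = j then om else if i = 1 then om * p else om * ip)"

abbreviation nrels where "nrels \<equiv> nichols_relations 3 qq"
abbreviation NR where "NR \<equiv> nichols_algebra 3 qq"
abbreviation NI where "NI \<equiv> relation_ideal nrels"

definition ly :: "'k vec \<Rightarrow> 'k vec" where
  "ly v = (\<lambda>a c b. pw (om * om) a * dn (\<lambda>c. v a c b) c)"

lemma left_mult_rules:
  "lx1 (lx2 v) = ly v + sv om (lx2 (lx1 v))" "lx1 (ly v) = sv (om * om) (ly (lx1 v))"
  "ly (lx2 v) = sv (om * om) (lx2 (ly v))" "lx1 (lx1 (lx1 v)) = 0" "ly (ly (ly v)) = 0" "lx2 (lx2 (lx2 v)) = 0"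
  "tw2 x (ly v) = sv x (ly (tw2 x v))" "ly (sv x v) = sv x (ly v)" "ly (v + w) = ly v + ly w" "ly 0 = 0"
  by (rule vec_eqI; simp add: vec_defs ly_def dn_def pw_def om2 om3 algebra_simps split: tri.splits)+

definition gy :: "nichols_gen word \<Rightarrow>\<^sub>0 'k" where "gy = gen X1 * gen X2 - scal (om * p) * gen X2 * gen X1"

lemma nrels_eq: "nrels =
  {(gen X1)^2 * gen X2 - scal (- p) * gen X1 * gen X2 * gen X1 + scal (p * p) * gen X2 * (gen X1)^2,
   (gen X2)^2 * gen X1 - scal (- ip) * gen X2 * gen X1 * gen X2 + scal (ip * ip) * gen X1 * (gen X2)^2,
   (gen X1)^3, (gen X2)^3, gy^3}"
proof -
  have 1: "om * p + om * p * om = - p" "(om * p)\<^sup>2 * om = p * p" "om * ip + om * ip * om = - ip" "(om * ip)\<^sup>2 * om = ip * ip"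
    by (simp_all add: power2_eq_square om2 om3 algebra_simps)
  have q: "qq 1 1 = om" "qq 2 2 = om" "qq 1 2 = om * p" "qq 2 1 = om * ip"
    by (simp_all add: qq_def)
  show ?thesis unfolding nichols_relations_def Let_def q 1 gy_def ..
qed

text \<open>The factor p in q12 gives x2 x1 the same power of p as x1 x2. What remains is the
  untwisted left multiplication by y, weighted by the degree in x2.\<close>

lemma act_gy: "N.act gy f = (\<lambda>i l j. sv (p ^ (l + 3 * j)) (tw2 p (ly (f i l j))))"
proof (rule chn_eqI)
  fix i l j
  have e: "N.act gy f = A1 (A2 f) - sc (om * p) (A2 (A1 f))"
    unfolding gy_def N.act_diff N.act_mult by simp
  show "N.act gy f i l j = sv (p ^ (l + 3 * j)) (tw2 p (ly (f i l j)))"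
    unfolding e by (intro vec_eqI) (simp add: A1_def A2_def sc_def push_rules left_mult_rules algebra_simps)
qed

lemma pip: "p * ip = 1" "p * (ip * x) = x"
  using p_nz by (simp_all add: ip_def mult.assoc[symmetric])

lemma relations_act: "r \<in> nrels \<Longrightarrow> N.act r f = 0"
proof -
  assume "r \<in> nrels"
  moreover have "N.act ((gen X1)^2 * gen X2 - scal (- p) * gen X1 * gen X2 * gen X1 + scal (p * p) * gen X2 * (gen X1)^2) f = 0"
    by (rule chn_eqI, rule vec_eqI)
      (simp add: N.act_add N.act_diff N.act_mult power2_eq_square A1_def A2_def sc_def push_rules left_mult_rules om2 om3 algebra_simps)
  moreover have "N.act ((gen X2)^2 * gen X1 - scal (- ip) * gen X2 * gen X1 * gen X2 + scal (ip * ip) * gen X1 * (gen X2)^2) f = 0"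
    by (rule chn_eqI, rule vec_eqI)
      (simp add: N.act_add N.act_diff N.act_mult power2_eq_square A1_def A2_def sc_def push_rules left_mult_rules om2 om3 pip algebra_simps)
  moreover have "N.act ((gen X1)^3) f = 0" "N.act ((gen X2)^3) f = 0"
    by (rule chn_eqI; simp add: N.act_mult power3_eq_cube A1_def A2_def push_rules left_mult_rules)+
  moreover have "N.act (gy^3) f = 0"
    by (rule chn_eqI) (simp add: N.act_mult power3_eq_cube act_gy push_rules left_mult_rules)
  ultimately show "N.act r f = 0" unfolding nrels_eq by auto
qed

lemma ideal_act: "r \<in> NI \<Longrightarrow> N.act r f = 0"
proof -
  have "NI \<subseteq> {r. \<forall>f. N.act r f = 0}"
    by (rule relation_ideal_minimal) (use relations_act in \<open>auto simp: N.act_add N.act_mult N.act_minus\<close>)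
  then show "r \<in> NI \<Longrightarrow> N.act r f = 0" by blast
qed

text \<open>Any representative will do, since the ideal acts by zero.\<close>

definition ract :: "(nichols_gen word \<Rightarrow>\<^sub>0 'k) set \<Rightarrow> 'k chn \<Rightarrow> 'k chn" where
  "ract X f = N.act (SOME r. r \<in> X) f"

lemma ract_pclass: "ract (pclass nrels r) f = N.act r f"
proof -
  have "r \<in> pclass nrels r" by (simp add: mem_pclass relation_ideal_closed)
  then have "(SOME r'. r' \<in> pclass nrels r) \<in> pclass nrels r" by (rule someI)
  then show ?thesis using ideal_act[of "(SOME r'. r' \<in> pclass nrels r) - r" f]
    by (simp add: mem_pclass N.act_diff ract_def)
qed

definition QM :: "nat \<Rightarrow> ((nichols_gen word \<Rightarrow>\<^sub>0 'k) set, 'k chn) module" where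
  "QM n = \<lparr>carrier = Qc n, monoid.mult = undefined, one = undefined, zero = 0, add = (+), smult = ract\<rparr>"

lemma QM_simps [simp]: "carrier (QM n) = Qc n" "\<zero>\<^bsub>QM n\<^esub> = 0" "f \<oplus>\<^bsub>QM n\<^esub> g = f + g" "r \<odot>\<^bsub>QM n\<^esub> f = ract r f"
  by (simp_all add: QM_def)

lemmas NR_simps = presented_algebra_pclass[of nrels, folded nichols_algebra_def]

lemma act_Qc: "f \<in> Qc n \<Longrightarrow> N.act r f \<in> Qc n"
proof (rule N.act_invariant)
  fix g u assume "u \<in> Qc n" then show "nop g u \<in> Qc n" by (cases g) (simp_all add: Qc_closed)
qed (auto intro: Qc_closed)

lemma ring_NR: "ring NR" unfolding nichols_algebra_def by (rule ring_presented_algebra)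

lemma left_module_QM: "left_module NR (QM n)"
proof (intro left_module.intro left_module_axioms.intro ring_NR)
  show "abelian_group (QM n)"
  proof (rule abelian_groupI)
    fix f assume "f \<in> carrier (QM n)"
    then show "\<exists>g\<in>carrier (QM n). g \<oplus>\<^bsub>QM n\<^esub> f = \<zero>\<^bsub>QM n\<^esub>"
      by (intro bexI[of _ "- f"]) (simp_all add: Qc_closed)
  qed (simp_all add: Qc_closed add.assoc add.commute)
next
  fix X Y f g assume "X \<in> carrier NR" "Y \<in> carrier NR"
  then obtain r s where XY: "X = pclass nrels r" "Y = pclass nrels s" by (auto simp: NR_simps)
  show "(X \<oplus>\<^bsub>NR\<^esub> Y) \<odot>\<^bsub>QM n\<^esub> f = X \<odot>\<^bsub>QM n\<^esub> f \<oplus>\<^bsub>QM n\<^esub> Y \<odot>\<^bsub>QM n\<^esub> f"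
    "(X \<otimes>\<^bsub>NR\<^esub> Y) \<odot>\<^bsub>QM n\<^esub> f = X \<odot>\<^bsub>QM n\<^esub> (Y \<odot>\<^bsub>QM n\<^esub> f)"
    by (simp_all add: XY NR_simps ract_pclass N.act_add N.act_mult)
next
  fix X f g assume "X \<in> carrier NR" and f: "f \<in> carrier (QM n)"
  then obtain r where X: "X = pclass nrels r" by (auto simp: NR_simps)
  show "X \<odot>\<^bsub>QM n\<^esub> f \<in> carrier (QM n)" "X \<odot>\<^bsub>QM n\<^esub> (f \<oplus>\<^bsub>QM n\<^esub> g) = X \<odot>\<^bsub>QM n\<^esub> f \<oplus>\<^bsub>QM n\<^esub> X \<odot>\<^bsub>QM n\<^esub> g"
    using f by (simp_all add: X ract_pclass N.act_linear act_Qc)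
next
  fix f show "\<one>\<^bsub>NR\<^esub> \<odot>\<^bsub>QM n\<^esub> f = f" by (simp add: NR_simps ract_pclass)
qed

section \<open>Straightening and the spanning monomials\<close>

definition cong (infix "\<sim>" 50) where "a \<sim> b \<longleftrightarrow> a - b \<in> NI"

lemma cong_refl [simp]: "a \<sim> a" by (simp add: cong_def relation_ideal_closed)
lemma cong_sym: "a \<sim> b \<Longrightarrow> b \<sim> a" using relation_ideal_closed(3)[of "a - b" nrels] by (simp add: cong_def)
lemma cong_trans [trans]: "a \<sim> b \<Longrightarrow> b \<sim> c \<Longrightarrow> a \<sim> c"
  using relation_ideal_closed(2)[of "a - b" nrels "b - c"] by (simp add: cong_def)
lemma cong_add: "a \<sim> b \<Longrightarrow> c \<sim> d \<Longrightarrow> a + c \<sim> b + d"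
  using relation_ideal_closed(2)[of "a - b" nrels "c - d"] by (simp add: cong_def algebra_simps)
lemma cong_mult: "a \<sim> b \<Longrightarrow> c * a \<sim> c * b" "a \<sim> b \<Longrightarrow> a * c \<sim> b * c"
  using relation_ideal_closed(4,5)[of "a - b" nrels c] by (simp_all add: cong_def algebra_simps)
definition mon :: "nat \<Rightarrow> nat \<Rightarrow> nat \<Rightarrow> nichols_gen word \<Rightarrow>\<^sub>0 'k" where
  "mon a c b = gen X2 ^ a * gy ^ c * gen X1 ^ b"

lemma power_cong_0: assumes "x ^ 3 \<in> NI" "n \<ge> 3" shows "x ^ n \<sim> 0"
proof -
  obtain m where "n = 3 + m" using assms(2) le_Suc_ex by blast
  then show ?thesis using relation_ideal_closed(5)[OF assms(1), of "x ^ m"] by (simp add: cong_def power_add)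
qed

lemma cubes: "gen X1 ^ 3 \<in> NI" "gen X2 ^ 3 \<in> NI" "gy ^ 3 \<in> NI"
  by (rule relation_ideal_closed(6), simp add: nrels_eq)+

lemma mon_0: "a \<ge> 3 \<or> c \<ge> 3 \<or> b \<ge> 3 \<Longrightarrow> mon a c b \<sim> 0"
  using cong_mult(2)[OF power_cong_0[OF cubes(2), of a], of "gy ^ c * gen X1 ^ b"]
    cong_mult(1)[OF cong_mult(2)[OF power_cong_0[OF cubes(3), of c], of "gen X1 ^ b"], of "gen X2 ^ a"]
    cong_mult(1)[OF power_cong_0[OF cubes(1), of b], of "gen X2 ^ a * gy ^ c"]
  by (auto simp: mon_def mult.assoc)

lemma scal_comm: "w * (scal k * u) = scal k * (w * (u :: nichols_gen word \<Rightarrow>\<^sub>0 'k))" "scal k * (scal k' * u) = scal (k * k') * u"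
proof -
  show "w * (scal k * u) = scal k * (w * u)" by (metis mult.assoc scal_central)
  show "scal k * (scal k' * u) = scal (k * k') * u" by (simp add: scal_simps mult.assoc)
qed

lemmas scal_rules = scal_comm(1)[of "gen g" for g] scal_comm(1)[of "gen g ^ n" for g n] scal_comm(1)[of gy] scal_comm(1)[of "gy ^ n" for n]
  scal_comm(2)

lemma om_cube: "om * om * om = 1"
proof -
  have "om * om * om = om * (om * om)" by (simp only: mult.assoc)
  also have "\<dots> = - om - om * om" by (rule om3)
  finally show ?thesis by (simp add: om2)
qed

lemma coef_facts: "om * p + om * om * p = - p" "om * om * p * (om * p) = p * p" "p * p * (- ip) = - p" "p * p * (ip * ip) = 1"
proof -
  show "om * p + om * om * p = - p" by (simp add: om2 left_diff_distrib)
  have "om * om * p * (om * p) = (om * om * om) * (p * p)" by (simp only: ac_simps)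
  then show "om * om * p * (om * p) = p * p" by (simp add: om_cube)
  show "p * p * (- ip) = - p" "p * p * (ip * ip) = 1" by (simp_all add: mult.assoc pip)
qed

text \<open>With y = x z - s z x, commuting y with x or z up to the scalar t amounts to a cubic
  Serre relation with coefficients s + t and t s. For s = om p and t = om^2 p these are - p and
  p^2.\<close>

lemma central_identity:
  fixes x z s t :: "'r::ring_1"
  assumes "\<And>w. x * (s * w) = s * (x * w)" "\<And>w. z * (t * w) = t * (z * w)" "\<And>w. z * (s * w) = s * (z * w)"
  shows "x * (x * z - s * z * x) - t * (x * z - s * z * x) * x = x * x * z - (s + t) * (x * z * x) + t * s * (z * x * x)"
    "(x * z - s * z * x) * z - t * z * (x * z - s * z * x) = x * z * z - (s + t) * (z * x * z) + t * s * (z * z * x)"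
  by (simp_all add: left_diff_distrib right_diff_distrib distrib_right mult.assoc assms)

lemma x1_y: "gen X1 * gy \<sim> scal (om * om * p) * gy * gen X1"
proof -
  let ?x = "gen X1 :: nichols_gen word \<Rightarrow>\<^sub>0 'k" and ?z = "gen X2 :: nichols_gen word \<Rightarrow>\<^sub>0 'k"
  let ?S = "scal :: 'k \<Rightarrow> nichols_gen word \<Rightarrow>\<^sub>0 'k"
  have "?x * gy - ?S (om * om * p) * gy * ?x =
     ?x * ?x * ?z - (?S (om * p) + ?S (om * om * p)) * (?x * ?z * ?x) + ?S (om * om * p) * ?S (om * p) * (?z * ?x * ?x)"
    unfolding gy_def by (rule central_identity(1)) (rule scal_comm(1))+
  also have "\<dots> = ?x^2 * ?z - ?S (- p) * ?x * ?z * ?x + ?S (p * p) * ?z * ?x^2"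
    unfolding scal_simps(1)[symmetric] scal_simps(2)[symmetric] coef_facts by (simp add: power2_eq_square mult.assoc)
  finally show ?thesis unfolding cong_def using relation_ideal_closed(6)[of _ nrels] by (simp add: nrels_eq)
qed

text \<open>The difference of both sides is p^2 times the second Serre relation.\<close>

lemma y_x2: "gy * gen X2 \<sim> scal (om * om * p) * gen X2 * gy"
proof -
  let ?x = "gen X1 :: nichols_gen word \<Rightarrow>\<^sub>0 'k" and ?z = "gen X2 :: nichols_gen word \<Rightarrow>\<^sub>0 'k"
  let ?S = "scal :: 'k \<Rightarrow> nichols_gen word \<Rightarrow>\<^sub>0 'k"
  let ?r = "?z^2 * ?x - ?S (- ip) * ?z * ?x * ?z + ?S (ip * ip) * ?x * ?z^2"
  have "gy * ?z - ?S (om * om * p) * ?z * gy =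
     ?x * ?z * ?z - (?S (om * p) + ?S (om * om * p)) * (?z * ?x * ?z) + ?S (om * om * p) * ?S (om * p) * (?z * ?z * ?x)"
    unfolding gy_def by (rule central_identity(2)) (rule scal_comm(1))+
  also have "\<dots> = ?S (p * p) * (?z^2 * ?x) - ?S (p * p * (- ip)) * (?z * ?x * ?z) + ?S (p * p * (ip * ip)) * (?x * ?z^2)"
    unfolding scal_simps(1)[symmetric] scal_simps(2)[symmetric] coef_facts
    by (simp add: power2_eq_square mult.assoc scal_simps(3))
  also have "\<dots> = ?S (p * p) * ?r"
    by (simp only: distrib_left right_diff_distrib scal_simps(2) mult.assoc)
  finally show ?thesis unfolding cong_def using relation_ideal_closed(4)[OF relation_ideal_closed(6)[of ?r nrels], of "?S (p * p)"]
    by (simp add: nrels_eq)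
qed

lemma x1_yc: "gen X1 * gy ^ c \<sim> scal ((om * om * p) ^ c) * (gy ^ c * gen X1)"
proof (induction c)
  case (Suc c)
  have "gen X1 * gy ^ Suc c = (gen X1 * gy) * gy ^ c" by (simp add: mult.assoc)
  also have "\<dots> \<sim> (scal (om * om * p) * gy * gen X1) * gy ^ c" by (rule cong_mult(2)[OF x1_y])
  also have "\<dots> = (scal (om * om * p) * gy) * (gen X1 * gy ^ c)" by (simp add: mult.assoc)
  also have "\<dots> \<sim> (scal (om * om * p) * gy) * (scal ((om * om * p) ^ c) * (gy ^ c * gen X1))"
    by (rule cong_mult(1)[OF Suc])
  also have "\<dots> = scal ((om * om * p) ^ Suc c) * (gy ^ Suc c * gen X1)"
    by (simp add: scal_rules mult.assoc)
  finally show ?case .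
qed (simp add: scal_simps)

lemma x1_mon_0: "gen X1 * mon 0 c b \<sim> scal ((om * om * p) ^ c) * mon 0 c (Suc b)"
  using cong_mult(2)[OF x1_yc[of c], of "gen X1 ^ b"] by (simp add: mon_def mult.assoc)

lemma x1_mon_1: "gen X1 * mon (Suc 0) c b \<sim> mon 0 (Suc c) b + scal (om * p * (om * om * p) ^ c) * mon (Suc 0) c (Suc b)"
proof -
  have "gen X1 * mon (Suc 0) c b = mon 0 (Suc c) b + scal (om * p) * gen X2 * (gen X1 * mon 0 c b)"
    by (simp add: mon_def gy_def algebra_simps)
  also have "\<dots> \<sim> mon 0 (Suc c) b + scal (om * p) * gen X2 * (scal ((om * om * p) ^ c) * mon 0 c (Suc b))"
    by (intro cong_add cong_mult(1) x1_mon_0 cong_refl)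
  also have "\<dots> = mon 0 (Suc c) b + scal (om * p * (om * om * p) ^ c) * mon (Suc 0) c (Suc b)"
    by (simp add: scal_rules mult.assoc) (simp add: mon_def mult.assoc)
  finally show ?thesis .
qed

lemma y_mon_1: "gy * mon (Suc 0) c b \<sim> scal (om * om * p) * mon (Suc 0) (Suc c) b"
  using cong_mult(2)[OF y_x2, of "gy ^ c * gen X1 ^ b"] by (simp add: mon_def mult.assoc)

lemma x1_mon_2: "gen X1 * mon (Suc (Suc 0)) c b \<sim>
    scal (- p) * mon (Suc 0) (Suc c) b + scal (om * p * (om * p) * (om * om * p) ^ c) * mon (Suc (Suc 0)) c (Suc b)"
proof -
  have "gen X1 * mon (Suc (Suc 0)) c b = gy * mon (Suc 0) c b + scal (om * p) * gen X2 * (gen X1 * mon (Suc 0) c b)"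
    by (simp add: mon_def gy_def algebra_simps)
  also have "\<dots> \<sim> scal (om * om * p) * mon (Suc 0) (Suc c) b +
      scal (om * p) * gen X2 * (mon 0 (Suc c) b + scal (om * p * (om * om * p) ^ c) * mon (Suc 0) c (Suc b))"
    by (intro cong_add cong_mult(1) x1_mon_1 y_mon_1)
  also have "\<dots> = scal (om * om * p + om * p) * mon (Suc 0) (Suc c) b + scal (om * p * (om * p) * (om * om * p) ^ c) * mon (Suc (Suc 0)) c (Suc b)"
  proof -
    have "gen X2 * mon 0 (Suc c) b = mon (Suc 0) (Suc c) b" "gen X2 * mon (Suc 0) c (Suc b) = mon (Suc (Suc 0)) c (Suc b)"
      by (simp_all add: mon_def mult.assoc)
    then show ?thesis by (simp add: scal_rules mult.assoc distrib_left distrib_right scal_simps(1) add.assoc)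
  qed
  also have "om * om * p + om * p = - p" by (simp add: om2 algebra_simps)
  finally show ?thesis .
qed

text \<open>p^(-c(c+1)/2), the ratio between the basis vector and the monomial with y^c: the action
  of y sends the vector of y^c to p^(c+1) times that of y^(c+1).\<close>

primrec kapn :: "nat \<Rightarrow> 'k" where "kapn 0 = 1" | "kapn (Suc c) = kapn c * ip ^ Suc c"

lemma kapn_p: "p ^ Suc c * kapn (Suc c) = kapn c"
  using ip_p[of "Suc c"] by (simp add: algebra_simps del: power_Suc) 

definition nf :: "'k vec \<Rightarrow> nichols_gen word \<Rightarrow>\<^sub>0 'k" where
  "nf v = (\<Sum>a\<in>tris. \<Sum>c\<in>tris. \<Sum>b\<in>tris. scal (v a c b * kapn (tn c)) * mon (tn a) (tn c) (tn b))"

lemma nf_linear: "nf (v + w) = nf v + nf w" "nf (sv k v) = scal k * nf v" "nf 0 = 0"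
proof -
  show "nf (v + w) = nf v + nf w"
    by (simp add: nf_def distrib_right scal_simps(1) sum.distrib)
  show "nf (sv k v) = scal k * nf v"
    by (simp add: nf_def sum_distrib_left scal_rules mult.assoc)
  show "nf 0 = 0" by (simp add: nf_def scal_simps)
qed

lemma tn_surj: "n < 3 \<Longrightarrow> \<exists>t. tn t = n"
proof -
  assume "n < 3"
  then consider "n = 0" | "n = 1" | "n = 2" by linarith
  then show ?thesis by cases (auto intro: exI[of _ T0] exI[of _ T1] exI[of _ T2])
qed

lemma nf_dl: "nf (dl a c b) \<sim> scal (kapn c) * mon a c b"
proof (cases "a < 3 \<and> c < 3 \<and> b < 3")
  case True
  then obtain a' c' b' where "a = tn a'" "c = tn c'" "b = tn b'"
    using tn_surj[of a] tn_surj[of c] tn_surj[of b] by auto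
  then have "nf (dl a c b) = scal (kapn c) * mon a c b"
    by (cases a'; cases c'; cases b'; simp add: nf_def tris_def dl_def scal_simps)
  then show ?thesis by simp
next
  case False
  then have "mon a c b \<sim> 0" using mon_0[of a c b] by linarith
  then have "scal (kapn c) * mon a c b \<sim> 0" using cong_mult(1) by fastforce
  moreover have "dl a c b = (0 :: 'k vec)"
  proof (rule vec_eqI)
    fix a' c' b'
    have "tn a' < 3" "tn c' < 3" "tn b' < 3" by (cases a'; cases c'; cases b'; simp)+
    then show "dl a c b a' c' b' = (0 :: 'k vec) a' c' b'" using False by (auto simp: dl_def)
  qed
  ultimately show ?thesis using cong_sym nf_linear(3) by simp
qed

lemma dl_ops:
  "tw2 p (lx1 (dl 0 c b)) = sv ((om * om * p) ^ c) (dl 0 c (Suc b))"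
  "tw2 p (lx1 (dl (Suc 0) c b)) = sv (p ^ Suc c) (dl 0 (Suc c) b) + sv (om * p * (om * om * p) ^ c) (dl (Suc 0) c (Suc b))"
  "tw2 p (lx1 (dl (Suc (Suc 0)) c b)) = sv (- p * p ^ Suc c) (dl (Suc 0) (Suc c) b) + sv (om * p * (om * p) * (om * om * p) ^ c) (dl (Suc (Suc 0)) c (Suc b))"
  "lx2 (dl a c b) = dl (Suc a) c b"
proof -
  show "lx2 (dl a c b) = dl (Suc a) c b"
    by (rule vec_eqI) (auto simp: lx2_def dl_def dn_def split: tri.splits)
  show "tw2 p (lx1 (dl 0 c b)) = sv ((om * om * p) ^ c) (dl 0 c (Suc b))"
    "tw2 p (lx1 (dl (Suc 0) c b)) = sv (p ^ Suc c) (dl 0 (Suc c) b) + sv (om * p * (om * om * p) ^ c) (dl (Suc 0) c (Suc b))"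
    "tw2 p (lx1 (dl (Suc (Suc 0)) c b)) = sv (- p * p ^ Suc c) (dl (Suc 0) (Suc c) b) + sv (om * p * (om * p) * (om * om * p) ^ c) (dl (Suc (Suc 0)) c (Suc b))"
    by (rule vec_eqI, rename_tac x y z, case_tac x; case_tac y; case_tac z;
      auto simp: lx1_def tw2_def dl_def dn_def pw_def power2_eq_square mult_ac)+
qed

lemma nf_x2: "gen X2 * nf v \<sim> nf (lx2 v)" and nf_x1: "gen X1 * nf v \<sim> nf (tw2 p (lx1 v))"
proof -
  \<comment> \<open>The restriction a < 3 costs nothing, because the expansion of a vector uses only
    such exponents, and the straightening rules for x1 cover just these.\<close>
  have vec_induct: "P v" if "\<And>v w. P v \<Longrightarrow> P w \<Longrightarrow> P (v + w)" "\<And>k v. P v \<Longrightarrow> P (sv k v)"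
      "P 0" "\<And>a c b. a < 3 \<Longrightarrow> P (dl a c b)" for P and v :: "'k vec"
  proof -
    have s: "P (\<Sum>x\<in>S. f x)" if "finite S" "\<And>x. x \<in> S \<Longrightarrow> P (f x)" for S and f :: "tri \<Rightarrow> 'k vec"
      using that by (induction S) (use \<open>P 0\<close> \<open>\<And>v w. P v \<Longrightarrow> P w \<Longrightarrow> P (v + w)\<close> in auto)
    have "finite tris" "\<And>a. tn a < 3" by (simp add: tris_def) (case_tac a; simp)
    then show ?thesis by (subst vec_expand) (intro s that(2,4); simp)
  qed
  show "gen X2 * nf v \<sim> nf (lx2 v)"
  proof (rule vec_induct[of "\<lambda>v. gen X2 * nf v \<sim> nf (lx2 v)"])
    fix a c b :: nat assume "a < 3"
    have "gen X2 * nf (dl a c b) \<sim> gen X2 * (scal (kapn c) * mon a c b)" by (rule cong_mult(1)[OF nf_dl])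
    also have "\<dots> = scal (kapn c) * mon (Suc a) c b" by (simp add: scal_rules) (simp add: mon_def mult.assoc)
    also have "\<dots> \<sim> nf (lx2 (dl a c b))" unfolding dl_ops(4) by (rule cong_sym[OF nf_dl])
    finally show "gen X2 * nf (dl a c b) \<sim> nf (lx2 (dl a c b))" .
  next
    fix v w assume vw: "gen X2 * nf v \<sim> nf (lx2 v)" "gen X2 * nf w \<sim> nf (lx2 w)"
    show "gen X2 * nf (v + w) \<sim> nf (lx2 (v + w))"
      unfolding nf_linear left_mult_linear distrib_left by (rule cong_add[OF vw])
  next
    fix k v assume v: "gen X2 * nf v \<sim> nf (lx2 v)"
    show "gen X2 * nf (sv k v) \<sim> nf (lx2 (sv k v))"
      unfolding nf_linear left_mult_linear scal_rules by (rule cong_mult(1)[OF v])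
  qed (simp add: nf_linear left_mult_linear)
  show "gen X1 * nf v \<sim> nf (tw2 p (lx1 v))"
  proof (rule vec_induct[of "\<lambda>v. gen X1 * nf v \<sim> nf (tw2 p (lx1 v))"])
    fix a c b :: nat assume 4: "a < 3"
    have 1: "gen X1 * nf (dl a c b) \<sim> scal (kapn c) * (gen X1 * mon a c b)"
      using cong_mult(1)[OF nf_dl[of a c b], of "gen X1"] by (simp add: scal_rules)
    have n: "nf (sv k (dl a' c' b')) \<sim> scal (k * kapn c') * mon a' c' b'" for k a' c' b'
      using cong_mult(1)[OF nf_dl[of a' c' b'], of "scal k"] by (simp add: nf_linear scal_rules)
    have k: "kapn c = p ^ Suc c * kapn (Suc c)" "kapn c * - p = - p * p ^ Suc c * kapn (Suc c)"
      using kapn_p[of c] by (simp_all add: algebra_simps del: kapn.simps power_Suc)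
    have "scal (kapn c) * (gen X1 * mon a c b) \<sim> nf (tw2 p (lx1 (dl a c b)))"
    proof -
      consider "a = 0" | "a = Suc 0" | "a = Suc (Suc 0)" using 4 by linarith
      then show ?thesis
      proof cases
        case 1
        have "scal (kapn c) * (gen X1 * mon 0 c b) \<sim> scal (kapn c) * (scal ((om * om * p) ^ c) * mon 0 c (Suc b))"
          by (rule cong_mult(1)[OF x1_mon_0])
        also have "\<dots> = scal ((om * om * p) ^ c * kapn c) * mon 0 c (Suc b)" by (simp add: scal_rules mult.commute)
        also have "\<dots> \<sim> nf (tw2 p (lx1 (dl 0 c b)))" unfolding dl_ops by (rule cong_sym[OF n])
        finally show ?thesis using 1 by simp
      next
        case 2
        have "scal (kapn c) * (gen X1 * mon (Suc 0) c b) \<sim> scal (kapn c) * (mon 0 (Suc c) b + scal (om * p * (om * om * p) ^ c) * mon (Suc 0) c (Suc b))"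
          by (rule cong_mult(1)[OF x1_mon_1])
        also have "\<dots> = scal (p ^ Suc c * kapn (Suc c)) * mon 0 (Suc c) b + scal (om * p * (om * om * p) ^ c * kapn c) * mon (Suc 0) c (Suc b)"
          unfolding k(1)[symmetric] by (simp add: distrib_left scal_rules mult.commute mult.left_commute)
        also have "\<dots> \<sim> nf (tw2 p (lx1 (dl (Suc 0) c b)))" unfolding dl_ops nf_linear(1) by (intro cong_add cong_sym[OF n])
        finally show ?thesis using 2 by simp
      next
        case 3
        have "scal (kapn c) * (gen X1 * mon (Suc (Suc 0)) c b) \<sim> scal (kapn c) * (scal (- p) * mon (Suc 0) (Suc c) b +
            scal (om * p * (om * p) * (om * om * p) ^ c) * mon (Suc (Suc 0)) c (Suc b))"
          by (rule cong_mult(1)[OF x1_mon_2])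
        also have "\<dots> = scal (- p * p ^ Suc c * kapn (Suc c)) * mon (Suc 0) (Suc c) b + scal (om * p * (om * p) * (om * om * p) ^ c * kapn c) * mon (Suc (Suc 0)) c (Suc b)"
          unfolding k(2)[symmetric] by (simp add: distrib_left scal_rules mult.commute mult.left_commute)
        also have "\<dots> \<sim> nf (tw2 p (lx1 (dl (Suc (Suc 0)) c b)))" unfolding dl_ops nf_linear(1) by (intro cong_add cong_sym[OF n])
        finally show ?thesis using 3 by simp
      qed
    qed
    then show "gen X1 * nf (dl a c b) \<sim> nf (tw2 p (lx1 (dl a c b)))" using cong_trans[OF 1] by blast
  next
    fix v w assume vw: "gen X1 * nf v \<sim> nf (tw2 p (lx1 v))" "gen X1 * nf w \<sim> nf (tw2 p (lx1 w))"
    show "gen X1 * nf (v + w) \<sim> nf (tw2 p (lx1 (v + w)))"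
      unfolding nf_linear left_mult_linear twist_linear distrib_left by (rule cong_add[OF vw])
  next
    fix k v assume v: "gen X1 * nf v \<sim> nf (tw2 p (lx1 v))"
    show "gen X1 * nf (sv k v) \<sim> nf (tw2 p (lx1 (sv k v)))"
      unfolding nf_linear left_mult_linear twist_linear scal_rules by (rule cong_mult(1)[OF v])
  qed (simp add: nf_linear left_mult_linear twist_linear)
qed

text \<open>The action on a single coefficient at \<open>(i, l, j)\<close>, which depends only on \<open>e = l + 3 j\<close>.\<close>

definition vop :: "nat \<Rightarrow> nichols_gen \<Rightarrow> 'k vec \<Rightarrow> 'k vec" where
  "vop e g v = (case g of X1 \<Rightarrow> sv (p ^ e) (tw2 p (lx1 v)) | X2 \<Rightarrow> lx2 v)"

lemma vop_action: "word_action (sv :: 'k \<Rightarrow> 'k vec \<Rightarrow> 'k vec) (vop e)"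
proof (intro word_action.intro word_action_axioms.intro)
  show "Modules.module (sv :: 'k \<Rightarrow> 'k vec \<Rightarrow> 'k vec)"
    by standard (rule vec_eqI, simp add: algebra_simps)+
  fix g v w c
  show "vop e g (v + w) = vop e g v + vop e g w" "vop e g (sv c v) = sv c (vop e g v)"
    by (cases g; simp add: vop_def left_mult_linear twist_linear mult.commute)+
qed

definition vact :: "nat \<Rightarrow> (nichols_gen word \<Rightarrow>\<^sub>0 'k) \<Rightarrow> 'k vec \<Rightarrow> 'k vec" where
  "vact e = word_action.act sv (vop e)"

lemmas vact_simps = word_action.act_mult[OF vop_action, folded vact_def] word_action.act_add[OF vop_action, folded vact_def]
  word_action.act_gen[OF vop_action, folded vact_def] word_action.act_scal[OF vop_action, folded vact_def]
  word_action.act_diff[OF vop_action, folded vact_def]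

lemma act_pointwise: "N.act r f i l j = vact (l + 3 * j) r (f i l j)"
proof (induction r arbitrary: f rule: free_algebra_left_induct)
  case (gen g r)
  then show ?case by (cases g) (simp_all add: N.act_mult vact_simps vop_def A1_def A2_def)
qed (simp_all add: N.act_add vact_simps sc_def)

text \<open>The action depends on e only through the factor p^e of x1, and x1 raises the x1-degree
  by one. So all these actions are conjugate to the one with e = 0.\<close>

lemma vact_twist: "vact e r (tw1 (p ^ e) v) = tw1 (p ^ e) (vact 0 r v)"
proof (induction r rule: free_algebra_left_induct)
  case (gen g r)
  then show ?case by (cases g) (simp_all add: vact_simps vop_def twist_mult twist_linear)
qed (simp_all only: vact_simps twist_linear)

abbreviation v1 :: "'k vec" where "v1 \<equiv> dl 0 0 0"

lemma tw1_v1: "tw1 x v1 = v1"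
  by (rule vec_eqI, rename_tac a c b, case_tac a; case_tac c; case_tac b) (simp_all add: tw1_def dl_def pw_def)

lemma vact_v1: "vact e r v1 = tw1 (p ^ e) (vact 0 r v1)"
  using vact_twist[of e r v1] by (simp only: tw1_v1)

text \<open>Every element is congruent to the normal form of its value on 1. Hence the monomials
  span, and an element that sends 1 to zero lies in the ideal; this is the faithfulness behind the
  PBW basis.\<close>

lemma cong_nf: "r \<sim> nf (vact 0 r v1)"
proof (induction r rule: free_algebra_left_induct)
  case (scal c)
  have e: "scal (kapn 0) * mon 0 0 0 = 1" by (simp add: mon_def scal_simps)
  show ?case using cong_mult(1)[OF cong_sym[OF nf_dl[of 0 0 0]], of "scal c"]
    unfolding e vact_simps nf_linear by (simp only: mult_1_right)
next
  case (add r s)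
  then show ?case by (simp only: vact_simps nf_linear cong_add)
next
  case (gen g r)
  show ?case
  proof (cases g)
    case X1
    show ?thesis unfolding X1 vact_simps vop_def
      using cong_trans[OF cong_mult(1)[OF gen, of "gen X1"] nf_x1] by simp
  next
    case X2
    show ?thesis unfolding X2 vact_simps vop_def
      using cong_trans[OF cong_mult(1)[OF gen, of "gen X2"] nf_x2] by simp
  qed
qed

text \<open>The vectors reached from 1 form a submodule. It contains x1^b, then y^c x1^b, then x2^a
  y^c x1^b. The conjugation by \<open>tw1\<close> reduces a general e to e = 0.\<close>

lemma vact_surj: "\<exists>r. vact e r v1 = v"
proof -
  have s: "\<exists>r. vact 0 r v1 = v" for v
  proof -
    let ?W = "{v. \<exists>r. vact 0 r v1 = v}"
    have add: "v + w \<in> ?W" if "v \<in> ?W" "w \<in> ?W" for v w using that vact_simps(2)[of 0 _ _ v1] by fastforce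
    have sc: "sv k v \<in> ?W" if v: "v \<in> ?W" for k v
    proof -
      obtain r where "vact 0 r v1 = v" using v by blast
      then have "vact 0 (scal k * r) v1 = sv k v" by (simp add: vact_simps del: sv_apply plus_fun_apply)
      then show ?thesis by blast
    qed
    have op: "vact 0 s v \<in> ?W" if v: "v \<in> ?W" for s v using v vact_simps(1)[of 0 s _ v1] by blast
    have 1: "dl 0 0 b \<in> ?W" for b
    proof (induction b)
      case 0
      have "vact 0 (scal 1) v1 = v1" by (simp only: vact_simps sv_simps)
      then show ?case by blast
    next
      case (Suc b)
      have "vact 0 (gen X1) (dl 0 0 b) = dl 0 0 (Suc b)" by (simp add: vact_simps vop_def dl_ops del: sv_apply plus_fun_apply)
      then show ?case using op[OF Suc, of "gen X1"] by simp
    qed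
    have 2: "dl 0 c b \<in> ?W" for c b
    proof (induction c)
      case (Suc c)
      have "vact 0 gy (dl 0 c b) = sv (p ^ Suc c) (dl 0 (Suc c) b)"
        unfolding gy_def vact_simps
        by (simp add: vop_def dl_ops left_mult_linear twist_linear mult_ac del: sv_apply plus_fun_apply)
      then have "sv (ip ^ Suc c) (sv (p ^ Suc c) (dl 0 (Suc c) b)) \<in> ?W" using sc[OF op[OF Suc, of gy], of "ip ^ Suc c"] by simp
      moreover have "ip ^ Suc c * p ^ Suc c = 1" using ip_p[of "Suc c"] by (simp only: mult.commute)
      ultimately show ?case by (simp only: sv_simps)
    qed (rule 1)
    have 3: "dl a c b \<in> ?W" for a c b
    proof (induction a)
      case (Suc a)
      have "vact 0 (gen X2) (dl a c b) = dl (Suc a) c b" by (simp add: vact_simps vop_def dl_ops del: sv_apply plus_fun_apply)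
      then show ?case using op[OF Suc, of "gen X2"] by simp
    qed (rule 2)
    have z: "0 \<in> ?W" using sc[OF 1[of 0], of 0] by (simp only: sv_simps)
    have s: "(\<Sum>x\<in>S. f x) \<in> ?W" if "finite S" "\<And>x. x \<in> S \<Longrightarrow> f x \<in> ?W" for S and f :: "tri \<Rightarrow> 'k vec"
      using that
    proof (induction S rule: finite_induct)
      case (insert a S) then show ?case using add[of "f a" "sum f S"] by (simp del: plus_fun_apply)
    qed (use z in simp)
    have "finite tris" by (simp add: tris_def)
    then have "v \<in> ?W" by (subst vec_expand) (intro s sc 3)
    then show ?thesis by blast
  qed
  obtain r where "vact 0 r v1 = tw1 (ip ^ e) v" using s by blast
  moreover have "tw1 (p ^ e) (tw1 (ip ^ e) v) = v"
  proof -
    have m: "pw x t * pw y t = pw (x * y) t" for x y :: 'k and t by (cases t) (simp_all add: pw_def mult_ac)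
    have o: "pw (1::'k) t = 1" for t by (cases t) (simp_all add: pw_def)
    show ?thesis
    proof (rule vec_eqI)
      fix a c b
      have "tw1 (p ^ e) (tw1 (ip ^ e) v) a c b = (pw (p ^ e) c * pw (ip ^ e) c) * (pw (p ^ e) b * pw (ip ^ e) b) * v a c b"
        by (simp only: tw1_def ac_simps)
      then show "tw1 (p ^ e) (tw1 (ip ^ e) v) a c b = v a c b" by (simp only: m ip_p o mult_1_left)
    qed
  qed
  ultimately show ?thesis using vact_v1[of e r] by auto
qed

lemma vact_inj: assumes "vact e r v1 = vact e s v1" shows "r \<sim> s"
proof -
  have i: "p ^ e \<noteq> 0" using p_nz by simp
  have "tw1 (p ^ e) (vact 0 r v1) = tw1 (p ^ e) (vact 0 s v1)" unfolding vact_v1[of e r, symmetric] vact_v1[of e s, symmetric] by (rule assms)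
  then have "pw (p ^ e) c * pw (p ^ e) b * vact 0 r v1 a c b = pw (p ^ e) c * pw (p ^ e) b * vact 0 s v1 a c b" for a c b
    unfolding tw1_def by (rule fun_cong[THEN fun_cong, THEN fun_cong])
  moreover have "pw (p ^ e) t \<noteq> 0" for t using i by (cases t) (simp_all add: pw_def)
  ultimately have "vact 0 r v1 = vact 0 s v1" by (intro vec_eqI) simp
  then have "r \<sim> nf (vact 0 s v1)" using cong_nf[of r] by (simp only:)
  then show ?thesis by (rule cong_trans[OF _ cong_sym[OF cong_nf]])
qed

end

section \<open>The free resolution of the trivial module\<close>

lemma sum_apply3: "(\<Sum>t\<in>S. f t) i l j = (\<Sum>t\<in>S. f t i l (j :: 'c))"
  by (induction S rule: infinite_finite_induct) simp_all

context a2_twist begin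

lemma wt_strict_mono: "strict_mono wt"
proof (rule strict_mono_Suc_iff[THEN iffD2], rule allI)
  fix n show "wt n < wt (Suc n)" by (cases "even n") (simp_all add: wt_Suc)
qed

lemma wt_inj: "wt n = wt m \<longleftrightarrow> n = m"
  using wt_strict_mono by (simp add: strict_mono_eq)

definition Wt :: "nat \<times> nat \<times> nat \<Rightarrow> 'k chn" where
  "Wt t = (\<lambda>i l j. if (i, l, j) = t then v1 else 0)"

text \<open>The constant coefficient at a position, the only part of a chain that a homomorphism
  into the trivial module can see.\<close>

definition crn :: "'k chn \<Rightarrow> nat \<times> nat \<times> nat \<Rightarrow> 'k" where
  "crn f t = f (fst t) (fst (snd t)) (snd (snd t)) T0 T0 T0"

definition idx :: "nat \<Rightarrow> (nat \<times> nat \<times> nat) set" where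
  "idx n = {(i, l, j). i + l + 3 * j = wt n}"

lemma finite_idx: "finite (idx n)"
proof (rule finite_subset)
  show "idx n \<subseteq> {..wt n} \<times> {..wt n} \<times> {..wt n}" by (auto simp: idx_def)
qed simp

lemma Wt_Qc: "t \<in> idx n \<Longrightarrow> Wt t \<in> Qc n"
  by (auto simp: idx_def Qc_def Wt_def)

lemma v1_corner: "v1 T0 T0 T0 = 1" by (simp add: dl_def)

lemma Wt_inj: "Wt t = Wt t' \<Longrightarrow> t = t'"
proof -
  assume a: "Wt t = Wt t'"
  obtain i l j where t: "t = (i, l, j)" by (cases t)
  have "Wt t i l j T0 T0 T0 = Wt t' i l j T0 T0 T0" using a by simp
  then show "t = t'" by (simp add: Wt_def t v1_corner split: if_splits)
qed

lemma vact_zero: "vact e r 0 = 0"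
  using word_action.act_zero(2)[OF vop_action] by (simp add: vact_def)

lemma act_Wt: "N.act r (Wt (i', l', j')) i l j = (if (i, l, j) = (i', l', j') then vact (l + 3 * j) r v1 else 0)"
proof (cases "(i, l, j) = (i', l', j')")
  case True show ?thesis unfolding act_pointwise Wt_def if_P[OF True] ..
next
  case False show ?thesis unfolding act_pointwise Wt_def if_not_P[OF False] by (rule vact_zero)
qed

lemma ract_zero: "ract \<zero>\<^bsub>NR\<^esub> f = 0" by (simp add: NR_simps ract_pclass)

lemma QM_finsum:
  assumes "finite S" "\<And>b. b \<in> S \<Longrightarrow> g b \<in> Qc n"
  shows "(\<Oplus>\<^bsub>QM n\<^esub>b\<in>S. g b) = (\<Sum>b\<in>S. g b)"
  using assms
proof (induction S rule: finite_induct)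
  interpret QM: left_module NR "QM n" by (rule left_module_QM)
  {
    case empty show ?case by (simp only: QM.M.finsum_empty sum.empty QM_simps)
  next
    case (insert a S)
    have "(\<Oplus>\<^bsub>QM n\<^esub>b\<in>insert a S. g b) = g a \<oplus>\<^bsub>QM n\<^esub> (\<Oplus>\<^bsub>QM n\<^esub>b\<in>S. g b)"
      by (rule QM.M.finsum_insert) (use insert in auto)
    then show ?case using insert by (simp del: plus_fun_apply)
  }
qed

text \<open>Basis symbols sit at different positions, so an expansion amounts to one equation per
  position. Each is uniquely solvable modulo the relations, by \<open>vact_surj\<close> and
  \<open>vact_inj\<close>.\<close>

lemma QM_basis: "is_basis NR (QM n) (Wt ` idx n)"
  unfolding is_basis_def
proof (intro conjI ballI)
  let ?B = "Wt ` idx n"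
  show "?B \<subseteq> carrier (QM n)" using Wt_Qc by auto
  fix x assume x: "x \<in> carrier (QM n)"
  have injW: "inj_on Wt (idx n)" by (rule inj_onI) (rule Wt_inj)
  have sum: "x = (\<Oplus>\<^bsub>QM n\<^esub>b\<in>{b\<in>?B. c b \<noteq> \<zero>\<^bsub>NR\<^esub>}. c b \<odot>\<^bsub>QM n\<^esub> b) \<longleftrightarrow>
      (\<forall>(i, l, j)\<in>idx n. x i l j = ract (c (Wt (i, l, j))) (Wt (i, l, j)) i l j)"
    if c: "c \<in> ?B \<rightarrow>\<^sub>E carrier NR" for c
  proof -
    have cb: "ract (c b) b \<in> Qc n" if b: "b \<in> ?B" for b
    proof -
      obtain r where "c b = pclass nrels r" using c b by (auto simp: NR_simps PiE_iff)
      then show ?thesis using act_Qc Wt_Qc b by (auto simp: ract_pclass)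
    qed
    have "(\<Oplus>\<^bsub>QM n\<^esub>b\<in>{b\<in>?B. c b \<noteq> \<zero>\<^bsub>NR\<^esub>}. c b \<odot>\<^bsub>QM n\<^esub> b) = (\<Sum>b\<in>{b\<in>?B. c b \<noteq> \<zero>\<^bsub>NR\<^esub>}. ract (c b) b)"
      unfolding QM_simps(4) by (rule QM_finsum) (use cb finite_idx in auto)
    also have "\<dots> = (\<Sum>b\<in>?B. ract (c b) b)"
      by (rule sum.mono_neutral_left) (use finite_idx ract_zero in auto)
    also have "\<dots> = (\<Sum>t\<in>idx n. ract (c (Wt t)) (Wt t))"
      by (rule sum.reindex_cong[OF injW refl]) simp
    finally have eq: "(\<Oplus>\<^bsub>QM n\<^esub>b\<in>{b\<in>?B. c b \<noteq> \<zero>\<^bsub>NR\<^esub>}. c b \<odot>\<^bsub>QM n\<^esub> b) = (\<Sum>t\<in>idx n. ract (c (Wt t)) (Wt t))" .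
    have off: "ract (c (Wt t)) (Wt t) i l j = 0" if t: "t \<in> idx n" "t \<noteq> (i, l, j)" for t i l j
    proof -
      obtain r where "c (Wt t) = pclass nrels r" using c t by (auto simp: NR_simps PiE_iff)
      then show ?thesis using t(2) act_Wt[of r "fst t" "fst (snd t)" "snd (snd t)" i l j] by (auto simp: ract_pclass)
    qed
    have at: "(\<Sum>t\<in>idx n. ract (c (Wt t)) (Wt t)) i l j =
        (if (i, l, j) \<in> idx n then ract (c (Wt (i, l, j))) (Wt (i, l, j)) i l j else 0)" for i l j
    proof (cases "(i, l, j) \<in> idx n")
      case True
      have "(\<Sum>t\<in>idx n - {(i, l, j)}. ract (c (Wt t)) (Wt t) i l j) = 0"
        by (rule sum.neutral) (use off in auto)
      then show ?thesis unfolding sum_apply3 sum.remove[OF finite_idx True] using True by simp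
    next
      case False
      have "(\<Sum>t\<in>idx n. ract (c (Wt t)) (Wt t) i l j) = 0"
      proof (rule sum.neutral, rule ballI)
        fix t assume t: "t \<in> idx n"
        then have "t \<noteq> (i, l, j)" using False by blast
        then show "ract (c (Wt t)) (Wt t) i l j = 0" by (rule off[OF t])
      qed
      then show ?thesis unfolding sum_apply3 using False by simp
    qed
    show ?thesis unfolding eq
    proof
      assume e: "x = (\<Sum>t\<in>idx n. ract (c (Wt t)) (Wt t))"
      show "\<forall>(i, l, j)\<in>idx n. x i l j = ract (c (Wt (i, l, j))) (Wt (i, l, j)) i l j"
        by (subst e) (auto simp only: at if_True split: prod.splits)
    next
      assume e: "\<forall>(i, l, j)\<in>idx n. x i l j = ract (c (Wt (i, l, j))) (Wt (i, l, j)) i l j"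
      show "x = (\<Sum>t\<in>idx n. ract (c (Wt t)) (Wt t))"
      proof (rule chn_eqI)
        fix i l j show "x i l j = (\<Sum>t\<in>idx n. ract (c (Wt t)) (Wt t)) i l j"
        proof (cases "(i, l, j) \<in> idx n")
          case True then show ?thesis using e unfolding at by auto
        next
          case False
          then have "x i l j = 0" using x by (intro QcD[of x n]) (auto simp: idx_def)
          then show ?thesis using False unfolding at by simp
        qed
      qed
    qed
  qed
  have "\<forall>t\<in>idx n. \<exists>r. vact (fst (snd t) + 3 * snd (snd t)) r v1 = x (fst t) (fst (snd t)) (snd (snd t))"
    using vact_surj by blast
  then obtain r where r: "\<forall>t\<in>idx n. vact (fst (snd t) + 3 * snd (snd t)) (r t) v1 = x (fst t) (fst (snd t)) (snd (snd t))"
    by (rule bchoice[THEN exE])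
  \<comment> \<open>Coefficients are indexed by the basis elements themselves, hence the inverse of
    \<open>Wt\<close>.\<close>
  let ?c = "\<lambda>b\<in>?B. pclass nrels (r (the_inv_into (idx n) Wt b))"
  have cW: "?c (Wt t) = pclass nrels (r t)" if "t \<in> idx n" for t
    using that by (simp add: the_inv_into_f_f[OF injW])
  have cE: "?c \<in> ?B \<rightarrow>\<^sub>E carrier NR" by (auto simp: NR_simps)
  have fin: "finite {b \<in> ?B. c b \<noteq> \<zero>\<^bsub>NR\<^esub>}" for c :: "'k chn \<Rightarrow> (nichols_gen word \<Rightarrow>\<^sub>0 'k) set" using finite_idx by simp
  show "\<exists>!c. c \<in> ?B \<rightarrow>\<^sub>E carrier NR \<and> finite {b \<in> ?B. c b \<noteq> \<zero>\<^bsub>NR\<^esub>} \<and>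
      x = (\<Oplus>\<^bsub>QM n\<^esub>b\<in>{b\<in>?B. c b \<noteq> \<zero>\<^bsub>NR\<^esub>}. c b \<odot>\<^bsub>QM n\<^esub> b)"
  proof (rule ex1I[of _ ?c])
    have "\<forall>(i, l, j)\<in>idx n. x i l j = ract (?c (Wt (i, l, j))) (Wt (i, l, j)) i l j"
    proof (clarify)
      fix i l j assume t: "(i, l, j) \<in> idx n"
      show "x i l j = ract (?c (Wt (i, l, j))) (Wt (i, l, j)) i l j"
        unfolding cW[OF t] ract_pclass act_Wt using bspec[OF r t] by simp
    qed
    then show "?c \<in> ?B \<rightarrow>\<^sub>E carrier NR \<and> finite {b \<in> ?B. ?c b \<noteq> \<zero>\<^bsub>NR\<^esub>} \<and>
      x = (\<Oplus>\<^bsub>QM n\<^esub>b\<in>{b\<in>?B. ?c b \<noteq> \<zero>\<^bsub>NR\<^esub>}. ?c b \<odot>\<^bsub>QM n\<^esub> b)"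
      by (intro conjI cE fin sum[OF cE, THEN iffD2])
  next
    fix c assume c: "c \<in> ?B \<rightarrow>\<^sub>E carrier NR \<and> finite {b \<in> ?B. c b \<noteq> \<zero>\<^bsub>NR\<^esub>} \<and>
      x = (\<Oplus>\<^bsub>QM n\<^esub>b\<in>{b\<in>?B. c b \<noteq> \<zero>\<^bsub>NR\<^esub>}. c b \<odot>\<^bsub>QM n\<^esub> b)"
    then have cP: "c \<in> ?B \<rightarrow>\<^sub>E carrier NR" by blast
    have cx: "\<forall>(i, l, j)\<in>idx n. x i l j = ract (c (Wt (i, l, j))) (Wt (i, l, j)) i l j"
      using c sum[OF cP] by blast
    show "c = ?c"
    proof (rule extensionalityI[of _ ?B])
      show "c \<in> extensional ?B" using cP by (auto simp: PiE_iff)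
      fix b assume "b \<in> ?B"
      then obtain i l j where t: "(i, l, j) \<in> idx n" "b = Wt (i, l, j)" by auto
      obtain r' where r': "c b = pclass nrels r'" using cP t by (auto simp: NR_simps PiE_iff)
      have "x i l j = ract (c (Wt (i, l, j))) (Wt (i, l, j)) i l j" using cx t(1) by blast
      then have "vact (l + 3 * j) r' v1 = vact (l + 3 * j) (r (i, l, j)) v1"
        unfolding r'[unfolded t(2)] ract_pclass act_Wt using bspec[OF r t(1)] by simp
      then have "r' \<sim> r (i, l, j)" by (rule vact_inj)
      then show "c b = ?c b" unfolding t(2) cW[OF t(1)] r'[unfolded t(2)] by (simp add: pclass_eq_iff cong_def)
    qed simp
  qed
qed

lemma free_QM: "free_left_module NR (QM n)"
  unfolding free_left_module_def using left_module_QM QM_basis by blast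

abbreviation TN :: "((nichols_gen word \<Rightarrow>\<^sub>0 'k) set, 'k) module" where "TN \<equiv> trivial_module"

lemma trivial_NR: "left_module NR TN" by (rule left_module_trivial) simp

lemma nrels_constant: "r \<in> NI \<Longrightarrow> Poly_Mapping.lookup r 0 = 0"
proof -
  have "nrels \<subseteq> {r. Poly_Mapping.lookup r 0 = 0}"
    by (simp add: nichols_relations_def Let_def lookup_add lookup_minus lookup_mult_0 lookup_power_0 lookup_gen_0)
  then have "NI \<subseteq> {r. Poly_Mapping.lookup r 0 = 0}"
    by (rule relation_ideal_minimal) (simp_all add: lookup_add lookup_mult_0)
  then show "r \<in> NI \<Longrightarrow> Poly_Mapping.lookup r 0 = 0" by blast
qed

lemma trivial_smult: "pclass nrels r \<odot>\<^bsub>TN\<^esub> y = Poly_Mapping.lookup r 0 * y"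
proof -
  have "(\<lambda>r. Poly_Mapping.lookup r 0) ` pclass nrels r = {Poly_Mapping.lookup r 0}"
  proof (intro equalityI subsetI)
    fix y assume "y \<in> (\<lambda>r. Poly_Mapping.lookup r 0) ` pclass nrels r"
    then obtain r' where "r' - r \<in> NI" "y = Poly_Mapping.lookup r' 0" by (auto simp: mem_pclass)
    then show "y \<in> {Poly_Mapping.lookup r 0}" using nrels_constant[of "r' - r"] by (simp add: lookup_minus)
  next
    fix y assume "y \<in> {Poly_Mapping.lookup r 0}"
    moreover have "r \<in> pclass nrels r" by (simp add: mem_pclass relation_ideal_closed)
    ultimately show "y \<in> (\<lambda>r. Poly_Mapping.lookup r 0) ` pclass nrels r" by blast
  qed
  then show ?thesis by (simp add: trivial_module_def)
qed

lemma act_corner: "N.act r f i l j T0 T0 T0 = Poly_Mapping.lookup r 0 * f i l j T0 T0 T0"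
proof (induction r rule: free_algebra_left_induct)
  case (scal c)
  have "Poly_Mapping.lookup (scal c :: nichols_gen word \<Rightarrow>\<^sub>0 'k) 0 = c" by (simp add: scal_def)
  then show ?case by (simp only: N.act_scal) (simp only: sc_def sv_apply)
next
  case (gen g r)
  have "nop g h i l j T0 T0 T0 = 0" for h by (cases g) (simp_all add: corner_zero)
  then show ?case by (simp add: N.act_mult lookup_mult_0 lookup_gen_0)
qed (simp add: N.act_add lookup_add distrib_right)

lemma dQ_act: "dQ n (N.act r f) = N.act r (dQ n f)"
proof (induction r rule: free_algebra_left_induct)
  case (scal c) show ?case by (simp add: dQ_def op_linear)
next
  case (add r s) then show ?case by (cases "even n") (simp_all add: N.act_add dQ_def op_linear del: plus_fun_apply)
next
  case (gen g r) then show ?case by (cases g; cases "even n") (simp_all add: N.act_mult dQ_def A_D)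
qed

definition dR :: "nat \<Rightarrow> 'k chn \<Rightarrow> 'k chn" where "dR n = restrict (dQ n) (Qc (Suc n))"
definition eR :: "'k chn \<Rightarrow> 'k" where "eR = restrict (\<lambda>f. f 0 0 0 T0 T0 T0) (Qc 0)"

lemma dQ_add: "dQ n (f + g) = dQ n f + dQ n g" by (simp add: dQ_def op_linear)
lemma dQ_zero: "dQ n 0 = 0" by (simp add: dQ_def op_zero)

lemma resolution_QM: "free_resolution NR TN QM dR eR"
proof -
  have "dR n \<in> left_hom NR (QM (Suc n)) (QM n)" for n
  proof (rule left_homI)
    fix X f assume "X \<in> carrier NR" "f \<in> carrier (QM (Suc n))"
    then obtain r where "X = pclass nrels r" "f \<in> Qc (Suc n)" by (auto simp: NR_simps)
    then show "dR n (X \<odot>\<^bsub>QM (Suc n)\<^esub> f) = X \<odot>\<^bsub>QM n\<^esub> dR n f" by (simp add: dR_def ract_pclass dQ_act act_Qc)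
  qed (simp_all add: dR_def dQ_closed dQ_add Qc_closed del: plus_fun_apply)
  moreover have "eR \<in> left_hom NR (QM 0) TN"
  proof (rule left_homI)
    fix X f assume "X \<in> carrier NR" "f \<in> carrier (QM 0)"
    then obtain r where "X = pclass nrels r" "f \<in> Qc 0" by (auto simp: NR_simps)
    then show "eR (X \<odot>\<^bsub>QM 0\<^esub> f) = X \<odot>\<^bsub>TN\<^esub> eR f" by (simp add: eR_def ract_pclass act_corner act_Qc trivial_smult)
  qed (simp_all add: eR_def Qc_closed trivial_simps)
  moreover have "eR ` carrier (QM 0) = carrier TN"
  proof -
    have w: "Wt (0, 0, 0) \<in> Qc 0" by (rule Wt_Qc) (simp add: idx_def wt_def)
    have "y = eR (sc y (Wt (0, 0, 0)))" for y
      using Qc_closed(3)[OF w] by (simp add: eR_def sc_def Wt_def v1_corner)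
    then show ?thesis using Qc_closed(3)[OF w] by (auto simp: trivial_simps)
  qed
  moreover have "{f \<in> carrier (QM 0). eR f = \<zero>\<^bsub>TN\<^esub>} = dR 0 ` carrier (QM 1)"
  proof (intro equalityI subsetI)
    fix f assume "f \<in> {f \<in> carrier (QM 0). eR f = \<zero>\<^bsub>TN\<^esub>}"
    then obtain g where "g \<in> Qc (Suc 0)" "dQ 0 g = f" using dQ_exact0[of f] by (auto simp: eR_def trivial_simps)
    then show "f \<in> dR 0 ` carrier (QM 1)" by (auto simp: dR_def)
  next
    fix f assume "f \<in> dR 0 ` carrier (QM 1)"
    then obtain g where "g \<in> Qc (Suc 0)" "f = dQ 0 g" by (auto simp: dR_def)
    then show "f \<in> {f \<in> carrier (QM 0). eR f = \<zero>\<^bsub>TN\<^esub>}"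
      by (simp add: dQ_closed eR_def trivial_simps dQ_corner)
  qed
  moreover have "{f \<in> carrier (QM (Suc n)). dR n f = \<zero>\<^bsub>QM n\<^esub>} = dR (Suc n) ` carrier (QM (Suc (Suc n)))" for n
  proof (intro equalityI subsetI)
    fix f assume "f \<in> {f \<in> carrier (QM (Suc n)). dR n f = \<zero>\<^bsub>QM n\<^esub>}"
    then obtain g where "g \<in> Qc (Suc (Suc n))" "dQ (Suc n) g = f" using dQ_exact[of f n] by (auto simp: dR_def)
    then show "f \<in> dR (Suc n) ` carrier (QM (Suc (Suc n)))" by (auto simp: dR_def)
  next
    fix f assume "f \<in> dR (Suc n) ` carrier (QM (Suc (Suc n)))"
    then obtain g where "g \<in> Qc (Suc (Suc n))" "f = dQ (Suc n) g" by (auto simp: dR_def)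
    then show "f \<in> {f \<in> carrier (QM (Suc n)). dR n f = \<zero>\<^bsub>QM n\<^esub>}"
      using dQ_closed[of g "Suc n"] dQ_dQ[of g n] by (simp add: dR_def)
  qed
  ultimately show ?thesis unfolding free_resolution_def using free_QM by blast
qed

lemma scalar_NR: "(c \<odot>\<^bsub>NR\<^esub> \<one>\<^bsub>NR\<^esub>) \<odot>\<^bsub>TN\<^esub> y = c * y"
  unfolding NR_simps trivial_smult by (simp add: scal_def)

sublocale Qr: trivial_resolution NR QM dR eR
  by (intro trivial_resolution.intro trivial_NR resolution_QM scalar_NR)

text \<open>The algebra acts on the trivial module and on constant coefficients by the same
  character, so the right-hand side is a homomorphism. It agrees with g on the basis.\<close>

lemma hom_expand:
  assumes g: "g \<in> left_hom NR (QM n) TN" and f: "f \<in> Qc n"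
  shows "g f = (\<Sum>t\<in>idx n. crn f t * g (Wt t))"
proof -
  let ?g = "\<lambda>f\<in>Qc n. \<Sum>t\<in>idx n. crn f t * g (Wt t)"
  have g': "?g \<in> left_hom NR (QM n) TN"
  proof (rule left_homI)
    fix x y assume "x \<in> carrier (QM n)" "y \<in> carrier (QM n)"
    then show "?g (x \<oplus>\<^bsub>QM n\<^esub> y) = ?g x \<oplus>\<^bsub>TN\<^esub> ?g y"
      by (simp add: Qc_closed trivial_simps sum.distrib[symmetric] crn_def split_beta distrib_right)
  next
    fix X x assume "X \<in> carrier NR" "x \<in> carrier (QM n)"
    then obtain r where "X = pclass nrels r" "x \<in> Qc n" by (auto simp: NR_simps)
    then show "?g (X \<odot>\<^bsub>QM n\<^esub> x) = X \<odot>\<^bsub>TN\<^esub> ?g x"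
      by (simp add: ract_pclass act_Qc trivial_smult crn_def split_beta act_corner sum_distrib_left mult.assoc)
  qed (simp_all add: trivial_simps)
  have "g f = ?g f"
  proof (rule free_eqI[OF left_module_QM QM_basis trivial_NR g g'])
    fix b assume "b \<in> Wt ` idx n"
    then obtain t where t: "t \<in> idx n" "b = Wt t" by blast
    have "(\<Sum>t'\<in>idx n. crn (Wt t) t' * g (Wt t')) = (\<Sum>t'\<in>idx n. if t' = t then g (Wt t') else 0)"
      by (rule sum.cong) (auto simp: crn_def Wt_def v1_corner)
    then show "g b = ?g b" using t Wt_Qc[OF t(1)] finite_idx by (simp add: sum.delta)
  qed (use f in simp)
  then show ?thesis using f by simp
qed

text \<open>Every homomorphism is a cocycle and every coboundary is zero, so for this resolution Ext
  is Hom itself.\<close>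

lemma hom_dQ: assumes g: "g \<in> left_hom NR (QM n) TN" and f: "f \<in> Qc (Suc n)" shows "g (dQ n f) = 0"
  unfolding hom_expand[OF g dQ_closed[OF f]] by (simp add: crn_def split_beta dQ_corner)

lemma Qr_cocycle: "g \<in> left_hom NR (QM n) TN \<Longrightarrow> g \<in> cocycles NR TN QM dR n"
  using hom_dQ by (simp add: cocycles_def dR_def trivial_simps)

lemma Qr_coboundary: "b \<in> coboundaries NR TN QM dR n \<Longrightarrow> f \<in> Qc n \<Longrightarrow> b f = 0"
  by (cases n) (auto simp: trivial_simps compose_def dR_def hom_dQ)

section \<open>Inhomogeneous elements acting on the resolution\<close>

definition degw :: "ext_gen list \<Rightarrow> nat" where "degw l = sum_list (map ext_gen_degree l)"

lemma foldr_lop_Qc: "f \<in> Qc (n + degw l) \<Longrightarrow> foldr lop l f \<in> Qc n"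
proof (induction l arbitrary: n)
  case (Cons g l)
  have "foldr lop l f \<in> Qc (n + ext_gen_degree g)" by (rule Cons.IH) (use Cons.prems in \<open>simp add: degw_def add.assoc\<close>)
  then show ?case by (simp add: lop_Qc)
qed (simp add: degw_def)

lemma lop_zero: "lop g 0 = 0"
  using L.opr_scale[of g 0 0] by (simp only: sc_simps)

lemma dQ_sc: "dQ n (sc c f) = sc c (dQ n f)" by (simp add: dQ_def op_linear)

lemma foldr_lop_below: "f \<in> Qc n \<Longrightarrow> n < degw l \<Longrightarrow> foldr lop l f = 0"
proof (induction l)
  case (Cons g l)
  show ?case
  proof (cases "n < degw l")
    case True
    have "foldr lop l f = 0" by (rule Cons.IH[OF Cons.prems(1) True])
    then show ?thesis by (simp only: foldr_Cons comp_apply lop_zero)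
  next
    case False
    have "foldr lop l f \<in> Qc (n - degw l)" by (rule foldr_lop_Qc) (use False Cons.prems in simp)
    then show ?thesis using lop_below[of _ "n - degw l" g] Cons.prems False by (simp add: degw_def)
  qed
qed (simp add: degw_def)

lemma foldr_lop_dQ: "f \<in> Qc (Suc n + degw l) \<Longrightarrow> dQ n (foldr lop l f) = foldr lop l (dQ (n + degw l) f)"
proof (induction l arbitrary: n)
  case (Cons g l)
  have m: "f \<in> Qc (Suc (n + ext_gen_degree g) + degw l)" using Cons.prems by (simp add: degw_def add.assoc)
  have "foldr lop l f \<in> Qc (Suc n + ext_gen_degree g)" using foldr_lop_Qc[OF m] by simp
  then have "dQ n (lop g (foldr lop l f)) = lop g (dQ (n + ext_gen_degree g) (foldr lop l f))" by (rule dQ_lop)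
  then show ?case using Cons.IH[OF m] by (simp add: degw_def add.assoc)
qed (simp add: degw_def)

lemma resw_other: "f \<in> Qc n \<Longrightarrow> m \<noteq> n \<Longrightarrow> resw m f = 0"
  by (rule chn_eqI) (auto simp: resw_def res_def wt_inj intro!: QcD)

lemma resw_linear: "resw m (f + g) = resw m f + resw m g" "resw m (sc c f) = sc c (resw m f)" "resw m 0 = 0"
  by (rule chn_eqI; simp add: resw_def res_def sc_def)+

text \<open>As r may mix degrees, the identity is stated for the component in degree N. A word of
  degree n + 1 kills \<open>dQ n f\<close> and sends f to degree 0, where the left side has no
  component; longer words kill both.\<close>

lemma act_resw_dQ: assumes f: "f \<in> Qc (Suc n)"
  shows "dQ N (resw (Suc N) (L.act r f)) = resw N (L.act r (dQ n f))"
proof (induction r rule: free_algebra_induct)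
  case (single w c)
  define l where "l = letters w"
  have df: "dQ n f \<in> Qc n" by (rule dQ_closed[OF f])
  have "dQ N (resw (Suc N) (foldr lop l f)) = resw N (foldr lop l (dQ n f))"
  proof (cases "degw l \<le> n")
    case True
    then obtain m where n: "n = m + degw l" using le_Suc_ex by (metis add.commute)
    have Q: "foldr lop l f \<in> Qc (Suc m)" "foldr lop l (dQ n f) \<in> Qc m"
      by (rule foldr_lop_Qc, use f df n in simp)+
    have e: "dQ m (foldr lop l f) = foldr lop l (dQ n f)" using foldr_lop_dQ[of f m l] f n by simp
    show ?thesis
    proof (cases "N = m")
      case True then show ?thesis using Q e by (simp add: resw(2))
    next
      case False then show ?thesis using resw_other[OF Q(1), of "Suc N"] resw_other[OF Q(2), of N] by (simp add: dQ_zero)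
    qed
  next
    case False
    then have 1: "foldr lop l (dQ n f) = 0" using foldr_lop_below[OF df] by simp
    show ?thesis
    proof (cases "degw l = Suc n")
      case True
      have "foldr lop l f \<in> Qc 0" by (rule foldr_lop_Qc) (use f True in simp)
      then show ?thesis using resw_other[of _ 0 "Suc N"] 1 by (simp add: dQ_zero resw_linear)
    next
      case ne: False
      then have "foldr lop l f = 0" using foldr_lop_below[OF f, of l] False by simp
      then show ?thesis using 1 by (simp add: dQ_zero resw_linear)
    qed
  qed
  then have "sc c (dQ N (resw (Suc N) (foldr lop l f))) = sc c (resw N (foldr lop l (dQ n f)))" by (rule arg_cong)
  then show ?case by (simp only: L.act_single l_def resw_linear dQ_sc)
next
  case zero show ?case by (simp only: L.act_zero resw_linear dQ_zero)
next
  case (add r s) then show ?case by (simp only: L.act_add resw_linear dQ_add)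
qed

text \<open>Words of degree i move f to degree n - i, and words of degree above n kill it, so there
  are no further components.\<close>

lemma act_decompose: assumes f: "f \<in> Qc n" shows "L.act r f = (\<Sum>i\<le>n. resw i (L.act r f))"
proof (induction r rule: free_algebra_induct)
  case zero show ?case by (simp only: L.act_zero resw_linear sum.neutral_const)
next
  case (add r s)
  then show ?case by (simp add: L.act_add resw_linear sum.distrib del: plus_fun_apply)
next
  case (single w c)
  define l where "l = letters w"
  have dec: "foldr lop l f = (\<Sum>i\<le>n. resw i (foldr lop l f))"
  proof (cases "degw l \<le> n")
    case True
    then obtain m where n: "n = m + degw l" using le_Suc_ex by (metis add.commute)
    have Q: "foldr lop l f \<in> Qc m" by (rule foldr_lop_Qc) (use f n in simp)
    have "(\<Sum>i\<le>n. resw i (foldr lop l f)) = (\<Sum>i\<le>n. if i = m then foldr lop l f else 0)"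
      by (rule sum.cong) (simp_all add: resw(2)[OF Q] resw_other[OF Q])
    then show ?thesis using n by (simp add: sum.delta)
  next
    case False
    then have "foldr lop l f = 0" using foldr_lop_below[OF f] by simp
    then show ?thesis by (simp add: resw_linear)
  qed
  have "sc c (foldr lop l f) = sc c (\<Sum>i\<le>n. resw i (foldr lop l f))" by (rule arg_cong[OF dec])
  then have "sc c (foldr lop l f) = (\<Sum>i\<le>n. sc c (resw i (foldr lop l f)))" by (simp only: N.scale_sum_right)
  then show ?case unfolding L.act_single l_def[symmetric] resw_linear(2) .
qed

lemma act_L_N: "L.act r (N.act s f) = N.act s (L.act r f)"
proof -
  have g: "lop g (N.act s h) = N.act s (lop g h)" for g h
  proof (induction s rule: free_algebra_left_induct)
    case (scal c) show ?case by (simp only: N.act_scal lop_linear)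
  next
    case (add s t) then show ?case by (simp only: N.act_add lop_linear)
  next
    case (gen g' s) then show ?case by (cases g') (simp_all only: N.act_mult N.act_gen nop.simps lop_A)
  qed
  have "\<forall>f. L.act r (N.act s f) = N.act s (L.act r f)"
    by (rule free_algebra_left_induct[where P = "\<lambda>r. \<forall>f. L.act r (N.act s f) = N.act s (L.act r f)"])
      (simp_all only: L.act_scal L.act_add L.act_mult L.act_gen N.act_linear g simp_thms)
  then show ?thesis by blast
qed

lemma resw_act: "resw m (N.act s f) = N.act s (resw m f)"
proof (rule chn_eqI)
  fix i l j show "resw m (N.act s f) i l j = N.act s (resw m f) i l j"
    by (cases "i + l + 3 * j = wt m") (simp_all add: act_pointwise resw_def res_def vact_zero)
qed

end

section \<open>Normal words in the presented algebra\<close>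

definition wmon :: "'g list \<Rightarrow> ('g word \<Rightarrow>\<^sub>0 'k::comm_ring_1)" where
  "wmon l = Poly_Mapping.single (Word l) 1"

lemma wmon_append: "wmon (u @ v) = wmon u * wmon v"
  by (simp add: wmon_def mult_single plus_word_def)

lemma wmon_simps: "wmon [] = 1" "wmon [g] = gen g" "wmon [g, g'] = gen g * gen g'"
  by (simp_all add: wmon_def gen_def zero_word_def[symmetric] mult_single plus_word_def)

lemma single_wmon: "Poly_Mapping.single (Word l) c = scal c * wmon l"
  by (simp add: wmon_def scal_def mult_single)

context a2_twist begin

abbreviation erels where "erels \<equiv> ext_relations om (om * p) (om * ip)"
abbreviation EI where "EI \<equiv> relation_ideal erels"

text \<open>All powers of om cancel because om^3 = 1; only powers of p remain in the
  relations.\<close>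

lemma coefficients:
  "(om * p)^3 = p^3" "(om * p)^6 = p^6" "(om * p)^9 = p^9" "om\<^sup>2 * (om * p) = p"
  "om * (om * p)\<^sup>2 = p\<^sup>2" "om * (om * ip)\<^sup>2 = ip\<^sup>2"
proof -
  have 3: "om^3 = 1" by (simp add: power3_eq_cube om2 om3 algebra_simps)
  have "om^6 = (om^3)^2" "om^9 = (om^3)^3" by (simp_all only: power_mult[symmetric]) simp_all
  then have "om^6 = 1" "om^9 = 1" by (simp_all only: 3 power_one)
  then show "(om * p)^3 = p^3" "(om * p)^6 = p^6" "(om * p)^9 = p^9" by (simp_all only: power_mult_distrib 3 mult_1_left)
  show "om\<^sup>2 * (om * p) = p" "om * (om * p)\<^sup>2 = p\<^sup>2" "om * (om * ip)\<^sup>2 = ip\<^sup>2"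
    using 3 by (simp_all add: power2_eq_square power3_eq_cube mult_ac)
qed

lemmas erels_eq = ext_relations_def[of om "om * p" "om * ip", unfolded Let_def coefficients]

text \<open>The scalar may be 0, so a vanishing word is related to every word. This is enough for
  spanning and spares case distinctions.\<close>

definition prp :: "ext_gen list \<Rightarrow> ext_gen list \<Rightarrow> bool" (infix "\<unlhd>" 50) where
  "u \<unlhd> v \<longleftrightarrow> (\<exists>k. wmon u - scal k * wmon v \<in> EI)"

lemma prp_refl: "u \<unlhd> u"
  unfolding prp_def by (rule exI[of _ 1]) (simp add: scal_simps relation_ideal_closed)

lemma prp_trans [trans]: "u \<unlhd> v \<Longrightarrow> v \<unlhd> w \<Longrightarrow> u \<unlhd> w"
proof -
  assume "u \<unlhd> v" "v \<unlhd> w"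
  then obtain k k' where k: "wmon u - scal k * wmon v \<in> EI" "wmon v - scal k' * wmon w \<in> EI"
    unfolding prp_def by blast
  have eq: "wmon u - scal k * wmon v + scal k * (wmon v - scal k' * wmon w) = wmon u - scal (k * k') * wmon w"
    by (simp add: scal_simps right_diff_distrib mult.assoc)
  have "wmon u - scal (k * k') * wmon w \<in> EI"
    using relation_ideal_closed(2)[OF k(1) relation_ideal_closed(4)[OF k(2), of "scal k"]] unfolding eq .
  then show "u \<unlhd> w" unfolding prp_def by blast
qed

lemma prp_context: "u \<unlhd> v \<Longrightarrow> s @ u @ t \<unlhd> s @ v @ t"
proof -
  assume "u \<unlhd> v"
  then obtain k where k: "wmon u - scal k * wmon v \<in> EI" unfolding prp_def by blast
  have "wmon s * (wmon u - scal k * wmon v) * wmon t = wmon (s @ u @ t) - scal k * wmon (s @ v @ t)"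
    unfolding wmon_append right_diff_distrib left_diff_distrib mult.assoc
    by (simp only: mult.assoc[symmetric] scal_central[of k "wmon s"])
  then have "wmon (s @ u @ t) - scal k * wmon (s @ v @ t) \<in> EI"
    using relation_ideal_closed(5)[OF relation_ideal_closed(4)[OF k, of "wmon s"], of "wmon t"] by simp
  then show ?thesis unfolding prp_def by blast
qed

lemmas prp_left = prp_context[where t = "[]", unfolded append_Nil2]
  and prp_right = prp_context[where s = "[]", unfolded append_Nil]

lemma prpI:
  "wmon u \<in> EI \<Longrightarrow> u \<unlhd> v" "wmon u - scal k * wmon v \<in> EI \<Longrightarrow> u \<unlhd> v"
  "wmon u - scal k * wmon v \<in> EI \<Longrightarrow> k \<noteq> 0 \<Longrightarrow> v \<unlhd> u"
proof -
  show "wmon u \<in> EI \<Longrightarrow> u \<unlhd> v"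
    unfolding prp_def by (rule exI[of _ 0]) (simp add: scal_simps)
  show "wmon u - scal k * wmon v \<in> EI \<Longrightarrow> u \<unlhd> v" unfolding prp_def by blast
  assume k: "wmon u - scal k * wmon v \<in> EI" "k \<noteq> 0"
  have "scal (- inverse k) * (wmon u - scal k * wmon v) = - scal (inverse k) * wmon u + scal (inverse k * k) * wmon v"
    by (simp add: scal_simps right_diff_distrib mult.assoc)
  then have "scal (- inverse k) * (wmon u - scal k * wmon v) = wmon v - scal (inverse k) * wmon u"
    using k(2) by (simp add: scal_simps)
  then have "wmon v - scal (inverse k) * wmon u \<in> EI"
    using relation_ideal_closed(4)[OF k(1), of "scal (- inverse k)"] by simp
  then show "v \<unlhd> u" unfolding prp_def by blast
qed

lemma erel: "r \<in> erels \<Longrightarrow> r \<in> EI" by (rule relation_ideal_closed)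

lemma zero_words: "[Ga1, Ga1] \<unlhd> v" "[Ga2, Ga2] \<unlhd> v" "[Ga1, Ga2] \<unlhd> v" "[Ga2, Ga1] \<unlhd> v"
  by (rule prpI(1)[OF erel], simp only: wmon_simps erels_eq power2_eq_square insert_iff simp_thms)+

text \<open>A relation \<open>u - k v\<close> (first list) or \<open>k u - v\<close> (second list) with \<open>k \<noteq> 0\<close>.\<close>

lemma proportional:
  assumes "(u, v) \<in> {([Ga1, Gb1], [Gb1, Ga1]), ([Ga1, Gby], [Gby, Ga1]), ([Ga1, Gb2], [Gb2, Ga1]),
      ([Ga1, Gc1], [Gc1, Ga1]), ([Ga1, Gc2], [Gc2, Ga1]), ([Ga2, Gb2], [Gb2, Ga2]), ([Ga2, Gc1], [Gc1, Ga2]),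
      ([Ga1, Gb2], [Ga2, Gc2]), ([Gc1, Ga2], [Gc2, Ga1]), ([Gb1, Gc2], [Gc1, Gc1]), ([Gb1, Gb2], [Gc1, Gc2]),
      ([Gc1, Gc2], [Gc2, Gc1]), ([Gb1, Gby], [Gby, Gb1]), ([Gb1, Gb2], [Gb2, Gb1]), ([Gby, Gb2], [Gb2, Gby]),
      ([Gc1, Gby], [Gby, Gc1]), ([Gc1, Gb2], [Gb2, Gc1]), ([Gc2, Gb2], [Gb2, Gc2])} \<union>
     {([Gb1, Ga2], [Ga2, Gb1]), ([Gby, Ga2], [Ga2, Gby]), ([Gc2, Ga2], [Ga2, Gc2]), ([Ga1, Gc1], [Ga2, Gb1]),
      ([Gc2, Gc2], [Gb2, Gc1]), ([Gb1, Gc1], [Gc1, Gb1]), ([Gb1, Gc2], [Gc2, Gb1]), ([Gby, Gc2], [Gc2, Gby])}"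
  shows "u \<unlhd> v" "v \<unlhd> u"
proof -
  have nz: "p^3 \<noteq> 0" "p^6 \<noteq> 0" "p^9 \<noteq> 0" "p\<^sup>2 \<noteq> 0" "ip\<^sup>2 \<noteq> 0" "p \<noteq> 0"
    using p_nz by (simp_all add: ip_def)
  have R: "u \<unlhd> v \<and> v \<unlhd> u" if "wmon u - scal k * wmon v \<in> erels" "k \<noteq> 0" for u v k
    using prpI(2,3)[OF erel[OF that(1)]] that(2) by blast
  \<comment> \<open>\<open>R1\<close> to \<open>R5\<close> match the shapes in which the relations
    are written: a scalar on either side, no scalar, or a square as the second term.\<close>
  have R1: "[a, b] \<unlhd> [c, d] \<and> [c, d] \<unlhd> [a, b]" if "gen a * gen b - scal k * gen c * gen d \<in> erels" "k \<noteq> 0" for a b c d k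
    using R[of "[a, b]" k "[c, d]"] that by (simp add: wmon_simps mult.assoc)
  have R2: "[a, b] \<unlhd> [c, d] \<and> [c, d] \<unlhd> [a, b]" if "gen a * gen b - gen c * gen d \<in> erels" for a b c d
    using R[of "[a, b]" 1 "[c, d]"] that by (simp add: wmon_simps scal_simps)
  have R3: "[c, d] \<unlhd> [a, b] \<and> [a, b] \<unlhd> [c, d]" if "scal k * gen a * gen b - gen c * gen d \<in> erels" "k \<noteq> 0" for a b c d k
  proof -
    have "- (scal k * gen a * gen b - gen c * gen d) \<in> EI" by (rule relation_ideal_closed(3)[OF erel[OF that(1)]])
    then have "wmon [c, d] - scal k * wmon [a, b] \<in> EI" by (simp only: wmon_simps mult.assoc minus_diff_eq)
    then show ?thesis using prpI(2,3) that(2) by blast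
  qed
  have R4: "[a, b] \<unlhd> [c, c] \<and> [c, c] \<unlhd> [a, b]" if "gen a * gen b - scal k * (gen c)\<^sup>2 \<in> erels" "k \<noteq> 0" for a b c k
    using R1[of a b k c c] that by (simp add: power2_eq_square mult.assoc)
  have R5: "[c, c] \<unlhd> [a, b] \<and> [a, b] \<unlhd> [c, c]" if "scal k * gen a * gen b - (gen c)\<^sup>2 \<in> erels" "k \<noteq> 0" for a b c k
    using R3[of k a b c c] that by (simp add: power2_eq_square)
  have "u \<unlhd> v \<and> v \<unlhd> u"
    by (insert assms; elim UnE insertE emptyE Pair_inject; hypsubst;
      ((rule R1, unfold erels_eq, (rule insertI1 | rule insertI2)+, simp only: nz not_False_eq_True; fail)
      | (rule R2, unfold erels_eq, (rule insertI1 | rule insertI2)+; fail)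
      | (rule R3, unfold erels_eq, (rule insertI1 | rule insertI2)+, simp only: nz not_False_eq_True; fail)
      | (rule R4, unfold erels_eq, (rule insertI1 | rule insertI2)+, simp only: nz not_False_eq_True; fail)
      | (rule R5, unfold erels_eq, (rule insertI1 | rule insertI2)+, simp only: nz not_False_eq_True; fail)))
  then show "u \<unlhd> v" "v \<unlhd> u" by blast+
qed

section \<open>Spanning: reduction of words to normal words\<close>

abbreviation bset :: "ext_gen set" where "bset \<equiv> {Gb1, Gb2, Gby}"

text \<open>Each b commutes with every generator up to a scalar, so the letters b can be collected
  on the right.\<close>

lemma swap: assumes b: "b \<in> bset" shows "[b, g] \<unlhd> [g, b]"
  by (insert b; elim insertE emptyE; cases g; hypsubst;
    (rule prp_refl | (rule proportional(1), simp; fail) | (rule proportional(2), simp; fail)))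

lemma swap_list: assumes b: "b \<in> bset" shows "b # l \<unlhd> l @ [b]"
proof (induction l)
  case (Cons g l)
  have "b # g # l \<unlhd> g # b # l" using prp_right[OF swap[OF b, of g], of l] by simp
  also have "\<dots> \<unlhd> g # l @ [b]" using prp_left[OF Cons.IH, of "[g]"] by simp
  finally show ?case by simp
qed (simp add: prp_refl)

definition bmon :: "nat \<Rightarrow> nat \<Rightarrow> nat \<Rightarrow> ext_gen list" where
  "bmon x y z = replicate x Gb1 @ replicate y Gb2 @ replicate z Gby"

lemma bset_bmon: assumes "b \<in> bset" shows "\<exists>x' y' z'. b # bmon x y z \<unlhd> bmon x' y' z'"
proof -
  have "Gb1 # bmon x y z \<unlhd> bmon (Suc x) y z" by (simp add: bmon_def prp_refl)
  moreover have "Gb2 # bmon x y z \<unlhd> bmon x (Suc y) z"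
    using prp_right[OF swap_list[of Gb2 "replicate x Gb1"], of "replicate y Gb2 @ replicate z Gby"] by (simp add: bmon_def)
  moreover have "Gby # bmon x y z \<unlhd> bmon x y (Suc z)"
    using swap_list[of Gby "bmon x y z"] by (simp add: bmon_def replicate_append_same)
  ultimately show ?thesis using assms by blast
qed

lemma bset_bmon_list: "set bs \<subseteq> bset \<Longrightarrow> \<exists>x' y' z'. bs @ bmon x y z \<unlhd> bmon x' y' z'"
proof (induction bs)
  case Nil show ?case using prp_refl[of "bmon x y z"] by auto
next
  case (Cons b bs)
  then obtain x' y' z' where "bs @ bmon x y z \<unlhd> bmon x' y' z'" by auto
  then have 1: "[b] @ bs @ bmon x y z \<unlhd> [b] @ bmon x' y' z'" by (rule prp_left)
  have "b \<in> bset" using Cons.prems by simp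
  then obtain x2 y2 z2 where 2: "[b] @ bmon x' y' z' \<unlhd> bmon x2 y2 z2" using bset_bmon by fastforce
  have "(b # bs) @ bmon x y z \<unlhd> bmon x2 y2 z2" using prp_trans[OF 1 2] by simp
  then show ?case by blast
qed

definition bases :: "ext_gen list set" where "bases = {[], [Ga1], [Ga2], [Gc1], [Gc2], [Ga1, Gc2]}"

text \<open>The multiplication table of the six bases: a generator times a base is a multiple of a
  base followed by letters b. Where the product is zero, as for a1 a1 c2, the target may be chosen
  freely.\<close>

lemma gen_base: assumes \<beta>: "\<beta> \<in> bases" shows "\<exists>\<beta>'\<in>bases. \<exists>bs. set bs \<subseteq> bset \<and> g # \<beta> \<unlhd> \<beta>' @ bs"
proof (cases "g \<in> bset")
  case True
  then show ?thesis using swap_list[OF True] \<beta> by (intro bexI[of _ \<beta>] exI[of _ "[g]"]) auto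
next
  case False
  have I: "\<beta>' \<in> bases \<Longrightarrow> set bs \<subseteq> bset \<Longrightarrow> g # \<beta> \<unlhd> \<beta>' @ bs \<Longrightarrow> ?thesis" for \<beta>' bs by blast
  have pr: "u \<unlhd> v \<Longrightarrow> v \<unlhd> w \<Longrightarrow> u \<unlhd> w" for u v w by (rule prp_trans)
  have 1: "[Ga1, Gc1] \<unlhd> [Ga2, Gb1]" "[Ga2, Gc2] \<unlhd> [Ga1, Gb2]" "[Gc1, Gc2] \<unlhd> [Gb1, Gb2]" "[Gc2, Gc1] \<unlhd> [Gc1, Gc2]"
     "[Gc1, Ga1] \<unlhd> [Ga1, Gc1]" "[Gc1, Ga2] \<unlhd> [Gc2, Ga1]" "[Gc2, Ga1] \<unlhd> [Ga1, Gc2]" "[Gc2, Ga2] \<unlhd> [Ga2, Gc2]"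
     "[Ga2, Gc1] \<unlhd> [Gc1, Ga2]" "[Gc1, Gc1] \<unlhd> [Gb1, Gc2]" "[Gc2, Gc2] \<unlhd> [Gb2, Gc1]"
    by ((rule proportional(1), simp; fail) | (rule proportional(2), simp; fail))+
  have 2: "[Gc1, Gc1] \<unlhd> [Gc2, Gb1]" "[Gc2, Gc2] \<unlhd> [Gc1, Gb2]" "[Gb1, Gc2] \<unlhd> [Gc2, Gb1]"
    using pr[OF 1(10) swap] pr[OF 1(11) swap] swap by simp_all
  have 3: "[Gc1, Ga2] \<unlhd> [Ga1, Gc2]" "[Ga2, Gc1] \<unlhd> [Ga1, Gc2]" "[Gc1, Ga1] \<unlhd> [Ga2, Gb1]" "[Gc2, Ga2] \<unlhd> [Ga1, Gb2]" "[Gc2, Gc1] \<unlhd> [Gb1, Gb2]"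
    by (fact pr[OF 1(6) 1(7)] pr[OF 1(9) pr[OF 1(6) 1(7)]] pr[OF 1(5) 1(1)] pr[OF 1(8) 1(2)] pr[OF 1(4) 1(3)])+
  have 4: "[Ga1, Ga1, Gc2] \<unlhd> v @ [Gc2]" "[Ga2, Ga1, Gc2] \<unlhd> v @ [Gc2]" for v
    using prp_right[OF zero_words(1)[of v], of "[Gc2]"] prp_right[OF zero_words(4)[of v], of "[Gc2]"] by simp_all
  have 5: "[Gc1, Ga1, Gc2] \<unlhd> [Ga1, Gb2, Gb1]"
  proof -
    have "[Gc1, Ga1, Gc2] \<unlhd> [Ga2, Gb1, Gc2]" using prp_right[OF 3(3), of "[Gc2]"] by simp
    also have "\<dots> \<unlhd> [Ga2, Gc2, Gb1]" using prp_left[OF 2(3), of "[Ga2]"] by simp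
    also have "\<dots> \<unlhd> [Ga1, Gb2, Gb1]" using prp_right[OF 1(2), of "[Gb1]"] by simp
    finally show ?thesis .
  qed
  have 6: "[Gc2, Ga1, Gc2] \<unlhd> [Ga2, Gb1, Gb2]"
  proof -
    have "[Gc2, Ga1, Gc2] \<unlhd> [Ga1, Gc2, Gc2]" using prp_right[OF 1(7), of "[Gc2]"] by simp
    also have "\<dots> \<unlhd> [Ga1, Gc1, Gb2]" using prp_left[OF 2(2), of "[Ga1]"] by simp
    also have "\<dots> \<unlhd> [Ga2, Gb1, Gb2]" using prp_right[OF 1(1), of "[Gb2]"] by simp
    finally show ?thesis .
  qed
  consider "g = Ga1" | "g = Ga2" | "g = Gc1" | "g = Gc2" using False by (cases g) auto
  then show ?thesis
  proof cases
    case 1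
    note a = I[unfolded 1]
    show ?thesis
      using \<beta> a[of "[Ga1]" "[]"] a[of "[]" "[]"] a[of "[Ga2]" "[Gb1]"] a[of "[Ga1, Gc2]" "[]"] a[of "[Gc2]" "[]"]
        prp_refl[of "[Ga1]"] prp_refl[of "[Ga1, Gc2]"] zero_words[of "[]"] \<open>[Ga1, Gc1] \<unlhd> [Ga2, Gb1]\<close> 4[of "[]"]
      unfolding 1 by (auto simp: bases_def)
  next
    case 2
    note a = I[unfolded 2]
    show ?thesis
      using \<beta> a[of "[Ga2]" "[]"] a[of "[]" "[]"] a[of "[Ga1]" "[Gb2]"] a[of "[Ga1, Gc2]" "[]"] a[of "[Gc2]" "[]"]
        prp_refl[of "[Ga2]"] zero_words[of "[]"] \<open>[Ga2, Gc2] \<unlhd> [Ga1, Gb2]\<close> 3 4[of "[]"]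
      unfolding 2 by (auto simp: bases_def)
  next
    case g: 3
    note a = I[unfolded g]
    show ?thesis
      using \<beta> a[of "[Gc1]" "[]"] a[of "[Ga2]" "[Gb1]"] a[of "[Ga1, Gc2]" "[]"] a[of "[Gc2]" "[Gb1]"]
        a[of "[]" "[Gb1, Gb2]"] a[of "[Ga1]" "[Gb2, Gb1]"] prp_refl[of "[Gc1]"] 1(3) 2 3 5
      unfolding g by (auto simp: bases_def)
  next
    case g: 4
    note a = I[unfolded g]
    show ?thesis
      using \<beta> a[of "[Gc2]" "[]"] a[of "[Ga1, Gc2]" "[]"] a[of "[Ga1]" "[Gb2]"] a[of "[Gc1]" "[Gb2]"]
        a[of "[]" "[Gb1, Gb2]"] a[of "[Ga2]" "[Gb1, Gb2]"] prp_refl[of "[Gc2]"] 1(7) 2 3 6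
      unfolding g by (auto simp: bases_def)
  qed
qed

lemma word_normal: "\<exists>\<beta>\<in>bases. \<exists>x y z. l \<unlhd> \<beta> @ bmon x y z"
proof (induction l)
  case Nil
  show ?case by (rule bexI[of _ "[]"], intro exI[of _ 0]) (simp_all add: bmon_def prp_refl bases_def)
next
  case (Cons g l)
  then obtain \<beta> x y z where \<beta>: "\<beta> \<in> bases" "l \<unlhd> \<beta> @ bmon x y z" by blast
  obtain \<beta>' bs where b: "\<beta>' \<in> bases" "set bs \<subseteq> bset" "g # \<beta> \<unlhd> \<beta>' @ bs" using gen_base[OF \<beta>(1)] by blast
  obtain x' y' z' where m: "bs @ bmon x y z \<unlhd> bmon x' y' z'" using bset_bmon_list[OF b(2)] by blast
  have "g # l \<unlhd> g # \<beta> @ bmon x y z" using prp_left[OF \<beta>(2), of "[g]"] by simp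
  also have "\<dots> \<unlhd> \<beta>' @ bs @ bmon x y z" using prp_right[OF b(3), of "bmon x y z"] by simp
  also have "\<dots> \<unlhd> \<beta>' @ bmon x' y' z'" using prp_left[OF m] .
  finally show ?case using b(1) by blast
qed

section \<open>Normal words indexed by the positions that occur in the resolution\<close>

definition valid :: "(nat \<times> nat \<times> nat) set" where "valid = {(i, l, j). (i + l) mod 3 \<le> 1}"

fun base :: "nat \<Rightarrow> nat \<Rightarrow> ext_gen list" where
  "base r t = (if r = 0 \<and> t = 1 then [Ga1] else if r = 1 \<and> t = 0 then [Ga2] else if r = 1 \<and> t = 2 then [Gc1]
    else if r = 2 \<and> t = 1 then [Gc2] else if r = 2 \<and> t = 2 then [Ga1, Gc2] else [])"

text \<open>The residues of i and l select the base, the quotients the powers of the b. Since b1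
  raises l and b2 raises i by 3, the quotient of l comes first.\<close>

definition nfw :: "nat \<times> nat \<times> nat \<Rightarrow> ext_gen list" where
  "nfw t = (case t of (i, l, j) \<Rightarrow> base (i mod 3) (l mod 3) @ bmon (l div 3) (i div 3) j)"

lemma word_nfw: "\<exists>t\<in>valid. l \<unlhd> nfw t"
proof -
  obtain \<beta> x y z where \<beta>: "\<beta> \<in> bases" "l \<unlhd> \<beta> @ bmon x y z" using word_normal by blast
  have "\<exists>t\<in>valid. nfw t = \<beta> @ bmon x y z"
  proof -
    have ex: "\<exists>t\<in>valid. nfw t = base r s @ bmon x y z" if rs: "r < 3" "s < 3" "(r + s) mod 3 \<le> 1" for r s
    proof (rule bexI[of _ "(r + 3 * y, s + 3 * x, z)"])
      have "(r + 3 * y) mod 3 = r" "(r + 3 * y) div 3 = y" "(s + 3 * x) mod 3 = s" "(s + 3 * x) div 3 = x"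
        using rs by simp_all
      then show "nfw (r + 3 * y, s + 3 * x, z) = base r s @ bmon x y z" by (simp only: nfw_def prod.case)
      have "(r + 3 * y + (s + 3 * x)) mod 3 = (r + s) mod 3" by presburger
      then show "(r + 3 * y, s + 3 * x, z) \<in> valid" using rs(3) by (simp only: valid_def mem_Collect_eq prod.case)
    qed
    consider "\<beta> = base 0 0" | "\<beta> = base 0 1" | "\<beta> = base 1 0" | "\<beta> = base 1 2" | "\<beta> = base 2 1" | "\<beta> = base 2 2"
      using \<beta>(1) by (auto simp: bases_def)
    then show ?thesis
      by cases (use ex[of 0 0] ex[of 0 1] ex[of 1 0] ex[of 1 2] ex[of 2 1] ex[of 2 2] in \<open>simp_all del: base.simps\<close>)
  qed
  then show ?thesis using \<beta>(2) by metis
qed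

lemma normal_form: "\<exists>S k. finite S \<and> S \<subseteq> valid \<and> r - (\<Sum>t\<in>S. scal (k t) * wmon (nfw t)) \<in> EI"
proof (induction r rule: free_algebra_induct)
  case zero show ?case by (rule exI[of _ "{}"]) (simp add: relation_ideal_closed)
next
  case (single w c)
  obtain l where w: "w = Word l" by (cases w)
  obtain t k where t: "t \<in> valid" and k: "wmon l - scal k * wmon (nfw t) \<in> EI" using word_nfw[of l] unfolding prp_def by blast
  have "scal c * (wmon l - scal k * wmon (nfw t)) \<in> EI" by (rule relation_ideal_closed(4)[OF k])
  then have "Poly_Mapping.single w c - (\<Sum>t\<in>{t}. scal (c * k) * wmon (nfw t)) \<in> EI"
    by (simp add: w single_wmon right_diff_distrib scal_simps mult.assoc)
  then show ?case using t by (intro exI[of _ "{t}"] exI[of _ "\<lambda>_. c * k"]) simp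
next
  case (add r s)
  obtain S k where S: "finite S" "S \<subseteq> valid" "r - (\<Sum>t\<in>S. scal (k t) * wmon (nfw t)) \<in> EI" using add(1) by blast
  obtain S' k' where S': "finite S'" "S' \<subseteq> valid" "s - (\<Sum>t\<in>S'. scal (k' t) * wmon (nfw t)) \<in> EI" using add(2) by blast
  have ext: "(\<Sum>t\<in>S. scal (k t) * wmon (nfw t)) = (\<Sum>t\<in>S \<union> S'. scal (if t \<in> S then k t else 0) * wmon (nfw t))"
    "(\<Sum>t\<in>S'. scal (k' t) * wmon (nfw t)) = (\<Sum>t\<in>S \<union> S'. scal (if t \<in> S' then k' t else 0) * wmon (nfw t))"
    by (rule sum.mono_neutral_cong_left; use S(1) S'(1) in \<open>simp add: scal_simps\<close>)+
  define kk where "kk t = (if t \<in> S then k t else 0) + (if t \<in> S' then k' t else 0)" for t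
  have eq: "(r - (\<Sum>t\<in>S. scal (k t) * wmon (nfw t))) + (s - (\<Sum>t\<in>S'. scal (k' t) * wmon (nfw t)))
      = r + s - (\<Sum>t\<in>S \<union> S'. scal (kk t) * wmon (nfw t))"
    unfolding ext kk_def scal_simps(1) distrib_right sum.distrib by simp
  have "r + s - (\<Sum>t\<in>S \<union> S'. scal (kk t) * wmon (nfw t)) \<in> EI"
    using relation_ideal_closed(2)[OF S(3) S'(3)] unfolding eq .
  then show ?case using S S' by (intro exI[of _ "S \<union> S'"] exI[of _ kk]) simp
qed

section \<open>Linear independence of the normal words\<close>

abbreviation corner :: "'k chn \<Rightarrow> 'k" where "corner f \<equiv> f 0 0 0 T0 T0 T0"

fun pos :: "nat \<times> nat \<times> nat \<Rightarrow> ext_gen list \<Rightarrow> nat \<times> nat \<times> nat" where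
  "pos t [] = t"
| "pos (i, l, j) (g # gs) = pos (i + fst (ghi g), l + fst (snd (ghi g)), j + snd (snd (ghi g))) gs"

lemma norm_coeff_nz: "norm_coeff g \<noteq> 0" "ip \<noteq> 0" using p_nz by (cases g; simp add: ip_def)+

lemma crn_lop:
  "crn (lop g f) (i, l, j) = (if (i + l) mod 3 = 0 \<or> (i + l) mod 3 = 1 \<and> ext_gen_degree g = 2 then
     norm_coeff g * ip ^ (ht g * (i + 3 * j)) * crn f (pos (i, l, j) [g]) else 0)"
  by (simp add: crn_def lop_corner)

text \<open>A generator of degree 2 changes i + l by a multiple of 3. So it keeps positions valid,
  and on constant coefficients it acts as a shift with a nonzero scalar.\<close>

lemma even_word_corner:
  assumes "\<forall>g\<in>set gs. ext_gen_degree g = 2" "t \<in> valid"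
  shows "\<exists>k. k \<noteq> 0 \<and> (\<forall>f. crn (foldr lop gs f) t = k * crn f (pos t gs))"
  using assms
proof (induction gs arbitrary: t)
  case Nil show ?case by (rule exI[of _ 1]) simp
next
  case (Cons g gs)
  obtain i l j where t: "t = (i, l, j)" by (cases t)
  have g: "ext_gen_degree g = 2" using Cons.prems by simp
  have m: "(i + l) mod 3 = 0 \<or> (i + l) mod 3 = 1" using Cons.prems(2) by (auto simp: valid_def t)
  have "(fst (ghi g) + fst (snd (ghi g))) mod 3 = 0" using g by (cases g) simp_all
  then have "pos t [g] \<in> valid" using Cons.prems(2) unfolding t valid_def by simp presburger
  then obtain k where k: "k \<noteq> 0" "\<forall>f. crn (foldr lop gs f) (pos t [g]) = k * crn f (pos (pos t [g]) gs)"
    using Cons.IH Cons.prems(1) by (metis list.set_intros(2))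
  have "pos (pos t [g]) gs = pos t (g # gs)" by (simp add: t)
  then have "crn (foldr lop (g # gs) f) t = (norm_coeff g * ip ^ (ht g * (i + 3 * j)) * k) * crn f (pos t (g # gs))" for f
    using k(2) m g unfolding foldr_Cons comp_apply t crn_lop by auto
  then show ?case using k(1) norm_coeff_nz by (intro exI[of _ "norm_coeff g * ip ^ (ht g * (i + 3 * j)) * k"]) simp
qed

lemma pos_replicate:
  "pos (i, l, j) (replicate n Gb1 @ gs) = pos (i, l + 3 * n, j) gs"
  "pos (i, l, j) (replicate n Gb2 @ gs) = pos (i + 3 * n, l, j) gs"
  "pos (i, l, j) (replicate n Gby @ gs) = pos (i, l, j + n) gs"
  by (induction n arbitrary: i l j) (simp_all add: ac_simps)

lemma pos_bmon: "pos (i, l, j) (bmon x y z) = (i + 3 * y, l + 3 * x, j + z)"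
  using pos_replicate(3)[of _ _ j z "[]"] by (simp add: bmon_def pos_replicate)

lemma act_wmon: "L.act (wmon gs) f = foldr lop gs f"
  by (simp add: wmon_def L.act_single)

text \<open>A letter of degree 1 occurs in a normal word only in front. It therefore acts last and
  is evaluated at (0, 0, 0), where it does not vanish; every other letter has degree 2.\<close>

lemma nfw_corner: assumes "t \<in> valid" shows "\<exists>k. k \<noteq> 0 \<and> (\<forall>f. corner (L.act (wmon (nfw t)) f) = k * crn f t)"
proof -
  obtain i l j where t: "t = (i, l, j)" by (cases t)
  define r s where "r = i mod 3" and "s = l mod 3"
  let ?m = "bmon (l div 3) (i div 3) j"
  have c: "corner f = crn f (0, 0, 0)" for f by (simp add: crn_def)
  have v0: "(0, 0, 0) \<in> valid" "(0, 1, 0) \<in> valid" "(1, 0, 0) \<in> valid" by (simp_all add: valid_def)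
  have bm: "\<forall>g\<in>set ?m. ext_gen_degree g = 2" by (auto simp: bmon_def)
  have n: "nfw t = base r s @ ?m" by (simp add: nfw_def t r_def s_def)
  have rs: "r + 3 * (i div 3) = i" "s + 3 * (l div 3) = l" by (simp_all add: r_def s_def)
  have odd: "\<exists>k. k \<noteq> 0 \<and> (\<forall>f. corner (L.act (wmon (g # gs)) f) = k * crn f t)"
    if g: "g \<in> {Ga1, Ga2}" and gs: "\<forall>g\<in>set gs. ext_gen_degree g = 2" and p: "pos (0, 0, 0) (g # gs) = t" for g gs
  proof -
    have "pos (0, 0, 0) [g] \<in> valid" using g v0 by auto
    then obtain k where k: "k \<noteq> 0" "\<forall>f. crn (foldr lop gs f) (pos (0, 0, 0) [g]) = k * crn f (pos (pos (0, 0, 0) [g]) gs)"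
      using even_word_corner[OF gs] by blast
    have "pos (pos (0, 0, 0) [g]) gs = t" using p by simp
    then have "corner (L.act (wmon (g # gs)) f) = k * crn f t" for f
      using k(2) g unfolding act_wmon foldr_Cons comp_apply c crn_lop by auto
    then show ?thesis using k(1) by blast
  qed
  have even: "\<exists>k. k \<noteq> 0 \<and> (\<forall>f. corner (L.act (wmon gs) f) = k * crn f t)"
    if gs: "\<forall>g\<in>set gs. ext_gen_degree g = 2" and p: "pos (0, 0, 0) gs = t" for gs
    using even_word_corner[OF gs v0(1)] p by (simp only: act_wmon c)
  have rs3: "r < 3" "s < 3" "(r + s) mod 3 \<le> 1"
  proof -
    have "(r + s) mod 3 = (i + l) mod 3" unfolding r_def s_def by presburger
    then show "(r + s) mod 3 \<le> 1" using assms by (simp add: valid_def t)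
  qed (simp_all add: r_def s_def)
  have "r \<in> {0, 1, 2}" "s \<in> {0, 1, 2}" using rs3 by auto
  then consider "(r, s) = (0, 0)" | "(r, s) = (0, 1)" | "(r, s) = (1, 0)" | "(r, s) = (1, 2)" | "(r, s) = (2, 1)" | "(r, s) = (2, 2)"
    using rs3(3) by auto
  note rs_cases = this
  then have "pos (0, 0, 0) (base r s @ ?m) = (r + 3 * (i div 3), s + 3 * (l div 3), j)"
    by cases (simp_all add: pos_bmon)
  then have p: "pos (0, 0, 0) (base r s @ ?m) = t" by (simp only: rs t)
  have o: "\<exists>k. k \<noteq> 0 \<and> (\<forall>f. corner (L.act (wmon (nfw t)) f) = k * crn f t)"
    if "base r s = g # gs" "g \<in> {Ga1, Ga2}" "\<forall>g\<in>set gs. ext_gen_degree g = 2" for g gs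
    unfolding n that(1) append_Cons
    by (rule odd[OF that(2)]) (use that(1,3) bm p in auto)
  have e: "\<exists>k. k \<noteq> 0 \<and> (\<forall>f. corner (L.act (wmon (nfw t)) f) = k * crn f t)"
    if "\<forall>g\<in>set (base r s). ext_gen_degree g = 2"
    unfolding n by (rule even[OF _ p]) (use that bm in \<open>unfold set_append, blast\<close>)
  show ?thesis using rs_cases by cases (use o e in simp_all)
qed

lemma idx_valid: "idx n \<subseteq> valid"
proof
  fix t assume t: "t \<in> idx n"
  obtain i l j where e: "t = (i, l, j)" by (cases t)
  then have "i + l + 3 * j = wt n" using t by (simp add: idx_def)
  then show "t \<in> valid" using wt_pos_mod[of i l j n] by (cases "even n") (simp_all add: valid_def e)
qed

lemma valid_idx: assumes "t \<in> valid" shows "\<exists>n. t \<in> idx n"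
proof -
  obtain i l j where e: "t = (i, l, j)" by (cases t)
  have m: "(i + l) mod 3 \<le> 1" using assms by (simp add: valid_def e)
  \<comment> \<open>A position of weight 3 a + b with b <= 1 belongs to the homological degree 2 a +
    b.\<close>
  define a b where "a = (i + l + 3 * j) div 3" and "b = (i + l + 3 * j) mod 3"
  have ab: "i + l + 3 * j = 3 * a + b" by (simp add: a_def b_def)
  have "b = (i + l) mod 3" unfolding b_def by (rule mod_mult_self2)
  then have "b = 0 \<or> b = 1" using m by arith
  then have "wt (2 * a + b) = 3 * a + b" by (auto simp: wt_def)
  then show ?thesis using ab by (intro exI[of _ "2 * a + b"]) (simp add: e idx_def)
qed

lemma crn_Wt: "crn (Wt t) t' = (if t' = t then 1 else 0)"
  by (auto simp: crn_def Wt_def v1_corner)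

lemma crn_other: "f \<in> Qc n \<Longrightarrow> t \<in> idx m \<Longrightarrow> m \<noteq> n \<Longrightarrow> crn f t = 0"
  using QcD[of f n "fst t" "fst (snd t)" "snd (snd t)"] wt_inj[of m n] by (auto simp: crn_def idx_def)

lemma corner_linear: "corner (f + g) = corner f + corner g" "corner (sc c f) = c * corner f" "corner (0 :: 'k chn) = 0"
  by (simp_all add: sc_def)

lemma corner_combination:
  assumes "finite S" "\<And>t. t \<in> S \<Longrightarrow> corner (L.act (wmon (nfw t)) f) = lam t * crn f t"
  shows "corner (L.act (\<Sum>t\<in>S. scal (k t) * wmon (nfw t)) f) = (\<Sum>t\<in>S. k t * lam t * crn f t)"
  using assms
proof (induction S rule: finite_induct)
  case empty show ?case by (simp only: sum.empty L.act_zero corner_linear)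
next
  case (insert t S)
  have "corner (L.act (\<Sum>t\<in>S. scal (k t) * wmon (nfw t)) f) = (\<Sum>t\<in>S. k t * lam t * crn f t)" using insert by blast
  then show ?case unfolding sum.insert[OF insert(1,2)] L.act_add L.act_mult L.act_scal corner_linear
    using insert.prems[of t] by (simp add: mult.assoc)
qed

text \<open>Evaluated on the basis symbol at t, the combination returns \<open>k t\<close> times a
  nonzero scalar.\<close>

lemma independent:
  assumes S: "finite S" "S \<subseteq> valid"
    and z: "\<And>n f. f \<in> Qc n \<Longrightarrow> corner (L.act (\<Sum>t\<in>S. scal (k t) * wmon (nfw t)) f) = 0"
  shows "(\<Sum>t\<in>S. scal (k t) * wmon (nfw t)) = 0"
proof -
  obtain lam where l: "\<And>t. t \<in> valid \<Longrightarrow> lam t \<noteq> 0 \<and> (\<forall>f. corner (L.act (wmon (nfw t)) f) = lam t * crn f t)"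
    using nfw_corner by metis
  have "k t = 0" if t: "t \<in> S" for t
  proof -
    obtain n where n: "t \<in> idx n" using valid_idx t S by blast
    have "0 = (\<Sum>t'\<in>S. k t' * lam t' * crn (Wt t) t')"
      using corner_combination[OF S(1), of "Wt t" lam k] z[OF Wt_Qc[OF n]] l S(2) by auto
    also have "\<dots> = (\<Sum>t'\<in>S. if t' = t then k t * lam t else 0)" by (rule sum.cong) (simp_all add: crn_Wt)
    also have "\<dots> = k t * lam t" using S(1) t by (simp add: sum.delta)
    finally show "k t = 0" using l[of t] t S(2) by auto
  qed
  then show ?thesis by (intro sum.neutral ballI) (simp add: scal_simps)
qed

end

context a2_twist begin

lemma pair_corner: "corner (L.act (gen g * gen h) f) = crn (lop g (lop h f)) (0, 0, 0)"
  by (simp add: L.act_mult crn_def)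

text \<open>The two words of a relation lead to the same position, so only powers of p have to be
  compared. In a product of two letters of degree 1 the second is evaluated where i + l = 1 mod 3,
  and there it vanishes.\<close>

lemma erels_corner: assumes "r \<in> erels" shows "corner (L.act r f) = 0"
proof -
  have sub: "corner (L.act (r - s) f) = corner (L.act r f) - corner (L.act s f)" for r s by (simp add: L.act_diff)
  have s3: "scal k * r * s = scal k * (r * s)" for k and r s :: "ext_gen word \<Rightarrow>\<^sub>0 'k" by (rule mult.assoc)
  have sm: "corner (L.act (scal k * r) f) = k * corner (L.act r f)" for k r by (simp add: L.act_mult sc_def)
  show ?thesis
    by (insert assms[unfolded erels_eq]; elim insertE emptyE; simp only: sub s3 sm power2_eq_square pair_corner;
      simp add: crn_lop; (simp add: ip_def p_nz eval_nat_numeral field_simps)?)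
qed

end

section \<open>The isomorphism\<close>

context a2_twist begin

lemma act_minus_right: "N.act r (f - g) = N.act r f - N.act r g"
proof -
  have "N.act r (f - g) + N.act r g = N.act r f" by (simp add: N.act_linear[symmetric])
  then show ?thesis by (simp add: algebra_simps)
qed

lemma corner_hom: "(\<lambda>f\<in>Qc n. corner (L.act r f)) \<in> left_hom NR (QM n) TN"
proof (rule left_homI)
  fix X x assume "X \<in> carrier NR" "x \<in> carrier (QM n)"
  then obtain s where s: "X = pclass nrels s" "x \<in> Qc n" by (auto simp: NR_simps)
  then show "(\<lambda>f\<in>Qc n. corner (L.act r f)) (X \<odot>\<^bsub>QM n\<^esub> x) = X \<odot>\<^bsub>TN\<^esub> (\<lambda>f\<in>Qc n. corner (L.act r f)) x"
    by (simp add: ract_pclass act_Qc trivial_smult act_L_N act_corner)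
next
  fix x y assume "x \<in> carrier (QM n)" "y \<in> carrier (QM n)"
  then show "(\<lambda>f\<in>Qc n. corner (L.act r f)) (x \<oplus>\<^bsub>QM n\<^esub> y) = (\<lambda>f\<in>Qc n. corner (L.act r f)) x \<oplus>\<^bsub>TN\<^esub> (\<lambda>f\<in>Qc n. corner (L.act r f)) y"
    by (simp add: trivial_simps Qc_closed L.act_linear del: plus_fun_apply) (simp add: plus_fun_apply)
qed (simp_all add: trivial_simps)

lemma shift_hom: "(\<lambda>f\<in>Qc (k + i). resw i (L.act s f)) \<in> left_hom NR (QM (k + i)) (QM i)"
proof (rule left_homI)
  fix X x assume "X \<in> carrier NR" "x \<in> carrier (QM (k + i))"
  then obtain r where r: "X = pclass nrels r" "x \<in> Qc (k + i)" by (auto simp: NR_simps)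
  then show "(\<lambda>f\<in>Qc (k + i). resw i (L.act s f)) (X \<odot>\<^bsub>QM (k + i)\<^esub> x) = X \<odot>\<^bsub>QM i\<^esub> (\<lambda>f\<in>Qc (k + i). resw i (L.act s f)) x"
    by (simp add: ract_pclass act_Qc act_L_N resw_act)
next
  fix x y assume "x \<in> carrier (QM (k + i))" "y \<in> carrier (QM (k + i))"
  then show "(\<lambda>f\<in>Qc (k + i). resw i (L.act s f)) (x \<oplus>\<^bsub>QM (k + i)\<^esub> y) =
      (\<lambda>f\<in>Qc (k + i). resw i (L.act s f)) x \<oplus>\<^bsub>QM i\<^esub> (\<lambda>f\<in>Qc (k + i). resw i (L.act s f)) y"
    by (simp add: Qc_closed L.act_linear resw_linear del: plus_fun_apply)
qed (simp_all add: resw)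

lemma eventually_zero: "\<exists>N. \<forall>n>N. \<forall>f\<in>Qc n. corner (L.act r f) = 0"
proof (induction r rule: free_algebra_induct)
  case zero show ?case by (simp only: L.act_zero corner_linear) simp
next
  case (add r s)
  obtain N N' where N: "\<And>n f. n > N \<Longrightarrow> f \<in> Qc n \<Longrightarrow> corner (L.act r f) = 0"
    "\<And>n f. n > N' \<Longrightarrow> f \<in> Qc n \<Longrightarrow> corner (L.act s f) = 0" using add by blast
  have "corner (L.act (r + s) f) = 0" if n: "n > max N N'" and f: "f \<in> Qc n" for n f
    using N(1)[OF _ f] N(2)[OF _ f] n by (simp add: L.act_add)
  then show ?case by blast
next
  case (single w c)
  have "corner (foldr lop (letters w) f) = 0" if n: "n > degw (letters w)" and f: "f \<in> Qc n" for n f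
  proof -
    have "foldr lop (letters w) f \<in> Qc (n - degw (letters w))" by (rule foldr_lop_Qc) (use n f in simp)
    moreover have "wt (n - degw (letters w)) \<noteq> wt 0" using n wt_inj by simp
    ultimately show ?thesis using QcD[of _ _ 0 0 0] by (simp add: wt_def)
  qed
  then show ?case unfolding L.act_single corner_linear by (intro exI[of _ "degw (letters w)"]) simp
qed

lemma gen_corner: assumes "f \<in> Qc n" "n \<noteq> ext_gen_degree g" shows "corner (L.act (gen g) f) = 0"
proof -
  have "pos (0, 0, 0) [g] \<in> idx (ext_gen_degree g)" by (cases g) (simp_all add: idx_def wt_def)
  then have "crn f (pos (0, 0, 0) [g]) = 0" using crn_other assms by blast
  then have "crn (lop g f) (0, 0, 0) = 0" unfolding crn_lop by simp
  then show ?thesis by (simp add: crn_def)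
qed

lemma TN_minus: "x \<ominus>\<^bsub>TN\<^esub> y = x - y"
proof -
  interpret TN: left_module NR TN by (rule trivial_NR)
  have "\<ominus>\<^bsub>TN\<^esub> y = - y" by (rule TN.M.minus_equality) (simp_all add: trivial_simps)
  then show ?thesis by (simp add: a_minus_def trivial_simps)
qed

end

section \<open>Transport to an arbitrary free resolution\<close>

locale a2_ext = a2_twist +
  fixes P :: "nat \<Rightarrow> ((nichols_gen word \<Rightarrow>\<^sub>0 'a) set, 'm) module" and d :: "nat \<Rightarrow> 'm \<Rightarrow> 'm" and e :: "'m \<Rightarrow> 'a"
    and \<phi> :: "nat \<Rightarrow> 'm \<Rightarrow> 'a chn" and \<psi> :: "nat \<Rightarrow> 'a chn \<Rightarrow> 'm"
  assumes resP: "free_resolution NR TN P d e"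
    and \<phi>: "\<phi> n \<in> left_hom NR (P n) (QM n)"
      "x \<in> carrier (P 0) \<Longrightarrow> corner (\<phi> 0 x) = e x"
      "x \<in> carrier (P (Suc n)) \<Longrightarrow> dQ n (\<phi> (Suc n) x) = \<phi> n (d n x)"
    and \<psi>: "\<psi> n \<in> left_hom NR (QM n) (P n)"
      "f \<in> Qc 0 \<Longrightarrow> e (\<psi> 0 f) = corner f"
      "f \<in> Qc (Suc n) \<Longrightarrow> d n (\<psi> (Suc n) f) = \<psi> n (dQ n f)"
begin

sublocale Pr: trivial_resolution NR P d e
  by (intro trivial_resolution.intro trivial_NR resP scalar_NR)

lemma \<phi>_Qc: "x \<in> carrier (P n) \<Longrightarrow> \<phi> n x \<in> Qc n" using left_homD(1)[OF \<phi>(1)] by simp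
lemma \<psi>_P: "f \<in> Qc n \<Longrightarrow> \<psi> n f \<in> carrier (P n)" using left_homD(1)[OF \<psi>(1)] by simp

lemma pullback: assumes g: "g \<in> left_hom NR (QM n) TN" shows "compose (carrier (P n)) g (\<phi> n) \<in> Pr.Z n"
proof -
  have "compose (carrier (P n)) g (\<phi> n) \<in> left_hom NR (P n) TN"
    by (rule left_hom_compose[OF Pr.res(2) \<phi>(1) g])
  moreover have "compose (carrier (P n)) g (\<phi> n) (d n x) = 0" if x: "x \<in> carrier (P (Suc n))" for x
    using hom_dQ[OF g \<phi>_Qc[OF x]] Pr.d_closed[OF x] by (simp add: compose_eq \<phi>(3)[OF x])
  ultimately show ?thesis by (simp add: cocycles_def trivial_simps)
qed

text \<open>The round trip minus the identity is a chain map over zero, so its composite with g is a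
  coboundary. On the minimal resolution this is zero, and the equality is exact.\<close>

lemma \<phi>_\<psi>: assumes g: "g \<in> left_hom NR (QM n) TN" and f: "f \<in> Qc n" shows "g (\<phi> n (\<psi> n f)) = g f"
proof -
  define F where "F i = (\<lambda>x\<in>Qc i. \<phi> i (\<psi> i x) - x)" for i
  have Fx: "F i x = \<phi> i (\<psi> i x) - x" if "x \<in> Qc i" for i x using that by (simp add: F_def)
  have FQ: "F i x \<in> Qc i" if x: "x \<in> Qc i" for i x
    unfolding Fx[OF x] diff_conv_add_uminus by (intro Qc_closed \<phi>_Qc \<psi>_P x)
  have add: "\<phi> i (\<psi> i (x + y)) = \<phi> i (\<psi> i x) + \<phi> i (\<psi> i y)" if xy: "x \<in> Qc i" "y \<in> Qc i" for i x y
  proof -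
    have "\<psi> i (x + y) = \<psi> i x \<oplus>\<^bsub>P i\<^esub> \<psi> i y" using left_homD(3)[OF \<psi>(1)[of i], of x y] xy by (simp del: plus_fun_apply)
    then show ?thesis using left_homD(3)[OF \<phi>(1)[of i] \<psi>_P[OF xy(1)] \<psi>_P[OF xy(2)]] by (simp del: plus_fun_apply)
  qed
  have sm: "\<phi> i (\<psi> i (ract X x)) = ract X (\<phi> i (\<psi> i x))" if "X \<in> carrier NR" "x \<in> Qc i" for i X x
    using left_homD(4)[OF \<psi>(1)[of i], of X x] left_homD(4)[OF \<phi>(1)[of i] that(1) \<psi>_P[OF that(2)]] that by simp
  have Fh: "F i \<in> left_hom NR (QM i) (QM i)" for i
  proof (rule left_homI)
    fix x y assume "x \<in> carrier (QM i)" "y \<in> carrier (QM i)"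
    then have xy: "x \<in> Qc i" "y \<in> Qc i" by simp_all
    show "F i (x \<oplus>\<^bsub>QM i\<^esub> y) = F i x \<oplus>\<^bsub>QM i\<^esub> F i y"
      unfolding QM_simps Fx[OF xy(1)] Fx[OF xy(2)] Fx[OF Qc_closed(2)[OF xy]] add[OF xy] by (simp only: add_diff_add)
  next
    fix X x assume X: "X \<in> carrier NR" and "x \<in> carrier (QM i)"
    then obtain r where r: "X = pclass nrels r" and x: "x \<in> Qc i" by (auto simp: NR_simps)
    have rx: "ract X x \<in> Qc i" unfolding r ract_pclass by (rule act_Qc[OF x])
    show "F i (X \<odot>\<^bsub>QM i\<^esub> x) = X \<odot>\<^bsub>QM i\<^esub> F i x"
      unfolding QM_simps Fx[OF x] Fx[OF rx] sm[OF X x] unfolding r ract_pclass act_minus_right ..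
  qed (use FQ in \<open>simp_all add: F_def\<close>)
  have Fd: "dQ i (F (Suc i) x) = F i (dQ i x)" if x: "x \<in> Qc (Suc i)" for i x
    unfolding Fx[OF x] Fx[OF dQ_closed[OF x]] dQ_diff \<phi>(3)[OF \<psi>_P[OF x]] \<psi>(3)[OF x] ..
  have cob: "(\<lambda>x\<in>carrier (QM 0). eR (F 0 x)) \<in> coboundaries NR TN QM dR 0"
  proof -
    have "eR (F 0 x) = 0" if x: "x \<in> Qc 0" for x
      using FQ[OF x] \<phi>(2)[OF \<psi>_P[OF x]] \<psi>(2)[OF x] by (simp add: eR_def Fx[OF x])
    then have "(\<lambda>x\<in>carrier (QM 0). eR (F 0 x)) = (\<lambda>x\<in>carrier (QM 0). \<zero>\<^bsub>TN\<^esub>)"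
      by (intro restrict_ext) (simp add: trivial_simps)
    then show ?thesis by simp
  qed
  have "compose (carrier (QM (0 + n))) g (F n) \<in> coboundaries NR TN QM dR (0 + n)"
  proof (rule lift_of_coboundary[where n = 0 and F = F and f = g, OF trivial_NR resolution_QM _ _ cob Qr_cocycle[OF g]])
    show "F i \<in> left_hom NR (QM (0 + i)) (QM i)" for i using Fh by simp
    show "dR i (F (Suc i) x) = F i (dR (0 + i) x)" if "x \<in> carrier (QM (0 + Suc i))" for i x
      using that FQ[of x "Suc i"] Fd[of x i] by (simp add: dR_def)
  qed
  then have "g (F n f) = 0" using Qr_coboundary[of "compose (carrier (QM (0 + n))) g (F n)" "0 + n" f] f by (simp add: compose_eq)
  moreover have "g (F n f + f) = g (F n f) + g f"
    using left_homD(3)[OF g, of "F n f" f] FQ[OF f] f by (simp add: trivial_simps del: plus_fun_apply)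
  moreover have "F n f + f = \<phi> n (\<psi> n f)" unfolding Fx[OF f] by (rule diff_add_cancel)
  ultimately show ?thesis by simp
qed

text \<open>The same argument on the other side; P need not be minimal, so a coboundary
  remains.\<close>

lemma \<psi>_\<phi>: assumes z: "z \<in> Pr.Z n"
  shows "\<exists>b\<in>Pr.B n. \<forall>x\<in>carrier (P n). z (\<psi> n (\<phi> n x)) = z x + b x"
proof -
  define F where "F i = (\<lambda>x\<in>carrier (P i). compose (carrier (P i)) (\<psi> i) (\<phi> i) x \<ominus>\<^bsub>P i\<^esub> (\<lambda>x\<in>carrier (P i). x) x)" for i
  have Fx: "F i x = \<psi> i (\<phi> i x) \<ominus>\<^bsub>P i\<^esub> x" if "x \<in> carrier (P i)" for i x
    using that by (simp add: F_def compose_eq)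
  have "(\<lambda>x\<in>carrier (P i). x) \<in> left_hom NR (P i) (P i)" for i
  proof -
    interpret Pi: left_module NR "P i" by (rule Pr.res(2))
    show ?thesis by (rule left_homI) simp_all
  qed
  then have Fh: "F i \<in> left_hom NR (P i) (P i)" for i
    unfolding F_def by (intro left_hom_minus left_hom_compose[OF _ \<phi>(1) \<psi>(1)] Pr.res(2))
  have cl: "\<psi> i (\<phi> i x) \<in> carrier (P i)" if "x \<in> carrier (P i)" for i x by (intro \<psi>_P \<phi>_Qc that)
  have Fd: "d i (F (Suc i) x) = F i (d i x)" if x: "x \<in> carrier (P (Suc i))" for i x
    unfolding Fx[OF x] Fx[OF Pr.d_closed[OF x]] left_hom_diff[OF Pr.res(2) Pr.res(2) Pr.res(3) cl[OF x] x]
      \<psi>(3)[OF \<phi>_Qc[OF x]] \<phi>(3)[OF x] ..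
  have cob: "(\<lambda>x\<in>carrier (P 0). e (F 0 x)) \<in> Pr.B 0"
  proof -
    have "e (F 0 x) = 0" if x: "x \<in> carrier (P 0)" for x
      unfolding Fx[OF x] left_hom_diff[OF Pr.res(2) trivial_NR Pr.res(4) cl[OF x] x]
      using \<psi>(2)[OF \<phi>_Qc[OF x]] \<phi>(2)[OF x] by (simp add: TN_minus)
    then have "(\<lambda>x\<in>carrier (P 0). e (F 0 x)) = (\<lambda>x\<in>carrier (P 0). \<zero>\<^bsub>TN\<^esub>)"
      by (intro restrict_ext) (simp add: trivial_simps)
    then show ?thesis by simp
  qed
  have b: "compose (carrier (P (0 + n))) z (F n) \<in> Pr.B (0 + n)"
  proof (rule lift_of_coboundary[where n = 0 and F = F and f = z, OF trivial_NR resP _ _ cob z])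
    show "F i \<in> left_hom NR (P (0 + i)) (P i)" for i using Fh by simp
    show "d i (F (Suc i) x) = F i (d (0 + i) x)" if "x \<in> carrier (P (0 + Suc i))" for i x
      using that Fd[of x i] by simp
  qed
  have "z (\<psi> n (\<phi> n x)) = z x + compose (carrier (P (0 + n))) z (F n) x" if x: "x \<in> carrier (P n)" for x
  proof -
    have "z (F n x) = z (\<psi> n (\<phi> n x)) - z x"
      unfolding Fx[OF x] left_hom_diff[OF Pr.res(2) trivial_NR Pr.Z_hom[OF z] cl[OF x] x] by (rule TN_minus)
    then show ?thesis using x by (simp add: compose_eq)
  qed
  then show ?thesis using b by (intro bexI[of _ "compose (carrier (P (0 + n))) z (F n)"]) simp_all
qed

section \<open>The multiplicative map from the free algebra to Ext\<close>

definition coc :: "(ext_gen word \<Rightarrow>\<^sub>0 'a) \<Rightarrow> nat \<Rightarrow> 'm \<Rightarrow> 'a" where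
  "coc r n = compose (carrier (P n)) (\<lambda>f\<in>Qc n. corner (L.act r f)) (\<phi> n)"

definition H :: "(ext_gen word \<Rightarrow>\<^sub>0 'a) \<Rightarrow> nat \<Rightarrow> ('m \<Rightarrow> 'a) set" where "H r n = Pr.cl n (coc r n)"

lemma coc_Z: "coc r n \<in> Pr.Z n" unfolding coc_def by (rule pullback[OF corner_hom])

lemma coc_eq: "x \<in> carrier (P n) \<Longrightarrow> coc r n x = corner (L.act r (\<phi> n x))"
  by (simp add: coc_def compose_eq \<phi>_Qc)

lemma Pr_coboundary_\<psi>: assumes b: "b \<in> Pr.B n" and f: "f \<in> Qc n" shows "b (\<psi> n f) = 0"
proof (cases n)
  case 0 then show ?thesis using b \<psi>_P[OF f] by (simp add: trivial_simps)
next
  case (Suc m)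
  then obtain h where h: "h \<in> left_hom NR (P m) TN" "b = compose (carrier (P (Suc m))) h (d m)" using b by auto
  have f': "f \<in> Qc (Suc m)" using f Suc by simp
  have "b (\<psi> n f) = h (\<psi> m (dQ m f))"
    using \<psi>_P[OF f'] \<psi>(3)[OF f'] by (simp add: h(2) Suc compose_eq)
  also have "\<dots> = compose (carrier (QM m)) h (\<psi> m) (dQ m f)" using dQ_closed[OF f'] by (simp add: compose_eq)
  also have "\<dots> = 0" by (rule hom_dQ[OF left_hom_compose[OF left_module_QM \<psi>(1) h(1)] f'])
  finally show ?thesis .
qed

text \<open>Composing with \<psi> recovers the functional on the minimal resolution, and there the
  coboundaries of P restrict to zero. So classes are equal exactly when the functionals are.\<close>

lemma H_eq_iff: "H r n = H s n \<longleftrightarrow> (\<forall>f\<in>Qc n. corner (L.act r f) = corner (L.act s f))"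
proof
  assume "H r n = H s n"
  then obtain b where b: "b \<in> Pr.B n" "\<And>x. x \<in> carrier (P n) \<Longrightarrow> coc r n x = coc s n x + b x"
    unfolding H_def by (rule Pr.cl_eqD[OF coc_Z]) blast
  show "\<forall>f\<in>Qc n. corner (L.act r f) = corner (L.act s f)"
  proof
    fix f assume f: "f \<in> Qc n"
    have "coc r n (\<psi> n f) = corner (L.act r f)" for r
      using \<phi>_\<psi>[OF corner_hom f, of r] f by (simp add: coc_eq \<psi>_P \<phi>_Qc)
    then show "corner (L.act r f) = corner (L.act s f)" using b(2)[OF \<psi>_P[OF f]] Pr_coboundary_\<psi>[OF b(1) f] by simp
  qed
next
  assume eq: "\<forall>f\<in>Qc n. corner (L.act r f) = corner (L.act s f)"
  show "H r n = H s n" unfolding H_def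
    by (rule Pr.cl_eqI[OF coc_Z coc_Z Pr.B_0]) (use eq \<phi>_Qc in \<open>simp add: coc_eq\<close>)
qed

abbreviation XA where "XA \<equiv> ext_algebra NR TN P d e"

lemma XA_simps:
  "carrier XA = {X. (\<forall>n. X n \<in> carrier (Pr.E n)) \<and> finite {n. X n \<noteq> \<zero>\<^bsub>Pr.E n\<^esub>}}"
  "X \<otimes>\<^bsub>XA\<^esub> Y = (\<lambda>n. \<Oplus>\<^bsub>Pr.E n\<^esub>i\<in>{..n}. yoneda NR TN P d e i (n - i) (X i) (Y (n - i)))"
  "\<one>\<^bsub>XA\<^esub> = (\<lambda>n. if n = 0 then Pr.cl 0 e else \<zero>\<^bsub>Pr.E n\<^esub>)" "X \<oplus>\<^bsub>XA\<^esub> Y = (\<lambda>n. X n \<oplus>\<^bsub>Pr.E n\<^esub> Y n)"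
  "c \<odot>\<^bsub>XA\<^esub> X = (\<lambda>n. c \<odot>\<^bsub>Pr.E n\<^esub> X n)"
  by (simp_all add: ext_algebra_def Let_def)

lemma H_zero: "H 0 n = \<zero>\<^bsub>Pr.E n\<^esub>"
  unfolding H_def Pr.E_simps
  by (rule Pr.cl_eqI[OF coc_Z Pr.Z_closed(3) Pr.B_0]) (simp only: coc_eq L.act_zero corner_linear restrict_apply' add_0)

lemma H_zeroI: "(\<And>f. f \<in> Qc n \<Longrightarrow> corner (L.act r f) = 0) \<Longrightarrow> H r n = \<zero>\<^bsub>Pr.E n\<^esub>"
  unfolding H_zero[symmetric] H_eq_iff L.act_zero corner_linear by blast

lemma H_add: "H (r + s) = H r \<oplus>\<^bsub>XA\<^esub> H s"
proof
  fix n
  have "H (r + s) n = Pr.cl n (Pr.fadd n (coc r n) (coc s n))"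
    unfolding H_def by (rule Pr.cl_eqI[OF coc_Z Pr.Z_closed(1)[OF coc_Z coc_Z] Pr.B_0])
      (simp only: coc_eq L.act_add corner_linear restrict_apply' add_0_right)
  then show "H (r + s) n = (H r \<oplus>\<^bsub>XA\<^esub> H s) n" by (simp only: XA_simps H_def Pr.E_add[OF coc_Z coc_Z])
qed

lemma H_scal: "H (scal c * r) = c \<odot>\<^bsub>XA\<^esub> H r"
proof
  fix n
  have "H (scal c * r) n = Pr.cl n (Pr.fscale n c (coc r n))"
    unfolding H_def by (rule Pr.cl_eqI[OF coc_Z Pr.Z_closed(2)[OF coc_Z] Pr.B_0])
      (simp only: coc_eq L.act_mult L.act_scal corner_linear restrict_apply' add_0_right)
  then show "H (scal c * r) n = (c \<odot>\<^bsub>XA\<^esub> H r) n" by (simp only: XA_simps H_def Pr.E_smult[OF coc_Z])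
qed

lemma H_one: "H 1 = \<one>\<^bsub>XA\<^esub>"
proof
  fix n show "H 1 n = \<one>\<^bsub>XA\<^esub> n"
  proof (cases n)
    case 0
    have "coc 1 0 = e"
    proof (rule extensionalityI[of _ "carrier (P 0)"])
      show "coc 1 0 \<in> extensional (carrier (P 0))" by (rule Pr.Z_ext[OF coc_Z])
      show "e \<in> extensional (carrier (P 0))" by (rule left_homD(2)[OF Pr.res(4)])
    qed (simp add: coc_eq \<phi>(2))
    then show ?thesis using 0 by (simp add: XA_simps H_def)
  next
    case (Suc m)
    have "H 1 n = \<zero>\<^bsub>Pr.E n\<^esub>"
    proof (rule H_zeroI)
      fix f assume "f \<in> Qc n"
      moreover have "wt n \<noteq> wt 0" using Suc wt_inj by simp
      ultimately show "corner (L.act 1 f) = 0" using QcD[of f n 0 0 0] by (simp add: wt_def)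
    qed
    then show ?thesis using Suc by (simp add: XA_simps)
  qed
qed

lemma H_carrier: "H r \<in> carrier XA"
proof -
  obtain N where N: "\<And>n f. n > N \<Longrightarrow> f \<in> Qc n \<Longrightarrow> corner (L.act r f) = 0" using eventually_zero by blast
  have "{n. H r n \<noteq> \<zero>\<^bsub>Pr.E n\<^esub>} \<subseteq> {..N}"
  proof
    fix n assume "n \<in> {n. H r n \<noteq> \<zero>\<^bsub>Pr.E n\<^esub>}"
    then show "n \<in> {..N}" using H_zeroI[of n r, OF N] by (cases "N < n") auto
  qed
  then have "finite {n. H r n \<noteq> \<zero>\<^bsub>Pr.E n\<^esub>}" by (rule finite_subset) simp
  then show ?thesis using coc_Z by (simp add: XA_simps Pr.E_simps(1) H_def)
qed

text \<open>The action of s, transported by the comparison maps, is an explicit lift. The projection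
  picks the component of s that lowers the degree by k.\<close>

lemma coc_lift:
  "(\<lambda>i. compose (carrier (P (k + i))) (compose (carrier (QM (k + i))) (\<psi> i) (\<lambda>f\<in>Qc (k + i). resw i (L.act s f))) (\<phi> (k + i)))
    \<in> chain_lifts NR P d e k (coc s k)" (is "?F \<in> _")
proof -
  have F: "?F i x = \<psi> i (resw i (L.act s (\<phi> (k + i) x)))" if "x \<in> carrier (P (k + i))" for i x
    using that by (simp add: compose_eq \<phi>_Qc)
  have "?F i \<in> left_hom NR (P (k + i)) (P i)" for i
    by (intro left_hom_compose[OF Pr.res(2) \<phi>(1)] left_hom_compose[OF left_module_QM shift_hom] \<psi>(1))
  moreover have "e (?F 0 x) = coc s k x" if "x \<in> carrier (P k)" for x
    using that F[of x 0] \<psi>(2)[OF resw(1)] by (simp add: coc_eq) (simp add: resw_def res_def wt_def)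
  moreover have "d i (?F (Suc i) x) = ?F i (d (k + i) x)" if x: "x \<in> carrier (P (k + Suc i))" for i x
  proof -
    have x': "x \<in> carrier (P (Suc (k + i)))" using x by simp
    have "d i (?F (Suc i) x) = \<psi> i (dQ i (resw (Suc i) (L.act s (\<phi> (Suc (k + i)) x))))"
      unfolding F[OF x] \<psi>(3)[OF resw(1)] by simp
    also have "\<dots> = \<psi> i (resw i (L.act s (\<phi> (k + i) (d (k + i) x))))"
      unfolding act_resw_dQ[OF \<phi>_Qc[OF x']] \<phi>(3)[OF x'] ..
    finally show ?thesis unfolding F[OF Pr.d_closed[OF x']] .
  qed
  ultimately show ?thesis unfolding chain_lifts_def by blast
qed

text \<open>Composing \<open>coc r i\<close> with the lift puts \<phi> after \<psi> in the middle,
  which \<open>\<phi>_\<psi>\<close> removes. The summands of the product are then the components of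
  \<open>L.act s\<close>, and \<open>act_decompose\<close> adds them up.\<close>

lemma H_mult: "H (r * s) = H r \<otimes>\<^bsub>XA\<^esub> H s"
proof
  fix n
  define z where "z i = (\<lambda>x\<in>carrier (P n). corner (L.act r (resw i (L.act s (\<phi> n x)))))" for i
  have y: "z i \<in> Pr.Z n \<and> yoneda NR TN P d e i (n - i) (H r i) (H s (n - i)) = Pr.cl n (z i)" if i: "i \<le> n" for i
  proof -
    let ?F = "\<lambda>j. compose (carrier (P (n - i + j))) (compose (carrier (QM (n - i + j))) (\<psi> j) (\<lambda>f\<in>Qc (n - i + j). resw j (L.act s f))) (\<phi> (n - i + j))"
    have n: "n - i + i = n" using i by simp
    have "compose (carrier (P (n - i + i))) (coc r i) (?F i) = z i"
    proof (rule extensionalityI[of _ "carrier (P n)"])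
      fix x assume x: "x \<in> carrier (P n)"
      have R: "resw i (L.act s (\<phi> n x)) \<in> Qc i" by (rule resw(1))
      have "compose (carrier (P (n - i + i))) (coc r i) (?F i) x = coc r i (\<psi> i (resw i (L.act s (\<phi> n x))))"
        unfolding n using x by (simp add: compose_eq \<phi>_Qc)
      also have "\<dots> = corner (L.act r (\<phi> i (\<psi> i (resw i (L.act s (\<phi> n x))))))" by (rule coc_eq[OF \<psi>_P[OF R]])
      also have "\<dots> = corner (L.act r (resw i (L.act s (\<phi> n x))))"
        using \<phi>_\<psi>[OF corner_hom R, of r] R by (simp add: \<phi>_Qc \<psi>_P)
      also have "\<dots> = z i x" using x by (simp add: z_def)
      finally show "compose (carrier (P (n - i + i))) (coc r i) (?F i) x = z i x" .
    qed (simp_all add: n z_def compose_extensional)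
    then show ?thesis
      using Pr.yoneda_cl[OF coc_Z[of r i] coc_Z coc_lift[of "n - i" s]] Pr.cocycle_compose[OF coc_Z[of r i] coc_lift[of "n - i" s]]
      unfolding H_def n by simp
  qed
  have "(H r \<otimes>\<^bsub>XA\<^esub> H s) n = (\<Oplus>\<^bsub>Pr.E n\<^esub>i\<in>{..n}. Pr.cl n (z i))"
    unfolding XA_simps
    by (rule abelian_monoid.finsum_cong'[OF Pr.E_abelian_monoid refl]) (use y in \<open>auto simp: Pr.E_simps\<close>)
  also have "\<dots> = Pr.cl n (\<lambda>x\<in>carrier (P n). \<Sum>i\<in>{..n}. z i x)"
    using Pr.E_finsum[of "{..n}" z n] y by simp
  also have "(\<lambda>x\<in>carrier (P n). \<Sum>i\<in>{..n}. z i x) = coc (r * s) n"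
  proof (rule extensionalityI[of _ "carrier (P n)"])
    fix x assume x: "x \<in> carrier (P n)"
    have act_sum: "corner (L.act r (\<Sum>i\<in>S. f i)) = (\<Sum>i\<in>S. corner (L.act r (f i)))" if "finite S" for S and f :: "nat \<Rightarrow> 'a chn"
      using that
    proof (induction S rule: finite_induct)
      case empty show ?case by (simp only: sum.empty L.act_zero corner_linear)
    next
      case (insert a S) show ?case unfolding sum.insert[OF insert(1,2)] L.act_linear corner_linear insert(3) ..
    qed
    have "coc (r * s) n x = corner (L.act r (L.act s (\<phi> n x)))" using x by (simp add: coc_eq L.act_mult)
    also have "\<dots> = corner (L.act r (\<Sum>i\<le>n. resw i (L.act s (\<phi> n x))))" by (simp only: act_decompose[OF \<phi>_Qc[OF x], symmetric])
    also have "\<dots> = (\<Sum>i\<le>n. z i x)" using x by (simp add: act_sum z_def)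
    finally show "(\<lambda>x\<in>carrier (P n). \<Sum>i\<in>{..n}. z i x) x = coc (r * s) n x" using x by simp
  qed (use Pr.Z_ext[OF coc_Z] in simp_all)
  finally show "H (r * s) n = (H r \<otimes>\<^bsub>XA\<^esub> H s) n" by (simp only: H_def[of "r * s"])
qed

text \<open>The kernel is a two-sided ideal by multiplicativity, so only the relations themselves
  have to be tested, and these only on the constant coefficient at (0, 0, 0).\<close>

lemma H_ideal: "r \<in> EI \<Longrightarrow> H r = H 0"
proof -
  have m: "H (u * r) = H 0" "H (r * u) = H 0" if "H r = H 0" for r u
    using H_mult[of u r] H_mult[of u 0] H_mult[of r u] H_mult[of 0 u] that by simp_all
  have "EI \<subseteq> {r. H r = H 0}"
  proof (rule relation_ideal_minimal)
    show "erels \<subseteq> {r. H r = H 0}"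
    proof
      fix r assume "r \<in> erels"
      then have "H r n = H 0 n" for n unfolding H_eq_iff erels_corner[OF \<open>r \<in> erels\<close>] L.act_zero corner_linear by blast
      then show "r \<in> {r. H r = H 0}" by auto
    qed
    show "- r \<in> {r. H r = H 0}" if "r \<in> {r. H r = H 0}" for r using m(1)[of r "- 1"] that by simp
    show "r + s \<in> {r. H r = H 0}" if "r \<in> {r. H r = H 0}" "s \<in> {r. H r = H 0}" for r s
      using H_add[of r s] H_add[of 0 0] that by simp
  qed (use m in auto)
  then show "r \<in> EI \<Longrightarrow> H r = H 0" by blast
qed

text \<open>Modulo the relations an element of the kernel is a combination of normal words, and
  their independence makes this combination zero.\<close>

lemma H_kernel: assumes "H r = H 0" shows "r \<in> EI"
proof -
  obtain S k where S: "finite S" "S \<subseteq> valid" and r: "r - (\<Sum>t\<in>S. scal (k t) * wmon (nfw t)) \<in> EI"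
    using normal_form by blast
  let ?s = "\<Sum>t\<in>S. scal (k t) * wmon (nfw t)"
  have "H r = H (r - ?s) \<oplus>\<^bsub>XA\<^esub> H ?s" unfolding H_add[symmetric] by simp
  also have "\<dots> = H (0 + ?s)" unfolding H_ideal[OF r] by (rule H_add[symmetric])
  finally have "H ?s n = H 0 n" for n using assms by simp
  then have "\<forall>f\<in>Qc n. corner (L.act ?s f) = corner (L.act 0 f)" for n unfolding H_eq_iff .
  then have "corner (L.act ?s f) = 0" if "f \<in> Qc n" for n f using that by (simp only: L.act_zero corner_linear)
  then have "?s = 0" by (rule independent[OF S])
  then show ?thesis using r by simp
qed

lemma H_surj: assumes X: "X \<in> carrier XA" shows "\<exists>r. H r = X"
proof -
  define A where "A = {n. X n \<noteq> \<zero>\<^bsub>Pr.E n\<^esub>}"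
  have A: "finite A" using X by (simp add: XA_simps A_def)
  have "\<forall>n. \<exists>z. z \<in> Pr.Z n \<and> X n = Pr.cl n z" using X by (auto simp: XA_simps Pr.E_simps)
  then obtain z where z: "\<And>n. z n \<in> Pr.Z n" "\<And>n. X n = Pr.cl n (z n)" by metis
  obtain lam where l: "\<And>t. t \<in> valid \<Longrightarrow> lam t \<noteq> 0 \<and> (\<forall>f. corner (L.act (wmon (nfw t)) f) = lam t * crn f t)"
    using nfw_corner by metis
  \<comment> \<open>The coefficient at t is the value of the cocycle on the transported basis
    symbol; \<open>lam t\<close> removes the scalar by which the normal word of t differs from the
    dual basis vector.\<close>
  define r where "r = (\<Sum>n\<in>A. \<Sum>t\<in>idx n. scal (z n (\<psi> n (Wt t)) / lam t) * wmon (nfw t))"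
  have inner: "corner (L.act (\<Sum>t\<in>idx n. scal (z n (\<psi> n (Wt t)) / lam t) * wmon (nfw t)) f)
      = (if m = n then z n (\<psi> n f) else 0)" if f: "f \<in> Qc m" for f n m
  proof -
    have "corner (L.act (\<Sum>t\<in>idx n. scal (z n (\<psi> n (Wt t)) / lam t) * wmon (nfw t)) f)
        = (\<Sum>t\<in>idx n. z n (\<psi> n (Wt t)) / lam t * lam t * crn f t)"
      by (rule corner_combination[OF finite_idx]) (use l idx_valid in blast)
    also have "\<dots> = (\<Sum>t\<in>idx n. crn f t * z n (\<psi> n (Wt t)))"
    proof (rule sum.cong[OF refl])
      fix t assume "t \<in> idx n"
      then have "lam t \<noteq> 0" using l idx_valid by blast
      then show "z n (\<psi> n (Wt t)) / lam t * lam t * crn f t = crn f t * z n (\<psi> n (Wt t))" by (simp add: mult.commute)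
    qed
    also have "\<dots> = (if m = n then z n (\<psi> n f) else 0)"
    proof (cases "m = n")
      case True
      have g: "compose (carrier (QM n)) (z n) (\<psi> n) \<in> left_hom NR (QM n) TN"
        by (rule left_hom_compose[OF left_module_QM \<psi>(1) Pr.Z_hom[OF z(1)]])
      have "(\<Sum>t\<in>idx n. crn f t * z n (\<psi> n (Wt t))) = (\<Sum>t\<in>idx n. crn f t * compose (carrier (QM n)) (z n) (\<psi> n) (Wt t))"
        by (rule sum.cong) (simp_all add: compose_eq Wt_Qc)
      also have "\<dots> = z n (\<psi> n f)" using hom_expand[OF g, of f] f True by (simp add: compose_eq)
      finally show ?thesis using True by simp
    next
      case False
      then have "crn f t = 0" if "t \<in> idx n" for t using crn_other[OF f that] by blast
      then show ?thesis using False by simp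
    qed
    finally show ?thesis .
  qed
  have c: "corner (L.act r f) = (if m \<in> A then z m (\<psi> m f) else 0)" if f: "f \<in> Qc m" for f m
  proof -
    have "corner (L.act (\<Sum>n\<in>S. g n) f) = (\<Sum>n\<in>S. corner (L.act (g n) f))" if "finite S" for S and g :: "nat \<Rightarrow> ext_gen word \<Rightarrow>\<^sub>0 'a"
      using that
    proof (induction S rule: finite_induct)
      case empty show ?case by (simp only: sum.empty L.act_zero corner_linear)
    next
      case (insert a S) show ?case unfolding sum.insert[OF insert(1,2)] L.act_add corner_linear insert(3) ..
    qed
    then have "corner (L.act r f) = (\<Sum>n\<in>A. if m = n then z n (\<psi> n f) else 0)" unfolding r_def using A by (simp add: inner[OF f])
    then show ?thesis using A by simp
  qed
  have "H r n = X n" for n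
  proof (cases "n \<in> A")
    case True
    obtain b where b: "b \<in> Pr.B n" "\<forall>x\<in>carrier (P n). z n (\<psi> n (\<phi> n x)) = z n x + b x" using \<psi>_\<phi>[OF z(1)] by blast
    show ?thesis unfolding z(2) H_def
      by (rule Pr.cl_eqI[OF coc_Z z(1) b(1)]) (use b(2) True c[OF \<phi>_Qc] in \<open>simp add: coc_eq\<close>)
  next
    case False
    have "H r n = \<zero>\<^bsub>Pr.E n\<^esub>" by (rule H_zeroI) (use c False in simp)
    then show ?thesis using False by (simp add: A_def)
  qed
  then show ?thesis by blast
qed

theorem presentation:
  "\<exists>h\<in>algebra_iso (presented_algebra erels) XA. \<forall>g. h (pgen erels g) \<in> ext_degree NR TN P d e (ext_gen_degree g)"
proof -
  define h where "h X = H (SOME r. r \<in> X)" for X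
  have h: "h (pclass erels r) = H r" for r
  proof -
    have "r \<in> pclass erels r" by (simp add: mem_pclass relation_ideal_closed)
    then have "(SOME r'. r' \<in> pclass erels r) \<in> pclass erels r" by (rule someI)
    then obtain r' where r': "h (pclass erels r) = H r'" "r' - r \<in> EI" by (simp add: mem_pclass h_def)
    have "H r' = H (r' - r) \<oplus>\<^bsub>XA\<^esub> H r" unfolding H_add[symmetric] by simp
    also have "\<dots> = H (0 + r)" unfolding H_ideal[OF r'(2)] by (rule H_add[symmetric])
    finally show ?thesis using r'(1) by simp
  qed
  note A = presented_algebra_pclass[of erels]
  have "h \<in> ring_hom (presented_algebra erels) XA"
    by (rule ring_hom_memI) (auto simp: A h H_carrier H_mult H_add H_one)
  moreover have "inj_on h (carrier (presented_algebra erels))"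
  proof (rule inj_onI)
    fix X Y assume "X \<in> carrier (presented_algebra erels)" "Y \<in> carrier (presented_algebra erels)" and eq: "h X = h Y"
    then obtain r s where rs: "X = pclass erels r" "Y = pclass erels s" by (auto simp: A)
    have "H (r - s) = H r \<oplus>\<^bsub>XA\<^esub> H (- s)" unfolding H_add[symmetric] by simp
    also have "\<dots> = H s \<oplus>\<^bsub>XA\<^esub> H (- s)" using eq by (simp add: rs h)
    also have "\<dots> = H 0" unfolding H_add[symmetric] by simp
    finally have "r - s \<in> EI" by (rule H_kernel)
    then show "X = Y" by (simp add: rs pclass_eq_iff)
  qed
  moreover have "h ` carrier (presented_algebra erels) = carrier XA"
  proof -
    have "h ` carrier (presented_algebra erels) = range H" by (simp only: A(1) image_image h)
    also have "\<dots> = carrier XA" using H_carrier H_surj by blast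
    finally show ?thesis .
  qed
  moreover have "\<forall>c. \<forall>X\<in>carrier (presented_algebra erels). h (c \<odot>\<^bsub>presented_algebra erels\<^esub> X) = c \<odot>\<^bsub>XA\<^esub> h X"
    by (auto simp: A h H_scal)
  ultimately have "h \<in> algebra_iso (presented_algebra erels) XA" by (simp add: algebra_iso_def ring_iso_def bij_betw_def)
  moreover have "h (pgen erels g) \<in> ext_degree NR TN P d e (ext_gen_degree g)" for g
    unfolding A h ext_degree_def using H_carrier H_zeroI gen_corner by blast
  ultimately show ?thesis by blast
qed

end

lemma (in a2_twist) ext_presentation:
  assumes res: "free_resolution NR TN P d e"
  shows "\<exists>h\<in>algebra_iso (presented_algebra erels) (ext_algebra NR TN P d e).
    \<forall>g. h (pgen erels g) \<in> ext_degree NR TN P d e (ext_gen_degree g)"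
proof -
  note rP = free_resolutionD[OF res] and rQ = free_resolutionD[OF resolution_QM]
  interpret Pr: trivial_resolution NR P d e by (intro trivial_resolution.intro trivial_NR res scalar_NR)
  have dd: "d n (d (Suc n) x) = \<zero>\<^bsub>P n\<^esub>" if "x \<in> carrier (P (Suc (Suc n)))" for n x
    using res that unfolding free_resolution_def by blast
  have ed: "e (d 0 x) = \<zero>\<^bsub>TN\<^esub>" if "x \<in> carrier (P (Suc 0))" for x
    using res that unfolding free_resolution_def by auto
  have "\<exists>\<phi>. (\<forall>i. \<phi> i \<in> left_hom NR (P i) (QM i)) \<and> (\<forall>x\<in>carrier (P 0). eR (\<phi> 0 x) = e x) \<and>
    (\<forall>i. \<forall>x\<in>carrier (P (Suc i)). dR i (\<phi> (Suc i) x) = \<phi> i (d i x))"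
    by (rule chain_lift_exists[OF rP(1) rP(3) dd trivial_NR resolution_QM rP(4) ed])
  then obtain \<phi> where \<phi>: "\<And>i. \<phi> i \<in> left_hom NR (P i) (QM i)" "\<And>x. x \<in> carrier (P 0) \<Longrightarrow> eR (\<phi> 0 x) = e x"
    "\<And>i x. x \<in> carrier (P (Suc i)) \<Longrightarrow> dR i (\<phi> (Suc i) x) = \<phi> i (d i x)" by blast
  have dd': "dR n (dR (Suc n) x) = \<zero>\<^bsub>QM n\<^esub>" if "x \<in> carrier (QM (Suc (Suc n)))" for n x
    using that dQ_dQ dQ_closed[of x "Suc n"] by (simp add: dR_def)
  have ed': "eR (dR 0 x) = \<zero>\<^bsub>TN\<^esub>" if "x \<in> carrier (QM (Suc 0))" for x
    using that dQ_closed[of x 0] by (simp add: eR_def dR_def dQ_corner trivial_simps)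
  have "\<exists>\<psi>. (\<forall>i. \<psi> i \<in> left_hom NR (QM i) (P i)) \<and> (\<forall>x\<in>carrier (QM 0). e (\<psi> 0 x) = eR x) \<and>
    (\<forall>i. \<forall>x\<in>carrier (QM (Suc i)). d i (\<psi> (Suc i) x) = \<psi> i (dR i x))"
    by (rule chain_lift_exists[where A = QM and a = dR and B = P and b = d and e = e and g = eR and M = TN])
      (erule dd' ed' | rule rQ(1) rQ(3) rQ(4) trivial_NR res)+
  then obtain \<psi> where \<psi>: "\<And>i. \<psi> i \<in> left_hom NR (QM i) (P i)" "\<And>x. x \<in> Qc 0 \<Longrightarrow> e (\<psi> 0 x) = eR x"
    "\<And>i x. x \<in> Qc (Suc i) \<Longrightarrow> d i (\<psi> (Suc i) x) = \<psi> i (dR i x)"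
    unfolding QM_simps by blast
  have c: "\<phi> i x \<in> Qc i" if "x \<in> carrier (P i)" for i x using left_homD(1)[OF \<phi>(1) that] by simp
  interpret a2_ext om p P d e \<phi> \<psi>
  proof
    show "corner (\<phi> 0 x) = e x" if "x \<in> carrier (P 0)" for x using \<phi>(2)[OF that] c[OF that] by (simp add: eR_def)
    show "dQ n (\<phi> (Suc n) x) = \<phi> n (d n x)" if "x \<in> carrier (P (Suc n))" for n x using \<phi>(3)[OF that] c[OF that] by (simp add: dR_def)
    show "e (\<psi> 0 f) = corner f" if "f \<in> Qc 0" for f using \<psi>(2)[OF that] that by (simp add: eR_def)
    show "d n (\<psi> (Suc n) f) = \<psi> n (dQ n f)" if "f \<in> Qc (Suc n)" for n f using \<psi>(3)[OF that] that by (simp add: dR_def)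
  qed (fact res \<phi>(1) \<psi>(1))+
  show ?thesis by (rule presentation)
qed

theorem theorem2p12:
  fixes qbar :: "'k::alg_closed_field"
    and q :: "nat \<Rightarrow> nat \<Rightarrow> 'k"
    and P :: "nat \<Rightarrow> ((nichols_gen word \<Rightarrow>\<^sub>0 'k) set, 'm) module"
    and d :: "nat \<Rightarrow> 'm \<Rightarrow> 'm"
    and e :: "'m \<Rightarrow> 'k"
  assumes "CHAR('k) \<noteq> 2"
    and "A2_parameters 3 qbar q"
    and "free_resolution (nichols_algebra 3 q) trivial_module P d e"
  shows "\<exists>h \<in> algebra_iso (presented_algebra (ext_relations qbar (q 1 2) (q 2 1)))
                  (ext_algebra (nichols_algebra 3 q) trivial_module P d e).
           \<forall>g. h (pgen (ext_relations qbar (q 1 2) (q 2 1)) g)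
                 \<in> ext_degree (nichols_algebra 3 q) trivial_module P d e (ext_gen_degree g)"
proof -
  have q: "q 1 1 = qbar" "q 2 2 = qbar" "q 1 2 * q 2 1 = inverse qbar" and r: "primitive_root_of_one 3 qbar"
    using assms(2) by (simp_all add: A2_parameters_def)
  have q3: "qbar ^ 3 = 1" "qbar \<noteq> 1" using r by (simp add: primitive_root_of_one_def, force simp: primitive_root_of_one_def dest: spec[of _ 1])
  then have nz: "qbar \<noteq> 0" by auto
  have "(qbar - 1) * (qbar * qbar + qbar + 1) = 0" using q3(1) by (simp add: algebra_simps power3_eq_cube)
  then have sq: "qbar * qbar + qbar + 1 = 0" using q3(2) by simp
  have nz12: "q 1 2 \<noteq> 0" using q(3) nz by auto
  \<comment> \<open>The solution of qbar p = q12, because qbar^3 = 1.\<close>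
  define p where "p = qbar * qbar * q 1 2"
  interpret a2_twist qbar p
  proof
    have "qbar * qbar = (qbar * qbar + qbar + 1) - 1 - qbar" by simp
    then show "qbar * qbar = - 1 - qbar" unfolding sq by simp
    show "p \<noteq> 0" unfolding p_def using nz nz12 by simp
  qed
  have e1: "qbar * p = q 1 2" using q3(1) by (simp add: p_def power3_eq_cube mult.assoc[symmetric])
  have e2: "qbar * ip = q 2 1"
  proof -
    have "q 1 2 * (qbar * ip) = qbar * (qbar * (p * ip))" unfolding e1[symmetric] by (simp only: mult_ac)
    also have "\<dots> = inverse qbar" using q3(1) nz by (simp add: pip power3_eq_cube field_simps)
    finally show ?thesis using q(3) nz12 by (metis mult_left_cancel)
  qed
  have qq: "qq 1 1 = qbar" "qq 2 2 = qbar" "qq 1 2 = q 1 2" "qq 2 1 = q 2 1"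
    unfolding e1[symmetric] e2[symmetric] by (simp_all add: qq_def)
  have "nichols_relations 3 q = nrels"
    unfolding nichols_relations_def q(1,2) qq ..
  then have N: "nichols_algebra 3 q = NR" by (simp add: nichols_algebra_def)
  show ?thesis using ext_presentation[OF assms(3)[unfolded N]] unfolding N e1 e2 .
qed

end
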